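(* Let $k$ be a field, let $G$ be a finite group such that $|G|$ is invertible in $k$, and let $H=kG$ (the group algebra) or $H=(kG)^*$ (its dual Hopf algebra). Let $R$ be a unital $k$-algebra which is a twisted $H$-module algebra with map $\sigma:H\otimes H\to R$, such that the crossed product $R\#_\sigma H$ is an (associative) algebra with unit. Then: (1) $r_j(R)=r_{Hj}(R)=r_{jH}(R)$; (2) $r_j(R\#_\sigma H)=r_{Hj}(R)\#_\sigma H$.
   Context: $r_j(A)$ denotes the Jacobson radical of a $k$-algebra $A$. Sweedler notation $\Delta(h)=\sum h_1\otimes h_2$ is used. A Hopf algebra $H$ weakly acts on $R$ if there is a $k$-linear map $H\otimes R\to R$, $h\otimes r\mapsto h\cdot r$, with $h\cdot(rs)=\sum (h_1\cdot r)(h_2\cdot s)$ and $1_H\cdot r=r$. $R$ is a twisted $H$-module algebra if $H$ weakly acts on $R$ and there is a convolution-invertible $\sigma\in \mathrm{Hom}_k(H\otimes H,R)$ with $h\cdot(g\cdot r)=\sum\sigma(h_1,g_1)(h_2g_2\cdot r)\sigma^{-1}(h_3,g_3)$ for all $h,g\in H$, $r\in R$. The crossed product $R\#_\sigma H$ is the vector space $R\otimes H$ (elements $a\# h$) with multiplication $(a\# h)(b\# g)=\sum a(h_1\cdot b)\sigma(h_2,g_1)\# h_3g_2$; it is assumed to be associative with unit $1\#1$. For an ideal $I$ of $R$, $(I:H)=\{x\in R\mid h\cdot x\in I \text{ for all } h\in H\}$. Put $r_{jH}(R)=(r_j(R):H)$. An $R$-$H$-module is a left $R$-module $M$ with a $k$-linear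 map $H\otimes M\to M$ satisfying $1_Hm=m$, $h(am)=\sum(h_1\cdot a)(h_2m)$ and $h(gm)=\sum\sigma(h_1,g_1)(h_2g_2m)$ for $h,g\in H$, $a\in R$, $m\in M$. It is $R$-$H$-irreducible if $RM\neq0$ and $M$ has no $R$-$H$-submodules other than $0$ and $M$. The $H$-Jacobson radical $r_{Hj}(R)$ is the intersection of the annihilators in $R$ of all $R$-$H$-irreducible modules (equal to $R$ if there are none). For a subspace $I\subseteq R$, $I\#_\sigma H$ denotes the image of $I\otimes H$ in $R\#_\sigma H$. *)

theory Defs
  imports "HOL-Algebra.Module" "HOL-Algebra.Ideal" "HOL-Algebra.Generated_Groups"
begin

section \<open>Algebras and the Jacobson radical\<close>

text \<open>The locale \<open>algebra\<close> of the library is restricted to commutative algebras.\<close>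

locale k_algebra = K?: field K + A?: ring A + module K A
  for K :: "('k, 'z) ring_scheme" (structure) and A :: "('k, 'a, 'y) module_scheme" (structure) +
  assumes smult_mult_left:
    "\<lbrakk>k \<in> carrier K; x \<in> carrier A; y \<in> carrier A\<rbrakk> \<Longrightarrow>
      (k \<odot>\<^bsub>A\<^esub> x) \<otimes>\<^bsub>A\<^esub> y = k \<odot>\<^bsub>A\<^esub> (x \<otimes>\<^bsub>A\<^esub> y)"
    and smult_mult_right:
    "\<lbrakk>k \<in> carrier K; x \<in> carrier A; y \<in> carrier A\<rbrakk> \<Longrightarrow>
      x \<otimes>\<^bsub>A\<^esub> (k \<odot>\<^bsub>A\<^esub> y) = k \<odot>\<^bsub>A\<^esub> (x \<otimes>\<^bsub>A\<^esub> y)"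

definition left_ideal :: "'a set \<Rightarrow> ('a, 'z) ring_scheme \<Rightarrow> bool" where
  "left_ideal I A \<longleftrightarrow>
    additive_subgroup I A \<and> (\<forall>a\<in>carrier A. \<forall>x\<in>I. a \<otimes>\<^bsub>A\<^esub> x \<in> I)"

definition maximal_left_ideal :: "'a set \<Rightarrow> ('a, 'z) ring_scheme \<Rightarrow> bool" where
  "maximal_left_ideal I A \<longleftrightarrow> left_ideal I A \<and> I \<noteq> carrier A \<and>
    (\<forall>J. left_ideal J A \<and> I \<subseteq> J \<longrightarrow> J = I \<or> J = carrier A)"

text \<open>For a unital ring; it is the whole carrier if the ring is zero.\<close>

definition jacobson_radical :: "('a, 'z) ring_scheme \<Rightarrow> 'a set" where
  "jacobson_radical A = {x \<in> carrier A. \<forall>L. maximal_left_ideal L A \<longrightarrow> x \<in> L}"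

definition bilinear_map ::
  "('k, 'z) ring_scheme \<Rightarrow> ('k, 'u, 'y1) module_scheme \<Rightarrow> ('k, 'v, 'y2) module_scheme \<Rightarrow>
    ('k, 'w, 'y3) module_scheme \<Rightarrow> ('u \<Rightarrow> 'v \<Rightarrow> 'w) \<Rightarrow> bool" where
  "bilinear_map K U V W f \<longleftrightarrow>
    (\<forall>u\<in>carrier U. \<forall>v\<in>carrier V. f u v \<in> carrier W) \<and>
    (\<forall>u\<in>carrier U. \<forall>u'\<in>carrier U. \<forall>v\<in>carrier V.
      f (u \<oplus>\<^bsub>U\<^esub> u') v = f u v \<oplus>\<^bsub>W\<^esub> f u' v) \<and>
    (\<forall>u\<in>carrier U. \<forall>v\<in>carrier V. \<forall>v'\<in>carrier V.
      f u (v \<oplus>\<^bsub>V\<^esub> v') = f u v \<oplus>\<^bsub>W\<^esub> f u v') \<and>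
    (\<forall>k\<in>carrier K. \<forall>u\<in>carrier U. \<forall>v\<in>carrier V.
      f (k \<odot>\<^bsub>U\<^esub> u) v = k \<odot>\<^bsub>W\<^esub> f u v \<and> f u (k \<odot>\<^bsub>V\<^esub> v) = k \<odot>\<^bsub>W\<^esub> f u v)"

section \<open>Finite-dimensional Hopf algebras in coordinates\<close>

text \<open>
  A Hopf algebra with a finite basis \<open>B\<close> is stored as the space of coordinate functions
  from \<open>B\<close> to the field, and its tensor square as the functions of two arguments in \<open>B\<close>:
  \<open>comult H h c d\<close> is the coefficient of the tensor product of the basis vectors \<open>c\<close> and \<open>d\<close>
  in the coproduct of \<open>h\<close>.
\<close>

record ('k, 'b) hopf = "('k, 'b \<Rightarrow> 'k) module" +
  basis :: "'b set"
  comult :: "('b \<Rightarrow> 'k) \<Rightarrow> 'b \<Rightarrow> 'b \<Rightarrow> 'k"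
  counit :: "('b \<Rightarrow> 'k) \<Rightarrow> 'k"
  antipode :: "('b \<Rightarrow> 'k) \<Rightarrow> 'b \<Rightarrow> 'k"

definition basis_vector ::
  "('k, 'z) ring_scheme \<Rightarrow> ('k, 'b) hopf \<Rightarrow> 'b \<Rightarrow> 'b \<Rightarrow> 'k" where
  "basis_vector K H b = (\<lambda>c\<in>basis H. if c = b then \<one>\<^bsub>K\<^esub> else \<zero>\<^bsub>K\<^esub>)"

text \<open>On group elements: comultiplication \<open>g \<mapsto> g \<otimes> g\<close>, counit \<open>g \<mapsto> 1\<close>, antipode \<open>g \<mapsto> g\<inverse>\<close>.\<close>

definition group_algebra ::
  "('k, 'z) ring_scheme \<Rightarrow> ('g, 'y) monoid_scheme \<Rightarrow> ('k, 'g) hopf" where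
  "group_algebra K G =
    \<lparr>carrier = carrier G \<rightarrow>\<^sub>E carrier K,
     mult = (\<lambda>x y. \<lambda>g\<in>carrier G. \<Oplus>\<^bsub>K\<^esub>a\<in>carrier G. x a \<otimes>\<^bsub>K\<^esub> y (inv\<^bsub>G\<^esub> a \<otimes>\<^bsub>G\<^esub> g)),
     one = (\<lambda>g\<in>carrier G. if g = \<one>\<^bsub>G\<^esub> then \<one>\<^bsub>K\<^esub> else \<zero>\<^bsub>K\<^esub>),
     zero = (\<lambda>g\<in>carrier G. \<zero>\<^bsub>K\<^esub>),
     add = (\<lambda>x y. \<lambda>g\<in>carrier G. x g \<oplus>\<^bsub>K\<^esub> y g),
     smult = (\<lambda>k x. \<lambda>g\<in>carrier G. k \<otimes>\<^bsub>K\<^esub> x g),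
     basis = carrier G,
     comult = (\<lambda>x a b. if a = b then x a else \<zero>\<^bsub>K\<^esub>),
     counit = (\<lambda>x. \<Oplus>\<^bsub>K\<^esub>g\<in>carrier G. x g),
     antipode = (\<lambda>x. \<lambda>g\<in>carrier G. x (inv\<^bsub>G\<^esub> g))\<rparr>"

text \<open>
  The dual Hopf algebra, in coordinates with respect to the dual basis: a functional \<open>f\<close> is
  represented by its values on the basis of \<open>H\<close>. Each structure map is the transpose of one
  of \<open>H\<close>.
\<close>

definition dual_hopf :: "('k, 'z) ring_scheme \<Rightarrow> ('k, 'b) hopf \<Rightarrow> ('k, 'b) hopf" where
  "dual_hopf K H =
    \<lparr>carrier = carrier H,
     mult = (\<lambda>f f'. \<lambda>b\<in>basis H. \<Oplus>\<^bsub>K\<^esub>c\<in>basis H. \<Oplus>\<^bsub>K\<^esub>d\<in>basis H.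
        comult H (basis_vector K H b) c d \<otimes>\<^bsub>K\<^esub> (f c \<otimes>\<^bsub>K\<^esub> f' d)),
     one = (\<lambda>b\<in>basis H. counit H (basis_vector K H b)),
     zero = zero H, add = add H, smult = smult H,
     basis = basis H,
     comult = (\<lambda>f c d. \<Oplus>\<^bsub>K\<^esub>b\<in>basis H.
        (basis_vector K H c \<otimes>\<^bsub>H\<^esub> basis_vector K H d) b \<otimes>\<^bsub>K\<^esub> f b),
     counit = (\<lambda>f. \<Oplus>\<^bsub>K\<^esub>b\<in>basis H. \<one>\<^bsub>H\<^esub> b \<otimes>\<^bsub>K\<^esub> f b),
     antipode = (\<lambda>f. \<lambda>b\<in>basis H. \<Oplus>\<^bsub>K\<^esub>c\<in>basis H. antipode H (basis_vector K H b) c \<otimes>\<^bsub>K\<^esub> f c)\<rparr>"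

text \<open>
  The dual of the group algebra is the algebra of functions on the group with pointwise
  multiplication, and the coproduct of a function \<open>f\<close> is \<open>f (c d)\<close>.
\<close>

lemma dual_group_algebra:
  assumes "field K" "group G" "finite (carrier G)"
    and f: "f \<in> carrier G \<rightarrow>\<^sub>E carrier K" and f': "f' \<in> carrier G \<rightarrow>\<^sub>E carrier K"
  defines "D \<equiv> dual_hopf K (group_algebra K G)"
  shows "f \<otimes>\<^bsub>D\<^esub> f' = (\<lambda>g\<in>carrier G. f g \<otimes>\<^bsub>K\<^esub> f' g)"
    and "\<one>\<^bsub>D\<^esub> = (\<lambda>g\<in>carrier G. \<one>\<^bsub>K\<^esub>)"
    and "\<lbrakk>c \<in> carrier G; d \<in> carrier G\<rbrakk> \<Longrightarrow> comult D f c d = f (c \<otimes>\<^bsub>G\<^esub> d)"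
    and "counit D f = f \<one>\<^bsub>G\<^esub>"
    and "antipode D f = (\<lambda>g\<in>carrier G. f (inv\<^bsub>G\<^esub> g))"
proof -
  interpret K: field K by fact
  interpret G: group G by fact
  have v: "f g \<in> carrier K" "f' g \<in> carrier K" if "g \<in> carrier G" for g
    using f f' that by auto
  have single: "(\<Oplus>\<^bsub>K\<^esub>b\<in>carrier G. F b) = F i"
    if i: "i \<in> carrier G" and Fi: "F i \<in> carrier K"
      and z: "\<And>b. b \<in> carrier G \<Longrightarrow> b \<noteq> i \<Longrightarrow> F b = \<zero>\<^bsub>K\<^esub>" for F i
  proof -
    have "(\<Oplus>\<^bsub>K\<^esub>b\<in>carrier G. F b) = (\<Oplus>\<^bsub>K\<^esub>b\<in>carrier G. if i = b then F b else \<zero>\<^bsub>K\<^esub>)"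
      by (rule K.finsum_cong') (use Fi z in auto)
    also have "\<dots> = F i"
    proof -
      have "(\<Oplus>\<^bsub>K\<^esub>b\<in>carrier G. if i = b then (\<lambda>_. F i) b else \<zero>\<^bsub>K\<^esub>) = (\<lambda>_. F i) i"
        by (rule K.finsum_singleton[OF i assms(3)]) (use Fi in auto)
      moreover have "(if i = b then (\<lambda>_. F i) b else \<zero>\<^bsub>K\<^esub>) = (if i = b then F b else \<zero>\<^bsub>K\<^esub>)" for b
        by auto
      ultimately show ?thesis by simp
    qed
    finally show ?thesis .
  qed
  let ?A = "group_algebra K G"
  have e: "basis_vector K ?A b = (\<lambda>c\<in>carrier G. if c = b then \<one>\<^bsub>K\<^esub> else \<zero>\<^bsub>K\<^esub>)" for b
    by (simp add: basis_vector_def group_algebra_def)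
  show "f \<otimes>\<^bsub>D\<^esub> f' = (\<lambda>g\<in>carrier G. f g \<otimes>\<^bsub>K\<^esub> f' g)"
  proof
    fix g
    let ?t = "\<lambda>c d. comult ?A (basis_vector K ?A g) c d \<otimes>\<^bsub>K\<^esub> (f c \<otimes>\<^bsub>K\<^esub> f' d)"
    have "(\<Oplus>\<^bsub>K\<^esub>c\<in>carrier G. \<Oplus>\<^bsub>K\<^esub>d\<in>carrier G. ?t c d) = f g \<otimes>\<^bsub>K\<^esub> f' g" if g: "g \<in> carrier G"
    proof -
      have t: "?t c d = (if c = g \<and> d = g then f g \<otimes>\<^bsub>K\<^esub> f' g else \<zero>\<^bsub>K\<^esub>)"
        if "c \<in> carrier G" "d \<in> carrier G" for c d
        unfolding e using that g by (simp add: group_algebra_def v)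
      have i: "(\<Oplus>\<^bsub>K\<^esub>d\<in>carrier G. ?t c d) = (if c = g then f g \<otimes>\<^bsub>K\<^esub> f' g else \<zero>\<^bsub>K\<^esub>)"
        if "c \<in> carrier G" for c
        by (subst single[OF g]) (use that t g v in auto)
      show ?thesis by (subst single[OF g]) (use i g v in auto)
    qed
    moreover have "(f \<otimes>\<^bsub>D\<^esub> f') g =
        (\<lambda>g\<in>carrier G. \<Oplus>\<^bsub>K\<^esub>c\<in>carrier G. \<Oplus>\<^bsub>K\<^esub>d\<in>carrier G.
          comult ?A (basis_vector K ?A g) c d \<otimes>\<^bsub>K\<^esub> (f c \<otimes>\<^bsub>K\<^esub> f' d)) g"
      by (simp add: D_def dual_hopf_def group_algebra_def)
    ultimately show "(f \<otimes>\<^bsub>D\<^esub> f') g = (\<lambda>g\<in>carrier G. f g \<otimes>\<^bsub>K\<^esub> f' g) g"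
      by simp
  qed
  show "\<one>\<^bsub>D\<^esub> = (\<lambda>g\<in>carrier G. \<one>\<^bsub>K\<^esub>)"
  proof
    fix g
    have "(\<Oplus>\<^bsub>K\<^esub>h\<in>carrier G. basis_vector K ?A g h) = \<one>\<^bsub>K\<^esub>" if "g \<in> carrier G"
      by (subst single[OF that]) (use that in \<open>auto simp: e\<close>)
    then show "\<one>\<^bsub>D\<^esub> g = (\<lambda>g\<in>carrier G. \<one>\<^bsub>K\<^esub>) g"
      by (simp add: D_def dual_hopf_def group_algebra_def)
  qed
  show "comult D f c d = f (c \<otimes>\<^bsub>G\<^esub> d)" if c: "c \<in> carrier G" and d: "d \<in> carrier G"
  proof -
    let ?m = "\<lambda>b. \<Oplus>\<^bsub>K\<^esub>a\<in>carrier G. basis_vector K ?A c a \<otimes>\<^bsub>K\<^esub> basis_vector K ?A d (inv\<^bsub>G\<^esub> a \<otimes>\<^bsub>G\<^esub> b)"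
    have m: "?m b = (if b = c \<otimes>\<^bsub>G\<^esub> d then \<one>\<^bsub>K\<^esub> else \<zero>\<^bsub>K\<^esub>)" if b: "b \<in> carrier G" for b
    proof -
      have "inv\<^bsub>G\<^esub> c \<otimes>\<^bsub>G\<^esub> b = d \<longleftrightarrow> b = c \<otimes>\<^bsub>G\<^esub> d"
        using b c d by (metis G.inv_closed G.inv_solve_left G.m_closed)
      then show ?thesis
        by (subst single[OF c]) (use b c d in \<open>auto simp: e\<close>)
    qed
    have "comult D f c d = (\<Oplus>\<^bsub>K\<^esub>b\<in>carrier G. ?m b \<otimes>\<^bsub>K\<^esub> f b)"
      unfolding D_def dual_hopf_def
      by (simp add: group_algebra_def) (rule K.finsum_cong', use m v in \<open>auto simp: group_algebra_def\<close>)
    also have "\<dots> = f (c \<otimes>\<^bsub>G\<^esub> d)"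
      by (subst single[of "c \<otimes>\<^bsub>G\<^esub> d"]) (use c d m v in auto)
    finally show ?thesis .
  qed
  show "counit D f = f \<one>\<^bsub>G\<^esub>"
  proof -
    have "counit D f = (\<Oplus>\<^bsub>K\<^esub>b\<in>carrier G. \<one>\<^bsub>?A\<^esub> b \<otimes>\<^bsub>K\<^esub> f b)"
      by (simp add: D_def dual_hopf_def group_algebra_def)
    also have "\<dots> = f \<one>\<^bsub>G\<^esub>"
      by (subst single[of "\<one>\<^bsub>G\<^esub>"]) (use v in \<open>auto simp: group_algebra_def\<close>)
    finally show ?thesis .
  qed
  show "antipode D f = (\<lambda>g\<in>carrier G. f (inv\<^bsub>G\<^esub> g))"
  proof
    fix g
    have "(\<Oplus>\<^bsub>K\<^esub>c\<in>carrier G. antipode ?A (basis_vector K ?A g) c \<otimes>\<^bsub>K\<^esub> f c) = f (inv\<^bsub>G\<^esub> g)"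
      if g: "g \<in> carrier G"
    proof -
      have "antipode ?A (basis_vector K ?A g) c = (if c = inv\<^bsub>G\<^esub> g then \<one>\<^bsub>K\<^esub> else \<zero>\<^bsub>K\<^esub>)"
        if "c \<in> carrier G" for c
        unfolding e using that g by (auto simp: group_algebra_def)
      then show ?thesis
        by (subst single[of "inv\<^bsub>G\<^esub> g"]) (use g v in auto)
    qed
    then show "antipode D f g = (\<lambda>g\<in>carrier G. f (inv\<^bsub>G\<^esub> g)) g"
      by (simp add: D_def dual_hopf_def group_algebra_def)
  qed
qed

text \<open>
  For a bilinear \<open>F\<close> with values in \<open>V\<close>, \<open>sweedler2 K H V h F\<close> is the Sweedler sum
  of \<open>F h\<^sub>1 h\<^sub>2\<close>; similarly for \<open>sweedler3\<close>, where the coproduct is iterated on the left factor.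
\<close>

definition sweedler2 ::
  "('k, 'z) ring_scheme \<Rightarrow> ('k, 'b) hopf \<Rightarrow> ('k, 'v, 'y) module_scheme \<Rightarrow> ('b \<Rightarrow> 'k) \<Rightarrow>
    (('b \<Rightarrow> 'k) \<Rightarrow> ('b \<Rightarrow> 'k) \<Rightarrow> 'v) \<Rightarrow> 'v" where
  "sweedler2 K H V h F = (\<Oplus>\<^bsub>V\<^esub>c\<in>basis H. \<Oplus>\<^bsub>V\<^esub>d\<in>basis H.
     comult H h c d \<odot>\<^bsub>V\<^esub> F (basis_vector K H c) (basis_vector K H d))"

definition sweedler3 ::
  "('k, 'z) ring_scheme \<Rightarrow> ('k, 'b) hopf \<Rightarrow> ('k, 'v, 'y) module_scheme \<Rightarrow> ('b \<Rightarrow> 'k) \<Rightarrow>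
    (('b \<Rightarrow> 'k) \<Rightarrow> ('b \<Rightarrow> 'k) \<Rightarrow> ('b \<Rightarrow> 'k) \<Rightarrow> 'v) \<Rightarrow> 'v" where
  "sweedler3 K H V h F =
     sweedler2 K H V h (\<lambda>h' h3. sweedler2 K H V h' (\<lambda>h1 h2. F h1 h2 h3))"

section \<open>Twisted module algebras and crossed products\<close>

definition weak_action ::
  "('k, 'z) ring_scheme \<Rightarrow> ('k, 'b) hopf \<Rightarrow> ('k, 'r, 'y) module_scheme \<Rightarrow>
    (('b \<Rightarrow> 'k) \<Rightarrow> 'r \<Rightarrow> 'r) \<Rightarrow> bool" where
  "weak_action K H R act \<longleftrightarrow> bilinear_map K H R R act \<and>
    (\<forall>h\<in>carrier H. \<forall>r\<in>carrier R. \<forall>s\<in>carrier R.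
      act h (r \<otimes>\<^bsub>R\<^esub> s) = sweedler2 K H R h (\<lambda>h1 h2. act h1 r \<otimes>\<^bsub>R\<^esub> act h2 s)) \<and>
    (\<forall>r\<in>carrier R. act \<one>\<^bsub>H\<^esub> r = r)"

definition convolution_inverse ::
  "('k, 'z) ring_scheme \<Rightarrow> ('k, 'b) hopf \<Rightarrow> ('k, 'r, 'y) module_scheme \<Rightarrow>
    (('b \<Rightarrow> 'k) \<Rightarrow> ('b \<Rightarrow> 'k) \<Rightarrow> 'r) \<Rightarrow> (('b \<Rightarrow> 'k) \<Rightarrow> ('b \<Rightarrow> 'k) \<Rightarrow> 'r) \<Rightarrow> bool" where
  "convolution_inverse K H R \<sigma> \<tau> \<longleftrightarrow>
    (\<forall>h\<in>carrier H. \<forall>g\<in>carrier H.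
      sweedler2 K H R h (\<lambda>h1 h2. sweedler2 K H R g (\<lambda>g1 g2. \<sigma> h1 g1 \<otimes>\<^bsub>R\<^esub> \<tau> h2 g2))
        = (counit H h \<otimes>\<^bsub>K\<^esub> counit H g) \<odot>\<^bsub>R\<^esub> \<one>\<^bsub>R\<^esub> \<and>
      sweedler2 K H R h (\<lambda>h1 h2. sweedler2 K H R g (\<lambda>g1 g2. \<tau> h1 g1 \<otimes>\<^bsub>R\<^esub> \<sigma> h2 g2))
        = (counit H h \<otimes>\<^bsub>K\<^esub> counit H g) \<odot>\<^bsub>R\<^esub> \<one>\<^bsub>R\<^esub>)"

definition twisted_module_algebra ::
  "('k, 'z) ring_scheme \<Rightarrow> ('k, 'b) hopf \<Rightarrow> ('k, 'r, 'y) module_scheme \<Rightarrow>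
    (('b \<Rightarrow> 'k) \<Rightarrow> 'r \<Rightarrow> 'r) \<Rightarrow> (('b \<Rightarrow> 'k) \<Rightarrow> ('b \<Rightarrow> 'k) \<Rightarrow> 'r) \<Rightarrow> bool" where
  "twisted_module_algebra K H R act \<sigma> \<longleftrightarrow>
    weak_action K H R act \<and> bilinear_map K H H R \<sigma> \<and>
    (\<exists>\<tau>. bilinear_map K H H R \<tau> \<and> convolution_inverse K H R \<sigma> \<tau> \<and>
      (\<forall>h\<in>carrier H. \<forall>g\<in>carrier H. \<forall>r\<in>carrier R.
        act h (act g r) =
          sweedler3 K H R h (\<lambda>h1 h2 h3. sweedler3 K H R g (\<lambda>g1 g2 g3.
            \<sigma> h1 g1 \<otimes>\<^bsub>R\<^esub> act (h2 \<otimes>\<^bsub>H\<^esub> g2) r \<otimes>\<^bsub>R\<^esub> \<tau> h3 g3))))"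

text \<open>
  The vector space \<open>R \<otimes> H\<close> is free over \<open>R\<close> on the basis of \<open>H\<close>, so its elements are the
  coordinate functions from the basis of \<open>H\<close> to \<open>R\<close>. The fields \<open>mult\<close> and \<open>one\<close> of
  \<open>tensor_space\<close> are not used.
\<close>

definition tensor_space ::
  "('k, 'b) hopf \<Rightarrow> ('k, 'r, 'y) module_scheme \<Rightarrow> ('k, 'b \<Rightarrow> 'r) module" where
  "tensor_space H R =
    \<lparr>carrier = basis H \<rightarrow>\<^sub>E carrier R, mult = undefined, one = undefined,
     zero = (\<lambda>b\<in>basis H. \<zero>\<^bsub>R\<^esub>),
     add = (\<lambda>x y. \<lambda>b\<in>basis H. x b \<oplus>\<^bsub>R\<^esub> y b),
     smult = (\<lambda>k x. \<lambda>b\<in>basis H. k \<odot>\<^bsub>R\<^esub> x b)\<rparr>"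

text \<open>The pure tensor \<open>a # h\<close>.\<close>

definition pure_tensor ::
  "('k, 'b) hopf \<Rightarrow> ('k, 'r, 'y) module_scheme \<Rightarrow> 'r \<Rightarrow> ('b \<Rightarrow> 'k) \<Rightarrow> 'b \<Rightarrow> 'r" where
  "pure_tensor H R a h = (\<lambda>b\<in>basis H. h b \<odot>\<^bsub>R\<^esub> a)"

definition pure_mult ::
  "('k, 'z) ring_scheme \<Rightarrow> ('k, 'b) hopf \<Rightarrow> ('k, 'r, 'y) module_scheme \<Rightarrow>
    (('b \<Rightarrow> 'k) \<Rightarrow> 'r \<Rightarrow> 'r) \<Rightarrow> (('b \<Rightarrow> 'k) \<Rightarrow> ('b \<Rightarrow> 'k) \<Rightarrow> 'r) \<Rightarrow>
    'r \<Rightarrow> ('b \<Rightarrow> 'k) \<Rightarrow> 'r \<Rightarrow> ('b \<Rightarrow> 'k) \<Rightarrow> 'b \<Rightarrow> 'r" where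
  "pure_mult K H R act \<sigma> a h b g =
     sweedler3 K H (tensor_space H R) h (\<lambda>h1 h2 h3.
       sweedler2 K H (tensor_space H R) g (\<lambda>g1 g2.
         pure_tensor H R (a \<otimes>\<^bsub>R\<^esub> act h1 b \<otimes>\<^bsub>R\<^esub> \<sigma> h2 g1) (h3 \<otimes>\<^bsub>H\<^esub> g2)))"

text \<open>
  The product of pure tensors is \<open>pure_mult\<close>; it is extended bilinearly by writing
  an element \<open>x\<close> as the sum of \<open>x b # b\<close> over the basis.
\<close>

definition crossed_product ::
  "('k, 'z) ring_scheme \<Rightarrow> ('k, 'b) hopf \<Rightarrow> ('k, 'r, 'y) module_scheme \<Rightarrow>
    (('b \<Rightarrow> 'k) \<Rightarrow> 'r \<Rightarrow> 'r) \<Rightarrow> (('b \<Rightarrow> 'k) \<Rightarrow> ('b \<Rightarrow> 'k) \<Rightarrow> 'r) \<Rightarrow>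
    ('k, 'b \<Rightarrow> 'r) module" where
  "crossed_product K H R act \<sigma> = (tensor_space H R)
    \<lparr>mult := (\<lambda>x y. \<Oplus>\<^bsub>tensor_space H R\<^esub>b\<in>basis H. \<Oplus>\<^bsub>tensor_space H R\<^esub>c\<in>basis H.
        pure_mult K H R act \<sigma> (x b) (basis_vector K H b) (y c) (basis_vector K H c)),
     one := pure_tensor H R \<one>\<^bsub>R\<^esub> \<one>\<^bsub>H\<^esub>\<rparr>"

text \<open>The image of \<open>I \<otimes> H\<close>, i.e. all finite sums of pure tensors \<open>a # h\<close> with \<open>a\<close> in \<open>I\<close>.\<close>

definition tensor_image ::
  "('k, 'b) hopf \<Rightarrow> ('k, 'r, 'y) module_scheme \<Rightarrow> 'r set \<Rightarrow> ('b \<Rightarrow> 'r) set" where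
  "tensor_image H R I =
     generate (add_monoid (tensor_space H R)) {pure_tensor H R a h | a h. a \<in> I \<and> h \<in> carrier H}"

section \<open>The H-radicals\<close>

text \<open>\<open>(I : H)\<close>\<close>

definition H_core ::
  "('k, 'b) hopf \<Rightarrow> ('k, 'r, 'y) module_scheme \<Rightarrow> (('b \<Rightarrow> 'k) \<Rightarrow> 'r \<Rightarrow> 'r) \<Rightarrow> 'r set \<Rightarrow> 'r set" where
  "H_core H R act I = {x \<in> carrier R. \<forall>h\<in>carrier H. act h x \<in> I}"

definition H_jacobson_core ::
  "('k, 'b) hopf \<Rightarrow> ('k, 'r, 'y) module_scheme \<Rightarrow> (('b \<Rightarrow> 'k) \<Rightarrow> 'r \<Rightarrow> 'r) \<Rightarrow> 'r set" where
  "H_jacobson_core H R act = H_core H R act (jacobson_radical R)"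

text \<open>
  The underlying vector space of the module is \<open>M\<close>. The identity of \<open>R\<close> is not required
  to act as the identity; on irreducible modules it does so automatically.
\<close>

locale RH_module = M?: module K M
  for K :: "('k, 'z) ring_scheme" and H :: "('k, 'b) hopf" and R :: "('k, 'r, 'y) module_scheme"
    and act :: "('b \<Rightarrow> 'k) \<Rightarrow> 'r \<Rightarrow> 'r" and \<sigma> :: "('b \<Rightarrow> 'k) \<Rightarrow> ('b \<Rightarrow> 'k) \<Rightarrow> 'r"
    and M :: "('k, 'm) module"
    and ract :: "'r \<Rightarrow> 'm \<Rightarrow> 'm" and hact :: "('b \<Rightarrow> 'k) \<Rightarrow> 'm \<Rightarrow> 'm" +
  assumes ract_bilinear: "bilinear_map K R M M ract"
    and ract_mult: "\<lbrakk>a \<in> carrier R; b \<in> carrier R; m \<in> carrier M\<rbrakk> \<Longrightarrow>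
      ract (a \<otimes>\<^bsub>R\<^esub> b) m = ract a (ract b m)"
    and hact_bilinear: "bilinear_map K H M M hact"
    and hact_one: "m \<in> carrier M \<Longrightarrow> hact \<one>\<^bsub>H\<^esub> m = m"
    and hact_ract: "\<lbrakk>h \<in> carrier H; a \<in> carrier R; m \<in> carrier M\<rbrakk> \<Longrightarrow>
      hact h (ract a m) = sweedler2 K H M h (\<lambda>h1 h2. ract (act h1 a) (hact h2 m))"
    and hact_hact: "\<lbrakk>h \<in> carrier H; g \<in> carrier H; m \<in> carrier M\<rbrakk> \<Longrightarrow>
      hact h (hact g m) =
        sweedler2 K H M h (\<lambda>h1 h2. sweedler2 K H M g (\<lambda>g1 g2.
          ract (\<sigma> h1 g1) (hact (h2 \<otimes>\<^bsub>H\<^esub> g2) m)))"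

definition RH_submodule ::
  "('k, 'z) ring_scheme \<Rightarrow> ('k, 'b) hopf \<Rightarrow> ('k, 'r, 'y) module_scheme \<Rightarrow> ('k, 'm) module \<Rightarrow>
    ('r \<Rightarrow> 'm \<Rightarrow> 'm) \<Rightarrow> (('b \<Rightarrow> 'k) \<Rightarrow> 'm \<Rightarrow> 'm) \<Rightarrow> 'm set \<Rightarrow> bool" where
  "RH_submodule K H R M ract hact N \<longleftrightarrow> submodule N K M \<and>
    (\<forall>a\<in>carrier R. \<forall>m\<in>N. ract a m \<in> N) \<and> (\<forall>h\<in>carrier H. \<forall>m\<in>N. hact h m \<in> N)"

definition RH_irreducible ::
  "('k, 'z) ring_scheme \<Rightarrow> ('k, 'b) hopf \<Rightarrow> ('k, 'r, 'y) module_scheme \<Rightarrow>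
    (('b \<Rightarrow> 'k) \<Rightarrow> 'r \<Rightarrow> 'r) \<Rightarrow> (('b \<Rightarrow> 'k) \<Rightarrow> ('b \<Rightarrow> 'k) \<Rightarrow> 'r) \<Rightarrow> ('k, 'm) module \<Rightarrow>
    ('r \<Rightarrow> 'm \<Rightarrow> 'm) \<Rightarrow> (('b \<Rightarrow> 'k) \<Rightarrow> 'm \<Rightarrow> 'm) \<Rightarrow> bool" where
  "RH_irreducible K H R act \<sigma> M ract hact \<longleftrightarrow> RH_module K H R act \<sigma> M ract hact \<and>
    (\<exists>a\<in>carrier R. \<exists>m\<in>carrier M. ract a m \<noteq> \<zero>\<^bsub>M\<^esub>) \<and>
    (\<forall>N. RH_submodule K H R M ract hact N \<longrightarrow> N = {\<zero>\<^bsub>M\<^esub>} \<or> N = carrier M)"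

text \<open>
  A definition cannot quantify over all types, so the modules here have their elements in the
  type of sets of elements of \<open>R \<otimes> H\<close>. This loses nothing, since an irreducible module is
  isomorphic to a quotient of \<open>R \<otimes> H\<close>; lemma \<open>H_jacobson_radical_annihilates\<close> below
  confirms that this radical annihilates the irreducible modules of every type.
\<close>

definition H_jacobson_radical ::
  "('k, 'z) ring_scheme \<Rightarrow> ('k, 'b) hopf \<Rightarrow> ('k, 'r, 'y) module_scheme \<Rightarrow>
    (('b \<Rightarrow> 'k) \<Rightarrow> 'r \<Rightarrow> 'r) \<Rightarrow> (('b \<Rightarrow> 'k) \<Rightarrow> ('b \<Rightarrow> 'k) \<Rightarrow> 'r) \<Rightarrow> 'r set" where
  "H_jacobson_radical K H R act \<sigma> =
    {a \<in> carrier R. \<forall>(M :: ('k, ('b \<Rightarrow> 'r) set) module) ract hact.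
       RH_irreducible K H R act \<sigma> M ract hact \<longrightarrow> (\<forall>m\<in>carrier M. ract a m = \<zero>\<^bsub>M\<^esub>)}"

section \<open>The H-Jacobson radical does not depend on the type of the modules\<close>

text \<open>The closure properties of \<open>H\<close> that the lemmas below need.\<close>

definition coordinate_hopf :: "('k, 'z) ring_scheme \<Rightarrow> ('k, 'b) hopf \<Rightarrow> bool" where
  "coordinate_hopf K H \<longleftrightarrow> finite (basis H) \<and> carrier H = basis H \<rightarrow>\<^sub>E carrier K \<and>
     zero H = (\<lambda>b\<in>basis H. \<zero>\<^bsub>K\<^esub>) \<and>
     add H = (\<lambda>x y. \<lambda>b\<in>basis H. x b \<oplus>\<^bsub>K\<^esub> y b) \<and>
     smult H = (\<lambda>k x. \<lambda>b\<in>basis H. k \<otimes>\<^bsub>K\<^esub> x b) \<and>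
     \<one>\<^bsub>H\<^esub> \<in> carrier H \<and> (\<forall>x\<in>carrier H. \<forall>y\<in>carrier H. x \<otimes>\<^bsub>H\<^esub> y \<in> carrier H) \<and>
     (\<forall>x\<in>carrier H. \<forall>c\<in>basis H. \<forall>d\<in>basis H. comult H x c d \<in> carrier K) \<and>
     (\<forall>x\<in>carrier H. counit H x \<in> carrier K)"

lemma basis_vector_closed:
  assumes "field K" "coordinate_hopf K H"
  shows "basis_vector K H b \<in> carrier H"
proof -
  interpret field K by fact
  show ?thesis
    using assms(2) by (auto simp: coordinate_hopf_def basis_vector_def)
qed

lemma coordinate_hopf_group_algebra:
  assumes "field K" "group G" "finite (carrier G)"
  shows "coordinate_hopf K (group_algebra K G)"
proof -
  interpret K: field K by fact
  interpret G: group G by fact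
  show ?thesis
    using assms(3)
    by (auto simp: coordinate_hopf_def group_algebra_def intro!: K.finsum_closed)
qed

lemma coordinate_hopf_dual:
  assumes "field K" "coordinate_hopf K H"
  shows "coordinate_hopf K (dual_hopf K H)"
proof -
  interpret K: field K by fact
  have e: "basis_vector K H b \<in> carrier H" for b
    using basis_vector_closed[OF assms] .
  have v: "x b \<in> carrier K" if "x \<in> carrier H" "b \<in> basis H" for x b
    using that assms(2) by (auto simp: coordinate_hopf_def)
  have 1: "(basis_vector K H c \<otimes>\<^bsub>H\<^esub> basis_vector K H d) b \<in> carrier K" if "b \<in> basis H" for b c d
    using assms(2) e v that by (auto simp: coordinate_hopf_def)
  have 2: "\<one>\<^bsub>H\<^esub> b \<in> carrier K" if "b \<in> basis H" for b
    using assms(2) v that by (auto simp: coordinate_hopf_def)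
  have 3: "comult H (basis_vector K H b) c d \<in> carrier K" if "c \<in> basis H" "d \<in> basis H" for b c d
    using assms(2) e that by (auto simp: coordinate_hopf_def)
  have 4: "counit H (basis_vector K H b) \<in> carrier K" for b
    using assms(2) e by (auto simp: coordinate_hopf_def)
  have C: "carrier H = basis H \<rightarrow>\<^sub>E carrier K"
    using assms(2) by (auto simp: coordinate_hopf_def)
  have m: "(\<lambda>b\<in>basis H. \<Oplus>\<^bsub>K\<^esub>c\<in>basis H. \<Oplus>\<^bsub>K\<^esub>d\<in>basis H.
        comult H (basis_vector K H b) c d \<otimes>\<^bsub>K\<^esub> (x c \<otimes>\<^bsub>K\<^esub> y d)) \<in> carrier H"
    if "x \<in> carrier H" "y \<in> carrier H" for x y
    unfolding C by (auto intro!: K.finsum_closed K.m_closed 3 v[OF that(1)] v[OF that(2)])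
  have n: "(\<Oplus>\<^bsub>K\<^esub>b\<in>basis H. (basis_vector K H c \<otimes>\<^bsub>H\<^esub> basis_vector K H d) b \<otimes>\<^bsub>K\<^esub> x b) \<in> carrier K"
    if "x \<in> carrier H" for x c d
    by (auto intro!: K.finsum_closed K.m_closed 1 v[OF that])
  have o: "(\<Oplus>\<^bsub>K\<^esub>b\<in>basis H. \<one>\<^bsub>H\<^esub> b \<otimes>\<^bsub>K\<^esub> x b) \<in> carrier K" if "x \<in> carrier H" for x
    by (auto intro!: K.finsum_closed K.m_closed 2 v[OF that])
  have p: "(\<lambda>b\<in>basis H. counit H (basis_vector K H b)) \<in> carrier H"
    unfolding C using 4 by auto
  show ?thesis
    using assms(2) m n o p unfolding coordinate_hopf_def by (simp add: dual_hopf_def)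
qed

lemma finsum_hom:
  assumes "abelian_group A" "abelian_group B"
    and f: "\<And>x. x \<in> carrier A \<Longrightarrow> f x \<in> carrier B"
    and add: "\<And>x y. x \<in> carrier A \<Longrightarrow> y \<in> carrier A \<Longrightarrow> f (x \<oplus>\<^bsub>A\<^esub> y) = f x \<oplus>\<^bsub>B\<^esub> f y"
    and "finite S" "\<And>s. s \<in> S \<Longrightarrow> g s \<in> carrier A"
  shows "f (\<Oplus>\<^bsub>A\<^esub>s\<in>S. g s) = (\<Oplus>\<^bsub>B\<^esub>s\<in>S. f (g s))"
proof -
  interpret A: abelian_group A by fact
  interpret B: abelian_group B by fact
  have "f \<zero>\<^bsub>A\<^esub> \<oplus>\<^bsub>B\<^esub> f \<zero>\<^bsub>A\<^esub> = f \<zero>\<^bsub>A\<^esub>"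
    using add[of "\<zero>\<^bsub>A\<^esub>" "\<zero>\<^bsub>A\<^esub>"] by simp
  then have z: "f \<zero>\<^bsub>A\<^esub> = \<zero>\<^bsub>B\<^esub>"
    using B.add.l_cancel_one f by fastforce
  show ?thesis
    using assms(5,6)
  proof (induction S)
    case (insert s S)
    then have "g \<in> S \<rightarrow> carrier A" by auto
    with insert show ?case
      by (simp add: Pi_iff f add)
  qed (simp add: z)
qed

lemma finsum_submodule:
  assumes "module K V" "submodule N K V" "finite S" "\<And>s. s \<in> S \<Longrightarrow> g s \<in> N"
  shows "(\<Oplus>\<^bsub>V\<^esub>s\<in>S. g s) \<in> N"
proof -
  interpret V: module K V by fact
  have N: "N \<subseteq> carrier V" "\<zero>\<^bsub>V\<^esub> \<in> N"
    using V.submoduleE(1)[OF assms(2)] subgroup.one_closed[OF submodule.axioms(1)[OF assms(2)]] by auto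
  show ?thesis
    using assms(3,4)
  proof (induction S)
    case (insert s S)
    then have "g \<in> S \<rightarrow> carrier V" "g s \<in> carrier V" using N by auto
    with insert show ?case
      using V.submoduleE(5)[OF assms(2)] by simp
  qed (simp add: N)
qed

lemma sweedler2_submodule:
  assumes "module K V" "submodule N K V" "coordinate_hopf K H" "h \<in> carrier H"
    and "\<And>c d. c \<in> basis H \<Longrightarrow> d \<in> basis H \<Longrightarrow> F (basis_vector K H c) (basis_vector K H d) \<in> N"
  shows "sweedler2 K H V h F \<in> N"
  unfolding sweedler2_def
  using assms
  by (auto intro!: finsum_submodule[OF assms(1,2)] submodule.smult_closed[OF assms(2)]
      simp: coordinate_hopf_def)

lemma sweedler2_closed:
  assumes "module K V" "coordinate_hopf K H" "h \<in> carrier H"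
    and "\<And>c d. c \<in> basis H \<Longrightarrow> d \<in> basis H \<Longrightarrow> F (basis_vector K H c) (basis_vector K H d) \<in> carrier V"
  shows "sweedler2 K H V h F \<in> carrier V"
  using sweedler2_submodule[of K V "carrier V" H h F] module.carrier_is_submodule[OF assms(1)] assms
  by blast

lemma sweedler2_cong:
  assumes "module K V" "coordinate_hopf K H" "h \<in> carrier H"
    and "\<And>c d. c \<in> basis H \<Longrightarrow> d \<in> basis H \<Longrightarrow> F (basis_vector K H c) (basis_vector K H d) \<in> carrier V"
    and "\<And>c d. c \<in> basis H \<Longrightarrow> d \<in> basis H \<Longrightarrow>
      F' (basis_vector K H c) (basis_vector K H d) = F (basis_vector K H c) (basis_vector K H d)"
  shows "sweedler2 K H V h F' = sweedler2 K H V h F"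
proof -
  interpret V: module K V by fact
  have "comult H h c d \<in> carrier K" if "c \<in> basis H" "d \<in> basis H" for c d
    using assms(2,3) that by (auto simp: coordinate_hopf_def)
  then show ?thesis
    unfolding sweedler2_def using assms(4,5)
    by (intro V.finsum_cong' refl) (auto intro!: V.finsum_closed V.finsum_cong')
qed

lemma sweedler2_hom:
  assumes "module K V" "module K W" "coordinate_hopf K H" "h \<in> carrier H"
    and f: "\<And>x. x \<in> carrier V \<Longrightarrow> f x \<in> carrier W"
    and add: "\<And>x y. x \<in> carrier V \<Longrightarrow> y \<in> carrier V \<Longrightarrow> f (x \<oplus>\<^bsub>V\<^esub> y) = f x \<oplus>\<^bsub>W\<^esub> f y"
    and smult: "\<And>k x. k \<in> carrier K \<Longrightarrow> x \<in> carrier V \<Longrightarrow> f (k \<odot>\<^bsub>V\<^esub> x) = k \<odot>\<^bsub>W\<^esub> f x"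
    and F: "\<And>c d. c \<in> basis H \<Longrightarrow> d \<in> basis H \<Longrightarrow>
      F (basis_vector K H c) (basis_vector K H d) \<in> carrier V"
  shows "f (sweedler2 K H V h F) = sweedler2 K H W h (\<lambda>x y. f (F x y))"
proof -
  interpret V: module K V by fact
  interpret W: module K W by fact
  have c: "comult H h c d \<in> carrier K" if "c \<in> basis H" "d \<in> basis H" for c d
    using assms(3,4) that by (auto simp: coordinate_hopf_def)
  have fin: "finite (basis H)" using assms(3) by (auto simp: coordinate_hopf_def)
  note hom = finsum_hom[of V W f, OF V.abelian_group_axioms W.abelian_group_axioms f add fin]
  have "f (sweedler2 K H V h F) = (\<Oplus>\<^bsub>W\<^esub>c\<in>basis H. f (\<Oplus>\<^bsub>V\<^esub>d\<in>basis H.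
      comult H h c d \<odot>\<^bsub>V\<^esub> F (basis_vector K H c) (basis_vector K H d)))"
    unfolding sweedler2_def by (rule hom) (auto intro!: V.finsum_closed c F)
  also have "\<dots> = sweedler2 K H W h (\<lambda>x y. f (F x y))"
    unfolding sweedler2_def
  proof (rule W.finsum_cong'[OF refl])
    show "(\<lambda>c. \<Oplus>\<^bsub>W\<^esub>d\<in>basis H. comult H h c d \<odot>\<^bsub>W\<^esub>
        f (F (basis_vector K H c) (basis_vector K H d))) \<in> basis H \<rightarrow> carrier W"
      by (intro Pi_I W.finsum_closed W.smult_closed c f F)
    fix i assume i: "i \<in> basis H"
    have "f (\<Oplus>\<^bsub>V\<^esub>d\<in>basis H. comult H h i d \<odot>\<^bsub>V\<^esub> F (basis_vector K H i) (basis_vector K H d)) =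
      (\<Oplus>\<^bsub>W\<^esub>d\<in>basis H. f (comult H h i d \<odot>\<^bsub>V\<^esub> F (basis_vector K H i) (basis_vector K H d)))"
      by (rule hom) (auto intro!: c F i)
    also have "\<dots> = (\<Oplus>\<^bsub>W\<^esub>d\<in>basis H. comult H h i d \<odot>\<^bsub>W\<^esub>
        f (F (basis_vector K H i) (basis_vector K H d)))"
      by (rule W.finsum_cong'[OF refl]) (auto simp: smult c F i f)
    finally show "f (\<Oplus>\<^bsub>V\<^esub>d\<in>basis H. comult H h i d \<odot>\<^bsub>V\<^esub> F (basis_vector K H i) (basis_vector K H d)) =
      (\<Oplus>\<^bsub>W\<^esub>d\<in>basis H. comult H h i d \<odot>\<^bsub>W\<^esub>
        f (F (basis_vector K H i) (basis_vector K H d)))" .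
  qed
  finally show ?thesis .
qed

lemma finsum_basis_expansion:
  assumes K: "field K" and "coordinate_hopf K H" and M: "module K M"
    and bil: "bilinear_map K H M M hact"
    and h: "h \<in> carrier H" and m: "m \<in> carrier M"
  shows "hact h m = (\<Oplus>\<^bsub>M\<^esub>b\<in>basis H. h b \<odot>\<^bsub>M\<^esub> hact (basis_vector K H b) m)"
proof -
  interpret K: field K by fact
  interpret M: module K M by fact
  note H = assms(2)[unfolded coordinate_hopf_def]
  note e = basis_vector_closed[OF K assms(2)]
  have Hc: "carrier H = basis H \<rightarrow>\<^sub>E carrier K"
    and Ha: "add H = (\<lambda>x y. \<lambda>b\<in>basis H. x b \<oplus>\<^bsub>K\<^esub> y b)"
    and Hs: "smult H = (\<lambda>k x. \<lambda>b\<in>basis H. k \<otimes>\<^bsub>K\<^esub> x b)"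
    using H by blast+
  have hb: "h b \<in> carrier K" if "b \<in> basis H" for b
    using h that unfolding Hc by auto
  have cl: "hact x m \<in> carrier M" if "x \<in> carrier H" for x
    using bil that m by (auto simp: bilinear_map_def)
  have ad: "hact (x \<oplus>\<^bsub>H\<^esub> y) m = hact x m \<oplus>\<^bsub>M\<^esub> hact y m" if "x \<in> carrier H" "y \<in> carrier H" for x y
    using bil that m by (auto simp: bilinear_map_def)
  have sm: "hact (k \<odot>\<^bsub>H\<^esub> x) m = k \<odot>\<^bsub>M\<^esub> hact x m" if "k \<in> carrier K" "x \<in> carrier H" for k x
    using bil that m by (auto simp: bilinear_map_def)
  define r where "r S = (\<lambda>b\<in>basis H. if b \<in> S then h b else \<zero>\<^bsub>K\<^esub>)" for S
  have rc: "r S \<in> carrier H" for S unfolding Hc using hb by (auto simp: r_def)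
  have "hact (r S) m = (\<Oplus>\<^bsub>M\<^esub>b\<in>S. h b \<odot>\<^bsub>M\<^esub> hact (basis_vector K H b) m)"
    if "finite S" "S \<subseteq> basis H" for S
    using that
  proof (induction S)
    case empty
    have "r {} = \<zero>\<^bsub>K\<^esub> \<odot>\<^bsub>H\<^esub> h"
      unfolding r_def Hs by (rule ext) (simp add: hb)
    then show ?case using sm[of "\<zero>\<^bsub>K\<^esub>" h] cl[OF h] h by (simp add: M.smult_l_null)
  next
    case (insert s S)
    have "r (insert s S) = (h s \<odot>\<^bsub>H\<^esub> basis_vector K H s) \<oplus>\<^bsub>H\<^esub> r S"
      unfolding r_def Hs Ha basis_vector_def
      by (rule ext) (use insert.hyps insert.prems in \<open>auto simp: hb\<close>)
    moreover have "h s \<odot>\<^bsub>H\<^esub> basis_vector K H s \<in> carrier H"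
      unfolding Hc Hs basis_vector_def using hb insert.prems by auto
    ultimately have "hact (r (insert s S)) m
        = h s \<odot>\<^bsub>M\<^esub> hact (basis_vector K H s) m \<oplus>\<^bsub>M\<^esub> hact (r S) m"
      using insert by (simp add: ad sm rc e hb)
    moreover have "(\<lambda>b. h b \<odot>\<^bsub>M\<^esub> hact (basis_vector K H b) m) \<in> S \<rightarrow> carrier M"
      "h s \<odot>\<^bsub>M\<^esub> hact (basis_vector K H s) m \<in> carrier M"
      using insert hb cl e by auto
    ultimately show ?case using insert by simp
  qed
  from this[of "basis H"] have "hact (r (basis H)) m = (\<Oplus>\<^bsub>M\<^esub>b\<in>basis H. h b \<odot>\<^bsub>M\<^esub> hact (basis_vector K H b) m)"
    using H by auto
  moreover have "r (basis H) = h"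
    using h unfolding Hc r_def by (auto simp: PiE_iff extensional_def fun_eq_iff)
  ultimately show ?thesis by simp
qed

text \<open>An irreducible module is a quotient of \<open>R \<otimes> H\<close>.\<close>

lemma RH_irreducible_cyclic:
  assumes K: "field K" and H: "coordinate_hopf K H" and R: "k_algebra K R"
    and tw: "twisted_module_algebra K H R act \<sigma>"
    and irr: "RH_irreducible K H R act \<sigma> M ract hact"
  obtains m0 where "m0 \<in> carrier M"
    "carrier M = (\<lambda>x. \<Oplus>\<^bsub>M\<^esub>b\<in>basis H. ract (x b) (hact (basis_vector K H b) m0)) `
      (basis H \<rightarrow>\<^sub>E carrier R)"
proof -
  interpret R: k_algebra K R by fact
  interpret M: RH_module K H R act \<sigma> M ract hact
    using irr by (simp add: RH_irreducible_def)
  have fin: "finite (basis H)" using H by (simp add: coordinate_hopf_def)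
  note e = basis_vector_closed[OF K H]
  have rcl: "ract a m \<in> carrier M" if "a \<in> carrier R" "m \<in> carrier M" for a m
    using M.ract_bilinear that by (auto simp: bilinear_map_def)
  have hcl: "hact h m \<in> carrier M" if "h \<in> carrier H" "m \<in> carrier M" for h m
    using M.hact_bilinear that by (auto simp: bilinear_map_def)
  have rad: "ract a (m \<oplus>\<^bsub>M\<^esub> n) = ract a m \<oplus>\<^bsub>M\<^esub> ract a n"
    if "a \<in> carrier R" "m \<in> carrier M" "n \<in> carrier M" for a m n
    using M.ract_bilinear that by (auto simp: bilinear_map_def)
  have rad': "ract (a \<oplus>\<^bsub>R\<^esub> b) m = ract a m \<oplus>\<^bsub>M\<^esub> ract b m"
    if "a \<in> carrier R" "b \<in> carrier R" "m \<in> carrier M" for a b m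
    using M.ract_bilinear that by (auto simp: bilinear_map_def)
  have rsm: "ract a (k \<odot>\<^bsub>M\<^esub> m) = k \<odot>\<^bsub>M\<^esub> ract a m" "ract (k \<odot>\<^bsub>R\<^esub> a) m = k \<odot>\<^bsub>M\<^esub> ract a m"
    if "a \<in> carrier R" "m \<in> carrier M" "k \<in> carrier K" for a m k
    using M.ract_bilinear that by (auto simp: bilinear_map_def)
  have had: "hact h (m \<oplus>\<^bsub>M\<^esub> n) = hact h m \<oplus>\<^bsub>M\<^esub> hact h n"
    if "h \<in> carrier H" "m \<in> carrier M" "n \<in> carrier M" for h m n
    using M.hact_bilinear that by (auto simp: bilinear_map_def)
  have bact: "bilinear_map K H R R act" and bsig: "bilinear_map K H H R \<sigma>"
    using tw[unfolded twisted_module_algebra_def weak_action_def, THEN conjunct1, THEN conjunct1]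
      tw[unfolded twisted_module_algebra_def, THEN conjunct2, THEN conjunct1] .
  have acl: "act h a \<in> carrier R" if "h \<in> carrier H" "a \<in> carrier R" for h a
    using bact that by (simp add: bilinear_map_def)
  have scl: "\<sigma> h g \<in> carrier R" if "h \<in> carrier H" "g \<in> carrier H" for h g
    using bsig that by (simp add: bilinear_map_def)
  have mcl: "h \<otimes>\<^bsub>H\<^esub> g \<in> carrier H" if "h \<in> carrier H" "g \<in> carrier H" for h g
    using H that unfolding coordinate_hopf_def by blast
  have vcl: "h b \<in> carrier K" if "h \<in> carrier H" "b \<in> basis H" for h b
    using H that by (auto simp: coordinate_hopf_def)
  have submI: "submodule N K M"
    if "N \<subseteq> carrier M" "\<zero>\<^bsub>M\<^esub> \<in> N" "\<And>a b. a \<in> N \<Longrightarrow> b \<in> N \<Longrightarrow> a \<oplus>\<^bsub>M\<^esub> b \<in> N"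
      "\<And>k x. k \<in> carrier K \<Longrightarrow> x \<in> N \<Longrightarrow> k \<odot>\<^bsub>M\<^esub> x \<in> N" for N
  proof (rule M.submoduleI)
    fix a assume a: "a \<in> N"
    have "(\<ominus>\<^bsub>K\<^esub> \<one>\<^bsub>K\<^esub>) \<odot>\<^bsub>M\<^esub> a = \<ominus>\<^bsub>M\<^esub> a"
      using M.smult_l_minus[of "\<one>\<^bsub>K\<^esub>" a] a that(1) by auto
    with that(4)[of "\<ominus>\<^bsub>K\<^esub> \<one>\<^bsub>K\<^esub>" a] a show "\<ominus>\<^bsub>M\<^esub> a \<in> N" by simp
  qed (use that in auto)
  have one_null: "ract \<one>\<^bsub>R\<^esub> \<zero>\<^bsub>M\<^esub> = \<zero>\<^bsub>M\<^esub>"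
    using rsm(1)[of "\<one>\<^bsub>R\<^esub>" "\<zero>\<^bsub>M\<^esub>" "\<zero>\<^bsub>K\<^esub>"] rcl[of "\<one>\<^bsub>R\<^esub>" "\<zero>\<^bsub>M\<^esub>"] by (simp add: M.smult_l_null)
  obtain a1 m1 where am: "a1 \<in> carrier R" "m1 \<in> carrier M" "ract a1 m1 \<noteq> \<zero>\<^bsub>M\<^esub>"
    using irr by (auto simp: RH_irreducible_def)
  let ?N = "{m \<in> carrier M. ract \<one>\<^bsub>R\<^esub> m = m}"
  have one_ract: "ract a m \<in> ?N" if "a \<in> carrier R" "m \<in> carrier M" for a m
    using that M.ract_mult[of "\<one>\<^bsub>R\<^esub>" a m] by (simp add: rcl)
  have sN: "submodule ?N K M"
    by (rule submI) (auto simp: one_null rad rsm)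
  have "RH_submodule K H R M ract hact ?N"
    unfolding RH_submodule_def
  proof (intro conjI ballI sN)
    fix a m assume "a \<in> carrier R" "m \<in> ?N"
    then show "ract a m \<in> ?N" using one_ract by blast
  next
    fix h m assume h: "h \<in> carrier H" and "m \<in> ?N"
    then have m: "m \<in> carrier M" "ract \<one>\<^bsub>R\<^esub> m = m" by auto
    have "sweedler2 K H M h (\<lambda>h1 h2. ract (act h1 \<one>\<^bsub>R\<^esub>) (hact h2 m)) \<in> ?N"
      by (rule sweedler2_submodule[OF M.module_axioms sN H h]) (intro one_ract acl hcl e m, simp)
    then show "hact h m \<in> ?N"
      using M.hact_ract[OF h _ m(1), of "\<one>\<^bsub>R\<^esub>"] m(2) by simp
  qed
  moreover have "?N \<noteq> {\<zero>\<^bsub>M\<^esub>}"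
    using one_ract[OF am(1,2)] am(3) by blast
  ultimately have "?N = carrier M"
    using irr by (auto simp: RH_irreducible_def)
  then have unit: "ract \<one>\<^bsub>R\<^esub> m = m" if "m \<in> carrier M" for m
    using that by blast
  define m0 where "m0 = ract a1 m1"
  have m0: "m0 \<in> carrier M" "m0 \<noteq> \<zero>\<^bsub>M\<^esub>" using am rcl by (auto simp: m0_def)
  define s where "s x = (\<Oplus>\<^bsub>M\<^esub>b\<in>basis H. ract (x b) (hact (basis_vector K H b) m0))" for x
  define N where "N = s ` (basis H \<rightarrow>\<^sub>E carrier R)"
  have em: "hact (basis_vector K H b) m0 \<in> carrier M" for b using hcl e m0 by simp
  have tcl: "(\<lambda>b. ract (x b) (hact (basis_vector K H b) m0)) \<in> basis H \<rightarrow> carrier M"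
    if "x \<in> basis H \<rightarrow> carrier R" for x
    using that by (auto intro!: rcl em)
  have scl': "s x \<in> carrier M" if "x \<in> basis H \<rightarrow> carrier R" for x
    unfolding s_def by (rule M.finsum_closed[OF tcl[OF that]])
  have srestr: "s (restrict x (basis H)) = s x" if "x \<in> basis H \<rightarrow> carrier R" for x
    unfolding s_def by (rule M.finsum_cong') (use tcl[OF that] in auto)
  have NI: "s x \<in> N" if "x \<in> basis H \<rightarrow> carrier R" for x
  proof -
    have "restrict x (basis H) \<in> basis H \<rightarrow>\<^sub>E carrier R" using that by auto
    from imageI[OF this, of s] show ?thesis by (simp add: N_def srestr[OF that])
  qed
  have NE: "\<exists>x\<in>basis H \<rightarrow> carrier R. y = s x" if "y \<in> N" for y
    using that unfolding N_def by (auto simp: PiE_iff Pi_iff)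
  have s_add: "s (\<lambda>b. x b \<oplus>\<^bsub>R\<^esub> y b) = s x \<oplus>\<^bsub>M\<^esub> s y"
    if "x \<in> basis H \<rightarrow> carrier R" "y \<in> basis H \<rightarrow> carrier R" for x y
    unfolding s_def M.finsum_addf[OF tcl[OF that(1)] tcl[OF that(2)], symmetric]
    by (rule M.finsum_cong') (use that tcl em rad' in \<open>auto simp: Pi_iff\<close>)
  have s_smult: "s (\<lambda>b. k \<odot>\<^bsub>R\<^esub> x b) = k \<odot>\<^bsub>M\<^esub> s x"
    if "k \<in> carrier K" "x \<in> basis H \<rightarrow> carrier R" for k x
    unfolding s_def M.finsum_smult_ldistr[OF fin that(1) tcl[OF that(2)]]
    by (rule M.finsum_cong') (use that tcl em rsm in \<open>auto simp: Pi_iff\<close>)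
  have s_ract: "s (\<lambda>b. a \<otimes>\<^bsub>R\<^esub> x b) = ract a (s x)"
    if "a \<in> carrier R" "x \<in> basis H \<rightarrow> carrier R" for a x
  proof -
    have "ract a (s x) = (\<Oplus>\<^bsub>M\<^esub>b\<in>basis H. ract a (ract (x b) (hact (basis_vector K H b) m0)))"
      unfolding s_def
      by (rule finsum_hom[OF M.abelian_group_axioms M.abelian_group_axioms _ _ fin])
         (use that tcl[OF that(2)] in \<open>auto simp: rcl rad\<close>)
    also have "\<dots> = s (\<lambda>b. a \<otimes>\<^bsub>R\<^esub> x b)"
      unfolding s_def
      by (rule M.finsum_cong') (use that em in \<open>auto simp: Pi_iff M.ract_mult intro!: rcl\<close>)
    finally show ?thesis ..
  qed
  have sub: "submodule N K M"
  proof (rule submI)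
    show "N \<subseteq> carrier M" using NE scl' by blast
    have z: "(\<lambda>b. \<one>\<^bsub>R\<^esub>) \<in> basis H \<rightarrow> carrier R" by auto
    then have "(\<lambda>b. \<zero>\<^bsub>K\<^esub> \<odot>\<^bsub>R\<^esub> \<one>\<^bsub>R\<^esub>) \<in> basis H \<rightarrow> carrier R" by auto
    from NI[OF this] show "\<zero>\<^bsub>M\<^esub> \<in> N"
      using s_smult[OF _ z, of "\<zero>\<^bsub>K\<^esub>"] scl'[OF z] by (simp add: M.smult_l_null)
  next
    fix y z assume "y \<in> N" "z \<in> N"
    then obtain u v where u: "u \<in> basis H \<rightarrow> carrier R" "y = s u"
      and v: "v \<in> basis H \<rightarrow> carrier R" "z = s v" using NE by blast
    have "(\<lambda>b. u b \<oplus>\<^bsub>R\<^esub> v b) \<in> basis H \<rightarrow> carrier R" using u v by (auto simp: Pi_iff)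
    from NI[OF this] show "y \<oplus>\<^bsub>M\<^esub> z \<in> N" using s_add u v by simp
  next
    fix k y assume k: "k \<in> carrier K" and "y \<in> N"
    then obtain u where u: "u \<in> basis H \<rightarrow> carrier R" "y = s u" using NE by blast
    have "(\<lambda>b. k \<odot>\<^bsub>R\<^esub> u b) \<in> basis H \<rightarrow> carrier R" using k u by (auto simp: Pi_iff)
    from NI[OF this] show "k \<odot>\<^bsub>M\<^esub> y \<in> N" using s_smult[OF k] u by simp
  qed
  have rN: "ract a y \<in> N" if a: "a \<in> carrier R" and "y \<in> N" for a y
  proof -
    from NE that obtain u where u: "u \<in> basis H \<rightarrow> carrier R" "y = s u" by blast
    have "(\<lambda>b. a \<otimes>\<^bsub>R\<^esub> u b) \<in> basis H \<rightarrow> carrier R" using a u by (auto simp: Pi_iff)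
    from NI[OF this] show ?thesis using s_ract[OF a] u by simp
  qed
  have hm: "hact h m0 \<in> N" if h: "h \<in> carrier H" for h
  proof -
    have x: "(\<lambda>b. h b \<odot>\<^bsub>R\<^esub> \<one>\<^bsub>R\<^esub>) \<in> basis H \<rightarrow> carrier R" using vcl h by (auto simp: Pi_iff)
    have "s (\<lambda>b. h b \<odot>\<^bsub>R\<^esub> \<one>\<^bsub>R\<^esub>) = (\<Oplus>\<^bsub>M\<^esub>b\<in>basis H. h b \<odot>\<^bsub>M\<^esub> hact (basis_vector K H b) m0)"
      unfolding s_def
      by (rule M.finsum_cong') (use em vcl h in \<open>auto simp: rsm unit\<close>)
    also have "\<dots> = hact h m0"
      using finsum_basis_expansion[OF K H M.module_axioms M.hact_bilinear h m0(1)] by simp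
    finally show ?thesis using NI[OF x] by simp
  qed
  have hN: "hact h y \<in> N" if h: "h \<in> carrier H" and "y \<in> N" for h y
  proof -
    from NE that obtain u where u: "u \<in> basis H \<rightarrow> carrier R" "y = s u" by blast
    have 1: "hact g (hact g' m0) \<in> N" if g: "g \<in> carrier H" "g' \<in> carrier H" for g g'
      unfolding M.hact_hact[OF g m0(1)]
      by (intro sweedler2_submodule[OF M.module_axioms sub H] g rN scl hm mcl e)
    have 2: "hact h (ract a (hact g' m0)) \<in> N" if a: "a \<in> carrier R" "g' \<in> carrier H" for a g'
      unfolding M.hact_ract[OF h a(1) hcl[OF a(2) m0(1)]]
      by (intro sweedler2_submodule[OF M.module_axioms sub H] h rN acl 1 e a)
    have "hact h y = (\<Oplus>\<^bsub>M\<^esub>b\<in>basis H. hact h (ract (u b) (hact (basis_vector K H b) m0)))"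
      unfolding u(2) s_def
      by (rule finsum_hom[OF M.abelian_group_axioms M.abelian_group_axioms _ _ fin])
         (use h tcl[OF u(1)] in \<open>auto simp: hcl had\<close>)
    also have "\<dots> \<in> N"
      by (rule finsum_submodule[OF M.module_axioms sub fin], rule 2) (use u e in auto)
    finally show ?thesis .
  qed
  have "RH_submodule K H R M ract hact N"
    using sub rN hN by (auto simp: RH_submodule_def)
  moreover have "\<one>\<^bsub>H\<^esub> \<in> carrier H"
    using H unfolding coordinate_hopf_def by blast
  then have "m0 \<in> N"
    using hm[of "\<one>\<^bsub>H\<^esub>"] M.hact_one[OF m0(1)] by simp
  then have "N \<noteq> {\<zero>\<^bsub>M\<^esub>}" using m0 by auto
  ultimately have "N = carrier M"
    using irr by (auto simp: RH_irreducible_def)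
  then show thesis
    using that[OF m0(1)] by (simp add: N_def s_def)
qed

lemma RH_irreducible_transport:
  fixes M :: "('k, 'm) module" and \<phi> :: "'m \<Rightarrow> 'n"
  assumes K: "field K" and H: "coordinate_hopf K H" and R: "k_algebra K R"
    and tw: "twisted_module_algebra K H R act \<sigma>"
    and irr: "RH_irreducible K H R act \<sigma> M ract hact"
    and inj: "inj_on \<phi> (carrier M)"
  obtains M' :: "('k, 'n) module" and ract' hact' where
    "RH_irreducible K H R act \<sigma> M' ract' hact'"
    "\<And>m. m \<in> carrier M \<Longrightarrow> \<phi> m \<in> carrier M'"
    "\<And>a m. m \<in> carrier M \<Longrightarrow> ract' a (\<phi> m) = \<phi> (ract a m)"
    "\<zero>\<^bsub>M'\<^esub> = \<phi> \<zero>\<^bsub>M\<^esub>"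
proof -
  interpret R: k_algebra K R by fact
  interpret M: RH_module K H R act \<sigma> M ract hact
    using irr by (simp add: RH_irreducible_def)
  note e = basis_vector_closed[OF K H]
  define \<psi> where "\<psi> = inv_into (carrier M) \<phi>"
  have \<psi>[simp]: "\<psi> (\<phi> m) = m" if "m \<in> carrier M" for m
    using that inj by (simp add: \<psi>_def)
  define M' :: "('k, 'n) module" where "M' = \<lparr>carrier = \<phi> ` carrier M, mult = undefined, one = undefined,
     zero = \<phi> \<zero>\<^bsub>M\<^esub>, add = (\<lambda>x y. \<phi> (\<psi> x \<oplus>\<^bsub>M\<^esub> \<psi> y)), smult = (\<lambda>k x. \<phi> (k \<odot>\<^bsub>M\<^esub> \<psi> x))\<rparr>"
  define ract' where "ract' a x = \<phi> (ract a (\<psi> x))" for a x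
  define hact' where "hact' h x = \<phi> (hact h (\<psi> x))" for h x
  have M'[simp]: "carrier M' = \<phi> ` carrier M" "\<zero>\<^bsub>M'\<^esub> = \<phi> \<zero>\<^bsub>M\<^esub>"
    "x \<oplus>\<^bsub>M'\<^esub> y = \<phi> (\<psi> x \<oplus>\<^bsub>M\<^esub> \<psi> y)" "k \<odot>\<^bsub>M'\<^esub> x = \<phi> (k \<odot>\<^bsub>M\<^esub> \<psi> x)" for x y k
    by (simp_all add: M'_def)
  have rcl[simp]: "ract a m \<in> carrier M" if "a \<in> carrier R" "m \<in> carrier M" for a m
    using M.ract_bilinear that by (auto simp: bilinear_map_def)
  have hcl[simp]: "hact h m \<in> carrier M" if "h \<in> carrier H" "m \<in> carrier M" for h m
    using M.hact_bilinear that by (auto simp: bilinear_map_def)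
  have bact: "bilinear_map K H R R act" and bsig: "bilinear_map K H H R \<sigma>"
    using tw[unfolded twisted_module_algebra_def weak_action_def, THEN conjunct1, THEN conjunct1]
      tw[unfolded twisted_module_algebra_def, THEN conjunct2, THEN conjunct1] .
  have acl: "act h a \<in> carrier R" if "h \<in> carrier H" "a \<in> carrier R" for h a
    using bact that by (simp add: bilinear_map_def)
  have scl: "\<sigma> h g \<in> carrier R" if "h \<in> carrier H" "g \<in> carrier H" for h g
    using bsig that by (simp add: bilinear_map_def)
  have mcl: "h \<otimes>\<^bsub>H\<^esub> g \<in> carrier H" if "h \<in> carrier H" "g \<in> carrier H" for h g
    using H that unfolding coordinate_hopf_def by blast
  have mod: "module K M'"
  proof (rule moduleI)
    show "cring K" by (rule module.axioms(1)[OF M.module_axioms])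
    show "abelian_group M'"
    proof (rule abelian_groupI)
      fix x assume "x \<in> carrier M'"
      then obtain m where m: "m \<in> carrier M" "x = \<phi> m" by auto
      show "\<exists>y\<in>carrier M'. y \<oplus>\<^bsub>M'\<^esub> x = \<zero>\<^bsub>M'\<^esub>"
        using m by (intro bexI[of _ "\<phi> (\<ominus>\<^bsub>M\<^esub> m)"]) (auto simp: M.l_neg)
    qed (auto simp: M.a_ac)
  qed (auto simp: M.smult_l_distr M.smult_r_distr M.smult_assoc1)
  have hom: "\<phi> (sweedler2 K H M h F) = sweedler2 K H M' h (\<lambda>x y. \<phi> (F x y))"
    if "h \<in> carrier H" "\<And>c d. c \<in> basis H \<Longrightarrow> d \<in> basis H \<Longrightarrow>
      F (basis_vector K H c) (basis_vector K H d) \<in> carrier M" for h F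
    by (rule sweedler2_hom[OF M.module_axioms mod H]) (use that in auto)
  have RH: "RH_module K H R act \<sigma> M' ract' hact'"
  proof (rule RH_module.intro[OF mod], unfold_locales)
    show "bilinear_map K R M' M' ract'"
      using M.ract_bilinear by (auto simp: bilinear_map_def ract'_def)
    show "bilinear_map K H M' M' hact'"
      using M.hact_bilinear by (auto simp: bilinear_map_def hact'_def)
    show "ract' (a \<otimes>\<^bsub>R\<^esub> b) m = ract' a (ract' b m)"
      if "a \<in> carrier R" "b \<in> carrier R" "m \<in> carrier M'" for a b m
      using that by (auto simp: ract'_def M.ract_mult)
    show "hact' \<one>\<^bsub>H\<^esub> m = m" if "m \<in> carrier M'" for m
      using that by (auto simp: hact'_def M.hact_one)
  next
    fix h a x assume h: "h \<in> carrier H" and a: "a \<in> carrier R" and "x \<in> carrier M'"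
    then obtain m where m: "m \<in> carrier M" "x = \<phi> m" by auto
    have "hact' h (ract' a x) = \<phi> (hact h (ract a m))"
      using m a by (simp add: hact'_def ract'_def)
    also have "\<dots> = sweedler2 K H M' h (\<lambda>h1 h2. \<phi> (ract (act h1 a) (hact h2 m)))"
      unfolding M.hact_ract[OF h a m(1)] by (rule hom[OF h]) (intro rcl acl hcl e a m)
    also have "\<dots> = sweedler2 K H M' h (\<lambda>h1 h2. ract' (act h1 a) (hact' h2 x))"
      by (rule sym, rule sweedler2_cong[OF mod H h])
         (use m e acl a in \<open>auto simp: ract'_def hact'_def\<close>)
    finally show "hact' h (ract' a x) = \<dots>" .
  next
    fix h g x assume h: "h \<in> carrier H" and g: "g \<in> carrier H" and "x \<in> carrier M'"
    then obtain m where m: "m \<in> carrier M" "x = \<phi> m" by auto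
    have in': "ract (\<sigma> h1 g1) (hact (h2 \<otimes>\<^bsub>H\<^esub> g2) m) \<in> carrier M"
      if "h1 \<in> carrier H" "h2 \<in> carrier H" "g1 \<in> carrier H" "g2 \<in> carrier H" for h1 h2 g1 g2
      using that m by (intro rcl scl hcl mcl)
    have "hact' h (hact' g x) = \<phi> (hact h (hact g m))"
      using m g by (simp add: hact'_def)
    also have "\<dots> = sweedler2 K H M' h (\<lambda>h1 h2. \<phi> (sweedler2 K H M g (\<lambda>g1 g2.
          ract (\<sigma> h1 g1) (hact (h2 \<otimes>\<^bsub>H\<^esub> g2) m))))"
      unfolding M.hact_hact[OF h g m(1)]
      by (rule hom[OF h], rule sweedler2_closed[OF M.module_axioms H g]) (intro in' e)
    also have "\<dots> = sweedler2 K H M' h (\<lambda>h1 h2. sweedler2 K H M' g (\<lambda>g1 g2.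
          ract' (\<sigma> h1 g1) (hact' (h2 \<otimes>\<^bsub>H\<^esub> g2) x)))"
    proof (rule sym, rule sweedler2_cong[OF mod H h])
      fix c d
      let ?F = "\<lambda>g1 g2. ract (\<sigma> (basis_vector K H c) g1) (hact (basis_vector K H d \<otimes>\<^bsub>H\<^esub> g2) m)"
      have "sweedler2 K H M g ?F \<in> carrier M"
        by (rule sweedler2_closed[OF M.module_axioms H g]) (intro in' e)
      then show "\<phi> (sweedler2 K H M g ?F) \<in> carrier M'" by simp
      have "\<phi> (sweedler2 K H M g ?F) = sweedler2 K H M' g (\<lambda>g1 g2. \<phi> (?F g1 g2))"
        by (rule hom[OF g]) (intro in' e)
      also have "\<dots> = sweedler2 K H M' g (\<lambda>g1 g2.
          ract' (\<sigma> (basis_vector K H c) g1) (hact' (basis_vector K H d \<otimes>\<^bsub>H\<^esub> g2) x))"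
        by (rule sym, rule sweedler2_cong[OF mod H g])
           (use m e mcl in' in \<open>auto simp: ract'_def hact'_def\<close>)
      finally show "sweedler2 K H M' g (\<lambda>g1 g2.
          ract' (\<sigma> (basis_vector K H c) g1) (hact' (basis_vector K H d \<otimes>\<^bsub>H\<^esub> g2) x))
          = \<phi> (sweedler2 K H M g ?F)" ..
    qed
    finally show "hact' h (hact' g x) = \<dots>" .
  qed
  have nz: "\<exists>a\<in>carrier R. \<exists>m\<in>carrier M'. ract' a m \<noteq> \<zero>\<^bsub>M'\<^esub>"
  proof -
    obtain a m where am: "a \<in> carrier R" "m \<in> carrier M" "ract a m \<noteq> \<zero>\<^bsub>M\<^esub>"
      using irr by (auto simp: RH_irreducible_def)
    then have "\<phi> (ract a m) \<noteq> \<phi> \<zero>\<^bsub>M\<^esub>" by (metis M.zero_closed \<psi> rcl)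
    then show ?thesis using am by (intro bexI[of _ a] bexI[of _ "\<phi> m"]) (auto simp: ract'_def)
  qed
  have subs: "N = {\<zero>\<^bsub>M'\<^esub>} \<or> N = carrier M'" if N: "RH_submodule K H R M' ract' hact' N" for N
  proof -
    let ?P = "{m \<in> carrier M. \<phi> m \<in> N}"
    have s: "submodule N K M'" using N by (simp add: RH_submodule_def)
    note sE = module.submoduleE[OF mod s]
    have sub: "N \<subseteq> \<phi> ` carrier M" using sE(1) by simp
    have z: "\<phi> \<zero>\<^bsub>M\<^esub> \<in> N" using subgroup.one_closed[OF submodule.axioms(1)[OF s]] by simp
    have sm: "\<phi> (k \<odot>\<^bsub>M\<^esub> m) \<in> N" if "k \<in> carrier K" "m \<in> ?P" for k m
      using sE(4)[of k "\<phi> m"] that by simp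
    have "submodule ?P K M"
    proof (rule M.submoduleI)
      fix m assume m: "m \<in> ?P"
      have "(\<ominus>\<^bsub>K\<^esub> \<one>\<^bsub>K\<^esub>) \<odot>\<^bsub>M\<^esub> m = \<ominus>\<^bsub>M\<^esub> m"
        using M.smult_l_minus[of "\<one>\<^bsub>K\<^esub>" m] m by auto
      with sm[of "\<ominus>\<^bsub>K\<^esub> \<one>\<^bsub>K\<^esub>" m] m show "\<ominus>\<^bsub>M\<^esub> m \<in> ?P" by simp
    next
      fix m n assume "m \<in> ?P" "n \<in> ?P"
      then show "m \<oplus>\<^bsub>M\<^esub> n \<in> ?P" using sE(5)[of "\<phi> m" "\<phi> n"] by simp
    qed (use z sm in auto)
    moreover have "\<forall>a\<in>carrier R. \<forall>m\<in>?P. ract a m \<in> ?P" "\<forall>h\<in>carrier H. \<forall>m\<in>?P. hact h m \<in> ?P"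
      using N by (force simp: RH_submodule_def ract'_def hact'_def)+
    ultimately have "?P = {\<zero>\<^bsub>M\<^esub>} \<or> ?P = carrier M"
      using irr by (simp add: RH_irreducible_def RH_submodule_def)
    moreover have "N = \<phi> ` ?P" using sub by auto
    ultimately show ?thesis by auto
  qed
  show thesis
  proof (rule that)
    show "RH_irreducible K H R act \<sigma> M' ract' hact'"
      using RH nz subs by (simp add: RH_irreducible_def)
  qed (auto simp: ract'_def)
qed

lemma H_jacobson_radical_annihilates:
  fixes M :: "('k, 'm) module"
  assumes "field K" and "group G" and "finite (carrier G)"
    and "H = group_algebra K G \<or> H = dual_hopf K (group_algebra K G)"
    and "k_algebra K R" and "twisted_module_algebra K H R act \<sigma>"
    and irr: "RH_irreducible K H R act \<sigma> M ract hact"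
    and a: "a \<in> H_jacobson_radical K H R act \<sigma>" and m: "m \<in> carrier M"
  shows "ract a m = \<zero>\<^bsub>M\<^esub>"
proof -
  have H: "coordinate_hopf K H"
    using assms(4) coordinate_hopf_group_algebra[OF assms(1-3)]
      coordinate_hopf_dual[OF assms(1) coordinate_hopf_group_algebra[OF assms(1-3)]] by auto
  obtain m0 where "m0 \<in> carrier M" and m0: "carrier M =
      (\<lambda>x. \<Oplus>\<^bsub>M\<^esub>b\<in>basis H. ract (x b) (hact (basis_vector K H b) m0)) ` (basis H \<rightarrow>\<^sub>E carrier R)"
    by (rule RH_irreducible_cyclic[OF assms(1) H assms(5,6) irr])
  define s where "s x = (\<Oplus>\<^bsub>M\<^esub>b\<in>basis H. ract (x b) (hact (basis_vector K H b) m0))" for x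
  define \<phi> where "\<phi> m = {x \<in> basis H \<rightarrow>\<^sub>E carrier R. s x = m}" for m
  have s: "carrier M = s ` (basis H \<rightarrow>\<^sub>E carrier R)" using m0 by (simp add: s_def)
  have inj: "inj_on \<phi> (carrier M)"
    unfolding s by (rule inj_onI) (auto simp: \<phi>_def set_eq_iff)
  obtain M' :: "('k, (_ \<Rightarrow> _) set) module" and ract' hact' where
    M': "RH_irreducible K H R act \<sigma> M' ract' hact'"
    "\<And>m. m \<in> carrier M \<Longrightarrow> \<phi> m \<in> carrier M'"
    "\<And>a m. m \<in> carrier M \<Longrightarrow> ract' a (\<phi> m) = \<phi> (ract a m)"
    "\<zero>\<^bsub>M'\<^esub> = \<phi> \<zero>\<^bsub>M\<^esub>"
  proof (rule RH_irreducible_transport[OF assms(1) H assms(5,6) irr inj], goal_cases)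
    case (1 M' ract' hact')
    show ?case by (rule 1(1)[OF 1(2)]) (use 1(3-5) in simp_all)
  qed
  have "a \<in> carrier R" using a by (simp add: H_jacobson_radical_def)
  interpret M: RH_module K H R act \<sigma> M ract hact
    using irr by (simp add: RH_irreducible_def)
  have "ract' a (\<phi> m) = \<zero>\<^bsub>M'\<^esub>"
    by (rule a[unfolded H_jacobson_radical_def, THEN CollectD, THEN conjunct2, rule_format,
          OF M'(1) M'(2)[OF m]])
  then have "\<phi> (ract a m) = \<phi> \<zero>\<^bsub>M\<^esub>" using M'(3,4) m by simp
  moreover have "ract a m \<in> carrier M"
    using M.ract_bilinear \<open>a \<in> carrier R\<close> m by (auto simp: bilinear_map_def)
  ultimately show ?thesis using inj by (auto dest: inj_onD)
qed

end

(*
  Write A for the crossed product and J for the Jacobson radical. Modules over R with an action of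
  H are the modules over A, so the H-Jacobson radical of R is the intersection of R with J(A), and
  everything follows from J(A) = J(R) # H.

  For H = kG, the inclusion of J(R) # H in J(A) is Nakayama's lemma for A over R. For the other
  inclusion let L be a maximal left ideal of R: A/AL is semisimple over R, and averaging over G
  turns an R-linear projection onto the image of J(A) into multiplication by an element of J(A),
  which forces J(A) to be contained in AL (Maschke's theorem).

  For H = (kG)^*, the group G acts on A by automorphisms with fixed ring R, and A is a G-Galois
  extension of R because the cocycle is invertible. Thus every x in A is a combination of traces
  tr(x y) in R, which lie in the intersection of R with J(A) if x is in J(A). The inclusion of J(R)
  in J(A) is the same averaging argument, now for the fixed ring.
*)

theory Submission
  imports Defs "HOL-Algebra.QuotRing"
begin

section \<open>The Jacobson radical of a ring\<close>

text \<open>The averaging arguments do without semisimple modules. A linear projection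
  \<open>p\<close> modulo finitely many maximal left ideals is built one ideal at a time. Combining
  its residues \<open>x - p x\<close> over \<open>G\<close>, without dividing, gives
  \<open>n x - x w \<in> N\<close>, where \<open>N\<close> is the left ideal to be reached,
  \<open>n\<close> the order of \<open>G\<close> and \<open>w\<close> an element of the radical that
  comes from the value of \<open>p\<close> at 1. For \<open>x = w\<close> this reads
  \<open>(n - w) w \<in> N\<close>, and \<open>n - w\<close> is left invertible because
  \<open>n\<close> is and \<open>w\<close> lies in the radical. So \<open>w\<close> lies in
  \<open>N\<close>, then \<open>n x\<close>, then \<open>x\<close>.

  A weak action need not satisfy \<open>g \<cdot> 1 = \<epsilon>(g) 1\<close>, nor the cocycle
  \<open>\<sigma>(g, 1) = \<epsilon>(g)\<close>. Both are extracted from the unit law of the crossed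
  product by an idempotent argument; only then do the products of \<open>R\<close> with the elements
  \<open>1 # h\<close> take the form that identifies modules over \<open>A\<close> with modules
  carrying an action of \<open>H\<close>.

  The radical of \<open>R\<close> is stable under \<open>H\<close> for different reasons: group
  elements act by automorphisms, while for the dual the stability is deduced from the radical of
  \<open>A\<close>.\<close>

context ring
begin

lemma left_idealI:
  assumes "I \<subseteq> carrier R" "\<zero> \<in> I" "\<And>x y. x \<in> I \<Longrightarrow> y \<in> I \<Longrightarrow> x \<oplus> y \<in> I"
    and mult: "\<And>a x. a \<in> carrier R \<Longrightarrow> x \<in> I \<Longrightarrow> a \<otimes> x \<in> I"
  shows "left_ideal I R"
proof -
  have "\<ominus> x \<in> I" if "x \<in> I" for x
    using mult[of "\<ominus> \<one>" x] that assms(1) by (simp add: l_minus subset_iff)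
  then have "subgroup I (add_monoid R)"
    using assms by (intro add.subgroupI) (auto simp: a_inv_def)
  with mult show ?thesis by (auto simp: left_ideal_def intro: additive_subgroupI)
qed

lemma left_idealD:
  assumes "left_ideal I R"
  shows "I \<subseteq> carrier R" "x \<in> I \<Longrightarrow> x \<in> carrier R" "\<zero> \<in> I" "x \<in> I \<Longrightarrow> y \<in> I \<Longrightarrow> x \<oplus> y \<in> I"
    and "a \<in> carrier R \<Longrightarrow> x \<in> I \<Longrightarrow> a \<otimes> x \<in> I"
    and "x \<in> I \<Longrightarrow> \<ominus> x \<in> I" "x \<in> I \<Longrightarrow> y \<in> I \<Longrightarrow> x \<ominus> y \<in> I"
proof -
  interpret additive_subgroup I R using assms by (simp add: left_ideal_def)
  show "I \<subseteq> carrier R" "x \<in> I \<Longrightarrow> x \<in> carrier R" "\<zero> \<in> I"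
    "x \<in> I \<Longrightarrow> y \<in> I \<Longrightarrow> x \<oplus> y \<in> I" using a_Hcarr by auto
  show "x \<in> I \<Longrightarrow> \<ominus> x \<in> I" using subgroup.m_inv_closed[OF a_subgroup] by (simp add: a_inv_def)
  then show "x \<in> I \<Longrightarrow> y \<in> I \<Longrightarrow> x \<ominus> y \<in> I"
    using a_subgroup by (metis a_closed additive_subgroup.a_inv_closed additive_subgroup_axioms minus_eq is_abelian_group)
  show "a \<in> carrier R \<Longrightarrow> x \<in> I \<Longrightarrow> a \<otimes> x \<in> I" using assms by (simp add: left_ideal_def)
qed

lemma left_ideal_finsum:
  assumes "left_ideal I R" "\<And>i. i \<in> S \<Longrightarrow> f i \<in> I"
  shows "(\<Oplus>i\<in>S. f i) \<in> I"
  using assms(2)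
proof (induction S rule: infinite_finite_induct)
  case (insert s S)
  moreover have "f \<in> S \<rightarrow> carrier R" "f s \<in> carrier R"
    using insert.prems left_idealD(2)[OF assms(1)] by auto
  ultimately show ?case using left_idealD(4)[OF assms(1)] by simp
qed (use left_idealD(3)[OF assms(1)] in auto)

lemma left_ideal_one: "left_ideal I R \<Longrightarrow> I = carrier R \<longleftrightarrow> \<one> \<in> I"
  by (metis left_idealD(1) left_idealD(5) one_closed r_one subsetI subset_antisym)

text \<open>Simplicity of the quotient by \<open>L\<close> in terms of elements: whatever lies
  outside \<open>L\<close> is left invertible modulo \<open>L\<close>. In this form maximality pulls
  back along homomorphisms and can be read off from annihilators, without quantifying over
  ideals.\<close>

lemma maximal_left_ideal_iff:
  "maximal_left_ideal L R \<longleftrightarrow> left_ideal L R \<and> \<one> \<notin> L \<and>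
    (\<forall>x\<in>carrier R - L. \<exists>a\<in>carrier R. \<one> \<ominus> a \<otimes> x \<in> L)"
proof
  assume L: "maximal_left_ideal L R"
  then have l: "left_ideal L R" by (simp add: maximal_left_ideal_def)
  note lD = left_idealD[OF l]
  have "\<exists>a\<in>carrier R. \<one> \<ominus> a \<otimes> x \<in> L" if x: "x \<in> carrier R - L" for x
  proof -
    \<comment> \<open>The left ideal \<open>L + R x\<close>; maximality forces it to contain
      \<one>.\<close>
    let ?J = "{l \<oplus> a \<otimes> x | l a. l \<in> L \<and> a \<in> carrier R}"
    have "left_ideal ?J R"
    proof (rule left_idealI)
      show "?J \<subseteq> carrier R" using x lD(2) by auto
      show "\<zero> \<in> ?J" using x lD(3) by (auto intro!: exI[of _ \<zero>])
      fix y z assume "y \<in> ?J" "z \<in> ?J"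
      then obtain l a l' a' where yz: "y = l \<oplus> a \<otimes> x" "z = l' \<oplus> a' \<otimes> x" "l \<in> L" "l' \<in> L"
        "a \<in> carrier R" "a' \<in> carrier R" by auto
      moreover have "y \<oplus> z = (l \<oplus> l') \<oplus> (a \<oplus> a') \<otimes> x"
        using yz x lD(2) by (simp add: l_distr a_ac)
      ultimately show "y \<oplus> z \<in> ?J" using lD(4) by blast
    next
      fix b y assume b: "b \<in> carrier R" and "y \<in> ?J"
      then obtain l a where y: "y = l \<oplus> a \<otimes> x" "l \<in> L" "a \<in> carrier R" by auto
      then have "b \<otimes> y = b \<otimes> l \<oplus> (b \<otimes> a) \<otimes> x"
        using b x lD(2) by (simp add: r_distr m_assoc)
      then show "b \<otimes> y \<in> ?J" using b y lD(5) by blast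
    qed
    moreover have "L \<subseteq> ?J"
    proof
      fix l assume l: "l \<in> L"
      then have "l = l \<oplus> \<zero> \<otimes> x" using x lD(2) by auto
      then show "l \<in> ?J" using l by blast
    qed
    moreover have "x = \<zero> \<oplus> \<one> \<otimes> x" using x by simp
    then have "x \<in> ?J" using lD(3) by blast
    ultimately have "?J = carrier R" using L x unfolding maximal_left_ideal_def by blast
    then obtain l a where la: "\<one> = l \<oplus> a \<otimes> x" "l \<in> L" "a \<in> carrier R"
      using one_closed by (smt (verit) mem_Collect_eq)
    then have "\<one> \<ominus> a \<otimes> x = l" using x lD(2)[OF la(2)] by (simp add: minus_eq a_assoc r_neg)
    with la(2,3) show ?thesis by metis
  qed
  with L l left_ideal_one[OF l] show "left_ideal L R \<and> \<one> \<notin> L \<and>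
      (\<forall>x\<in>carrier R - L. \<exists>a\<in>carrier R. \<one> \<ominus> a \<otimes> x \<in> L)"
    by (auto simp: maximal_left_ideal_def)
next
  assume a: "left_ideal L R \<and> \<one> \<notin> L \<and>
    (\<forall>x\<in>carrier R - L. \<exists>a\<in>carrier R. \<one> \<ominus> a \<otimes> x \<in> L)"
  have "J = carrier R" if J: "left_ideal J R" "L \<subseteq> J" "J \<noteq> L" for J
  proof -
    note JD = left_idealD[OF J(1)]
    obtain x where x: "x \<in> J" "x \<notin> L" using J by auto
    then obtain b where b: "b \<in> carrier R" "\<one> \<ominus> b \<otimes> x \<in> L" using a JD(1) by blast
    then have "(\<one> \<ominus> b \<otimes> x) \<oplus> b \<otimes> x \<in> J" using J(2) x JD(4,5) by blast
    moreover have "(\<one> \<ominus> b \<otimes> x) \<oplus> b \<otimes> x = \<one>"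
      using b x JD(2) by (simp add: minus_eq a_assoc l_neg)
    ultimately show ?thesis using left_ideal_one[OF J(1)] by simp
  qed
  with a show "maximal_left_ideal L R"
    unfolding maximal_left_ideal_def using left_ideal_one by blast
qed

lemma maximal_left_idealD:
  assumes "maximal_left_ideal L R"
  shows "left_ideal L R" "\<one> \<notin> L"
    "x \<in> carrier R \<Longrightarrow> x \<notin> L \<Longrightarrow> \<exists>a\<in>carrier R. \<one> \<ominus> a \<otimes> x \<in> L"
  using assms by (auto simp: maximal_left_ideal_iff)

text \<open>Zorn's lemma applies because properness is the condition
  \<open>\<one> \<notin> J\<close>, which survives unions of chains.\<close>

lemma proper_left_ideal_le_maximal:
  assumes I: "left_ideal I R" "\<one> \<notin> I"
  obtains L where "maximal_left_ideal L R" "I \<subseteq> L"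
proof -
  let ?S = "{J. left_ideal J R \<and> I \<subseteq> J \<and> \<one> \<notin> J}"
  have "\<exists>M\<in>?S. \<forall>X\<in>?S. M \<subseteq> X \<longrightarrow> X = M"
  proof (rule subset_Zorn_nonempty)
    show "?S \<noteq> {}" using I by auto
    fix C assume C: "C \<noteq> {}" "subset.chain ?S C"
    then have CS: "left_ideal J R" "I \<subseteq> J" "\<one> \<notin> J" if "J \<in> C" for J
      using that by (auto simp: subset.chain_def)
    have "left_ideal (\<Union>C) R"
    proof (rule left_idealI)
      show "\<Union>C \<subseteq> carrier R" using CS(1) left_idealD(1) by blast
      show "\<zero> \<in> \<Union>C" using CS(1) C(1) left_idealD(3) by blast
      fix x y assume "x \<in> \<Union>C" "y \<in> \<Union>C"
      then obtain X Y where X: "x \<in> X" "X \<in> C" "y \<in> Y" "Y \<in> C" by auto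
      then have "X \<subseteq> Y \<or> Y \<subseteq> X" using C(2) by (auto simp: subset_chain_def)
      then show "x \<oplus> y \<in> \<Union>C" using X CS(1) left_idealD(4) by blast
    qed (use CS(1) left_idealD(5) in blast)
    then show "\<Union>C \<in> ?S" using CS C(1) by blast
  qed
  then obtain M where M: "left_ideal M R" "I \<subseteq> M" "\<one> \<notin> M"
    "\<And>X. left_ideal X R \<Longrightarrow> I \<subseteq> X \<Longrightarrow> \<one> \<notin> X \<Longrightarrow> M \<subseteq> X \<Longrightarrow> X = M"
    by (elim bexE CollectE conjE, goal_cases) (metis (mono_tags, lifting) mem_Collect_eq)
  have "maximal_left_ideal M R"
    unfolding maximal_left_ideal_def using M left_ideal_one by blast
  with M(2) show thesis by (rule that[rotated])
qed

lemma jacobson_radical_left_ideal: "left_ideal (jacobson_radical R) R"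
proof (rule left_idealI)
  fix x y assume "x \<in> jacobson_radical R" "y \<in> jacobson_radical R"
  then show "x \<oplus> y \<in> jacobson_radical R"
    unfolding jacobson_radical_def by (auto intro: left_idealD(4) maximal_left_idealD(1))
next
  fix a x assume "a \<in> carrier R" "x \<in> jacobson_radical R"
  then show "a \<otimes> x \<in> jacobson_radical R"
    unfolding jacobson_radical_def by (auto intro: left_idealD(5) maximal_left_idealD(1))
qed (auto simp: jacobson_radical_def intro: left_idealD(3) maximal_left_idealD(1))

lemmas jacobson_radicalD = left_idealD[OF jacobson_radical_left_ideal]

text \<open>If \<open>1 - s x\<close> has no left inverse, its left multiples lie in a maximal left
  ideal; this also contains \<open>s x\<close>, hence 1. Conversely, an \<open>x\<close> outside a
  maximal \<open>L\<close> yields some \<open>1 - a x\<close> in \<open>L\<close>, which cannot be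
  left invertible. The criterion only mentions elements, so it can be transported along
  homomorphisms and traces.\<close>

lemma jacobson_radical_iff:
  "x \<in> jacobson_radical R \<longleftrightarrow> x \<in> carrier R \<and>
    (\<forall>s\<in>carrier R. \<exists>y\<in>carrier R. y \<otimes> (\<one> \<ominus> s \<otimes> x) = \<one>)" (is "?l \<longleftrightarrow> ?r")
proof
  assume x: ?l
  have "\<exists>y\<in>carrier R. y \<otimes> (\<one> \<ominus> s \<otimes> x) = \<one>" if s: "s \<in> carrier R" for s
  proof (rule ccontr)
    assume no: "\<not> ?thesis"
    have xc: "x \<in> carrier R" using x jacobson_radicalD(2) by blast
    let ?I = "(\<lambda>y. y \<otimes> (\<one> \<ominus> s \<otimes> x)) ` carrier R"
    have "left_ideal ?I R"
    proof (rule left_idealI)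
      show "\<zero> \<in> ?I" using s xc by (auto intro!: image_eqI[of _ _ \<zero>])
      show "a \<oplus> b \<in> ?I" if "a \<in> ?I" "b \<in> ?I" for a b
        using that s xc by (auto simp: l_distr[symmetric])
      show "a \<otimes> b \<in> ?I" if "a \<in> carrier R" "b \<in> ?I" for a b
        using that s xc by (auto simp: m_assoc[symmetric])
    qed (use s xc in auto)
    moreover have "\<one> \<notin> ?I" using no by (metis (no_types, lifting) imageE)
    ultimately obtain L where L: "maximal_left_ideal L R" "?I \<subseteq> L"
      by (rule proper_left_ideal_le_maximal)
    note lD = left_idealD[OF maximal_left_idealD(1)[OF L(1)]]
    have "\<one> \<otimes> (\<one> \<ominus> s \<otimes> x) \<in> L" using L(2) by blast
    moreover have "s \<otimes> x \<in> L" using x L(1) s lD(5) by (auto simp: jacobson_radical_def)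
    ultimately have "(\<one> \<ominus> s \<otimes> x) \<oplus> s \<otimes> x \<in> L" using s xc lD(4) by simp
    then have "\<one> \<in> L" using s xc by (simp add: minus_eq a_assoc l_neg)
    then show False using maximal_left_idealD(2)[OF L(1)] by simp
  qed
  with x show ?r using jacobson_radicalD(2) by blast
next
  assume x: ?r
  have "x \<in> L" if L: "maximal_left_ideal L R" for L
  proof (rule ccontr)
    assume "x \<notin> L"
    then obtain a where a: "a \<in> carrier R" "\<one> \<ominus> a \<otimes> x \<in> L"
      using maximal_left_idealD(3)[OF L] x by blast
    then obtain y where "y \<in> carrier R" "y \<otimes> (\<one> \<ominus> a \<otimes> x) = \<one>" using x by blast
    then have "\<one> \<in> L" using a left_idealD(5)[OF maximal_left_idealD(1)[OF L]] by metis
    then show False using maximal_left_idealD(2)[OF L] by simp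
  qed
  with x show ?l by (simp add: jacobson_radical_def)
qed

lemma jacobson_radical_inverse:
  assumes "x \<in> jacobson_radical R"
  obtains y where "y \<in> carrier R" "y \<otimes> (\<one> \<ominus> x) = \<one>"
  using assms[unfolded jacobson_radical_iff] by (metis l_one one_closed)

text \<open>The radical is defined through left ideals, so this side is not built in. It is needed
  because coefficients in the radical stand to the left of cocycle values and of unit
  vectors.\<close>

lemma jacobson_radical_right:
  assumes x: "x \<in> jacobson_radical R" and r: "r \<in> carrier R"
  shows "x \<otimes> r \<in> jacobson_radical R"
  unfolding jacobson_radical_iff
proof (intro conjI ballI)
  have xc: "x \<in> carrier R" using x jacobson_radicalD(2) by blast
  then show "x \<otimes> r \<in> carrier R" using r by simp
  fix s assume s: "s \<in> carrier R"
  obtain y where y: "y \<in> carrier R" "y \<otimes> (\<one> \<ominus> (r \<otimes> s) \<otimes> x) = \<one>"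
    using x r s unfolding jacobson_radical_iff by blast
  \<comment> \<open>From \<open>y (1 - r s x) = 1\<close> it follows that \<open>1 + s x y r\<close>
    is a left inverse of \<open>1 - s x r\<close>: the usual passage from \<open>1 - a b\<close> to
    \<open>1 - b a\<close>.\<close>
  define u where "u = s \<otimes> x \<otimes> y"
  have u: "u \<in> carrier R" using xc s y by (simp add: u_def)
  have "(\<one> \<oplus> u \<otimes> r) \<otimes> (\<one> \<ominus> s \<otimes> (x \<otimes> r)) =
      \<one> \<ominus> s \<otimes> x \<otimes> r \<oplus> s \<otimes> x \<otimes> (y \<otimes> (\<one> \<ominus> (r \<otimes> s) \<otimes> x)) \<otimes> r"
    unfolding u_def using xc s r y(1)
    by (simp add: l_distr r_distr minus_eq m_assoc l_minus r_minus minus_add a_ac)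
  also have "\<dots> = \<one>" unfolding y(2) using xc s r by (simp add: minus_eq a_assoc l_neg)
  finally show "\<exists>y\<in>carrier R. y \<otimes> (\<one> \<ominus> s \<otimes> (x \<otimes> r)) = \<one>"
    using u r by blast
qed

end

section \<open>Transport along surjective ring homomorphisms\<close>

lemma jacobson_radical_ring_hom:
  assumes "ring A" "ring B" "f \<in> ring_hom A B" "f ` carrier A = carrier B"
    and x: "x \<in> jacobson_radical A"
  shows "f x \<in> jacobson_radical B"
proof -
  interpret A: ring A by fact
  interpret B: ring B by fact
  interpret f: ring_hom_ring A B f
    by (rule ring_hom_ringI2) fact+
  have xc: "x \<in> carrier A" using x A.jacobson_radicalD(2) by blast
  show ?thesis unfolding B.jacobson_radical_iff
  proof (intro conjI ballI)
    fix s assume "s \<in> carrier B"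
    then obtain t where t: "t \<in> carrier A" "s = f t" using assms(4) by auto
    then obtain y where y: "y \<in> carrier A" "y \<otimes>\<^bsub>A\<^esub> (\<one>\<^bsub>A\<^esub> \<ominus>\<^bsub>A\<^esub> t \<otimes>\<^bsub>A\<^esub> x) = \<one>\<^bsub>A\<^esub>"
      using x unfolding A.jacobson_radical_iff by blast
    then have "f (y \<otimes>\<^bsub>A\<^esub> (\<one>\<^bsub>A\<^esub> \<ominus>\<^bsub>A\<^esub> t \<otimes>\<^bsub>A\<^esub> x)) = \<one>\<^bsub>B\<^esub>" by simp
    then have "f y \<otimes>\<^bsub>B\<^esub> (\<one>\<^bsub>B\<^esub> \<ominus>\<^bsub>B\<^esub> s \<otimes>\<^bsub>B\<^esub> f x) = \<one>\<^bsub>B\<^esub>"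
      using y(1) t xc by (simp add: A.minus_eq B.minus_eq)
    then show "\<exists>y\<in>carrier B. y \<otimes>\<^bsub>B\<^esub> (\<one>\<^bsub>B\<^esub> \<ominus>\<^bsub>B\<^esub> s \<otimes>\<^bsub>B\<^esub> f x) = \<one>\<^bsub>B\<^esub>"
      using f.hom_closed[OF y(1)] by blast
  qed (use xc in simp)
qed

text \<open>Surjectivity lifts the multiplier in the criterion
  \<open>maximal_left_ideal_iff\<close>. Applied to automorphisms, this supplies the finitely many
  twisted copies of a maximal left ideal over which the averaging takes place.\<close>

lemma maximal_left_ideal_vimage:
  assumes "ring A" "ring B" "f \<in> ring_hom A B" "f ` carrier A = carrier B"
    and L: "maximal_left_ideal L B"
  shows "maximal_left_ideal {x \<in> carrier A. f x \<in> L} A"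
proof -
  interpret A: ring A by fact
  interpret B: ring B by fact
  interpret f: ring_hom_ring A B f
    by (rule ring_hom_ringI2) fact+
  note L' = B.maximal_left_idealD[OF L]
  note lD = B.left_idealD[OF L'(1)]
  show ?thesis unfolding A.maximal_left_ideal_iff
  proof (intro conjI ballI)
    show "left_ideal {x \<in> carrier A. f x \<in> L} A"
      by (rule A.left_idealI) (use lD in auto)
    show "\<one>\<^bsub>A\<^esub> \<notin> {x \<in> carrier A. f x \<in> L}" using L'(2) by simp
    fix x assume x: "x \<in> carrier A - {x \<in> carrier A. f x \<in> L}"
    then obtain b where b: "b \<in> carrier B" "\<one>\<^bsub>B\<^esub> \<ominus>\<^bsub>B\<^esub> b \<otimes>\<^bsub>B\<^esub> f x \<in> L"
      using L'(3)[of "f x"] by auto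
    then obtain a where "a \<in> carrier A" "b = f a" using assms(4) by auto
    then show "\<exists>a\<in>carrier A. \<one>\<^bsub>A\<^esub> \<ominus>\<^bsub>A\<^esub> a \<otimes>\<^bsub>A\<^esub> x \<in> {x \<in> carrier A. f x \<in> L}"
      using b x by (auto simp: A.minus_eq B.minus_eq intro!: bexI[of _ a])
  qed
qed

section \<open>Radicals of ring extensions\<close>

text \<open>Last step of both averaging arguments. In the applications \<open>n\<close> is a sum of
  ones indexed by \<open>G\<close>, \<open>c\<close> its inverse, and \<open>w\<close> comes from
  the value of a projection at \<one>.\<close>

lemma (in ring) jacobson_radical_le_left_ideal:
  assumes N: "left_ideal N R" and c: "c \<in> carrier R" "n \<in> carrier R" "c \<otimes> n = \<one>"
    and w: "w \<in> jacobson_radical R"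
    and x: "\<And>x. x \<in> jacobson_radical R \<Longrightarrow> n \<otimes> x \<ominus> x \<otimes> w \<in> N"
  shows "jacobson_radical R \<subseteq> N"
proof -
  note JD = jacobson_radicalD
  note ND = left_idealD[OF N]
  have wc: "w \<in> carrier R" using w JD(2) by blast
  have "c \<otimes> w \<in> jacobson_radical R" using c w JD(5) by blast
  then obtain v where v: "v \<in> carrier R" "v \<otimes> (\<one> \<ominus> c \<otimes> w) = \<one>"
    by (rule jacobson_radical_inverse)
  \<comment> \<open>\<open>v c\<close> is a left inverse of \<open>n - w\<close>, so
    \<open>w\<close> is recovered from the instance \<open>x = w\<close> of the hypothesis.\<close>
  have "(v \<otimes> c) \<otimes> (n \<otimes> w \<ominus> w \<otimes> w) = v \<otimes> ((c \<otimes> n) \<ominus> c \<otimes> w) \<otimes> w"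
    using v c(1,2) wc by (simp add: minus_eq l_distr r_distr l_minus r_minus m_assoc)
  also have "\<dots> = w" using v c wc by simp
  finally have "w = (v \<otimes> c) \<otimes> (n \<otimes> w \<ominus> w \<otimes> w)" ..
  then have wN: "w \<in> N" using ND(5)[OF _ x[OF w], of "v \<otimes> c"] v c by simp
  show ?thesis
  proof
    fix y assume y: "y \<in> jacobson_radical R"
    then have yc: "y \<in> carrier R" using JD(2) by blast
    have "(n \<otimes> y \<ominus> y \<otimes> w) \<oplus> y \<otimes> w \<in> N" using x[OF y] ND(4,5) wN yc by blast
    then have "n \<otimes> y \<in> N" using c yc wc by (simp add: minus_eq a_assoc l_neg)
    then have "c \<otimes> (n \<otimes> y) \<in> N" using ND(5) c by blast
    then show "y \<in> N" using c yc by (simp add: m_assoc[symmetric])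
  qed
qed

text \<open>
  The quotient of \<open>A\<close> by finitely many maximal submodules is semisimple, so that the image of \<open>P\<close>
  is a direct summand. The projection lifts to a linear endomorphism of \<open>A\<close> because each of the
  maximal submodules is the preimage of a maximal left ideal under a linear functional \<open>\<phi> i\<close>.
\<close>

lemma projection_modulo_maximal_left_ideals:
  assumes "ring R" "ring A" "\<iota> \<in> ring_hom R A" "finite I"
    and \<phi>: "\<And>i x. i \<in> I \<Longrightarrow> x \<in> carrier A \<Longrightarrow> \<phi> i x \<in> carrier R"
    and \<phi>_add: "\<And>i x y. i \<in> I \<Longrightarrow> x \<in> carrier A \<Longrightarrow> y \<in> carrier A \<Longrightarrow>
      \<phi> i (x \<oplus>\<^bsub>A\<^esub> y) = \<phi> i x \<oplus>\<^bsub>R\<^esub> \<phi> i y"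
    and \<phi>_mult: "\<And>i r x. i \<in> I \<Longrightarrow> r \<in> carrier R \<Longrightarrow> x \<in> carrier A \<Longrightarrow>
      \<phi> i (\<iota> r \<otimes>\<^bsub>A\<^esub> x) = r \<otimes>\<^bsub>R\<^esub> \<phi> i x"
    and L: "\<And>i. i \<in> I \<Longrightarrow> maximal_left_ideal (L i) R"
    and P: "left_ideal P A"
  obtains p where "\<And>x. x \<in> carrier A \<Longrightarrow> p x \<in> P"
    "\<And>x y. x \<in> carrier A \<Longrightarrow> y \<in> carrier A \<Longrightarrow> p (x \<oplus>\<^bsub>A\<^esub> y) = p x \<oplus>\<^bsub>A\<^esub> p y"
    "\<And>r x. r \<in> carrier R \<Longrightarrow> x \<in> carrier A \<Longrightarrow> p (\<iota> r \<otimes>\<^bsub>A\<^esub> x) = \<iota> r \<otimes>\<^bsub>A\<^esub> p x"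
    "\<And>i x. i \<in> I \<Longrightarrow> x \<in> P \<Longrightarrow> \<phi> i (x \<ominus>\<^bsub>A\<^esub> p x) \<in> L i"
proof -
  interpret R: ring R by fact
  interpret A: ring A by fact
  interpret \<iota>: ring_hom_ring R A \<iota> by (rule ring_hom_ringI2) fact+
  note PD = A.left_idealD[OF P]
  have \<phi>_minus: "\<phi> i (x \<ominus>\<^bsub>A\<^esub> y) = \<phi> i x \<ominus>\<^bsub>R\<^esub> \<phi> i y"
    if "i \<in> I" "x \<in> carrier A" "y \<in> carrier A" for i x y
  proof -
    have "\<phi> i (x \<ominus>\<^bsub>A\<^esub> y) \<oplus>\<^bsub>R\<^esub> \<phi> i y = \<phi> i x"
      using \<phi>_add[of i "x \<ominus>\<^bsub>A\<^esub> y" y] that by (simp add: A.minus_eq A.a_assoc A.l_neg)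
    then show ?thesis using \<phi> that
      by (metis A.minus_closed R.add.inv_solve_right' R.minus_eq R.add.m_closed a_minus_def)
  qed
  \<comment> \<open>Induction over the ideals that are already taken care of; when there are none,
    the zero map will do.\<close>
  have "\<exists>p. (\<forall>x\<in>carrier A. p x \<in> P) \<and>
      (\<forall>x\<in>carrier A. \<forall>y\<in>carrier A. p (x \<oplus>\<^bsub>A\<^esub> y) = p x \<oplus>\<^bsub>A\<^esub> p y) \<and>
      (\<forall>r\<in>carrier R. \<forall>x\<in>carrier A. p (\<iota> r \<otimes>\<^bsub>A\<^esub> x) = \<iota> r \<otimes>\<^bsub>A\<^esub> p x) \<and>
      (\<forall>i\<in>S. \<forall>x\<in>P. \<phi> i (x \<ominus>\<^bsub>A\<^esub> p x) \<in> L i)" if "finite S" "S \<subseteq> I" for S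
    using that
  proof (induction S)
    case empty
    show ?case by (rule exI[of _ "\<lambda>_. \<zero>\<^bsub>A\<^esub>"]) (use PD(3) in auto)
  next
    case (insert s S)
    then have "S \<subseteq> I" by simp
    from insert.IH[OF this] obtain p where p: "\<And>x. x \<in> carrier A \<Longrightarrow> p x \<in> P"
      "\<And>x y. x \<in> carrier A \<Longrightarrow> y \<in> carrier A \<Longrightarrow> p (x \<oplus>\<^bsub>A\<^esub> y) = p x \<oplus>\<^bsub>A\<^esub> p y"
      "\<And>r x. r \<in> carrier R \<Longrightarrow> x \<in> carrier A \<Longrightarrow> p (\<iota> r \<otimes>\<^bsub>A\<^esub> x) = \<iota> r \<otimes>\<^bsub>A\<^esub> p x"
      "\<And>i x. i \<in> S \<Longrightarrow> x \<in> P \<Longrightarrow> \<phi> i (x \<ominus>\<^bsub>A\<^esub> p x) \<in> L i" by blast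
    have pc: "p x \<in> carrier A" if "x \<in> carrier A" for x using p(1) that PD(2) by blast
    have s: "s \<in> I" using insert.prems by simp
    note LD = R.left_idealD[OF R.maximal_left_idealD(1)[OF L]]
    show ?case
    proof (cases "\<forall>x\<in>P. \<phi> s (x \<ominus>\<^bsub>A\<^esub> p x) \<in> L s")
      case True
      then show ?thesis using p by (intro exI[of _ p]) auto
    next
      case False
      then obtain x where x: "x \<in> P" "\<phi> s (x \<ominus>\<^bsub>A\<^esub> p x) \<notin> L s" by blast
      \<comment> \<open>A residue of \<open>p\<close> that is nonzero modulo \<open>L s\<close>.
        Scaling it makes \<open>\<phi> s q'\<close> congruent to 1 modulo \<open>L s\<close>, so
        that adding \<open>\<phi> s (z y)\<close> times \<open>q'\<close> to \<open>p y\<close>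
        cancels the residue at \<open>s\<close>.\<close>
      define q where "q = x \<ominus>\<^bsub>A\<^esub> p x"
      have q: "q \<in> P" "q \<in> carrier A" "\<phi> s q \<notin> L s"
        using x PD(2,7) p(1) by (auto simp: q_def)
      obtain a where a: "a \<in> carrier R" "\<one>\<^bsub>R\<^esub> \<ominus>\<^bsub>R\<^esub> a \<otimes>\<^bsub>R\<^esub> \<phi> s q \<in> L s"
        using R.maximal_left_idealD(3)[OF L[OF s] \<phi>[OF s q(2)] q(3)] by blast
      define q' where "q' = \<iota> a \<otimes>\<^bsub>A\<^esub> q"
      have q': "q' \<in> P" "q' \<in> carrier A" "\<one>\<^bsub>R\<^esub> \<ominus>\<^bsub>R\<^esub> \<phi> s q' \<in> L s"
        using q a PD(5) \<phi>_mult s by (auto simp: q'_def)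
      define z where "z y = y \<ominus>\<^bsub>A\<^esub> p y" for y
      define p' where "p' y = p y \<oplus>\<^bsub>A\<^esub> \<iota> (\<phi> s (z y)) \<otimes>\<^bsub>A\<^esub> q'" for y
      have z: "z y \<in> carrier A" if "y \<in> carrier A" for y using that pc by (simp add: z_def)
      have z_add: "z (x \<oplus>\<^bsub>A\<^esub> y) = z x \<oplus>\<^bsub>A\<^esub> z y" if "x \<in> carrier A" "y \<in> carrier A" for x y
        using that pc by (simp add: z_def p(2) A.minus_eq A.minus_add A.a_ac)
      have z_mult: "z (\<iota> r \<otimes>\<^bsub>A\<^esub> x) = \<iota> r \<otimes>\<^bsub>A\<^esub> z x" if "r \<in> carrier R" "x \<in> carrier A" for r x
        using that pc by (simp add: z_def p(3) A.minus_eq A.r_distr A.r_minus)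
      have \<phi>z: "\<phi> s (z y) \<in> carrier R" if "y \<in> carrier A" for y using \<phi>[OF s z] that by simp
      have z': "y \<ominus>\<^bsub>A\<^esub> p' y = z y \<ominus>\<^bsub>A\<^esub> \<iota> (\<phi> s (z y)) \<otimes>\<^bsub>A\<^esub> q'" if "y \<in> carrier A" for y
        using that pc q'(2) \<phi>z[OF that] unfolding p'_def
        by (simp add: z_def A.minus_eq A.minus_add A.a_ac)
      \<comment> \<open>\<open>q'\<close> is a multiple of a residue of the old \<open>p\<close>, so
        the correction does not spoil the indices in \<open>S\<close>.\<close>
      have \<phi>q: "\<phi> i q' \<in> L i" if "i \<in> S" for i
      proof -
        have "\<phi> i q' = a \<otimes>\<^bsub>R\<^esub> \<phi> i q" using \<phi>_mult a q(2) that insert.prems by (auto simp: q'_def)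
        then show ?thesis using p(4)[OF that x(1)] LD(5)[of i] a that insert.prems
          by (auto simp: q_def)
      qed
      have "\<phi> i (y \<ominus>\<^bsub>A\<^esub> p' y) \<in> L i" if i: "i \<in> insert s S" and y: "y \<in> P" for i y
      proof -
        have yc: "y \<in> carrier A" and iI: "i \<in> I" using y PD(2) i insert.prems by auto
        have e: "\<phi> i (y \<ominus>\<^bsub>A\<^esub> p' y) = \<phi> i (z y) \<ominus>\<^bsub>R\<^esub> \<phi> s (z y) \<otimes>\<^bsub>R\<^esub> \<phi> i q'"
          using z'[OF yc] \<phi>_minus[OF iI] \<phi>_mult[OF iI] q'(2) \<phi>z[OF yc] z[OF yc] by simp
        show ?thesis
        proof (cases "i = s")
          case True
          have "\<phi> s (z y) \<ominus>\<^bsub>R\<^esub> \<phi> s (z y) \<otimes>\<^bsub>R\<^esub> \<phi> s q' =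
              \<phi> s (z y) \<otimes>\<^bsub>R\<^esub> (\<one>\<^bsub>R\<^esub> \<ominus>\<^bsub>R\<^esub> \<phi> s q')"
            using \<phi>z[OF yc] \<phi>[OF s q'(2)] by (simp add: R.minus_eq R.r_distr R.r_minus)
          then show ?thesis using e True LD(5)[OF s \<phi>z[OF yc] q'(3)] by simp
        next
          case False
          with i have iS: "i \<in> S" by simp
          show ?thesis unfolding e
            by (rule LD(7)[OF iI])
               (use p(4)[OF iS y] \<phi>q[OF iS] LD(5)[OF iI] \<phi>z[OF yc] in \<open>auto simp: z_def\<close>)
        qed
      qed
      moreover have "p' y \<in> P" if "y \<in> carrier A" for y
        unfolding p'_def using that PD(4,5) p(1) q'(1) \<phi>z by simp
      moreover have "p' (x \<oplus>\<^bsub>A\<^esub> y) = p' x \<oplus>\<^bsub>A\<^esub> p' y" if "x \<in> carrier A" "y \<in> carrier A" for x y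
        unfolding p'_def using that pc q'(2) \<phi>z z
        by (simp add: p(2) z_add \<phi>_add[OF s] A.l_distr A.a_ac)
      moreover have "p' (\<iota> r \<otimes>\<^bsub>A\<^esub> x) = \<iota> r \<otimes>\<^bsub>A\<^esub> p' x" if "r \<in> carrier R" "x \<in> carrier A" for r x
        unfolding p'_def using that pc q'(2) \<phi>z z
        by (simp add: p(3) z_mult \<phi>_mult[OF s] A.r_distr A.m_assoc)
      ultimately show ?thesis by (intro exI[of _ p']) blast
    qed
  qed
  from this[OF \<open>finite I\<close> subset_refl] show thesis
    using that by blast
qed

text \<open>Averaging the projection above over the automorphisms replaces Maschke's theorem.\<close>

lemma jacobson_radical_fixed_ring:
  assumes "ring R" "ring A" "\<iota> \<in> ring_hom R A"
    and \<alpha>: "\<And>i. i \<in> I \<Longrightarrow> \<alpha> i \<in> ring_hom A A" "\<And>i. i \<in> I \<Longrightarrow> \<alpha> i ` carrier A = carrier A"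
    and \<alpha>\<iota>: "\<And>i r. i \<in> I \<Longrightarrow> r \<in> carrier R \<Longrightarrow> \<alpha> i (\<iota> r) = \<iota> r"
    and "finite I"
    and tr: "\<And>x. x \<in> carrier A \<Longrightarrow> tr x \<in> carrier R"
      "\<And>x y. x \<in> carrier A \<Longrightarrow> y \<in> carrier A \<Longrightarrow> tr (x \<oplus>\<^bsub>A\<^esub> y) = tr x \<oplus>\<^bsub>R\<^esub> tr y"
      "\<And>x r. x \<in> carrier A \<Longrightarrow> r \<in> carrier R \<Longrightarrow> tr (x \<otimes>\<^bsub>A\<^esub> \<iota> r) = tr x \<otimes>\<^bsub>R\<^esub> r"
      "\<And>x. x \<in> carrier A \<Longrightarrow> \<iota> (tr x) = (\<Oplus>\<^bsub>A\<^esub>i\<in>I. \<alpha> i x)"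
    and c: "c \<in> carrier R" "c \<otimes>\<^bsub>R\<^esub> tr \<one>\<^bsub>A\<^esub> = \<one>\<^bsub>R\<^esub>"
    and r: "r \<in> carrier R"
  shows "\<iota> r \<in> jacobson_radical A \<longleftrightarrow> r \<in> jacobson_radical R"
proof -
  interpret R: ring R by fact
  interpret A: ring A by fact
  interpret \<iota>: ring_hom_ring R A \<iota> by (rule ring_hom_ringI2) fact+
  note JD = R.jacobson_radicalD
  have \<alpha>c: "\<alpha> i x \<in> carrier A" "\<alpha> i \<one>\<^bsub>A\<^esub> = \<one>\<^bsub>A\<^esub>" if "i \<in> I" "x \<in> carrier A" for i x
    using ring_hom_closed[OF \<alpha>(1)] ring_hom_one[OF \<alpha>(1)] that by auto
  show ?thesis
  proof
    assume r': "\<iota> r \<in> jacobson_radical A"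
    show "r \<in> jacobson_radical R" unfolding R.jacobson_radical_iff
    proof (intro conjI ballI r)
      fix s assume s: "s \<in> carrier R"
      \<comment> \<open>A left inverse \<open>y\<close> of \<open>1 - s r\<close> exists in
        \<open>A\<close>. As the trace is linear over \<open>R\<close> on the right,
        \<open>c\<close> times the trace of \<open>y\<close> is a left inverse in
        \<open>R\<close>.\<close>
      have "\<iota> s \<in> carrier A" using s by simp
      then obtain y where y: "y \<in> carrier A" "y \<otimes>\<^bsub>A\<^esub> (\<one>\<^bsub>A\<^esub> \<ominus>\<^bsub>A\<^esub> \<iota> s \<otimes>\<^bsub>A\<^esub> \<iota> r) = \<one>\<^bsub>A\<^esub>"
        using r' unfolding A.jacobson_radical_iff by blast
      have "\<one>\<^bsub>A\<^esub> \<ominus>\<^bsub>A\<^esub> \<iota> s \<otimes>\<^bsub>A\<^esub> \<iota> r = \<iota> (\<one>\<^bsub>R\<^esub> \<ominus>\<^bsub>R\<^esub> s \<otimes>\<^bsub>R\<^esub> r)"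
        using s r by (simp add: R.minus_eq A.minus_eq)
      then have "tr y \<otimes>\<^bsub>R\<^esub> (\<one>\<^bsub>R\<^esub> \<ominus>\<^bsub>R\<^esub> s \<otimes>\<^bsub>R\<^esub> r) = tr \<one>\<^bsub>A\<^esub>"
        using y tr(3)[of y "\<one>\<^bsub>R\<^esub> \<ominus>\<^bsub>R\<^esub> s \<otimes>\<^bsub>R\<^esub> r"] s r by simp
      then have "(c \<otimes>\<^bsub>R\<^esub> tr y) \<otimes>\<^bsub>R\<^esub> (\<one>\<^bsub>R\<^esub> \<ominus>\<^bsub>R\<^esub> s \<otimes>\<^bsub>R\<^esub> r) = \<one>\<^bsub>R\<^esub>"
        using c s r y(1) tr(1) by (simp add: R.m_assoc)
      then show "\<exists>y\<in>carrier R. y \<otimes>\<^bsub>R\<^esub> (\<one>\<^bsub>R\<^esub> \<ominus>\<^bsub>R\<^esub> s \<otimes>\<^bsub>R\<^esub> r) = \<one>\<^bsub>R\<^esub>"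
        using c(1) y(1) tr(1) R.m_closed by blast
    qed
  next
    assume r': "r \<in> jacobson_radical R"
    have "\<iota> r \<in> L" if L: "maximal_left_ideal L A" for L
    proof -
      note LD = A.left_idealD[OF A.maximal_left_idealD(1)[OF L]]
      \<comment> \<open>The largest left ideal of \<open>A\<close> whose traces lie in the radical
        of \<open>R\<close>. It contains the image of that radical because the trace is linear on
        the right.\<close>
      let ?P = "{x \<in> carrier A. \<forall>a\<in>carrier A. tr (a \<otimes>\<^bsub>A\<^esub> x) \<in> jacobson_radical R}"
      have trz: "tr \<zero>\<^bsub>A\<^esub> = \<zero>\<^bsub>R\<^esub>"
        using tr(2)[of "\<zero>\<^bsub>A\<^esub>" "\<zero>\<^bsub>A\<^esub>"] tr(1) by simp
      have P: "left_ideal ?P A"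
      proof (rule A.left_idealI)
        show "\<zero>\<^bsub>A\<^esub> \<in> ?P" using JD(3) trz by simp
        show "x \<oplus>\<^bsub>A\<^esub> y \<in> ?P" if "x \<in> ?P" "y \<in> ?P" for x y
          using that JD(4) by (simp add: A.r_distr tr(2))
        show "a \<otimes>\<^bsub>A\<^esub> x \<in> ?P" if "a \<in> carrier A" "x \<in> ?P" for a x
          using that by (simp add: A.m_assoc[symmetric])
      qed auto
      have Lv: "maximal_left_ideal {x \<in> carrier A. \<alpha> i x \<in> L} A" if "i \<in> I" for i
        by (rule maximal_left_ideal_vimage[OF A.ring_axioms A.ring_axioms \<alpha>(1)[OF that] \<alpha>(2)[OF that] L])
      \<comment> \<open>Base ring and module are both \<open>A\<close>, the functionals are
        identities, and the ideals are the preimages of \<open>L\<close> under the automorphisms. So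
        \<open>p\<close> is linear over \<open>A\<close>, hence right multiplication by its value at
        1, and every residue on \<open>?P\<close> lies in all these preimages at once.\<close>
      obtain p where p: "\<And>x. x \<in> carrier A \<Longrightarrow> p x \<in> ?P"
        "\<And>x y. x \<in> carrier A \<Longrightarrow> y \<in> carrier A \<Longrightarrow> p (x \<oplus>\<^bsub>A\<^esub> y) = p x \<oplus>\<^bsub>A\<^esub> p y"
        "\<And>r x. r \<in> carrier A \<Longrightarrow> x \<in> carrier A \<Longrightarrow> p (id r \<otimes>\<^bsub>A\<^esub> x) = id r \<otimes>\<^bsub>A\<^esub> p x"
        "\<And>i x. i \<in> I \<Longrightarrow> x \<in> ?P \<Longrightarrow> x \<ominus>\<^bsub>A\<^esub> p x \<in> {x \<in> carrier A. \<alpha> i x \<in> L}"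
        by (rule projection_modulo_maximal_left_ideals[where \<phi> = "\<lambda>_ x. x" and R = A and A = A
              and \<iota> = id and P = ?P and I = I and L = "\<lambda>i. {x \<in> carrier A. \<alpha> i x \<in> L}"])
           (use A.ring_axioms P \<open>finite I\<close> Lv in auto)
      define w where "w = p \<one>\<^bsub>A\<^esub>"
      have w: "w \<in> carrier A" "tr w \<in> jacobson_radical R"
        using p(1)[of "\<one>\<^bsub>A\<^esub>"] by (auto simp: w_def dest: bspec[of _ _ "\<one>\<^bsub>A\<^esub>"])
      have "jacobson_radical R \<subseteq> {r \<in> carrier R. \<iota> r \<in> L}"
      proof (rule R.jacobson_radical_le_left_ideal[OF _ c(1) _ c(2) w(2)])
        show "left_ideal {r \<in> carrier R. \<iota> r \<in> L} R"
          by (rule R.left_idealI) (use LD in auto)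
        show "tr \<one>\<^bsub>A\<^esub> \<in> carrier R" using tr(1) by simp
        fix x assume x: "x \<in> jacobson_radical R"
        then have xc: "x \<in> carrier R" using JD(2) by blast
        have "\<iota> x \<in> ?P" using x xc JD(5) tr(1,3) by simp
        have "\<iota> x \<ominus>\<^bsub>A\<^esub> \<iota> x \<otimes>\<^bsub>A\<^esub> \<alpha> i w \<in> L" if i: "i \<in> I" for i
        proof -
          interpret \<alpha>: ring_hom_ring A A "\<alpha> i"
            by (rule ring_hom_ringI2) (use A.ring_axioms \<alpha> i in auto)
          have "p (\<iota> x) = \<iota> x \<otimes>\<^bsub>A\<^esub> w" using p(3)[of "\<iota> x" "\<one>\<^bsub>A\<^esub>"] xc by (simp add: w_def)
          then have "\<alpha> i (\<iota> x \<ominus>\<^bsub>A\<^esub> \<iota> x \<otimes>\<^bsub>A\<^esub> w) \<in> L"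
            using p(4)[OF i \<open>\<iota> x \<in> ?P\<close>] by simp
          then show ?thesis using i xc w(1) by (simp add: A.minus_eq \<alpha>\<iota>)
        qed
        \<comment> \<open>Summing the memberships over \<open>I\<close> replaces 1 and
          \<open>w\<close> by their traces; the summand is written so that both sums can be pulled
          out by distributivity.\<close>
        then have "(\<Oplus>\<^bsub>A\<^esub>i\<in>I. \<alpha> i \<one>\<^bsub>A\<^esub> \<otimes>\<^bsub>A\<^esub> \<iota> x \<oplus>\<^bsub>A\<^esub> (\<ominus>\<^bsub>A\<^esub> \<iota> x) \<otimes>\<^bsub>A\<^esub> \<alpha> i w) \<in> L"
          using xc w(1) \<alpha>c
          by (intro A.left_ideal_finsum[OF A.maximal_left_idealD(1)[OF L]])
             (simp add: A.minus_eq A.l_minus)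
        also have "(\<Oplus>\<^bsub>A\<^esub>i\<in>I. \<alpha> i \<one>\<^bsub>A\<^esub> \<otimes>\<^bsub>A\<^esub> \<iota> x \<oplus>\<^bsub>A\<^esub> (\<ominus>\<^bsub>A\<^esub> \<iota> x) \<otimes>\<^bsub>A\<^esub> \<alpha> i w) =
            (\<Oplus>\<^bsub>A\<^esub>i\<in>I. \<alpha> i \<one>\<^bsub>A\<^esub>) \<otimes>\<^bsub>A\<^esub> \<iota> x \<oplus>\<^bsub>A\<^esub> (\<ominus>\<^bsub>A\<^esub> \<iota> x) \<otimes>\<^bsub>A\<^esub> (\<Oplus>\<^bsub>A\<^esub>i\<in>I. \<alpha> i w)"
          using xc w(1) \<alpha>c \<open>finite I\<close>
          by (subst A.finsum_addf)
             (auto simp: A.finsum_ldistr A.finsum_rdistr intro!: A.m_closed)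
        also have "\<dots> = \<iota> (tr \<one>\<^bsub>A\<^esub> \<otimes>\<^bsub>R\<^esub> x \<ominus>\<^bsub>R\<^esub> x \<otimes>\<^bsub>R\<^esub> tr w)"
          using xc w tr(1) by (simp add: tr(4)[symmetric] R.minus_eq A.l_minus)
        finally show "tr \<one>\<^bsub>A\<^esub> \<otimes>\<^bsub>R\<^esub> x \<ominus>\<^bsub>R\<^esub> x \<otimes>\<^bsub>R\<^esub> tr w \<in> {r \<in> carrier R. \<iota> r \<in> L}"
          using xc w tr(1) by simp
      qed
      then show ?thesis using r' by blast
    qed
    then show "\<iota> r \<in> jacobson_radical A" using r by (simp add: jacobson_radical_def)
  qed
qed

text \<open>Gaussian elimination modulo \<open>N\<close>. As \<open>R\<close> need not be
  commutative, there is no determinant to divide by. Instead the equation for one generator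
  \<open>b k\<close> is solved with a left inverse of \<open>1 - j k k\<close> and substituted into
  the others, whose coefficients stay in the radical.\<close>

lemma nakayama:
  assumes "ring R" "ring A" "\<iota> \<in> ring_hom R A"
    and N: "N \<subseteq> carrier A" "\<zero>\<^bsub>A\<^esub> \<in> N" "\<And>x y. x \<in> N \<Longrightarrow> y \<in> N \<Longrightarrow> x \<oplus>\<^bsub>A\<^esub> y \<in> N"
      "\<And>r x. r \<in> carrier R \<Longrightarrow> x \<in> N \<Longrightarrow> \<iota> r \<otimes>\<^bsub>A\<^esub> x \<in> N"
    and "finite S" "\<And>s. s \<in> S \<Longrightarrow> b s \<in> carrier A"
    and "\<And>s t. s \<in> S \<Longrightarrow> t \<in> S \<Longrightarrow> j s t \<in> jacobson_radical R"
    and "\<And>s. s \<in> S \<Longrightarrow> b s \<ominus>\<^bsub>A\<^esub> (\<Oplus>\<^bsub>A\<^esub>t\<in>S. \<iota> (j s t) \<otimes>\<^bsub>A\<^esub> b t) \<in> N"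
    and "s \<in> S"
  shows "b s \<in> N"
proof -
  interpret R: ring R by fact
  interpret A: ring A by fact
  interpret \<iota>: ring_hom_ring R A \<iota> by (rule ring_hom_ringI2) fact+
  note JD = R.jacobson_radicalD
  have "\<forall>s\<in>S. b s \<in> N"
    using assms(8-11)
  proof (induction S arbitrary: j)
    case (insert k S)
    have bc: "b s \<in> carrier A" if "s \<in> insert k S" for s using insert.prems that by auto
    have jJ: "j s t \<in> jacobson_radical R" if "s \<in> insert k S" "t \<in> insert k S" for s t
      using insert.prems that by auto
    have jc: "j s t \<in> carrier R" if "s \<in> insert k S" "t \<in> insert k S" for s t
      using jJ[OF that] JD(2) by blast
    define \<Sigma> where "\<Sigma> s = (\<Oplus>\<^bsub>A\<^esub>t\<in>S. \<iota> (j s t) \<otimes>\<^bsub>A\<^esub> b t)" for s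
    have \<Sigma>: "\<Sigma> s \<in> carrier A" if "s \<in> insert k S" for s
      unfolding \<Sigma>_def using that bc jc by (auto intro!: A.finsum_closed)
    have h: "b s \<ominus>\<^bsub>A\<^esub> (\<iota> (j s k) \<otimes>\<^bsub>A\<^esub> b k \<oplus>\<^bsub>A\<^esub> \<Sigma> s) \<in> N" if "s \<in> insert k S" for s
    proof -
      have "(\<lambda>t. \<iota> (j s t) \<otimes>\<^bsub>A\<^esub> b t) \<in> S \<rightarrow> carrier A" "\<iota> (j s k) \<otimes>\<^bsub>A\<^esub> b k \<in> carrier A"
        using bc jc that by auto
      then show ?thesis using insert.prems(3)[OF that] insert.hyps by (simp add: \<Sigma>_def)
    qed
    obtain u where u: "u \<in> carrier R" "u \<otimes>\<^bsub>R\<^esub> (\<one>\<^bsub>R\<^esub> \<ominus>\<^bsub>R\<^esub> j k k) = \<one>\<^bsub>R\<^esub>"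
      by (rule R.jacobson_radical_inverse[OF jJ[of k k]]) auto
    have k: "k \<in> insert k S" by simp
    \<comment> \<open>Membership of \<open>e\<close> in \<open>N\<close> is the solved equation:
      modulo \<open>N\<close>, the generator \<open>b k\<close> is \<open>u\<close> times
      \<open>\<Sigma> k\<close>.\<close>
    define e where "e = b k \<ominus>\<^bsub>A\<^esub> \<iota> u \<otimes>\<^bsub>A\<^esub> \<Sigma> k"
    have "\<iota> u \<otimes>\<^bsub>A\<^esub> (b k \<ominus>\<^bsub>A\<^esub> (\<iota> (j k k) \<otimes>\<^bsub>A\<^esub> b k \<oplus>\<^bsub>A\<^esub> \<Sigma> k)) =
        \<iota> (u \<otimes>\<^bsub>R\<^esub> (\<one>\<^bsub>R\<^esub> \<ominus>\<^bsub>R\<^esub> j k k)) \<otimes>\<^bsub>A\<^esub> b k \<ominus>\<^bsub>A\<^esub> \<iota> u \<otimes>\<^bsub>A\<^esub> \<Sigma> k"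
      using bc[OF k] jc[OF k k] \<Sigma>[OF k] u(1)
      by (simp add: R.minus_eq A.minus_eq A.minus_add A.l_distr A.r_distr A.l_minus A.r_minus A.m_assoc A.a_assoc)
    then have e: "e \<in> N" using N(4)[OF u(1) h[OF k]] u(2) bc[OF k] by (simp add: e_def)
    \<comment> \<open>The equation for \<open>b s\<close> after elimination of
      \<open>b k\<close>.\<close>
    have "b s \<ominus>\<^bsub>A\<^esub> (\<Oplus>\<^bsub>A\<^esub>t\<in>S. \<iota> (j s t \<oplus>\<^bsub>R\<^esub> (j s k \<otimes>\<^bsub>R\<^esub> u) \<otimes>\<^bsub>R\<^esub> j k t) \<otimes>\<^bsub>A\<^esub> b t) \<in> N" if s: "s \<in> S" for s
    proof -
      have s': "s \<in> insert k S" using s by simp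
      have "(\<Oplus>\<^bsub>A\<^esub>t\<in>S. \<iota> (j s t \<oplus>\<^bsub>R\<^esub> (j s k \<otimes>\<^bsub>R\<^esub> u) \<otimes>\<^bsub>R\<^esub> j k t) \<otimes>\<^bsub>A\<^esub> b t) =
          (\<Oplus>\<^bsub>A\<^esub>t\<in>S. \<iota> (j s t) \<otimes>\<^bsub>A\<^esub> b t \<oplus>\<^bsub>A\<^esub> \<iota> (j s k \<otimes>\<^bsub>R\<^esub> u) \<otimes>\<^bsub>A\<^esub> (\<iota> (j k t) \<otimes>\<^bsub>A\<^esub> b t))"
        by (rule A.finsum_cong') (use bc jc u s' in \<open>auto simp: A.l_distr A.m_assoc\<close>)
      also have "\<dots> = \<Sigma> s \<oplus>\<^bsub>A\<^esub> \<iota> (j s k \<otimes>\<^bsub>R\<^esub> u) \<otimes>\<^bsub>A\<^esub> \<Sigma> k"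
        unfolding \<Sigma>_def using bc jc u s' insert.hyps(1)
        by (subst A.finsum_addf) (auto simp: A.finsum_rdistr simp del: \<iota>.hom_mult)
      finally have "b s \<ominus>\<^bsub>A\<^esub> (\<Oplus>\<^bsub>A\<^esub>t\<in>S. \<iota> (j s t \<oplus>\<^bsub>R\<^esub> (j s k \<otimes>\<^bsub>R\<^esub> u) \<otimes>\<^bsub>R\<^esub> j k t) \<otimes>\<^bsub>A\<^esub> b t) =
          b s \<ominus>\<^bsub>A\<^esub> (\<Sigma> s \<oplus>\<^bsub>A\<^esub> \<iota> (j s k \<otimes>\<^bsub>R\<^esub> u) \<otimes>\<^bsub>A\<^esub> \<Sigma> k)" by simp
      also have "\<dots> = (b s \<ominus>\<^bsub>A\<^esub> (\<iota> (j s k) \<otimes>\<^bsub>A\<^esub> b k \<oplus>\<^bsub>A\<^esub> \<Sigma> s)) \<oplus>\<^bsub>A\<^esub> \<iota> (j s k) \<otimes>\<^bsub>A\<^esub> e"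
      proof -
        have "x \<ominus>\<^bsub>A\<^esub> (y \<oplus>\<^bsub>A\<^esub> z) = (x \<ominus>\<^bsub>A\<^esub> (v \<oplus>\<^bsub>A\<^esub> y)) \<oplus>\<^bsub>A\<^esub> (v \<ominus>\<^bsub>A\<^esub> z)"
          if "x \<in> carrier A" "y \<in> carrier A" "z \<in> carrier A" "v \<in> carrier A" for x y z v
        proof -
          have "(x \<ominus>\<^bsub>A\<^esub> (v \<oplus>\<^bsub>A\<^esub> y)) \<oplus>\<^bsub>A\<^esub> (v \<ominus>\<^bsub>A\<^esub> z) =
             (x \<oplus>\<^bsub>A\<^esub> (\<ominus>\<^bsub>A\<^esub> y \<oplus>\<^bsub>A\<^esub> \<ominus>\<^bsub>A\<^esub> z)) \<oplus>\<^bsub>A\<^esub> (v \<oplus>\<^bsub>A\<^esub> \<ominus>\<^bsub>A\<^esub> v)"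
            using that by (simp only: A.minus_eq A.minus_add A.a_ac A.a_closed A.a_inv_closed)
          also have "\<dots> = x \<ominus>\<^bsub>A\<^esub> (y \<oplus>\<^bsub>A\<^esub> z)"
            using that by (simp add: A.minus_eq A.minus_add A.r_neg)
          finally show ?thesis ..
        qed
        from this[of "b s" "\<Sigma> s" "\<iota> (j s k \<otimes>\<^bsub>R\<^esub> u) \<otimes>\<^bsub>A\<^esub> \<Sigma> k" "\<iota> (j s k) \<otimes>\<^bsub>A\<^esub> b k"]
        show ?thesis using bc[OF s'] bc[OF k] \<Sigma>[OF s'] \<Sigma>[OF k] u(1) jc[OF s' k]
          by (simp add: e_def A.minus_eq A.r_distr A.r_minus A.m_assoc)
      qed
      also have "\<dots> \<in> N" using N(3)[OF h[OF s'] N(4)[OF jc[OF s' k] e]] .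
      finally show ?thesis .
    qed
    moreover have "j s t \<oplus>\<^bsub>R\<^esub> (j s k \<otimes>\<^bsub>R\<^esub> u) \<otimes>\<^bsub>R\<^esub> j k t \<in> jacobson_radical R"
      if "s \<in> S" "t \<in> S" for s t
      using that jJ jc u(1) JD(4,5) by simp
    ultimately have IH: "\<forall>s\<in>S. b s \<in> N"
      using insert.prems(1) by (intro insert.IH[of "\<lambda>s t. j s t \<oplus>\<^bsub>R\<^esub> (j s k \<otimes>\<^bsub>R\<^esub> u) \<otimes>\<^bsub>R\<^esub> j k t"]) auto
    \<comment> \<open>Back substitution: the other generators lie in \<open>N\<close>, and the
      solved equation then gives \<open>b k\<close>.\<close>
    have "\<Sigma> k \<in> N"
    proof -
      have "(\<Oplus>\<^bsub>A\<^esub>t\<in>T. \<iota> (j k t) \<otimes>\<^bsub>A\<^esub> b t) \<in> N" if "finite T" "T \<subseteq> S" for T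
        using that
      proof (induction T)
        case (insert t T)
        moreover have "(\<lambda>t. \<iota> (j k t) \<otimes>\<^bsub>A\<^esub> b t) \<in> T \<rightarrow> carrier A" "\<iota> (j k t) \<otimes>\<^bsub>A\<^esub> b t \<in> carrier A"
          using bc jc insert.prems by auto
        ultimately show ?case using IH jc[OF k] N(3,4) by simp
      qed (use N(2) in simp)
      then show ?thesis using insert.hyps(1) by (simp add: \<Sigma>_def)
    qed
    then have "e \<oplus>\<^bsub>A\<^esub> \<iota> u \<otimes>\<^bsub>A\<^esub> \<Sigma> k \<in> N" using N(3,4) e u(1) by blast
    moreover have "e \<oplus>\<^bsub>A\<^esub> \<iota> u \<otimes>\<^bsub>A\<^esub> \<Sigma> k = b k"
      using bc[OF k] u(1) \<Sigma>[OF k] by (simp add: e_def A.minus_eq A.a_assoc A.l_neg)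
    ultimately show ?case using IH by simp
  qed simp
  then show ?thesis using \<open>s \<in> S\<close> by blast
qed

section \<open>Free extensions\<close>

context abelian_monoid
begin

lemma finsum_swap:
  assumes "finite S" "finite T" "\<And>s t. s \<in> S \<Longrightarrow> t \<in> T \<Longrightarrow> f s t \<in> carrier G"
  shows "(\<Oplus>s\<in>S. \<Oplus>t\<in>T. f s t) = (\<Oplus>t\<in>T. \<Oplus>s\<in>S. f s t)"
  using assms(1,3)
proof (induction S)
  case (insert s S)
  then have "(\<Oplus>t\<in>T. \<Oplus>s\<in>insert s S. f s t) = (\<Oplus>t\<in>T. f s t \<oplus> (\<Oplus>s\<in>S. f s t))"
    by (intro finsum_cong') (auto intro!: finsum_insert finsum_closed)
  also have "\<dots> = (\<Oplus>t\<in>T. f s t) \<oplus> (\<Oplus>t\<in>T. \<Oplus>s\<in>S. f s t)"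
    using insert by (intro finsum_addf) (auto intro!: finsum_closed)
  also have "(\<Oplus>t\<in>T. \<Oplus>s\<in>S. f s t) = (\<Oplus>s\<in>S. \<Oplus>t\<in>T. f s t)" using insert by auto
  finally show ?case using insert
    by (subst finsum_insert) (auto intro!: finsum_closed)
qed simp

lemma finsum_cong2:
  assumes "\<And>s t. s \<in> S \<Longrightarrow> t \<in> T \<Longrightarrow> f s t = g s t"
    "\<And>s t. s \<in> S \<Longrightarrow> t \<in> T \<Longrightarrow> g s t \<in> carrier G"
  shows "(\<Oplus>s\<in>S. \<Oplus>t\<in>T. f s t) = (\<Oplus>s\<in>S. \<Oplus>t\<in>T. g s t)"
  using assms by (intro finsum_cong' refl Pi_I finsum_closed) auto

lemma finsum_single:
  assumes "finite S" "i \<in> S" "f i \<in> carrier G" "\<And>j. j \<in> S \<Longrightarrow> j \<noteq> i \<Longrightarrow> f j = \<zero>"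
  shows "(\<Oplus>j\<in>S. f j) = f i"
proof -
  have "(\<Oplus>j\<in>S. f j) = (\<Oplus>j\<in>S. if i = j then f j else \<zero>)"
    by (rule finsum_cong') (use assms(3,4) in auto)
  also have "\<dots> = f i"
    by (rule finsum_singleton) (use assms in \<open>auto, metis zero_closed\<close>)
  finally show ?thesis .
qed

lemma finsum_bij:
  assumes "bij_betw h S T" "f \<in> T \<rightarrow> carrier G"
  shows "(\<Oplus>s\<in>S. f (h s)) = (\<Oplus>t\<in>T. f t)"
  using finsum_reindex[of f h S] assms by (auto simp: bij_betw_def)

end

text \<open>\<open>A\<close> is thought of as a free left \<open>R\<close>-module on the unit
  vectors. Of its product only \<open>scale_mult\<close> is recorded: left scaling passes through
  right multiplication. This makes \<open>emb\<close> a homomorphism and the coordinates linear over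
  \<open>R\<close>.\<close>

locale free_extension = R: ring R + A: ring A
  for R :: "('r, 'x) ring_scheme" (structure) and A :: "('b \<Rightarrow> 'r, 'y) ring_scheme" and B :: "'b set" +
  assumes finite_basis: "finite B"
    and carrier_eq: "carrier A = B \<rightarrow>\<^sub>E carrier R"
    and coord_add: "\<lbrakk>x \<in> carrier A; y \<in> carrier A; b \<in> B\<rbrakk> \<Longrightarrow> (x \<oplus>\<^bsub>A\<^esub> y) b = x b \<oplus> y b"
    and scale_mult: "\<lbrakk>r \<in> carrier R; x \<in> carrier A; y \<in> carrier A\<rbrakk> \<Longrightarrow>
      (\<lambda>b\<in>B. r \<otimes> x b) \<otimes>\<^bsub>A\<^esub> y = (\<lambda>b\<in>B. r \<otimes> (x \<otimes>\<^bsub>A\<^esub> y) b)"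
begin

text \<open>The unit of \<open>A\<close> is scaled rather than a unit vector, because it need not be
  one: over the dual of the group algebra all its coordinates are \<one>.\<close>

definition emb :: "'r \<Rightarrow> 'b \<Rightarrow> 'r" where
  "emb r = (\<lambda>b\<in>B. r \<otimes> \<one>\<^bsub>A\<^esub> b)"

definition unit_vector :: "'b \<Rightarrow> 'b \<Rightarrow> 'r" where
  "unit_vector b = (\<lambda>c\<in>B. if c = b then \<one> else \<zero>)"

definition coord_set :: "'r set \<Rightarrow> ('b \<Rightarrow> 'r) set" where
  "coord_set I = {x \<in> carrier A. \<forall>b\<in>B. x b \<in> I}"

lemma coord_closed: "x \<in> carrier A \<Longrightarrow> b \<in> B \<Longrightarrow> x b \<in> carrier R"
  by (auto simp: carrier_eq)

lemma coord_eqI: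
  assumes "x \<in> carrier A" "y \<in> carrier A" "\<And>b. b \<in> B \<Longrightarrow> x b = y b"
  shows "x = y"
  using assms unfolding carrier_eq by (rule PiE_ext)

lemma coord_zero: "b \<in> B \<Longrightarrow> \<zero>\<^bsub>A\<^esub> b = \<zero>"
  using coord_add[of "\<zero>\<^bsub>A\<^esub>" "\<zero>\<^bsub>A\<^esub>" b] coord_closed[of "\<zero>\<^bsub>A\<^esub>" b] by simp

lemma coord_finsum:
  assumes "\<And>i. i \<in> S \<Longrightarrow> f i \<in> carrier A" "b \<in> B"
  shows "(\<Oplus>\<^bsub>A\<^esub>i\<in>S. f i) b = (\<Oplus>i\<in>S. f i b)"
  using assms(1)
proof (induction S rule: infinite_finite_induct)
  case (insert i S)
  then have "f \<in> S \<rightarrow> carrier A" "(\<lambda>i. f i b) \<in> S \<rightarrow> carrier R" "f i b \<in> carrier R"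
    using assms(2) coord_closed by auto
  then show ?case using insert assms(2) by (simp add: coord_add)
qed (use assms(2) coord_zero in auto)

lemma emb_closed [simp]: "r \<in> carrier R \<Longrightarrow> emb r \<in> carrier A"
  using coord_closed[OF A.one_closed] by (auto simp: emb_def carrier_eq)

lemma emb_mult:
  assumes "r \<in> carrier R" "x \<in> carrier A"
  shows "emb r \<otimes>\<^bsub>A\<^esub> x = (\<lambda>b\<in>B. r \<otimes> x b)"
  using scale_mult[OF assms(1) A.one_closed assms(2)] assms by (simp add: emb_def)

lemma coord_emb_mult:
  "\<lbrakk>r \<in> carrier R; x \<in> carrier A; b \<in> B\<rbrakk> \<Longrightarrow> (emb r \<otimes>\<^bsub>A\<^esub> x) b = r \<otimes> x b"
  by (simp add: emb_mult)

lemma emb_hom: "emb \<in> ring_hom R A"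
proof (rule ring_hom_memI)
  fix r s assume r: "r \<in> carrier R" "s \<in> carrier R"
  show "emb (r \<otimes> s) = emb r \<otimes>\<^bsub>A\<^esub> emb s"
    unfolding emb_mult[OF r(1) emb_closed[OF r(2)]] using r coord_closed[OF A.one_closed]
    by (auto simp: emb_def R.m_assoc)
  show "emb (r \<oplus> s) = emb r \<oplus>\<^bsub>A\<^esub> emb s"
  proof (rule coord_eqI)
    show "emb (r \<oplus> s) b = (emb r \<oplus>\<^bsub>A\<^esub> emb s) b" if "b \<in> B" for b
      using r coord_closed[OF A.one_closed that] that
      by (simp add: coord_add[OF emb_closed[OF r(1)] emb_closed[OF r(2)] that])
         (simp add: emb_def R.l_distr)
  qed (use r in auto)
next
  show "emb \<one> = \<one>\<^bsub>A\<^esub>"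
    by (rule coord_eqI[OF emb_closed[OF R.one_closed] A.one_closed])
       (simp add: emb_def coord_closed[OF A.one_closed])
qed simp

sublocale emb: ring_hom_ring R A emb
  by (rule ring_hom_ringI2[OF R.ring_axioms A.ring_axioms emb_hom])

lemma unit_vector_closed [simp]: "unit_vector b \<in> carrier A"
  by (auto simp: unit_vector_def carrier_eq)

lemma coord_emb_unit_vector:
  "\<lbrakk>r \<in> carrier R; b \<in> B\<rbrakk> \<Longrightarrow>
    (emb r \<otimes>\<^bsub>A\<^esub> unit_vector c) b = (if b = c then r else \<zero>)"
  using coord_emb_mult[OF _ unit_vector_closed, of r b c] by (auto simp: unit_vector_def)

lemma basis_expansion:
  assumes x: "x \<in> carrier A"
  shows "x = (\<Oplus>\<^bsub>A\<^esub>b\<in>B. emb (x b) \<otimes>\<^bsub>A\<^esub> unit_vector b)"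
proof (rule coord_eqI[OF x])
  show "(\<Oplus>\<^bsub>A\<^esub>b\<in>B. emb (x b) \<otimes>\<^bsub>A\<^esub> unit_vector b) \<in> carrier A"
    using coord_closed[OF x] by (auto intro!: A.finsum_closed)
  fix b assume b: "b \<in> B"
  have "(\<Oplus>\<^bsub>A\<^esub>b\<in>B. emb (x b) \<otimes>\<^bsub>A\<^esub> unit_vector b) b =
      (\<Oplus>c\<in>B. (emb (x c) \<otimes>\<^bsub>A\<^esub> unit_vector c) b)"
    using coord_closed[OF x] by (intro coord_finsum b) auto
  also have "\<dots> = (emb (x b) \<otimes>\<^bsub>A\<^esub> unit_vector b) b"
    using coord_closed[OF x] b finite_basis
    by (intro R.finsum_single) (auto simp: coord_emb_unit_vector)
  also have "\<dots> = x b" using coord_closed[OF x b] b by (simp add: coord_emb_unit_vector)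
  finally show "x b = (\<Oplus>\<^bsub>A\<^esub>b\<in>B. emb (x b) \<otimes>\<^bsub>A\<^esub> unit_vector b) b" ..
qed

text \<open>Serves to recognise an averaged projection as a right multiplication: commuting with
  left multiplication by \<open>R\<close> and by unit vectors, it is determined by its value
  \<open>w\<close> at the unit.\<close>

lemma additive_eq_on_basis:
  assumes f: "\<And>x. x \<in> carrier A \<Longrightarrow> f x \<in> carrier A"
    "\<And>x y. x \<in> carrier A \<Longrightarrow> y \<in> carrier A \<Longrightarrow> f (x \<oplus>\<^bsub>A\<^esub> y) = f x \<oplus>\<^bsub>A\<^esub> f y"
    and h: "\<And>r b. r \<in> carrier R \<Longrightarrow> b \<in> B \<Longrightarrow>
      f (emb r \<otimes>\<^bsub>A\<^esub> unit_vector b) = emb r \<otimes>\<^bsub>A\<^esub> unit_vector b \<otimes>\<^bsub>A\<^esub> w"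
    and w: "w \<in> carrier A" and x: "x \<in> carrier A"
  shows "f x = x \<otimes>\<^bsub>A\<^esub> w"
proof -
  let ?e = "\<lambda>b. emb (x b) \<otimes>\<^bsub>A\<^esub> unit_vector b"
  have e: "?e b \<in> carrier A" if "b \<in> B" for b using coord_closed[OF x that] by simp
  have "f x = f (\<Oplus>\<^bsub>A\<^esub>b\<in>B. ?e b)" using basis_expansion[OF x] by simp
  also have "\<dots> = (\<Oplus>\<^bsub>A\<^esub>b\<in>B. f (?e b))"
    by (rule finsum_hom[OF A.abelian_group_axioms A.abelian_group_axioms f finite_basis e])
  also have "\<dots> = (\<Oplus>\<^bsub>A\<^esub>b\<in>B. ?e b \<otimes>\<^bsub>A\<^esub> w)"
    using coord_closed[OF x] w by (intro A.finsum_cong') (auto simp: h)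
  also have "\<dots> = (\<Oplus>\<^bsub>A\<^esub>b\<in>B. ?e b) \<otimes>\<^bsub>A\<^esub> w"
    using finite_basis w e by (intro A.finsum_ldistr[symmetric]) auto
  also have "\<dots> = x \<otimes>\<^bsub>A\<^esub> w" using basis_expansion[OF x] by simp
  finally show ?thesis .
qed

lemma coord_setI:
  "x \<in> carrier A \<Longrightarrow> (\<And>b. b \<in> B \<Longrightarrow> x b \<in> I) \<Longrightarrow> x \<in> coord_set I"
  by (auto simp: coord_set_def)

text \<open>The ideals may vary with the coordinate, because in a crossed product with a group the
  left ideal generated by a left ideal of \<open>R\<close> has different twists of it as
  coordinates. Expanding both factors in the basis leaves only products of a unit vector with a
  single term.\<close>

lemma left_ideal_by_coordinates:
  assumes I: "\<And>b. b \<in> B \<Longrightarrow> left_ideal (I b) R"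
    and unit: "\<And>b c r. \<lbrakk>b \<in> B; c \<in> B; r \<in> I c\<rbrakk> \<Longrightarrow>
      unit_vector b \<otimes>\<^bsub>A\<^esub> (emb r \<otimes>\<^bsub>A\<^esub> unit_vector c) \<in> {x \<in> carrier A. \<forall>b\<in>B. x b \<in> I b}"
  shows "left_ideal {x \<in> carrier A. \<forall>b\<in>B. x b \<in> I b} A" (is "left_ideal ?N A")
proof -
  note ID = R.left_idealD[OF I]
  have zero: "\<zero>\<^bsub>A\<^esub> \<in> ?N" using ID(3) by (simp add: coord_zero)
  have add: "x \<oplus>\<^bsub>A\<^esub> y \<in> ?N" if "x \<in> ?N" "y \<in> ?N" for x y
    using that ID(4) by (simp add: coord_add)
  have scale: "emb r \<otimes>\<^bsub>A\<^esub> x \<in> ?N" if "r \<in> carrier R" "x \<in> ?N" for r x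
    using that ID(5) by (simp add: coord_emb_mult)
  have sum: "(\<Oplus>\<^bsub>A\<^esub>s\<in>S. f s) \<in> ?N" if "\<And>s. s \<in> S \<Longrightarrow> f s \<in> ?N" for S :: "'b set" and f
    using that
  proof (induction S rule: infinite_finite_induct)
    case (insert s S)
    then have "f \<in> S \<rightarrow> carrier A" "f s \<in> carrier A" by auto
    moreover have "f s \<oplus>\<^bsub>A\<^esub> (\<Oplus>\<^bsub>A\<^esub>s\<in>S. f s) \<in> ?N" by (rule add) (use insert in auto)
    ultimately show ?case using insert.hyps by simp
  qed (use zero in auto)
  have unit': "unit_vector b \<otimes>\<^bsub>A\<^esub> x \<in> ?N" if b: "b \<in> B" and x: "x \<in> ?N" for b x
  proof -
    have xc: "x \<in> carrier A" and xI: "\<And>c. c \<in> B \<Longrightarrow> x c \<in> I c" using x by auto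
    have xc': "emb (x c) \<in> carrier A" if "c \<in> B" for c using coord_closed[OF xc that] by simp
    have "unit_vector b \<otimes>\<^bsub>A\<^esub> x =
        unit_vector b \<otimes>\<^bsub>A\<^esub> (\<Oplus>\<^bsub>A\<^esub>c\<in>B. emb (x c) \<otimes>\<^bsub>A\<^esub> unit_vector c)"
      using basis_expansion[OF xc] by simp
    also have "\<dots> = (\<Oplus>\<^bsub>A\<^esub>c\<in>B. unit_vector b \<otimes>\<^bsub>A\<^esub> (emb (x c) \<otimes>\<^bsub>A\<^esub> unit_vector c))"
      using finite_basis xc' by (intro A.finsum_rdistr) auto
    also have "\<dots> \<in> ?N" by (rule sum) (use unit[OF b] xI in blast)
    finally show ?thesis .
  qed
  show ?thesis
  proof (rule A.left_idealI)
    fix a x assume a: "a \<in> carrier A" and x: "x \<in> ?N"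
    have ac: "emb (a c) \<in> carrier A" if "c \<in> B" for c using coord_closed[OF a that] by simp
    have xc: "x \<in> carrier A" using x by simp
    have "a \<otimes>\<^bsub>A\<^esub> x = (\<Oplus>\<^bsub>A\<^esub>c\<in>B. emb (a c) \<otimes>\<^bsub>A\<^esub> unit_vector c) \<otimes>\<^bsub>A\<^esub> x"
      using basis_expansion[OF a] by simp
    also have "\<dots> = (\<Oplus>\<^bsub>A\<^esub>c\<in>B. (emb (a c) \<otimes>\<^bsub>A\<^esub> unit_vector c) \<otimes>\<^bsub>A\<^esub> x)"
      using finite_basis ac xc by (intro A.finsum_ldistr) auto
    also have "\<dots> \<in> ?N"
    proof (rule sum)
      fix c assume c: "c \<in> B"
      have "emb (a c) \<otimes>\<^bsub>A\<^esub> (unit_vector c \<otimes>\<^bsub>A\<^esub> x) \<in> ?N"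
        by (rule scale[OF coord_closed[OF a c] unit'[OF c x]])
      then show "emb (a c) \<otimes>\<^bsub>A\<^esub> unit_vector c \<otimes>\<^bsub>A\<^esub> x \<in> ?N"
        using ac[OF c] xc by (simp add: A.m_assoc)
    qed
    finally show "a \<otimes>\<^bsub>A\<^esub> x \<in> ?N" .
  qed (use zero add in auto)
qed

text \<open>For \<open>y\<close> with coordinates in the radical, each unit vector is congruent to
  its product with \<open>y\<close> modulo the left ideal \<open>A (1 - y)\<close>, and this product
  again has coordinates in the radical. By \<open>nakayama\<close> the ideal contains all unit
  vectors, hence the unit, so \<open>1 - y\<close> has a left inverse.\<close>

lemma coord_set_le_jacobson_radical:
  assumes I: "left_ideal (coord_set (jacobson_radical R)) A"
  shows "coord_set (jacobson_radical R) \<subseteq> jacobson_radical A"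
proof -
  note ID = A.left_idealD[OF I]
  have inv: "\<exists>z\<in>carrier A. z \<otimes>\<^bsub>A\<^esub> (\<one>\<^bsub>A\<^esub> \<ominus>\<^bsub>A\<^esub> y) = \<one>\<^bsub>A\<^esub>"
    if y: "y \<in> coord_set (jacobson_radical R)" for y
  proof -
    have yc: "y \<in> carrier A" using y ID(2) by blast
    let ?N = "(\<lambda>z. z \<otimes>\<^bsub>A\<^esub> (\<one>\<^bsub>A\<^esub> \<ominus>\<^bsub>A\<^esub> y)) ` carrier A"
    have N: "left_ideal ?N A"
    proof (rule A.left_idealI)
      show "\<zero>\<^bsub>A\<^esub> \<in> ?N" using yc by (auto intro!: image_eqI[of _ _ "\<zero>\<^bsub>A\<^esub>"])
      show "a \<oplus>\<^bsub>A\<^esub> b \<in> ?N" if "a \<in> ?N" "b \<in> ?N" for a b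
        using that yc by (auto simp: A.l_distr[symmetric])
      show "a \<otimes>\<^bsub>A\<^esub> b \<in> ?N" if "a \<in> carrier A" "b \<in> ?N" for a b
        using that yc by (auto simp: A.m_assoc[symmetric])
    qed (use yc in auto)
    note ND = A.left_idealD[OF N]
    \<comment> \<open>The matrix of right multiplication by \<open>y\<close>. Its entries lie in the
      radical because the coordinate set is a left ideal.\<close>
    define j where "j s t = (unit_vector s \<otimes>\<^bsub>A\<^esub> y) t" for s t
    have u: "unit_vector s \<in> ?N" if "s \<in> B" for s
    proof (rule nakayama[OF R.ring_axioms A.ring_axioms emb_hom, where N = ?N and S = B
          and b = unit_vector and j = j])
      show "emb r \<otimes>\<^bsub>A\<^esub> x \<in> ?N" if "r \<in> carrier R" "x \<in> ?N" for r x
        using ND(5)[OF emb_closed that(2)] that(1) by blast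
      show "j s t \<in> jacobson_radical R" if "s \<in> B" "t \<in> B" for s t
        using ID(5)[OF unit_vector_closed y] that by (auto simp: j_def coord_set_def)
      fix s assume "s \<in> B"
      have "unit_vector s \<ominus>\<^bsub>A\<^esub> (\<Oplus>\<^bsub>A\<^esub>t\<in>B. emb (j s t) \<otimes>\<^bsub>A\<^esub> unit_vector t) =
          unit_vector s \<otimes>\<^bsub>A\<^esub> (\<one>\<^bsub>A\<^esub> \<ominus>\<^bsub>A\<^esub> y)"
        unfolding j_def using basis_expansion[of "unit_vector s \<otimes>\<^bsub>A\<^esub> y"] yc
        by (simp add: A.minus_eq A.r_distr A.r_minus)
      then show "unit_vector s \<ominus>\<^bsub>A\<^esub> (\<Oplus>\<^bsub>A\<^esub>t\<in>B. emb (j s t) \<otimes>\<^bsub>A\<^esub> unit_vector t) \<in> ?N"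
        by simp
    qed (use ND(1,3,4) finite_basis that in auto)
    have "(\<Oplus>\<^bsub>A\<^esub>b\<in>B. emb (\<one>\<^bsub>A\<^esub> b) \<otimes>\<^bsub>A\<^esub> unit_vector b) \<in> ?N"
      by (rule A.left_ideal_finsum[OF N], rule ND(5)[OF _ u]) (simp_all add: coord_closed)
    then have "\<one>\<^bsub>A\<^esub> \<in> ?N" using basis_expansion[OF A.one_closed] by simp
    then show ?thesis by (metis (no_types, lifting) imageE)
  qed
  show ?thesis
  proof
    fix y assume y: "y \<in> coord_set (jacobson_radical R)"
    show "y \<in> jacobson_radical A" unfolding A.jacobson_radical_iff
      using inv[OF ID(5)[OF _ y]] ID(2)[OF y] by blast
  qed
qed

end

section \<open>Crossed products with a group\<close>

text \<open>The classical crossed product with a group. Group elements are group-like, so the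
  convolution inverse of the cocycle is a pointwise inverse \<open>t\<close>, and the twist in the
  action becomes conjugation by the unit \<open>s g h\<close>.\<close>

locale group_crossed_product = free_extension R A "carrier G" + G: group G
  for R :: "('r, 'x) ring_scheme" (structure) and A :: "('g \<Rightarrow> 'r, 'y) ring_scheme"
    and G :: "('g, 'z) monoid_scheme" +
  fixes a :: "'g \<Rightarrow> 'r \<Rightarrow> 'r" and s t :: "'g \<Rightarrow> 'g \<Rightarrow> 'r"
  assumes a_iso: "g \<in> carrier G \<Longrightarrow> a g \<in> ring_iso R R"
    and s_closed: "\<lbrakk>g \<in> carrier G; h \<in> carrier G\<rbrakk> \<Longrightarrow> s g h \<in> carrier R"
    and t_closed: "\<lbrakk>g \<in> carrier G; h \<in> carrier G\<rbrakk> \<Longrightarrow> t g h \<in> carrier R"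
    and s_t: "\<lbrakk>g \<in> carrier G; h \<in> carrier G\<rbrakk> \<Longrightarrow> s g h \<otimes> t g h = \<one>"
    and t_s: "\<lbrakk>g \<in> carrier G; h \<in> carrier G\<rbrakk> \<Longrightarrow> t g h \<otimes> s g h = \<one>"
    and a_a: "\<lbrakk>g \<in> carrier G; h \<in> carrier G; r \<in> carrier R\<rbrakk> \<Longrightarrow>
      a g (a h r) = s g h \<otimes> a (g \<otimes>\<^bsub>G\<^esub> h) r \<otimes> t g h"
    and unit_one: "unit_vector \<one>\<^bsub>G\<^esub> = \<one>\<^bsub>A\<^esub>"
    and unit_emb: "\<lbrakk>g \<in> carrier G; r \<in> carrier R\<rbrakk> \<Longrightarrow>
      unit_vector g \<otimes>\<^bsub>A\<^esub> emb r = emb (a g r) \<otimes>\<^bsub>A\<^esub> unit_vector g"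
    and unit_unit: "\<lbrakk>g \<in> carrier G; h \<in> carrier G\<rbrakk> \<Longrightarrow>
      unit_vector g \<otimes>\<^bsub>A\<^esub> unit_vector h = emb (s g h) \<otimes>\<^bsub>A\<^esub> unit_vector (g \<otimes>\<^bsub>G\<^esub> h)"
begin

lemma a_closed: "g \<in> carrier G \<Longrightarrow> r \<in> carrier R \<Longrightarrow> a g r \<in> carrier R"
  using ring_iso_memE(1)[OF a_iso] .

lemma a_hom: "g \<in> carrier G \<Longrightarrow> a g \<in> ring_hom R R" "g \<in> carrier G \<Longrightarrow> a g ` carrier R = carrier R"
  using a_iso by (auto simp: ring_iso_def bij_betw_def)

lemma a_jacobson_radical:
  "g \<in> carrier G \<Longrightarrow> r \<in> jacobson_radical R \<Longrightarrow> a g r \<in> jacobson_radical R"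
  using jacobson_radical_ring_hom[OF R.ring_axioms R.ring_axioms a_hom] .

lemma unit_mult_term:
  assumes "g \<in> carrier G" "h \<in> carrier G" "r \<in> carrier R"
  shows "unit_vector g \<otimes>\<^bsub>A\<^esub> (emb r \<otimes>\<^bsub>A\<^esub> unit_vector h) =
    emb (a g r \<otimes> s g h) \<otimes>\<^bsub>A\<^esub> unit_vector (g \<otimes>\<^bsub>G\<^esub> h)"
proof -
  have "unit_vector g \<otimes>\<^bsub>A\<^esub> (emb r \<otimes>\<^bsub>A\<^esub> unit_vector h) =
      emb (a g r) \<otimes>\<^bsub>A\<^esub> (unit_vector g \<otimes>\<^bsub>A\<^esub> unit_vector h)"
    using assms a_closed by (simp add: A.m_assoc[symmetric] unit_emb)
  also have "\<dots> = emb (a g r \<otimes> s g h) \<otimes>\<^bsub>A\<^esub> unit_vector (g \<otimes>\<^bsub>G\<^esub> h)"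
    using assms a_closed s_closed by (simp add: unit_unit A.m_assoc)
  finally show ?thesis .
qed

text \<open>The unit vectors at \<open>g\<close> and at its inverse multiply, in either order, to
  cocycle values, which are units of \<open>R\<close>. Correcting by \<open>t\<close> on the left
  and on the right gives two one-sided inverses, and these agree.\<close>

lemma unit_vector_Units:
  assumes g: "g \<in> carrier G"
  shows "unit_vector g \<in> Units A"
proof -
  let ?u = unit_vector and ?h = "inv\<^bsub>G\<^esub> g"
  have r: "?u g \<otimes>\<^bsub>A\<^esub> ?u ?h = emb (s g ?h)" "?u ?h \<otimes>\<^bsub>A\<^esub> ?u g = emb (s ?h g)"
    using g s_closed by (simp_all add: unit_unit unit_one)
  let ?l = "emb (t ?h g) \<otimes>\<^bsub>A\<^esub> ?u ?h" and ?r = "?u ?h \<otimes>\<^bsub>A\<^esub> emb (t g ?h)"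
  have lc: "?l \<in> carrier A" "?r \<in> carrier A" using g t_closed by auto
  have l: "?l \<otimes>\<^bsub>A\<^esub> ?u g = \<one>\<^bsub>A\<^esub>"
    using g t_closed s_closed t_s[of ?h g]
    by (simp add: A.m_assoc r(2)) (simp add: emb.hom_mult[symmetric] del: emb.hom_mult)
  have r': "?u g \<otimes>\<^bsub>A\<^esub> ?r = \<one>\<^bsub>A\<^esub>"
    using g t_closed s_closed s_t[of g ?h]
    by (simp add: A.m_assoc[symmetric] r(1)) (simp add: emb.hom_mult[symmetric] del: emb.hom_mult)
  have "?l = ?r" using A.inv_unique[OF l r' unit_vector_closed lc] .
  then show ?thesis using l r' lc unfolding Units_def by auto
qed

theorem jacobson_radical_eq:
  assumes c: "c \<in> carrier R" "c \<otimes> (\<Oplus>g\<in>carrier G. \<one>) = \<one>"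
  shows "jacobson_radical A = coord_set (jacobson_radical R)"
proof
  \<comment> \<open>The radical of \<open>R\<close> is two-sided and stable under automorphisms,
    hence stable under \<open>r \<mapsto> a b r \<otimes> s b c\<close>; the consequence of
    \<open>nakayama\<close> then gives this inclusion.\<close>
  have "left_ideal {x \<in> carrier A. \<forall>b\<in>carrier G. x b \<in> jacobson_radical R} A"
  proof (rule left_ideal_by_coordinates)
    fix b c r assume b: "b \<in> carrier G" "c \<in> carrier G" and r: "r \<in> jacobson_radical R"
    then have rc: "r \<in> carrier R" using R.jacobson_radicalD(2) by blast
    have "a b r \<otimes> s b c \<in> jacobson_radical R"
      using a_jacobson_radical r R.jacobson_radical_right b s_closed by blast
    then show "unit_vector b \<otimes>\<^bsub>A\<^esub> (emb r \<otimes>\<^bsub>A\<^esub> unit_vector c) \<in>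
        {x \<in> carrier A. \<forall>b\<in>carrier G. x b \<in> jacobson_radical R}"
      unfolding unit_mult_term[OF b rc] using b rc a_closed s_closed R.jacobson_radicalD(3)
      by (auto simp: coord_emb_unit_vector simp del: emb.hom_mult)
  qed (rule R.jacobson_radical_left_ideal)
  then show "coord_set (jacobson_radical R) \<subseteq> jacobson_radical A"
    using coord_set_le_jacobson_radical by (simp add: coord_set_def)
next
  define ai where "ai g = inv_into (carrier R) (a g)" for g
  have ai: "ai g \<in> ring_hom R R" "ai g ` carrier R = carrier R" if "g \<in> carrier G" for g
    using ring_iso_set_sym[OF R.ring_axioms a_iso[OF that]]
    by (auto simp: ring_iso_def bij_betw_def ai_def)
  have a_ai: "a g (ai g r) = r" if "g \<in> carrier G" "r \<in> carrier R" for g r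
    using f_inv_into_f[of r "a g" "carrier R"] a_hom(2)[OF that(1)] that by (simp add: ai_def)
  have ai_a: "ai g (a g r) = r" if "g \<in> carrier G" "r \<in> carrier R" for g r
    using inv_into_f_f[of "a g" "carrier R" r] a_iso[OF that(1)] that
    by (simp add: ai_def ring_iso_def bij_betw_def)
  have ai_closed: "ai g r \<in> carrier R" if "g \<in> carrier G" "r \<in> carrier R" for g r
    using ring_hom_closed[OF ai(1)] that by blast
  define v where "v g = inv\<^bsub>A\<^esub> (unit_vector g)" for g
  have v [simp]: "v g \<in> carrier A" "v g \<otimes>\<^bsub>A\<^esub> unit_vector g = \<one>\<^bsub>A\<^esub>"
      "unit_vector g \<otimes>\<^bsub>A\<^esub> v g = \<one>\<^bsub>A\<^esub>" if "g \<in> carrier G" for g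
    using unit_vector_Units[OF that] by (auto simp: v_def)
  have v_emb: "v g \<otimes>\<^bsub>A\<^esub> emb (a g r) = emb r \<otimes>\<^bsub>A\<^esub> v g"
    if g: "g \<in> carrier G" and r: "r \<in> carrier R" for g r
  proof -
    have "v g \<otimes>\<^bsub>A\<^esub> emb (a g r) = v g \<otimes>\<^bsub>A\<^esub> (emb (a g r) \<otimes>\<^bsub>A\<^esub> unit_vector g) \<otimes>\<^bsub>A\<^esub> v g"
      using g r a_closed by (simp add: A.m_assoc)
    also have "\<dots> = v g \<otimes>\<^bsub>A\<^esub> unit_vector g \<otimes>\<^bsub>A\<^esub> emb r \<otimes>\<^bsub>A\<^esub> v g"
      using g r unfolding unit_emb[OF g r, symmetric] by (simp add: A.m_assoc del: v(2,3))
    finally show ?thesis using g r by simp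
  qed
  \<comment> \<open>Together with \<open>v_emb\<close> this is what makes the sum \<open>q\<close>
    below commute with left multiplication by the unit vectors and by \<open>R\<close>.\<close>
  have v_unit: "unit_vector k \<otimes>\<^bsub>A\<^esub> v (g \<otimes>\<^bsub>G\<^esub> k) = v g \<otimes>\<^bsub>A\<^esub> emb (s g k)"
    if g: "g \<in> carrier G" and k: "k \<in> carrier G" for g k
  proof -
    have "unit_vector k \<otimes>\<^bsub>A\<^esub> v (g \<otimes>\<^bsub>G\<^esub> k) =
        v g \<otimes>\<^bsub>A\<^esub> unit_vector g \<otimes>\<^bsub>A\<^esub> unit_vector k \<otimes>\<^bsub>A\<^esub> v (g \<otimes>\<^bsub>G\<^esub> k)"
      using g k by simp
    also have "\<dots> = v g \<otimes>\<^bsub>A\<^esub> (unit_vector g \<otimes>\<^bsub>A\<^esub> unit_vector k) \<otimes>\<^bsub>A\<^esub> v (g \<otimes>\<^bsub>G\<^esub> k)"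
      using g k by (simp add: A.m_assoc del: v(2,3))
    also have "\<dots> = v g \<otimes>\<^bsub>A\<^esub> emb (s g k)"
      unfolding unit_unit[OF g k] using g k s_closed by (simp add: A.m_assoc)
    finally show ?thesis .
  qed
  have "x g \<in> jacobson_radical R" if x: "x \<in> jacobson_radical A" and g: "g \<in> carrier G" for x g
  proof -
    have xc: "x \<in> carrier A" using x A.jacobson_radicalD(2) by blast
    \<comment> \<open>Moving a coefficient to the right of the unit vector at \<open>h\<close>
      applies \<open>ai h\<close> to it. So \<open>?N\<close> below is the left ideal of
      \<open>A\<close> generated by \<open>L\<close>: its coordinates range over the images of
      \<open>L\<close> under the automorphisms \<open>a h\<close>.\<close>
    have "ai g (x g) \<in> L" if L: "maximal_left_ideal L R" for L
    proof -
      define Lg where "Lg h = {r \<in> carrier R. ai h r \<in> L}" for h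
      have Lg: "maximal_left_ideal (Lg h) R" if "h \<in> carrier G" for h
        unfolding Lg_def using maximal_left_ideal_vimage[OF R.ring_axioms R.ring_axioms ai L] that by simp
      note LD = R.left_idealD[OF R.maximal_left_idealD(1)[OF Lg]]
      note L' = R.left_idealD[OF R.maximal_left_idealD(1)[OF L]]
      let ?N = "{x \<in> carrier A. \<forall>h\<in>carrier G. x h \<in> Lg h}"
      have N: "left_ideal ?N A"
      proof (rule left_ideal_by_coordinates)
        show "left_ideal (Lg h) R" if "h \<in> carrier G" for h
          using R.maximal_left_idealD(1)[OF Lg[OF that]] .
        fix h k r assume h: "h \<in> carrier G" "k \<in> carrier G" and r: "r \<in> Lg k"
        then have rc: "r \<in> carrier R" and l: "ai k r \<in> L" by (auto simp: Lg_def)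
        let ?l = "ai k r"
        have lc: "?l \<in> carrier R" using l L'(2) by blast
        \<comment> \<open>The twisted composition of the automorphisms moves \<open>s h k\<close> to
          the left, where a left ideal absorbs it.\<close>
        have "a h r \<otimes> s h k = a h (a k ?l) \<otimes> s h k" using a_ai h rc by simp
        also have "\<dots> = s h k \<otimes> a (h \<otimes>\<^bsub>G\<^esub> k) ?l"
          using h lc a_closed s_closed t_closed by (simp add: a_a R.m_assoc t_s)
        also have "\<dots> \<in> Lg (h \<otimes>\<^bsub>G\<^esub> k)"
          using h lc a_closed s_closed l
          by (intro LD(5)) (auto simp: Lg_def ai_a)
        finally show "unit_vector h \<otimes>\<^bsub>A\<^esub> (emb r \<otimes>\<^bsub>A\<^esub> unit_vector k) \<in> ?N"
          unfolding unit_mult_term[OF h rc] using h rc a_closed s_closed LD(3)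
          by (auto simp: coord_emb_unit_vector simp del: emb.hom_mult)
      qed
      note ND = A.left_idealD[OF N]
      \<comment> \<open>The functionals are the coordinates, so \<open>p\<close> is linear over
        \<open>R\<close> only. The sum \<open>q\<close> of its conjugates by the unit vectors is
        linear over \<open>A\<close>.\<close>
      obtain p where p: "\<And>x. x \<in> carrier A \<Longrightarrow> p x \<in> jacobson_radical A"
        "\<And>x y. x \<in> carrier A \<Longrightarrow> y \<in> carrier A \<Longrightarrow> p (x \<oplus>\<^bsub>A\<^esub> y) = p x \<oplus>\<^bsub>A\<^esub> p y"
        "\<And>r x. r \<in> carrier R \<Longrightarrow> x \<in> carrier A \<Longrightarrow> p (emb r \<otimes>\<^bsub>A\<^esub> x) = emb r \<otimes>\<^bsub>A\<^esub> p x"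
        "\<And>h x. h \<in> carrier G \<Longrightarrow> x \<in> jacobson_radical A \<Longrightarrow> (x \<ominus>\<^bsub>A\<^esub> p x) h \<in> Lg h"
        by (rule projection_modulo_maximal_left_ideals[where \<phi> = "\<lambda>h x. x h" and \<iota> = emb
              and P = "jacobson_radical A" and I = "carrier G" and L = Lg,
              OF R.ring_axioms A.ring_axioms emb_hom finite_basis])
           (use coord_closed coord_add coord_emb_mult Lg A.jacobson_radical_left_ideal in auto)
      have pc: "p x \<in> carrier A" if "x \<in> carrier A" for x
        using p(1) that A.jacobson_radicalD(2) by blast
      define q where "q x = (\<Oplus>\<^bsub>A\<^esub>g\<in>carrier G. v g \<otimes>\<^bsub>A\<^esub> p (unit_vector g \<otimes>\<^bsub>A\<^esub> x))" for x
      have q_closed: "q x \<in> carrier A" if "x \<in> carrier A" for x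
        unfolding q_def using that pc by (intro A.finsum_closed Pi_I A.m_closed v(1) pc) auto
      have q_add: "q (x \<oplus>\<^bsub>A\<^esub> y) = q x \<oplus>\<^bsub>A\<^esub> q y" if "x \<in> carrier A" "y \<in> carrier A" for x y
      proof -
        have vp: "(\<lambda>g. v g \<otimes>\<^bsub>A\<^esub> p (unit_vector g \<otimes>\<^bsub>A\<^esub> z)) \<in> carrier G \<rightarrow> carrier A"
          if "z \<in> carrier A" for z
          by (intro Pi_I A.m_closed v(1) pc unit_vector_closed that)
        have "q (x \<oplus>\<^bsub>A\<^esub> y) = (\<Oplus>\<^bsub>A\<^esub>g\<in>carrier G.
            v g \<otimes>\<^bsub>A\<^esub> p (unit_vector g \<otimes>\<^bsub>A\<^esub> x) \<oplus>\<^bsub>A\<^esub> v g \<otimes>\<^bsub>A\<^esub> p (unit_vector g \<otimes>\<^bsub>A\<^esub> y))"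
          unfolding q_def using that vp[OF that(1)] vp[OF that(2)] pc
          by (intro A.finsum_cong' refl) (simp_all add: A.r_distr p(2) Pi_iff)
        also have "\<dots> = q x \<oplus>\<^bsub>A\<^esub> q y"
          unfolding q_def by (rule A.finsum_addf[OF vp[OF that(1)] vp[OF that(2)]])
        finally show ?thesis .
      qed
      have q_emb: "q (emb r \<otimes>\<^bsub>A\<^esub> x) = emb r \<otimes>\<^bsub>A\<^esub> q x" if "r \<in> carrier R" "x \<in> carrier A" for r x
      proof -
        have "v g \<otimes>\<^bsub>A\<^esub> p (unit_vector g \<otimes>\<^bsub>A\<^esub> (emb r \<otimes>\<^bsub>A\<^esub> x)) =
            emb r \<otimes>\<^bsub>A\<^esub> (v g \<otimes>\<^bsub>A\<^esub> p (unit_vector g \<otimes>\<^bsub>A\<^esub> x))" if g: "g \<in> carrier G" for g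
        proof -
          have "p (unit_vector g \<otimes>\<^bsub>A\<^esub> (emb r \<otimes>\<^bsub>A\<^esub> x)) = p (emb (a g r) \<otimes>\<^bsub>A\<^esub> (unit_vector g \<otimes>\<^bsub>A\<^esub> x))"
            using g \<open>r \<in> carrier R\<close> \<open>x \<in> carrier A\<close> a_closed by (simp add: A.m_assoc[symmetric] unit_emb)
          also have "\<dots> = emb (a g r) \<otimes>\<^bsub>A\<^esub> p (unit_vector g \<otimes>\<^bsub>A\<^esub> x)"
            using g \<open>r \<in> carrier R\<close> \<open>x \<in> carrier A\<close> a_closed by (simp add: p(3))
          finally show ?thesis
            using g \<open>r \<in> carrier R\<close> \<open>x \<in> carrier A\<close> a_closed pc
            by (simp add: A.m_assoc[symmetric] v_emb)
        qed
        then show ?thesis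
          unfolding q_def using that pc finite_basis
          by (subst A.finsum_rdistr) (auto intro!: A.finsum_cong')
      qed
      have q_unit: "q (unit_vector k \<otimes>\<^bsub>A\<^esub> x) = unit_vector k \<otimes>\<^bsub>A\<^esub> q x"
        if k: "k \<in> carrier G" and x: "x \<in> carrier A" for k x
      proof -
        \<comment> \<open>By \<open>v_unit\<close>, multiplying the argument by
          \<open>unit_vector k\<close> turns the term at \<open>g\<close> into
          \<open>unit_vector k\<close> times the term at \<open>g k\<close>; right translation by
          \<open>k\<close> then permutes the terms.\<close>
        have "v g \<otimes>\<^bsub>A\<^esub> p (unit_vector g \<otimes>\<^bsub>A\<^esub> (unit_vector k \<otimes>\<^bsub>A\<^esub> x)) =
            unit_vector k \<otimes>\<^bsub>A\<^esub> (v (g \<otimes>\<^bsub>G\<^esub> k) \<otimes>\<^bsub>A\<^esub> p (unit_vector (g \<otimes>\<^bsub>G\<^esub> k) \<otimes>\<^bsub>A\<^esub> x))"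
          if g: "g \<in> carrier G" for g
        proof -
          have "p (unit_vector g \<otimes>\<^bsub>A\<^esub> (unit_vector k \<otimes>\<^bsub>A\<^esub> x)) =
              emb (s g k) \<otimes>\<^bsub>A\<^esub> p (unit_vector (g \<otimes>\<^bsub>G\<^esub> k) \<otimes>\<^bsub>A\<^esub> x)"
            using g k x s_closed by (simp add: A.m_assoc[symmetric] unit_unit)
              (simp add: A.m_assoc p(3))
          then show ?thesis
            using g k x s_closed pc by (simp add: A.m_assoc[symmetric] v_unit)
        qed
        then have "q (unit_vector k \<otimes>\<^bsub>A\<^esub> x) = (\<Oplus>\<^bsub>A\<^esub>g\<in>carrier G.
            unit_vector k \<otimes>\<^bsub>A\<^esub> (v (g \<otimes>\<^bsub>G\<^esub> k) \<otimes>\<^bsub>A\<^esub> p (unit_vector (g \<otimes>\<^bsub>G\<^esub> k) \<otimes>\<^bsub>A\<^esub> x)))"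
          unfolding q_def using k x pc by (intro A.finsum_cong') auto
        also have "\<dots> = unit_vector k \<otimes>\<^bsub>A\<^esub> (\<Oplus>\<^bsub>A\<^esub>g\<in>carrier G.
            v (g \<otimes>\<^bsub>G\<^esub> k) \<otimes>\<^bsub>A\<^esub> p (unit_vector (g \<otimes>\<^bsub>G\<^esub> k) \<otimes>\<^bsub>A\<^esub> x))"
          using k x pc finite_basis by (intro A.finsum_rdistr[symmetric]) auto
        also have "(\<Oplus>\<^bsub>A\<^esub>g\<in>carrier G.
            v (g \<otimes>\<^bsub>G\<^esub> k) \<otimes>\<^bsub>A\<^esub> p (unit_vector (g \<otimes>\<^bsub>G\<^esub> k) \<otimes>\<^bsub>A\<^esub> x)) = q x"
          unfolding q_def
        proof (rule A.finsum_bij[where f = "\<lambda>g. v g \<otimes>\<^bsub>A\<^esub> p (unit_vector g \<otimes>\<^bsub>A\<^esub> x)"])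
          show "bij_betw (\<lambda>g. g \<otimes>\<^bsub>G\<^esub> k) (carrier G) (carrier G)"
            by (rule bij_betwI[where g = "\<lambda>g. g \<otimes>\<^bsub>G\<^esub> inv\<^bsub>G\<^esub> k"]) (use k in \<open>auto simp: G.m_assoc\<close>)
        qed (intro Pi_I A.m_closed v(1) pc unit_vector_closed x)
        finally show ?thesis .
      qed
      define w where "w = q \<one>\<^bsub>A\<^esub>"
      have wc: "w \<in> carrier A" using q_closed by (simp add: w_def)
      have q_eq: "q y = y \<otimes>\<^bsub>A\<^esub> w" if y: "y \<in> carrier A" for y
      proof (rule additive_eq_on_basis[OF q_closed q_add _ wc y])
        fix r b assume rb: "r \<in> carrier R" "b \<in> carrier G"
        show "q (emb r \<otimes>\<^bsub>A\<^esub> unit_vector b) = emb r \<otimes>\<^bsub>A\<^esub> unit_vector b \<otimes>\<^bsub>A\<^esub> w"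
          using q_emb[OF rb(1) unit_vector_closed, of b] q_unit[OF rb(2) A.one_closed] rb wc
          by (simp add: w_def A.m_assoc)
      qed
      have wJ: "w \<in> jacobson_radical A"
        unfolding w_def q_def
        by (rule A.left_ideal_finsum[OF A.jacobson_radical_left_ideal],
            rule A.jacobson_radicalD(5)) (use p(1) in auto)
      \<comment> \<open>The order of \<open>G\<close> as an element of \<open>A\<close>. Since
        \<open>q\<close> is a sum and not a mean, the division by \<open>n\<close> is left to
        \<open>jacobson_radical_le_left_ideal\<close>.\<close>
      define n where "n = (\<Oplus>\<^bsub>A\<^esub>g\<in>carrier G. \<one>\<^bsub>A\<^esub>)"
      have nc: "n \<in> carrier A" by (simp add: n_def)
      have "emb (\<Oplus>g\<in>carrier G. \<one>) = n"
        unfolding n_def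
        by (subst finsum_hom[OF R.abelian_group_axioms A.abelian_group_axioms, where f = emb])
           (use finite_basis in auto)
      then have cn: "emb c \<otimes>\<^bsub>A\<^esub> n = \<one>\<^bsub>A\<^esub>"
        using c emb.hom_mult[of c "\<Oplus>g\<in>carrier G. \<one>"] by simp
      have "jacobson_radical A \<subseteq> ?N"
      proof (rule A.jacobson_radical_le_left_ideal[OF N _ nc cn wJ])
        fix y assume y: "y \<in> jacobson_radical A"
        then have yc: "y \<in> carrier A" using A.jacobson_radicalD(2) by blast
        \<comment> \<open>The difference is the sum over \<open>g\<close> of \<open>v g\<close>
          times the residue of \<open>p\<close> at \<open>unit_vector g\<close> times
          \<open>y\<close>. Each residue lies in \<open>?N\<close>, which absorbs the factor
          \<open>v g\<close>.\<close>
        have "n \<otimes>\<^bsub>A\<^esub> y \<ominus>\<^bsub>A\<^esub> y \<otimes>\<^bsub>A\<^esub> w = (\<Oplus>\<^bsub>A\<^esub>g\<in>carrier G. y) \<oplus>\<^bsub>A\<^esub> (\<ominus>\<^bsub>A\<^esub> \<one>\<^bsub>A\<^esub>) \<otimes>\<^bsub>A\<^esub> q y"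
          using yc wc q_eq finite_basis unfolding n_def
          by (subst A.finsum_ldistr) (auto simp: A.minus_eq A.l_minus)
        also have "\<dots> = (\<Oplus>\<^bsub>A\<^esub>g\<in>carrier G. y \<oplus>\<^bsub>A\<^esub> (\<ominus>\<^bsub>A\<^esub> \<one>\<^bsub>A\<^esub>) \<otimes>\<^bsub>A\<^esub> (v g \<otimes>\<^bsub>A\<^esub> p (unit_vector g \<otimes>\<^bsub>A\<^esub> y)))"
          unfolding q_def using yc pc finite_basis
          by (subst A.finsum_rdistr) (auto intro!: A.finsum_addf[symmetric])
        also have "\<dots> \<in> ?N"
        proof (rule A.left_ideal_finsum[OF N])
          fix g assume g: "g \<in> carrier G"
          let ?y = "unit_vector g \<otimes>\<^bsub>A\<^esub> y"
          have yJ: "?y \<in> jacobson_radical A" using A.jacobson_radicalD(5) y g by simp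
          have "?y \<ominus>\<^bsub>A\<^esub> p ?y \<in> ?N" using p(4)[OF _ yJ] yc pc by simp
          then have "v g \<otimes>\<^bsub>A\<^esub> (?y \<ominus>\<^bsub>A\<^esub> p ?y) \<in> ?N" by (rule ND(5)[OF v(1)[OF g]])
          also have "v g \<otimes>\<^bsub>A\<^esub> (?y \<ominus>\<^bsub>A\<^esub> p ?y) = y \<oplus>\<^bsub>A\<^esub> (\<ominus>\<^bsub>A\<^esub> \<one>\<^bsub>A\<^esub>) \<otimes>\<^bsub>A\<^esub> (v g \<otimes>\<^bsub>A\<^esub> p ?y)"
            using g yc pc by (simp add: A.minus_eq A.r_distr A.r_minus A.l_minus A.m_assoc[symmetric])
          finally show "y \<oplus>\<^bsub>A\<^esub> (\<ominus>\<^bsub>A\<^esub> \<one>\<^bsub>A\<^esub>) \<otimes>\<^bsub>A\<^esub> (v g \<otimes>\<^bsub>A\<^esub> p ?y) \<in> ?N" .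
        qed
        finally show "n \<otimes>\<^bsub>A\<^esub> y \<ominus>\<^bsub>A\<^esub> y \<otimes>\<^bsub>A\<^esub> w \<in> ?N" .
      qed (use c in simp)
      then show ?thesis using x g by (auto simp: Lg_def)
    qed
    then have "ai g (x g) \<in> jacobson_radical R"
      using ai_closed g coord_closed[OF xc g] by (simp add: jacobson_radical_def)
    then show ?thesis using a_jacobson_radical[OF g] a_ai[OF g coord_closed[OF xc g]] by metis
  qed
  then show "jacobson_radical A \<subseteq> coord_set (jacobson_radical R)"
    using A.jacobson_radicalD(2) by (auto simp: coord_set_def)
qed

end

section \<open>Crossed products with the function algebra of a group\<close>

context group
begin

lemma bij_left_mult: "g \<in> carrier G \<Longrightarrow> bij_betw (\<lambda>x. g \<otimes> x) (carrier G) (carrier G)"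
  by (rule bij_betwI[where g = "\<lambda>x. inv g \<otimes> x"]) (auto simp: m_assoc[symmetric])

lemma bij_right_mult: "g \<in> carrier G \<Longrightarrow> bij_betw (\<lambda>x. x \<otimes> g) (carrier G) (carrier G)"
  by (rule bij_betwI[where g = "\<lambda>x. x \<otimes> inv g"]) (auto simp: m_assoc)

lemma bij_inv: "bij_betw (\<lambda>x. inv x) (carrier G) (carrier G)"
  by (rule bij_betwI[where g = "\<lambda>x. inv x"]) auto

lemma inv_mult_cancel:
  "\<lbrakk>g \<in> carrier G; h \<in> carrier G\<rbrakk> \<Longrightarrow> inv g \<otimes> (g \<otimes> h) = h"
  "\<lbrakk>g \<in> carrier G; h \<in> carrier G\<rbrakk> \<Longrightarrow> g \<otimes> (inv g \<otimes> h) = h"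
  by (simp_all add: m_assoc[symmetric])

end

text \<open>
  Here \<open>a g\<close>, \<open>s g h\<close> and \<open>t g h\<close> are the action, the cocycle and its convolution inverse on
  the dual basis of \<open>G\<close>. The formula for the product is arranged so that it is visibly
  invariant under right translation of the coordinates.
\<close>

locale function_crossed_product = free_extension R A "carrier G" + G: group G
  for R :: "('r, 'x) ring_scheme" (structure) and A :: "('g \<Rightarrow> 'r, 'y) ring_scheme"
    and G :: "('g, 'z) monoid_scheme" +
  fixes a :: "'g \<Rightarrow> 'r \<Rightarrow> 'r" and s t :: "'g \<Rightarrow> 'g \<Rightarrow> 'r"
  assumes a_closed: "\<lbrakk>g \<in> carrier G; r \<in> carrier R\<rbrakk> \<Longrightarrow> a g r \<in> carrier R"
    and a_zero: "g \<in> carrier G \<Longrightarrow> a g \<zero> = \<zero>"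
    and a_one: "g \<in> carrier G \<Longrightarrow>
      a g \<one> = (\<Oplus>u\<in>carrier G. a u \<one> \<otimes> a (inv\<^bsub>G\<^esub> u \<otimes>\<^bsub>G\<^esub> g) \<one>)"
    and s_closed: "\<lbrakk>g \<in> carrier G; h \<in> carrier G\<rbrakk> \<Longrightarrow> s g h \<in> carrier R"
    and t_closed: "\<lbrakk>g \<in> carrier G; h \<in> carrier G\<rbrakk> \<Longrightarrow> t g h \<in> carrier R"
    and t_s: "\<lbrakk>g \<in> carrier G; h \<in> carrier G\<rbrakk> \<Longrightarrow>
      (\<Oplus>p\<in>carrier G. \<Oplus>q\<in>carrier G. t p q \<otimes> s (inv\<^bsub>G\<^esub> p \<otimes>\<^bsub>G\<^esub> g) (inv\<^bsub>G\<^esub> q \<otimes>\<^bsub>G\<^esub> h)) =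
        (if g = \<one>\<^bsub>G\<^esub> \<and> h = \<one>\<^bsub>G\<^esub> then \<one> else \<zero>)"
    and one_coord: "g \<in> carrier G \<Longrightarrow> \<one>\<^bsub>A\<^esub> g = \<one>"
    and mult_coord: "\<lbrakk>x \<in> carrier A; y \<in> carrier A; w \<in> carrier G\<rbrakk> \<Longrightarrow>
      (x \<otimes>\<^bsub>A\<^esub> y) w = (\<Oplus>b\<in>carrier G. \<Oplus>c\<in>carrier G. x (b \<otimes>\<^bsub>G\<^esub> w) \<otimes>
        (\<Oplus>u\<in>carrier G. a u (y (c \<otimes>\<^bsub>G\<^esub> w)) \<otimes> s (inv\<^bsub>G\<^esub> u \<otimes>\<^bsub>G\<^esub> b) c))"
begin

lemma emb_coord: "r \<in> carrier R \<Longrightarrow> b \<in> carrier G \<Longrightarrow> emb r b = r"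
  by (simp add: emb_def one_coord)

text \<open>
  The identities \<open>g \<cdot> 1 = \<epsilon>(g)\<close> and \<open>\<sigma>(g, 1) = \<epsilon>(g)\<close> in the dual basis. The right unit law of
  \<open>A\<close> says that \<open>U * S = \<epsilon>\<close> for \<open>U g = g \<cdot> 1\<close> and \<open>S g = \<sigma>(g, 1)\<close>; as \<open>U * U = U\<close>, this gives
  \<open>U = U * (U * S) = U * S = \<epsilon>\<close>.
\<close>

lemma
  shows a_one_eq: "g \<in> carrier G \<Longrightarrow> a g \<one> = (if g = \<one>\<^bsub>G\<^esub> then \<one> else \<zero>)"
    and sum_s: "g \<in> carrier G \<Longrightarrow>
      (\<Oplus>c\<in>carrier G. s g c) = (if g = \<one>\<^bsub>G\<^esub> then \<one> else \<zero>)"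
proof -
  define U where "U g = a g \<one>" for g
  define S where "S g = (\<Oplus>c\<in>carrier G. s g c)" for g
  have U: "U g \<in> carrier R" if "g \<in> carrier G" for g using a_closed that by (simp add: U_def)
  have S: "S g \<in> carrier R" if "g \<in> carrier G" for g
    unfolding S_def using s_closed that by (intro R.finsum_closed) auto
  have US: "(\<Oplus>u\<in>carrier G. U u \<otimes> S (inv\<^bsub>G\<^esub> u \<otimes>\<^bsub>G\<^esub> g)) = (if g = \<one>\<^bsub>G\<^esub> then \<one> else \<zero>)"
    if g: "g \<in> carrier G" for g
  proof -
    \<comment> \<open>Evaluating the product of this unit vector with the unit of \<open>A\<close>
      at the inverse of \<open>g\<close> selects the index \<open>b = g\<close>.\<close>
    let ?e = "unit_vector \<one>\<^bsub>G\<^esub>" and ?w = "inv\<^bsub>G\<^esub> g"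
    let ?z = "\<lambda>b c. \<Oplus>u\<in>carrier G. U u \<otimes> s (inv\<^bsub>G\<^esub> u \<otimes>\<^bsub>G\<^esub> b) c"
    have z: "?z b c \<in> carrier R" if "b \<in> carrier G" "c \<in> carrier G" for b c
      using that U s_closed by (intro R.finsum_closed) auto
    have e: "?e (b \<otimes>\<^bsub>G\<^esub> ?w) = (if b = g then \<one> else \<zero>)" if "b \<in> carrier G" for b
      using that g G.inv_equality[of b "inv\<^bsub>G\<^esub> g"] by (auto simp: unit_vector_def)
    have "(if g = \<one>\<^bsub>G\<^esub> then \<one> else \<zero>) = (?e \<otimes>\<^bsub>A\<^esub> \<one>\<^bsub>A\<^esub>) ?w"
      using g e[of "\<one>\<^bsub>G\<^esub>"] by auto
    also have "\<dots> = (\<Oplus>b\<in>carrier G. \<Oplus>c\<in>carrier G. ?e (b \<otimes>\<^bsub>G\<^esub> ?w) \<otimes>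
        (\<Oplus>u\<in>carrier G. a u (\<one>\<^bsub>A\<^esub> (c \<otimes>\<^bsub>G\<^esub> ?w)) \<otimes> s (inv\<^bsub>G\<^esub> u \<otimes>\<^bsub>G\<^esub> b) c))"
      using g by (intro mult_coord) auto
    also have "\<dots> = (\<Oplus>b\<in>carrier G. \<Oplus>c\<in>carrier G. (if b = g then \<one> else \<zero>) \<otimes> ?z b c)"
      by (intro R.finsum_cong' refl Pi_I R.finsum_closed arg_cong2[where f = "(\<otimes>)"])
         (use g z e U s_closed in \<open>auto simp: one_coord U_def\<close>)
    also have "\<dots> = (\<Oplus>c\<in>carrier G. ?z g c)"
    proof (rule trans[OF R.finsum_single[OF finite_basis g]])
      show "(\<Oplus>c\<in>carrier G. (if g = g then \<one> else \<zero>) \<otimes> ?z g c) \<in> carrier R"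
        using g z by (intro R.finsum_closed) auto
      show "(\<Oplus>c\<in>carrier G. (if b = g then \<one> else \<zero>) \<otimes> ?z b c) = \<zero>"
        if "b \<in> carrier G" "b \<noteq> g" for b
        using that z by (intro R.add.finprod_one_eqI) auto
      show "(\<Oplus>c\<in>carrier G. (if g = g then \<one> else \<zero>) \<otimes> ?z g c) =
          (\<Oplus>c\<in>carrier G. ?z g c)"
        using g z by (intro R.finsum_cong') auto
    qed
    also have "\<dots> = (\<Oplus>u\<in>carrier G. \<Oplus>c\<in>carrier G. U u \<otimes> s (inv\<^bsub>G\<^esub> u \<otimes>\<^bsub>G\<^esub> g) c)"
      using g U s_closed by (intro R.finsum_swap finite_basis) auto
    also have "\<dots> = (\<Oplus>u\<in>carrier G. U u \<otimes> S (inv\<^bsub>G\<^esub> u \<otimes>\<^bsub>G\<^esub> g))"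
      unfolding S_def using g U s_closed
      by (intro R.finsum_cong' refl R.finsum_rdistr[symmetric] finite_basis Pi_I R.m_closed R.finsum_closed) auto
    finally show ?thesis ..
  qed
  have U_eq: "U g = (if g = \<one>\<^bsub>G\<^esub> then \<one> else \<zero>)" if g: "g \<in> carrier G" for g
  proof -
    have d: "inv\<^bsub>G\<^esub> k \<otimes>\<^bsub>G\<^esub> g = \<one>\<^bsub>G\<^esub> \<longleftrightarrow> k = g" if "k \<in> carrier G" for k
      using that g by (metis G.inv_closed G.l_inv G.inv_solve_left G.r_one G.one_closed)
    have "U g = (\<Oplus>k\<in>carrier G. U k \<otimes> (if inv\<^bsub>G\<^esub> k \<otimes>\<^bsub>G\<^esub> g = \<one>\<^bsub>G\<^esub> then \<one> else \<zero>))"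
      using g U finite_basis by (subst R.finsum_single[where i = g]) (auto simp: d)
    also have "\<dots> = (\<Oplus>k\<in>carrier G. \<Oplus>u\<in>carrier G.
        U k \<otimes> (U u \<otimes> S (inv\<^bsub>G\<^esub> u \<otimes>\<^bsub>G\<^esub> (inv\<^bsub>G\<^esub> k \<otimes>\<^bsub>G\<^esub> g))))"
    proof (rule R.finsum_cong'[OF refl])
      fix k assume k: "k \<in> carrier G"
      then show "U k \<otimes> (if inv\<^bsub>G\<^esub> k \<otimes>\<^bsub>G\<^esub> g = \<one>\<^bsub>G\<^esub> then \<one> else \<zero>) = (\<Oplus>u\<in>carrier G.
          U k \<otimes> (U u \<otimes> S (inv\<^bsub>G\<^esub> u \<otimes>\<^bsub>G\<^esub> (inv\<^bsub>G\<^esub> k \<otimes>\<^bsub>G\<^esub> g))))"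
        using g US[of "inv\<^bsub>G\<^esub> k \<otimes>\<^bsub>G\<^esub> g", symmetric] U S finite_basis by (simp add: R.finsum_rdistr Pi_iff)
    qed (use g U S in \<open>auto intro!: R.finsum_closed\<close>)
    \<comment> \<open>Substitution \<open>m = k u\<close>, which exhibits the convolution of
      \<open>U\<close> with itself.\<close>
    also have "\<dots> = (\<Oplus>k\<in>carrier G. \<Oplus>m\<in>carrier G.
        U k \<otimes> U (inv\<^bsub>G\<^esub> k \<otimes>\<^bsub>G\<^esub> m) \<otimes> S (inv\<^bsub>G\<^esub> m \<otimes>\<^bsub>G\<^esub> g))"
    proof (rule R.finsum_cong'[OF refl])
      fix k assume k: "k \<in> carrier G"
      have "(\<Oplus>u\<in>carrier G. U k \<otimes> (U u \<otimes> S (inv\<^bsub>G\<^esub> u \<otimes>\<^bsub>G\<^esub> (inv\<^bsub>G\<^esub> k \<otimes>\<^bsub>G\<^esub> g)))) = (\<Oplus>m\<in>carrier G.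
          U k \<otimes> (U (inv\<^bsub>G\<^esub> k \<otimes>\<^bsub>G\<^esub> m) \<otimes> S (inv\<^bsub>G\<^esub> (inv\<^bsub>G\<^esub> k \<otimes>\<^bsub>G\<^esub> m) \<otimes>\<^bsub>G\<^esub> (inv\<^bsub>G\<^esub> k \<otimes>\<^bsub>G\<^esub> g))))"
        using k g U S
        by (intro R.finsum_bij[OF G.bij_left_mult[of "inv\<^bsub>G\<^esub> k"], symmetric]) auto
      also have "\<dots> = (\<Oplus>m\<in>carrier G. U k \<otimes> U (inv\<^bsub>G\<^esub> k \<otimes>\<^bsub>G\<^esub> m) \<otimes> S (inv\<^bsub>G\<^esub> m \<otimes>\<^bsub>G\<^esub> g))"
        using k g U S
        by (intro R.finsum_cong') (auto simp: R.m_assoc G.inv_mult_group G.m_assoc G.inv_mult_cancel)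
      finally show "(\<Oplus>u\<in>carrier G. U k \<otimes> (U u \<otimes> S (inv\<^bsub>G\<^esub> u \<otimes>\<^bsub>G\<^esub> (inv\<^bsub>G\<^esub> k \<otimes>\<^bsub>G\<^esub> g)))) =
          (\<Oplus>m\<in>carrier G. U k \<otimes> U (inv\<^bsub>G\<^esub> k \<otimes>\<^bsub>G\<^esub> m) \<otimes> S (inv\<^bsub>G\<^esub> m \<otimes>\<^bsub>G\<^esub> g))" .
    qed (use g U S in \<open>auto intro!: R.finsum_closed\<close>)
    also have "\<dots> = (\<Oplus>m\<in>carrier G. \<Oplus>k\<in>carrier G.
        U k \<otimes> U (inv\<^bsub>G\<^esub> k \<otimes>\<^bsub>G\<^esub> m) \<otimes> S (inv\<^bsub>G\<^esub> m \<otimes>\<^bsub>G\<^esub> g))"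
      using g U S by (intro R.finsum_swap finite_basis) auto
    also have "\<dots> = (\<Oplus>m\<in>carrier G. U m \<otimes> S (inv\<^bsub>G\<^esub> m \<otimes>\<^bsub>G\<^esub> g))"
    proof (rule R.finsum_cong'[OF refl])
      fix m assume m: "m \<in> carrier G"
      have "U m = (\<Oplus>k\<in>carrier G. U k \<otimes> U (inv\<^bsub>G\<^esub> k \<otimes>\<^bsub>G\<^esub> m))"
        unfolding U_def by (rule a_one[OF m])
      then show "(\<Oplus>k\<in>carrier G. U k \<otimes> U (inv\<^bsub>G\<^esub> k \<otimes>\<^bsub>G\<^esub> m) \<otimes> S (inv\<^bsub>G\<^esub> m \<otimes>\<^bsub>G\<^esub> g)) =
          U m \<otimes> S (inv\<^bsub>G\<^esub> m \<otimes>\<^bsub>G\<^esub> g)"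
        using m g U S finite_basis by (subst R.finsum_ldistr[symmetric]) auto
    qed (use g U S in auto)
    also have "\<dots> = (if g = \<one>\<^bsub>G\<^esub> then \<one> else \<zero>)" by (rule US[OF g])
    finally show ?thesis .
  qed
  then show "g \<in> carrier G \<Longrightarrow> a g \<one> = (if g = \<one>\<^bsub>G\<^esub> then \<one> else \<zero>)" by (simp add: U_def)
  assume g: "g \<in> carrier G"
  have "(\<Oplus>u\<in>carrier G. U u \<otimes> S (inv\<^bsub>G\<^esub> u \<otimes>\<^bsub>G\<^esub> g)) = S g"
    using g S finite_basis
    by (subst R.finsum_single[where i = "\<one>\<^bsub>G\<^esub>"]) (auto simp: U_eq)
  then show "(\<Oplus>c\<in>carrier G. s g c) = (if g = \<one>\<^bsub>G\<^esub> then \<one> else \<zero>)"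
    using US[OF g] by (simp add: S_def)
qed

text \<open>The sum over \<open>u\<close> collapses to its term at the identity of \<open>G\<close>,
  because by \<open>a_one_eq\<close> every other \<open>a u\<close> annihilates \<one>.\<close>

lemma mult_unit_vector_coord:
  assumes x: "x \<in> carrier A" and c: "c \<in> carrier G" and w: "w \<in> carrier G"
  shows "(x \<otimes>\<^bsub>A\<^esub> unit_vector c) w =
    (\<Oplus>b\<in>carrier G. x (b \<otimes>\<^bsub>G\<^esub> w) \<otimes> s b (c \<otimes>\<^bsub>G\<^esub> inv\<^bsub>G\<^esub> w))"
  unfolding mult_coord[OF x unit_vector_closed w]
proof (rule R.finsum_cong'[OF refl])
  fix b assume b: "b \<in> carrier G"
  let ?k = "c \<otimes>\<^bsub>G\<^esub> inv\<^bsub>G\<^esub> w"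
  note xc = coord_closed[OF x]
  have k: "k \<otimes>\<^bsub>G\<^esub> w = c \<longleftrightarrow> k = ?k" if "k \<in> carrier G" for k
    using that c w by (metis G.inv_solve_right)
  have "(\<Oplus>u\<in>carrier G. a u (unit_vector c (k \<otimes>\<^bsub>G\<^esub> w)) \<otimes> s (inv\<^bsub>G\<^esub> u \<otimes>\<^bsub>G\<^esub> b) k) =
      (if k = ?k then s b k else \<zero>)" if k': "k \<in> carrier G" for k
  proof (cases "k = ?k")
    case True
    then show ?thesis using k' b w c k[OF k'] s_closed finite_basis
      by (subst R.finsum_single[where i = "\<one>\<^bsub>G\<^esub>"]) (auto simp: unit_vector_def a_one_eq)
  next
    case False
    then have "unit_vector c (k \<otimes>\<^bsub>G\<^esub> w) = \<zero>" using k' w k[OF k'] by (simp add: unit_vector_def)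
    then show ?thesis using False k' b s_closed
      by (simp add: a_zero R.add.finprod_one_eqI)
  qed
  then have "(\<Oplus>k\<in>carrier G. x (b \<otimes>\<^bsub>G\<^esub> w) \<otimes>
      (\<Oplus>u\<in>carrier G. a u (unit_vector c (k \<otimes>\<^bsub>G\<^esub> w)) \<otimes> s (inv\<^bsub>G\<^esub> u \<otimes>\<^bsub>G\<^esub> b) k)) =
      (\<Oplus>k\<in>carrier G. x (b \<otimes>\<^bsub>G\<^esub> w) \<otimes> (if k = ?k then s b k else \<zero>))"
    using b w xc s_closed by (intro R.finsum_cong') auto
  also have "\<dots> = x (b \<otimes>\<^bsub>G\<^esub> w) \<otimes> s b ?k"
    using b w c xc s_closed finite_basis by (subst R.finsum_single[where i = ?k]) auto
  finally show "(\<Oplus>k\<in>carrier G. x (b \<otimes>\<^bsub>G\<^esub> w) \<otimes>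
      (\<Oplus>u\<in>carrier G. a u (unit_vector c (k \<otimes>\<^bsub>G\<^esub> w)) \<otimes> s (inv\<^bsub>G\<^esub> u \<otimes>\<^bsub>G\<^esub> b) k)) =
      x (b \<otimes>\<^bsub>G\<^esub> w) \<otimes> s b ?k" .
qed (use coord_closed[OF x] s_closed c w in auto)

text \<open>The unit of the dual is the sum of the dual basis, so the sum of \<open>s g c\<close>
  over \<open>c\<close> is the value of the cocycle at \<open>g\<close> and 1, which
  \<open>sum_s\<close> evaluates. What remains is
  \<open>(1 # h) (r # 1) = (h\<^sub>1 \<cdot> r) # h\<^sub>2\<close> in coordinates.\<close>

lemma mult_emb_coord:
  assumes x: "x \<in> carrier A" and r: "r \<in> carrier R" and w: "w \<in> carrier G"
  shows "(x \<otimes>\<^bsub>A\<^esub> emb r) w = (\<Oplus>b\<in>carrier G. x (b \<otimes>\<^bsub>G\<^esub> w) \<otimes> a b r)"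
  unfolding mult_coord[OF x emb_closed[OF r] w]
proof (rule R.finsum_cong'[OF refl])
  fix b assume b: "b \<in> carrier G"
  let ?x = "x (b \<otimes>\<^bsub>G\<^esub> w)"
  have xc: "?x \<in> carrier R" using coord_closed[OF x] b w by simp
  have d: "inv\<^bsub>G\<^esub> u \<otimes>\<^bsub>G\<^esub> b = \<one>\<^bsub>G\<^esub> \<longleftrightarrow> u = b" if "u \<in> carrier G" for u
    using that b by (metis G.inv_closed G.l_inv G.inv_solve_left G.r_one G.one_closed)
  have "(\<Oplus>c\<in>carrier G. ?x \<otimes>
      (\<Oplus>u\<in>carrier G. a u (emb r (c \<otimes>\<^bsub>G\<^esub> w)) \<otimes> s (inv\<^bsub>G\<^esub> u \<otimes>\<^bsub>G\<^esub> b) c)) =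
      (\<Oplus>c\<in>carrier G. ?x \<otimes> (\<Oplus>u\<in>carrier G. a u r \<otimes> s (inv\<^bsub>G\<^esub> u \<otimes>\<^bsub>G\<^esub> b) c))"
    using b w r xc a_closed s_closed
    by (intro R.finsum_cong' refl arg_cong2[where f = "(\<otimes>)"]) (auto simp: emb_coord intro!: R.finsum_closed)
  also have "\<dots> = ?x \<otimes> (\<Oplus>c\<in>carrier G. \<Oplus>u\<in>carrier G. a u r \<otimes> s (inv\<^bsub>G\<^esub> u \<otimes>\<^bsub>G\<^esub> b) c)"
    using b r xc a_closed s_closed
    by (intro R.finsum_rdistr[symmetric] finite_basis) (auto intro!: R.finsum_closed)
  also have "(\<Oplus>c\<in>carrier G. \<Oplus>u\<in>carrier G. a u r \<otimes> s (inv\<^bsub>G\<^esub> u \<otimes>\<^bsub>G\<^esub> b) c) =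
      (\<Oplus>u\<in>carrier G. \<Oplus>c\<in>carrier G. a u r \<otimes> s (inv\<^bsub>G\<^esub> u \<otimes>\<^bsub>G\<^esub> b) c)"
    using b r a_closed s_closed by (intro R.finsum_swap finite_basis) auto
  also have "\<dots> = (\<Oplus>u\<in>carrier G. a u r \<otimes> (if inv\<^bsub>G\<^esub> u \<otimes>\<^bsub>G\<^esub> b = \<one>\<^bsub>G\<^esub> then \<one> else \<zero>))"
  proof (rule R.finsum_cong'[OF refl])
    fix u assume u: "u \<in> carrier G"
    show "(\<Oplus>c\<in>carrier G. a u r \<otimes> s (inv\<^bsub>G\<^esub> u \<otimes>\<^bsub>G\<^esub> b) c) =
        a u r \<otimes> (if inv\<^bsub>G\<^esub> u \<otimes>\<^bsub>G\<^esub> b = \<one>\<^bsub>G\<^esub> then \<one> else \<zero>)"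
      using u b r a_closed s_closed finite_basis sum_s[of "inv\<^bsub>G\<^esub> u \<otimes>\<^bsub>G\<^esub> b"]
      by (subst R.finsum_rdistr[symmetric]) auto
  qed (use a_closed r in auto)
  also have "\<dots> = a b r" using b r a_closed finite_basis
    by (subst R.finsum_single[where i = b]) (auto simp: d)
  finally show "(\<Oplus>c\<in>carrier G. ?x \<otimes>
      (\<Oplus>u\<in>carrier G. a u (emb r (c \<otimes>\<^bsub>G\<^esub> w)) \<otimes> s (inv\<^bsub>G\<^esub> u \<otimes>\<^bsub>G\<^esub> b) c)) = ?x \<otimes> a b r" .
qed (use coord_closed[OF x] a_closed r w in auto)

text \<open>For the identity as \<open>w\<close> this coordinate is \<open>a g r\<close>, so the
  action can be recovered from products in \<open>A\<close>.\<close>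

lemma unit_vector_mult_emb_coord:
  assumes g: "g \<in> carrier G" and r: "r \<in> carrier R" and w: "w \<in> carrier G"
  shows "(unit_vector g \<otimes>\<^bsub>A\<^esub> emb r) w = a (g \<otimes>\<^bsub>G\<^esub> inv\<^bsub>G\<^esub> w) r"
proof -
  have "b \<otimes>\<^bsub>G\<^esub> w = g \<longleftrightarrow> b = g \<otimes>\<^bsub>G\<^esub> inv\<^bsub>G\<^esub> w" if "b \<in> carrier G" for b
    using that g w by (metis G.inv_solve_right)
  then show ?thesis
    unfolding mult_emb_coord[OF unit_vector_closed r w] using g r w a_closed finite_basis
    by (subst R.finsum_single[where i = "g \<otimes>\<^bsub>G\<^esub> inv\<^bsub>G\<^esub> w"]) (auto simp: unit_vector_def)
qed

section \<open>The action of the group by translations, and its trace\<close>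

definition shift :: "'g \<Rightarrow> ('g \<Rightarrow> 'r) \<Rightarrow> 'g \<Rightarrow> 'r" where
  "shift g x = (\<lambda>b\<in>carrier G. x (b \<otimes>\<^bsub>G\<^esub> g))"

definition trace :: "('g \<Rightarrow> 'r) \<Rightarrow> 'r" where
  "trace x = (\<Oplus>b\<in>carrier G. x b)"

lemma shift_closed: "g \<in> carrier G \<Longrightarrow> x \<in> carrier A \<Longrightarrow> shift g x \<in> carrier A"
  by (auto simp: shift_def carrier_eq)

lemma shift_coord: "b \<in> carrier G \<Longrightarrow> shift g x b = x (b \<otimes>\<^bsub>G\<^esub> g)"
  by (simp add: shift_def)

text \<open>Translation by \<open>g\<close> is the coaction
  \<open>a # h \<mapsto> a # h\<^sub>1 \<otimes> h\<^sub>2\<close> with the last factor evaluated at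
  \<open>g\<close>. In coordinates it is multiplicative because \<open>mult_coord\<close> involves
  the point \<open>w\<close> only through \<open>b w\<close> and \<open>c w\<close>.\<close>

lemma shift_hom:
  assumes g: "g \<in> carrier G"
  shows "shift g \<in> ring_hom A A"
proof (rule ring_hom_memI)
  fix x y assume x: "x \<in> carrier A" and y: "y \<in> carrier A"
  note sc = shift_closed[OF g]
  show "shift g (x \<oplus>\<^bsub>A\<^esub> y) = shift g x \<oplus>\<^bsub>A\<^esub> shift g y"
    using x y g sc by (intro coord_eqI) (auto simp: shift_coord coord_add)
  show "shift g (x \<otimes>\<^bsub>A\<^esub> y) = shift g x \<otimes>\<^bsub>A\<^esub> shift g y"
  proof (rule coord_eqI)
    fix w assume w: "w \<in> carrier G"
    show "shift g (x \<otimes>\<^bsub>A\<^esub> y) w = (shift g x \<otimes>\<^bsub>A\<^esub> shift g y) w"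
      unfolding shift_coord[OF w] mult_coord[OF x y G.m_closed[OF w g]] mult_coord[OF sc[OF x] sc[OF y] w]
      using g w coord_closed[OF x] coord_closed[OF y] a_closed s_closed
      by (intro R.finsum_cong' refl Pi_I R.finsum_closed R.m_closed arg_cong2[where f = "(\<otimes>)"])
         (auto simp: shift_coord G.m_assoc)
  qed (use x y g sc in auto)
next
  show "shift g \<one>\<^bsub>A\<^esub> = \<one>\<^bsub>A\<^esub>"
    using g by (intro coord_eqI shift_closed) (auto simp: shift_coord one_coord)
qed (rule shift_closed[OF g])

lemma shift_surj:
  assumes g: "g \<in> carrier G"
  shows "shift g ` carrier A = carrier A"
proof
  show "carrier A \<subseteq> shift g ` carrier A"
  proof
    fix x assume x: "x \<in> carrier A"
    have "shift g (shift (inv\<^bsub>G\<^esub> g) x) = x"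
      using g x by (intro coord_eqI) (auto simp: shift_coord G.m_assoc shift_closed)
    then show "x \<in> shift g ` carrier A" using shift_closed[of "inv\<^bsub>G\<^esub> g" x] g x by force
  qed
qed (use shift_closed[OF g] in auto)

lemma shift_emb: "g \<in> carrier G \<Longrightarrow> r \<in> carrier R \<Longrightarrow> shift g (emb r) = emb r"
  by (intro coord_eqI) (auto simp: shift_coord emb_coord shift_closed)

lemma trace_closed: "x \<in> carrier A \<Longrightarrow> trace x \<in> carrier R"
  unfolding trace_def using coord_closed by (intro R.finsum_closed) auto

text \<open>For each fixed \<open>b\<close> the points \<open>b g\<close> run through all of
  \<open>G\<close>, so the sum of the translates is a constant function, and the constant functions
  are the image of \<open>R\<close>.\<close>

lemma emb_trace:
  assumes x: "x \<in> carrier A"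
  shows "emb (trace x) = (\<Oplus>\<^bsub>A\<^esub>g\<in>carrier G. shift g x)"
proof (rule coord_eqI)
  fix b assume b: "b \<in> carrier G"
  have "(\<Oplus>\<^bsub>A\<^esub>g\<in>carrier G. shift g x) b = (\<Oplus>g\<in>carrier G. shift g x b)"
    using shift_closed x b by (intro coord_finsum) auto
  also have "\<dots> = (\<Oplus>g\<in>carrier G. x (b \<otimes>\<^bsub>G\<^esub> g))"
    using b by (simp add: shift_coord)
  also have "\<dots> = trace x"
    unfolding trace_def using coord_closed[OF x] by (intro R.finsum_bij[OF G.bij_left_mult[OF b]]) auto
  finally show "emb (trace x) b = (\<Oplus>\<^bsub>A\<^esub>g\<in>carrier G. shift g x) b"
    using trace_closed[OF x] b by (simp add: emb_coord)
qed (use trace_closed[OF x] shift_closed x in \<open>auto intro!: A.finsum_closed\<close>)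

text \<open>Translations are homomorphisms that fix \<open>emb r\<close>, so after embedding this is
  the distributive law for the sum of the translates. The embedding is injective, as its argument
  can be read off at any coordinate.\<close>

lemma trace_mult_emb:
  assumes x: "x \<in> carrier A" and r: "r \<in> carrier R"
  shows "trace (x \<otimes>\<^bsub>A\<^esub> emb r) = trace x \<otimes> r"
proof -
  have "emb (trace (x \<otimes>\<^bsub>A\<^esub> emb r)) = (\<Oplus>\<^bsub>A\<^esub>g\<in>carrier G. shift g x \<otimes>\<^bsub>A\<^esub> emb r)"
    using x r shift_closed ring_hom_mult[OF shift_hom] shift_emb
    by (simp add: emb_trace) (rule A.finsum_cong', auto)
  also have "\<dots> = emb (trace x) \<otimes>\<^bsub>A\<^esub> emb r"
    using x r shift_closed finite_basis
    by (subst A.finsum_ldistr[symmetric]) (auto simp: emb_trace)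
  also have "\<dots> = emb (trace x \<otimes> r)" using x r trace_closed by simp
  finally show ?thesis
    using emb_coord[of _ "\<one>\<^bsub>G\<^esub>"] x r trace_closed
    by (metis A.m_closed G.one_closed R.m_closed emb_closed)
qed

section \<open>Galois coordinates\<close>

definition galois_vector :: "'g \<Rightarrow> 'g \<Rightarrow> 'r" where
  "galois_vector c =
    (\<lambda>m\<in>carrier G. \<Oplus>p\<in>carrier G. t p (p \<otimes>\<^bsub>G\<^esub> (m \<otimes>\<^bsub>G\<^esub> inv\<^bsub>G\<^esub> c)))"

lemma galois_vector_closed: "c \<in> carrier G \<Longrightarrow> galois_vector c \<in> carrier A"
  using t_closed by (auto simp: galois_vector_def carrier_eq intro!: R.finsum_closed)

text \<open>
  These are Galois coordinates for the group \<open>G\<close> of automorphisms of \<open>A\<close> with fixed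
  ring \<open>R\<close>. In Sweedler notation the tensor is the sum of
  \<open>\<sigma>\<inverse>(S h\<^sub>2, h\<^sub>3) # S h\<^sub>1 \<otimes> 1 # h\<^sub>4\<close>, which inverts the canonical map of the
  \<open>H\<close>-Galois extension.
\<close>

lemma galois_identity:
  assumes g: "g \<in> carrier G"
  shows "(\<Oplus>\<^bsub>A\<^esub>c\<in>carrier G. shift g (galois_vector c) \<otimes>\<^bsub>A\<^esub> unit_vector c) =
    (if g = \<one>\<^bsub>G\<^esub> then \<one>\<^bsub>A\<^esub> else \<zero>\<^bsub>A\<^esub>)"
proof (rule coord_eqI)
  note gc = shift_closed[OF g galois_vector_closed]
  show "(\<Oplus>\<^bsub>A\<^esub>c\<in>carrier G. shift g (galois_vector c) \<otimes>\<^bsub>A\<^esub> unit_vector c) \<in> carrier A"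
    using gc by (intro A.finsum_closed) auto
  fix w assume w: "w \<in> carrier G"
  let ?f = "w \<otimes>\<^bsub>G\<^esub> g"
  have f: "?f \<in> carrier G" using g w by simp
  have tm: "t p q \<otimes> s m n \<in> carrier R"
    if "p \<in> carrier G" "q \<in> carrier G" "m \<in> carrier G" "n \<in> carrier G" for p q m n
    using that t_closed s_closed by simp
  have "(\<Oplus>\<^bsub>A\<^esub>c\<in>carrier G. shift g (galois_vector c) \<otimes>\<^bsub>A\<^esub> unit_vector c) w =
      (\<Oplus>c\<in>carrier G. (shift g (galois_vector c) \<otimes>\<^bsub>A\<^esub> unit_vector c) w)"
    using gc by (intro coord_finsum w) auto
  also have "\<dots> = (\<Oplus>c\<in>carrier G. \<Oplus>b\<in>carrier G. \<Oplus>p\<in>carrier G.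
      t p (p \<otimes>\<^bsub>G\<^esub> b \<otimes>\<^bsub>G\<^esub> ?f \<otimes>\<^bsub>G\<^esub> inv\<^bsub>G\<^esub> c) \<otimes> s b (c \<otimes>\<^bsub>G\<^esub> inv\<^bsub>G\<^esub> w))"
  proof (rule R.finsum_cong'[OF refl])
    fix c assume c: "c \<in> carrier G"
    show "(shift g (galois_vector c) \<otimes>\<^bsub>A\<^esub> unit_vector c) w = (\<Oplus>b\<in>carrier G. \<Oplus>p\<in>carrier G.
        t p (p \<otimes>\<^bsub>G\<^esub> b \<otimes>\<^bsub>G\<^esub> ?f \<otimes>\<^bsub>G\<^esub> inv\<^bsub>G\<^esub> c) \<otimes> s b (c \<otimes>\<^bsub>G\<^esub> inv\<^bsub>G\<^esub> w))"
      unfolding mult_unit_vector_coord[OF gc[OF c] c w]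
    proof (rule R.finsum_cong'[OF refl])
      fix b assume b: "b \<in> carrier G"
      have "shift g (galois_vector c) (b \<otimes>\<^bsub>G\<^esub> w) =
          (\<Oplus>p\<in>carrier G. t p (p \<otimes>\<^bsub>G\<^esub> b \<otimes>\<^bsub>G\<^esub> ?f \<otimes>\<^bsub>G\<^esub> inv\<^bsub>G\<^esub> c))"
        using b c g w t_closed
        by (simp add: shift_coord galois_vector_def) (intro R.finsum_cong', auto simp: G.m_assoc)
      then show "shift g (galois_vector c) (b \<otimes>\<^bsub>G\<^esub> w) \<otimes> s b (c \<otimes>\<^bsub>G\<^esub> inv\<^bsub>G\<^esub> w) = (\<Oplus>p\<in>carrier G.
          t p (p \<otimes>\<^bsub>G\<^esub> b \<otimes>\<^bsub>G\<^esub> ?f \<otimes>\<^bsub>G\<^esub> inv\<^bsub>G\<^esub> c) \<otimes> s b (c \<otimes>\<^bsub>G\<^esub> inv\<^bsub>G\<^esub> w))"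
        using b c f w t_closed s_closed finite_basis by (simp add: R.finsum_ldistr Pi_iff)
    qed (use c f w tm in \<open>auto intro!: R.finsum_closed\<close>)
  qed (use f w tm in \<open>auto intro!: R.finsum_closed\<close>)
  also have "\<dots> = (\<Oplus>c\<in>carrier G. \<Oplus>p\<in>carrier G. \<Oplus>b\<in>carrier G.
      t p (p \<otimes>\<^bsub>G\<^esub> b \<otimes>\<^bsub>G\<^esub> ?f \<otimes>\<^bsub>G\<^esub> inv\<^bsub>G\<^esub> c) \<otimes> s b (c \<otimes>\<^bsub>G\<^esub> inv\<^bsub>G\<^esub> w))"
    using f w tm
    by (intro R.finsum_cong' R.finsum_swap finite_basis refl) (auto intro!: R.finsum_closed)
  \<comment> \<open>Substitution \<open>m = p b\<close>, which brings the first arguments of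
    \<open>t\<close> and \<open>s\<close> into the form of a convolution at
    \<open>m\<close>.\<close>
  also have "\<dots> = (\<Oplus>c\<in>carrier G. \<Oplus>p\<in>carrier G. \<Oplus>m\<in>carrier G.
      t p (m \<otimes>\<^bsub>G\<^esub> ?f \<otimes>\<^bsub>G\<^esub> inv\<^bsub>G\<^esub> c) \<otimes> s (inv\<^bsub>G\<^esub> p \<otimes>\<^bsub>G\<^esub> m) (c \<otimes>\<^bsub>G\<^esub> inv\<^bsub>G\<^esub> w))"
  proof (rule R.finsum_cong2)
    fix c p assume c: "c \<in> carrier G" and p: "p \<in> carrier G"
    have "(\<Oplus>m\<in>carrier G. t p (m \<otimes>\<^bsub>G\<^esub> ?f \<otimes>\<^bsub>G\<^esub> inv\<^bsub>G\<^esub> c) \<otimes> s (inv\<^bsub>G\<^esub> p \<otimes>\<^bsub>G\<^esub> m) (c \<otimes>\<^bsub>G\<^esub> inv\<^bsub>G\<^esub> w)) =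
        (\<Oplus>b\<in>carrier G. t p (p \<otimes>\<^bsub>G\<^esub> b \<otimes>\<^bsub>G\<^esub> ?f \<otimes>\<^bsub>G\<^esub> inv\<^bsub>G\<^esub> c) \<otimes>
          s (inv\<^bsub>G\<^esub> p \<otimes>\<^bsub>G\<^esub> (p \<otimes>\<^bsub>G\<^esub> b)) (c \<otimes>\<^bsub>G\<^esub> inv\<^bsub>G\<^esub> w))"
      using c p f w tm by (intro R.finsum_bij[OF G.bij_left_mult[OF p], symmetric]) auto
    also have "\<dots> = (\<Oplus>b\<in>carrier G. t p (p \<otimes>\<^bsub>G\<^esub> b \<otimes>\<^bsub>G\<^esub> ?f \<otimes>\<^bsub>G\<^esub> inv\<^bsub>G\<^esub> c) \<otimes>
          s b (c \<otimes>\<^bsub>G\<^esub> inv\<^bsub>G\<^esub> w))"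
      using c p f w tm by (intro R.finsum_cong') (auto simp: G.inv_mult_cancel)
    finally show "(\<Oplus>b\<in>carrier G. t p (p \<otimes>\<^bsub>G\<^esub> b \<otimes>\<^bsub>G\<^esub> ?f \<otimes>\<^bsub>G\<^esub> inv\<^bsub>G\<^esub> c) \<otimes> s b (c \<otimes>\<^bsub>G\<^esub> inv\<^bsub>G\<^esub> w)) =
      (\<Oplus>m\<in>carrier G. t p (m \<otimes>\<^bsub>G\<^esub> ?f \<otimes>\<^bsub>G\<^esub> inv\<^bsub>G\<^esub> c) \<otimes> s (inv\<^bsub>G\<^esub> p \<otimes>\<^bsub>G\<^esub> m) (c \<otimes>\<^bsub>G\<^esub> inv\<^bsub>G\<^esub> w))"
      ..
  qed (use f w tm in \<open>auto intro!: R.finsum_closed\<close>)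
  also have "\<dots> = (\<Oplus>p\<in>carrier G. \<Oplus>c\<in>carrier G. \<Oplus>m\<in>carrier G.
      t p (m \<otimes>\<^bsub>G\<^esub> ?f \<otimes>\<^bsub>G\<^esub> inv\<^bsub>G\<^esub> c) \<otimes> s (inv\<^bsub>G\<^esub> p \<otimes>\<^bsub>G\<^esub> m) (c \<otimes>\<^bsub>G\<^esub> inv\<^bsub>G\<^esub> w))"
    using f w tm by (intro R.finsum_swap finite_basis) (auto intro!: R.finsum_closed)
  also have "\<dots> = (\<Oplus>p\<in>carrier G. \<Oplus>m\<in>carrier G. \<Oplus>c\<in>carrier G.
      t p (m \<otimes>\<^bsub>G\<^esub> ?f \<otimes>\<^bsub>G\<^esub> inv\<^bsub>G\<^esub> c) \<otimes> s (inv\<^bsub>G\<^esub> p \<otimes>\<^bsub>G\<^esub> m) (c \<otimes>\<^bsub>G\<^esub> inv\<^bsub>G\<^esub> w))"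
    using f w tm
    by (intro R.finsum_cong' R.finsum_swap finite_basis refl) (auto intro!: R.finsum_closed)
  also have "\<dots> = (\<Oplus>m\<in>carrier G. \<Oplus>p\<in>carrier G. \<Oplus>c\<in>carrier G.
      t p (m \<otimes>\<^bsub>G\<^esub> ?f \<otimes>\<^bsub>G\<^esub> inv\<^bsub>G\<^esub> c) \<otimes> s (inv\<^bsub>G\<^esub> p \<otimes>\<^bsub>G\<^esub> m) (c \<otimes>\<^bsub>G\<^esub> inv\<^bsub>G\<^esub> w))"
    using f w tm by (intro R.finsum_swap finite_basis) (auto intro!: R.finsum_closed)
  \<comment> \<open>Substitution \<open>q = m f c^-1\<close> with \<open>f = w g\<close>. The two
    inner sums are now the convolution in \<open>t_s\<close>, evaluated at \<open>m\<close> and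
    \<open>m f w^-1\<close>.\<close>
  also have "\<dots> = (\<Oplus>m\<in>carrier G. \<Oplus>p\<in>carrier G. \<Oplus>q\<in>carrier G.
      t p q \<otimes> s (inv\<^bsub>G\<^esub> p \<otimes>\<^bsub>G\<^esub> m) (inv\<^bsub>G\<^esub> q \<otimes>\<^bsub>G\<^esub> (m \<otimes>\<^bsub>G\<^esub> ?f \<otimes>\<^bsub>G\<^esub> inv\<^bsub>G\<^esub> w)))"
  proof (rule R.finsum_cong2)
    fix m p assume m: "m \<in> carrier G" and p: "p \<in> carrier G"
    let ?h = "\<lambda>c. m \<otimes>\<^bsub>G\<^esub> ?f \<otimes>\<^bsub>G\<^esub> inv\<^bsub>G\<^esub> c"
    have bij: "bij_betw ?h (carrier G) (carrier G)"
      using bij_betw_trans[OF G.bij_inv G.bij_left_mult[of "m \<otimes>\<^bsub>G\<^esub> ?f"]] m f by (simp add: comp_def)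
    have "(\<Oplus>q\<in>carrier G.
        t p q \<otimes> s (inv\<^bsub>G\<^esub> p \<otimes>\<^bsub>G\<^esub> m) (inv\<^bsub>G\<^esub> q \<otimes>\<^bsub>G\<^esub> (m \<otimes>\<^bsub>G\<^esub> ?f \<otimes>\<^bsub>G\<^esub> inv\<^bsub>G\<^esub> w))) =
      (\<Oplus>c\<in>carrier G. t p (?h c) \<otimes>
        s (inv\<^bsub>G\<^esub> p \<otimes>\<^bsub>G\<^esub> m) (inv\<^bsub>G\<^esub> (?h c) \<otimes>\<^bsub>G\<^esub> (m \<otimes>\<^bsub>G\<^esub> ?f \<otimes>\<^bsub>G\<^esub> inv\<^bsub>G\<^esub> w)))"
      using m p f w tm by (intro R.finsum_bij[OF bij, symmetric]) auto
    also have "\<dots> = (\<Oplus>c\<in>carrier G. t p (?h c) \<otimes> s (inv\<^bsub>G\<^esub> p \<otimes>\<^bsub>G\<^esub> m) (c \<otimes>\<^bsub>G\<^esub> inv\<^bsub>G\<^esub> w))"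
    proof (rule R.finsum_cong'[OF refl])
      fix c assume c: "c \<in> carrier G"
      have "inv\<^bsub>G\<^esub> (?h c) \<otimes>\<^bsub>G\<^esub> (m \<otimes>\<^bsub>G\<^esub> ?f \<otimes>\<^bsub>G\<^esub> inv\<^bsub>G\<^esub> w) = c \<otimes>\<^bsub>G\<^esub> inv\<^bsub>G\<^esub> w"
        using c m f w by (simp add: G.inv_mult_group G.m_assoc G.inv_mult_cancel del: G.m_closed)
           (simp add: G.inv_mult_group G.m_assoc G.inv_mult_cancel g w)
      then show "t p (?h c) \<otimes> s (inv\<^bsub>G\<^esub> p \<otimes>\<^bsub>G\<^esub> m) (inv\<^bsub>G\<^esub> (?h c) \<otimes>\<^bsub>G\<^esub> (m \<otimes>\<^bsub>G\<^esub> ?f \<otimes>\<^bsub>G\<^esub> inv\<^bsub>G\<^esub> w)) =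
          t p (?h c) \<otimes> s (inv\<^bsub>G\<^esub> p \<otimes>\<^bsub>G\<^esub> m) (c \<otimes>\<^bsub>G\<^esub> inv\<^bsub>G\<^esub> w)" by simp
    qed (use m p f w tm in auto)
    finally show "(\<Oplus>c\<in>carrier G. t p (?h c) \<otimes> s (inv\<^bsub>G\<^esub> p \<otimes>\<^bsub>G\<^esub> m) (c \<otimes>\<^bsub>G\<^esub> inv\<^bsub>G\<^esub> w)) =
      (\<Oplus>q\<in>carrier G.
        t p q \<otimes> s (inv\<^bsub>G\<^esub> p \<otimes>\<^bsub>G\<^esub> m) (inv\<^bsub>G\<^esub> q \<otimes>\<^bsub>G\<^esub> (m \<otimes>\<^bsub>G\<^esub> ?f \<otimes>\<^bsub>G\<^esub> inv\<^bsub>G\<^esub> w)))" ..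
  qed (use f w tm in \<open>auto intro!: R.finsum_closed\<close>)
  also have "\<dots> = (\<Oplus>m\<in>carrier G.
      if m = \<one>\<^bsub>G\<^esub> \<and> m \<otimes>\<^bsub>G\<^esub> ?f \<otimes>\<^bsub>G\<^esub> inv\<^bsub>G\<^esub> w = \<one>\<^bsub>G\<^esub> then \<one> else \<zero>)"
    using f w by (intro R.finsum_cong' t_s refl) auto
  also have "\<dots> = (if ?f \<otimes>\<^bsub>G\<^esub> inv\<^bsub>G\<^esub> w = \<one>\<^bsub>G\<^esub> then \<one> else \<zero>)"
    using f w finite_basis by (subst R.finsum_single[where i = "\<one>\<^bsub>G\<^esub>"]) auto
  also have "?f \<otimes>\<^bsub>G\<^esub> inv\<^bsub>G\<^esub> w = \<one>\<^bsub>G\<^esub> \<longleftrightarrow> g = \<one>\<^bsub>G\<^esub>"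
    using g w by (metis G.inv_solve_right' G.l_cancel_one G.l_one G.one_closed f)
  finally show "(\<Oplus>\<^bsub>A\<^esub>c\<in>carrier G. shift g (galois_vector c) \<otimes>\<^bsub>A\<^esub> unit_vector c) w =
      (if g = \<one>\<^bsub>G\<^esub> then \<one>\<^bsub>A\<^esub> else \<zero>\<^bsub>A\<^esub>) w"
    using w by (simp add: one_coord coord_zero)
qed simp

text \<open>Multiply \<open>galois_identity\<close> on the left by the translates of
  \<open>x\<close> and sum over \<open>g\<close>. On one side only the identity of \<open>G\<close>
  survives and leaves \<open>x\<close>; on the other side the products of \<open>x\<close> with the
  Galois vectors turn into their traces. The traces are then the coordinates of
  \<open>x\<close>.\<close>

lemma coord_eq_trace:
  assumes x: "x \<in> carrier A" and b: "b \<in> carrier G"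
  shows "x b = trace (x \<otimes>\<^bsub>A\<^esub> galois_vector b)"
proof -
  note gc = galois_vector_closed
  have x1: "shift \<one>\<^bsub>G\<^esub> x = x"
    using x by (intro coord_eqI) (auto simp: shift_coord shift_closed)
  have tc: "trace (x \<otimes>\<^bsub>A\<^esub> galois_vector c) \<in> carrier R" if "c \<in> carrier G" for c
    using x gc that by (intro trace_closed) simp
  have sc: "shift g x \<in> carrier A" "shift g (galois_vector c) \<in> carrier A"
    if "g \<in> carrier G" "c \<in> carrier G" for g c
    using that x gc shift_closed by auto
  have "x = (\<Oplus>\<^bsub>A\<^esub>g\<in>carrier G. shift g x \<otimes>\<^bsub>A\<^esub> (if g = \<one>\<^bsub>G\<^esub> then \<one>\<^bsub>A\<^esub> else \<zero>\<^bsub>A\<^esub>))"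
    using x finite_basis shift_closed[OF _ x]
    by (subst A.finsum_single[where i = "\<one>\<^bsub>G\<^esub>"]) (auto simp: x1)
  also have "\<dots> = (\<Oplus>\<^bsub>A\<^esub>g\<in>carrier G. \<Oplus>\<^bsub>A\<^esub>c\<in>carrier G.
      shift g (x \<otimes>\<^bsub>A\<^esub> galois_vector c) \<otimes>\<^bsub>A\<^esub> unit_vector c)"
  proof (rule A.finsum_cong'[OF refl])
    fix g assume g: "g \<in> carrier G"
    have "shift g x \<otimes>\<^bsub>A\<^esub> (if g = \<one>\<^bsub>G\<^esub> then \<one>\<^bsub>A\<^esub> else \<zero>\<^bsub>A\<^esub>) =
        (\<Oplus>\<^bsub>A\<^esub>c\<in>carrier G. shift g x \<otimes>\<^bsub>A\<^esub> (shift g (galois_vector c) \<otimes>\<^bsub>A\<^esub> unit_vector c))"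
      unfolding galois_identity[OF g, symmetric] using g sc finite_basis
      by (intro A.finsum_rdistr) auto
    also have "\<dots> = (\<Oplus>\<^bsub>A\<^esub>c\<in>carrier G. shift g (x \<otimes>\<^bsub>A\<^esub> galois_vector c) \<otimes>\<^bsub>A\<^esub> unit_vector c)"
      using g x gc sc by (intro A.finsum_cong') (auto simp: ring_hom_mult[OF shift_hom] A.m_assoc)
    finally show "shift g x \<otimes>\<^bsub>A\<^esub> (if g = \<one>\<^bsub>G\<^esub> then \<one>\<^bsub>A\<^esub> else \<zero>\<^bsub>A\<^esub>) =
        (\<Oplus>\<^bsub>A\<^esub>c\<in>carrier G. shift g (x \<otimes>\<^bsub>A\<^esub> galois_vector c) \<otimes>\<^bsub>A\<^esub> unit_vector c)" .
  qed (use x gc shift_closed in \<open>auto intro!: A.finsum_closed\<close>)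
  also have "\<dots> = (\<Oplus>\<^bsub>A\<^esub>c\<in>carrier G. \<Oplus>\<^bsub>A\<^esub>g\<in>carrier G.
      shift g (x \<otimes>\<^bsub>A\<^esub> galois_vector c) \<otimes>\<^bsub>A\<^esub> unit_vector c)"
    using x gc shift_closed by (intro A.finsum_swap finite_basis) auto
  also have "\<dots> = (\<Oplus>\<^bsub>A\<^esub>c\<in>carrier G. emb (trace (x \<otimes>\<^bsub>A\<^esub> galois_vector c)) \<otimes>\<^bsub>A\<^esub> unit_vector c)"
  proof (rule A.finsum_cong'[OF refl])
    fix c assume c: "c \<in> carrier G"
    show "(\<Oplus>\<^bsub>A\<^esub>g\<in>carrier G. shift g (x \<otimes>\<^bsub>A\<^esub> galois_vector c) \<otimes>\<^bsub>A\<^esub> unit_vector c) =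
        emb (trace (x \<otimes>\<^bsub>A\<^esub> galois_vector c)) \<otimes>\<^bsub>A\<^esub> unit_vector c"
      using c x gc shift_closed finite_basis
      by (subst A.finsum_ldistr[symmetric]) (auto simp: emb_trace)
  qed (use tc in auto)
  finally have "x b = (\<Oplus>\<^bsub>A\<^esub>c\<in>carrier G. emb (trace (x \<otimes>\<^bsub>A\<^esub> galois_vector c)) \<otimes>\<^bsub>A\<^esub> unit_vector c) b"
    by simp
  also have "\<dots> = (\<Oplus>c\<in>carrier G. (emb (trace (x \<otimes>\<^bsub>A\<^esub> galois_vector c)) \<otimes>\<^bsub>A\<^esub> unit_vector c) b)"
    using tc by (intro coord_finsum b) auto
  also have "\<dots> = trace (x \<otimes>\<^bsub>A\<^esub> galois_vector b)"
    using tc b finite_basis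
    by (subst R.finsum_single[where i = b]) (auto simp: coord_emb_unit_vector)
  finally show ?thesis .
qed

section \<open>The radical when the order of the group is invertible\<close>

context
  fixes c
  assumes c: "c \<in> carrier R" "c \<otimes> (\<Oplus>g\<in>carrier G. \<one>) = \<one>"
begin

lemma emb_jacobson_radical_iff:
  assumes r: "r \<in> carrier R"
  shows "emb r \<in> jacobson_radical A \<longleftrightarrow> r \<in> jacobson_radical R"
proof (rule jacobson_radical_fixed_ring[OF R.ring_axioms A.ring_axioms emb_hom, where \<alpha> = shift
      and tr = trace and I = "carrier G" and c = c])
  show "trace (x \<oplus>\<^bsub>A\<^esub> y) = trace x \<oplus> trace y" if "x \<in> carrier A" "y \<in> carrier A" for x y
  proof -
    have "trace (x \<oplus>\<^bsub>A\<^esub> y) = (\<Oplus>b\<in>carrier G. x b \<oplus> y b)"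
      unfolding trace_def using that coord_closed by (intro R.finsum_cong') (auto simp: coord_add)
    also have "\<dots> = trace x \<oplus> trace y"
      unfolding trace_def using that coord_closed by (intro R.finsum_addf) auto
    finally show ?thesis .
  qed
  have "trace \<one>\<^bsub>A\<^esub> = (\<Oplus>g\<in>carrier G. \<one>)"
    unfolding trace_def by (intro R.finsum_cong') (auto simp: one_coord)
  then show "c \<otimes> trace \<one>\<^bsub>A\<^esub> = \<one>" using c(2) by simp
qed (use shift_hom shift_surj shift_emb trace_closed trace_mult_emb emb_trace finite_basis c(1) r
      in auto)

theorem jacobson_radical_eq: "jacobson_radical A = coord_set (jacobson_radical R)"
proof
  show "coord_set (jacobson_radical R) \<subseteq> jacobson_radical A"
  proof
    fix x assume "x \<in> coord_set (jacobson_radical R)"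
    then have x: "x \<in> carrier A" "\<And>b. b \<in> carrier G \<Longrightarrow> x b \<in> jacobson_radical R"
      by (auto simp: coord_set_def)
    have "(\<Oplus>\<^bsub>A\<^esub>b\<in>carrier G. emb (x b) \<otimes>\<^bsub>A\<^esub> unit_vector b) \<in> jacobson_radical A"
    proof (rule A.left_ideal_finsum[OF A.jacobson_radical_left_ideal])
      fix b assume b: "b \<in> carrier G"
      then have "emb (x b) \<in> jacobson_radical A"
        using x emb_jacobson_radical_iff[OF coord_closed[OF x(1) b]] by simp
      then show "emb (x b) \<otimes>\<^bsub>A\<^esub> unit_vector b \<in> jacobson_radical A"
        by (rule A.jacobson_radical_right) simp
    qed
    then show "x \<in> jacobson_radical A" using basis_expansion[OF x(1)] by simp
  qed
  show "jacobson_radical A \<subseteq> coord_set (jacobson_radical R)"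
  proof (rule subsetI, rule coord_setI)
    fix x b assume x: "x \<in> jacobson_radical A" and b: "b \<in> carrier G"
    then have xc: "x \<in> carrier A" using A.jacobson_radicalD(2) by blast
    let ?y = "x \<otimes>\<^bsub>A\<^esub> galois_vector b"
    have yJ: "?y \<in> jacobson_radical A"
      by (rule A.jacobson_radical_right[OF x galois_vector_closed[OF b]])
    then have yc: "?y \<in> carrier A" using A.jacobson_radicalD(2) by blast
    \<comment> \<open>The embedded trace of \<open>?y\<close> is a sum of images of
      \<open>?y\<close> under automorphisms, each of which preserves the radical.\<close>
    have "(\<Oplus>\<^bsub>A\<^esub>g\<in>carrier G. shift g ?y) \<in> jacobson_radical A"
      by (rule A.left_ideal_finsum[OF A.jacobson_radical_left_ideal])
         (use jacobson_radical_ring_hom[OF A.ring_axioms A.ring_axioms shift_hom shift_surj yJ] in blast)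
    then have "trace ?y \<in> jacobson_radical R"
      using emb_jacobson_radical_iff[OF trace_closed[OF yc]] emb_trace[OF yc] by simp
    then show "x b \<in> jacobson_radical R" using coord_eq_trace[OF xc b] by simp
  qed (use A.jacobson_radicalD(2) in blast)
qed

text \<open>For a vector of the dual basis, \<open>a g\<close> need not be multiplicative, so the
  radical cannot be transported along it. Instead \<open>a g r\<close> is a coordinate of an element
  of the radical of \<open>A\<close>, namely of \<open>unit_vector g\<close> times
  \<open>emb r\<close>.\<close>

lemma a_jacobson_radical:
  assumes g: "g \<in> carrier G" and r: "r \<in> jacobson_radical R"
  shows "a g r \<in> jacobson_radical R"
proof -
  have rc: "r \<in> carrier R" using r R.jacobson_radicalD(2) by blast
  have "unit_vector g \<otimes>\<^bsub>A\<^esub> emb r \<in> jacobson_radical A"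
    using emb_jacobson_radical_iff[OF rc] r A.jacobson_radicalD(5) by simp
  then have "(unit_vector g \<otimes>\<^bsub>A\<^esub> emb r) \<one>\<^bsub>G\<^esub> \<in> jacobson_radical R"
    unfolding jacobson_radical_eq by (simp add: coord_set_def)
  then show ?thesis using unit_vector_mult_emb_coord[OF g rc G.one_closed] g by simp
qed

end

end

section \<open>Modules over a crossed product\<close>

lemma (in module) submoduleI':
  assumes "N \<subseteq> carrier M" "\<zero>\<^bsub>M\<^esub> \<in> N" "\<And>x y. x \<in> N \<Longrightarrow> y \<in> N \<Longrightarrow> x \<oplus>\<^bsub>M\<^esub> y \<in> N"
    and smult: "\<And>k x. k \<in> carrier R \<Longrightarrow> x \<in> N \<Longrightarrow> k \<odot>\<^bsub>M\<^esub> x \<in> N"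
  shows "submodule N R M"
proof (rule submoduleI)
  fix x assume x: "x \<in> N"
  then have "(\<ominus> \<one>) \<odot>\<^bsub>M\<^esub> x = \<ominus>\<^bsub>M\<^esub> x"
    using smult_l_minus[of "\<one>" x] assms(1) by auto
  with smult[of "\<ominus> \<one>" x] x show "\<ominus>\<^bsub>M\<^esub> x \<in> N" by simp
qed (use assms in auto)

text \<open>The two product rules are all that the comparison of modules uses. They are assumptions
  here because they rest on the normalisation of action and cocycle, which the two Hopf algebras
  obtain from the unit law of \<open>A\<close> by separate computations.\<close>

locale hopf_crossed_product = free_extension R "crossed_product K H R act \<sigma>" B
  for K :: "('k, 'z) ring_scheme" and H :: "('k, 'b) hopf" and R :: "('k, 'r, 'x) module_scheme" (structure)
    and act :: "('b \<Rightarrow> 'k) \<Rightarrow> 'r \<Rightarrow> 'r" and \<sigma> :: "('b \<Rightarrow> 'k) \<Rightarrow> ('b \<Rightarrow> 'k) \<Rightarrow> 'r" and B :: "'b set" +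
  assumes field_K: "field K" and hopf: "coordinate_hopf K H" and basis_eq: "basis H = B"
    and k_algebra_R: "k_algebra K R"
    and twisted: "twisted_module_algebra K H R act \<sigma>"
    and k_algebra_A: "k_algebra K (crossed_product K H R act \<sigma>)"
    and tensor_emb: "\<lbrakk>h \<in> carrier H; r \<in> carrier R\<rbrakk> \<Longrightarrow>
      pure_tensor H R \<one> h \<otimes>\<^bsub>crossed_product K H R act \<sigma>\<^esub> emb r =
        sweedler2 K H (crossed_product K H R act \<sigma>) h (\<lambda>h1 h2.
          emb (act h1 r) \<otimes>\<^bsub>crossed_product K H R act \<sigma>\<^esub> pure_tensor H R \<one> h2)"
    and tensor_tensor: "\<lbrakk>h \<in> carrier H; g \<in> carrier H\<rbrakk> \<Longrightarrow>
      pure_tensor H R \<one> h \<otimes>\<^bsub>crossed_product K H R act \<sigma>\<^esub> pure_tensor H R \<one> g =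
        sweedler2 K H (crossed_product K H R act \<sigma>) h (\<lambda>h1 h2.
          sweedler2 K H (crossed_product K H R act \<sigma>) g (\<lambda>g1 g2.
            emb (\<sigma> h1 g1) \<otimes>\<^bsub>crossed_product K H R act \<sigma>\<^esub> pure_tensor H R \<one> (h2 \<otimes>\<^bsub>H\<^esub> g2)))"
begin

abbreviation A :: "('k, 'b \<Rightarrow> 'r) module" where
  "A \<equiv> crossed_product K H R act \<sigma>"

abbreviation e :: "'b \<Rightarrow> 'b \<Rightarrow> 'k" where
  "e \<equiv> basis_vector K H"

definition tens :: "('b \<Rightarrow> 'k) \<Rightarrow> 'b \<Rightarrow> 'r" where
  "tens h = pure_tensor H R \<one> h"

sublocale KR: k_algebra K R by (rule k_algebra_R)
sublocale KA: k_algebra K A by (rule k_algebra_A)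

lemma e_closed: "e b \<in> carrier H"
  by (rule basis_vector_closed[OF field_K hopf])

lemma H_coord_closed: "h \<in> carrier H \<Longrightarrow> b \<in> B \<Longrightarrow> h b \<in> carrier K"
  using hopf by (auto simp: coordinate_hopf_def basis_eq)

lemma H_one_closed: "\<one>\<^bsub>H\<^esub> \<in> carrier H"
  using hopf unfolding coordinate_hopf_def by blast

lemma H_mult_closed: "x \<in> carrier H \<Longrightarrow> y \<in> carrier H \<Longrightarrow> x \<otimes>\<^bsub>H\<^esub> y \<in> carrier H"
  using hopf unfolding coordinate_hopf_def by blast

lemma act_bilinear: "bilinear_map K H R R act" and \<sigma>_bilinear: "bilinear_map K H H R \<sigma>"
  using twisted[unfolded twisted_module_algebra_def weak_action_def, THEN conjunct1, THEN conjunct1]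
    twisted[unfolded twisted_module_algebra_def, THEN conjunct2, THEN conjunct1] .

lemma act_closed: "h \<in> carrier H \<Longrightarrow> r \<in> carrier R \<Longrightarrow> act h r \<in> carrier R"
  using act_bilinear by (simp add: bilinear_map_def)

lemma \<sigma>_closed: "h \<in> carrier H \<Longrightarrow> g \<in> carrier H \<Longrightarrow> \<sigma> h g \<in> carrier R"
  using \<sigma>_bilinear by (simp add: bilinear_map_def)

lemma smult_coord: "b \<in> B \<Longrightarrow> (k \<odot>\<^bsub>A\<^esub> x) b = k \<odot> x b"
  by (simp add: crossed_product_def tensor_space_def basis_eq)

lemma tens_coord: "b \<in> B \<Longrightarrow> tens h b = h b \<odot> \<one>"
  by (simp add: tens_def pure_tensor_def basis_eq)

lemma tens_closed: "h \<in> carrier H \<Longrightarrow> tens h \<in> carrier A"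
  using H_coord_closed by (auto simp: tens_def pure_tensor_def carrier_eq basis_eq)

lemma tens_one: "tens \<one>\<^bsub>H\<^esub> = \<one>\<^bsub>A\<^esub>"
  by (simp add: tens_def crossed_product_def)

lemma tens_basis: "b \<in> B \<Longrightarrow> tens (e b) = unit_vector b"
  by (rule coord_eqI[OF tens_closed[OF e_closed] unit_vector_closed])
     (auto simp: tens_coord unit_vector_def basis_vector_def basis_eq)

lemma emb_smult: "k \<in> carrier K \<Longrightarrow> r \<in> carrier R \<Longrightarrow> emb (k \<odot> r) = k \<odot>\<^bsub>A\<^esub> emb r"
  using coord_closed[OF A.one_closed]
  by (intro coord_eqI) (auto simp: smult_coord, simp_all add: emb_def KR.smult_mult_left)

lemma tens_smult: "k \<in> carrier K \<Longrightarrow> h \<in> carrier H \<Longrightarrow> tens (k \<odot>\<^bsub>H\<^esub> h) = k \<odot>\<^bsub>A\<^esub> tens h"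
proof (rule coord_eqI)
  assume k: "k \<in> carrier K" and h: "h \<in> carrier H"
  have Hs: "k \<odot>\<^bsub>H\<^esub> h = (\<lambda>b\<in>B. k \<otimes>\<^bsub>K\<^esub> h b)" and Hc: "carrier H = B \<rightarrow>\<^sub>E carrier K"
    using hopf unfolding coordinate_hopf_def basis_eq by metis+
  show "tens (k \<odot>\<^bsub>H\<^esub> h) \<in> carrier A"
    using h k H_coord_closed by (intro tens_closed) (auto simp: Hs Hc)
  show "k \<odot>\<^bsub>A\<^esub> tens h \<in> carrier A" using k h tens_closed by simp
  show "tens (k \<odot>\<^bsub>H\<^esub> h) b = (k \<odot>\<^bsub>A\<^esub> tens h) b" if "b \<in> B" for b
    using that k H_coord_closed[OF h that] by (simp add: tens_coord smult_coord Hs KR.smult_assoc1)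
qed

lemma tens_add: "h \<in> carrier H \<Longrightarrow> g \<in> carrier H \<Longrightarrow> tens (h \<oplus>\<^bsub>H\<^esub> g) = tens h \<oplus>\<^bsub>A\<^esub> tens g"
proof (rule coord_eqI)
  assume h: "h \<in> carrier H" and g: "g \<in> carrier H"
  have Ha: "h \<oplus>\<^bsub>H\<^esub> g = (\<lambda>b\<in>B. h b \<oplus>\<^bsub>K\<^esub> g b)" and Hc: "carrier H = B \<rightarrow>\<^sub>E carrier K"
    using hopf unfolding coordinate_hopf_def basis_eq by metis+
  show "tens (h \<oplus>\<^bsub>H\<^esub> g) \<in> carrier A"
    using h g H_coord_closed by (intro tens_closed) (auto simp: Ha Hc)
  show "tens h \<oplus>\<^bsub>A\<^esub> tens g \<in> carrier A" using h g tens_closed by simp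
  show "tens (h \<oplus>\<^bsub>H\<^esub> g) b = (tens h \<oplus>\<^bsub>A\<^esub> tens g) b" if "b \<in> B" for b
    using that H_coord_closed[OF h that] H_coord_closed[OF g that]
    by (simp add: tens_coord coord_add tens_closed h g Ha KR.smult_l_distr)
qed

lemma tens_emb: "\<lbrakk>h \<in> carrier H; r \<in> carrier R\<rbrakk> \<Longrightarrow>
    tens h \<otimes>\<^bsub>A\<^esub> emb r = sweedler2 K H A h (\<lambda>h1 h2. emb (act h1 r) \<otimes>\<^bsub>A\<^esub> tens h2)"
  and tens_tens: "\<lbrakk>h \<in> carrier H; g \<in> carrier H\<rbrakk> \<Longrightarrow>
    tens h \<otimes>\<^bsub>A\<^esub> tens g = sweedler2 K H A h (\<lambda>h1 h2. sweedler2 K H A g (\<lambda>g1 g2.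
      emb (\<sigma> h1 g1) \<otimes>\<^bsub>A\<^esub> tens (h2 \<otimes>\<^bsub>H\<^esub> g2)))"
  unfolding tens_def by (fact tensor_emb tensor_tensor)+

text \<open>Scalars act as left multiplication by multiples of the unit, so left ideals are
  subspaces and the quotient of \<open>A\<close> by one of them is a vector space over
  \<open>K\<close>.\<close>

lemma left_ideal_smult:
  assumes L: "left_ideal L A" and k: "k \<in> carrier K" and x: "x \<in> L"
  shows "k \<odot>\<^bsub>A\<^esub> x \<in> L"
proof -
  have xc: "x \<in> carrier A" using A.left_idealD(2)[OF L x] .
  then have "k \<odot>\<^bsub>A\<^esub> x = (k \<odot>\<^bsub>A\<^esub> \<one>\<^bsub>A\<^esub>) \<otimes>\<^bsub>A\<^esub> x"
    using k by (simp add: KA.smult_mult_left)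
  then show ?thesis using A.left_idealD(5)[OF L _ x, of "k \<odot>\<^bsub>A\<^esub> \<one>\<^bsub>A\<^esub>"] k by simp
qed

subsection \<open>From modules with an action of \<open>H\<close> to modules over the crossed product\<close>

context
  fixes M :: "('k, 'm) module" and ract hact
  assumes RH: "RH_module K H R act \<sigma> M ract hact"
    and unital: "\<And>m. m \<in> carrier M \<Longrightarrow> ract \<one> m = m"
begin

interpretation M: RH_module K H R act \<sigma> M ract hact by (rule RH)

lemma ract_closed: "a \<in> carrier R \<Longrightarrow> m \<in> carrier M \<Longrightarrow> ract a m \<in> carrier M"
  using M.ract_bilinear by (auto simp: bilinear_map_def)

lemma hact_closed: "h \<in> carrier H \<Longrightarrow> m \<in> carrier M \<Longrightarrow> hact h m \<in> carrier M"
  using M.hact_bilinear by (auto simp: bilinear_map_def)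

lemma ract_add:
  "a \<in> carrier R \<Longrightarrow> m \<in> carrier M \<Longrightarrow> n \<in> carrier M \<Longrightarrow> ract a (m \<oplus>\<^bsub>M\<^esub> n) = ract a m \<oplus>\<^bsub>M\<^esub> ract a n"
  "a \<in> carrier R \<Longrightarrow> b \<in> carrier R \<Longrightarrow> m \<in> carrier M \<Longrightarrow>
    ract (a \<oplus> b) m = ract a m \<oplus>\<^bsub>M\<^esub> ract b m"
  using M.ract_bilinear by (auto simp: bilinear_map_def)

lemma ract_smult:
  "k \<in> carrier K \<Longrightarrow> a \<in> carrier R \<Longrightarrow> m \<in> carrier M \<Longrightarrow> ract (k \<odot> a) m = k \<odot>\<^bsub>M\<^esub> ract a m"
  "k \<in> carrier K \<Longrightarrow> a \<in> carrier R \<Longrightarrow> m \<in> carrier M \<Longrightarrow> ract a (k \<odot>\<^bsub>M\<^esub> m) = k \<odot>\<^bsub>M\<^esub> ract a m"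
  using M.ract_bilinear by (auto simp: bilinear_map_def)

lemma hact_add:
  "h \<in> carrier H \<Longrightarrow> m \<in> carrier M \<Longrightarrow> n \<in> carrier M \<Longrightarrow> hact h (m \<oplus>\<^bsub>M\<^esub> n) = hact h m \<oplus>\<^bsub>M\<^esub> hact h n"
  using M.hact_bilinear by (auto simp: bilinear_map_def)

text \<open>The action of \<open>A\<close> that unites both structures: \<open>r # h\<close> acts as
  \<open>h\<close> followed by \<open>r\<close>.\<close>

definition star :: "('b \<Rightarrow> 'r) \<Rightarrow> 'm \<Rightarrow> 'm" where
  "star x m = (\<Oplus>\<^bsub>M\<^esub>b\<in>B. ract (x b) (hact (e b) m))"

lemma star_term: "x \<in> carrier A \<Longrightarrow> b \<in> B \<Longrightarrow> m \<in> carrier M \<Longrightarrow> ract (x b) (hact (e b) m) \<in> carrier M"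
  using coord_closed hact_closed e_closed ract_closed by simp

lemma star_closed: "x \<in> carrier A \<Longrightarrow> m \<in> carrier M \<Longrightarrow> star x m \<in> carrier M"
  unfolding star_def using star_term by (intro M.finsum_closed) auto

lemma star_add:
  assumes "x \<in> carrier A" "y \<in> carrier A" "m \<in> carrier M"
  shows "star (x \<oplus>\<^bsub>A\<^esub> y) m = star x m \<oplus>\<^bsub>M\<^esub> star y m"
proof -
  have "star (x \<oplus>\<^bsub>A\<^esub> y) m = (\<Oplus>\<^bsub>M\<^esub>b\<in>B. ract (x b) (hact (e b) m) \<oplus>\<^bsub>M\<^esub> ract (y b) (hact (e b) m))"
    unfolding star_def
    using assms star_term coord_closed hact_closed e_closed
    by (intro M.finsum_cong') (auto simp: coord_add ract_add)
  also have "\<dots> = star x m \<oplus>\<^bsub>M\<^esub> star y m"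
    unfolding star_def using assms star_term by (intro M.finsum_addf) auto
  finally show ?thesis .
qed

lemma star_smult:
  assumes "k \<in> carrier K" "x \<in> carrier A" "m \<in> carrier M"
  shows "star (k \<odot>\<^bsub>A\<^esub> x) m = k \<odot>\<^bsub>M\<^esub> star x m"
proof -
  have "star (k \<odot>\<^bsub>A\<^esub> x) m = (\<Oplus>\<^bsub>M\<^esub>b\<in>B. k \<odot>\<^bsub>M\<^esub> ract (x b) (hact (e b) m))"
    unfolding star_def
    using assms star_term coord_closed hact_closed e_closed
    by (intro M.finsum_cong') (auto simp: smult_coord ract_smult)
  also have "\<dots> = k \<odot>\<^bsub>M\<^esub> star x m"
    unfolding star_def using assms star_term finite_basis
    by (intro M.finsum_smult_ldistr[symmetric]) auto
  finally show ?thesis .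
qed

lemma star_minus:
  assumes "x \<in> carrier A" "y \<in> carrier A" "m \<in> carrier M"
  shows "star (x \<ominus>\<^bsub>A\<^esub> y) m = star x m \<ominus>\<^bsub>M\<^esub> star y m"
proof -
  have "star x m = star (x \<ominus>\<^bsub>A\<^esub> y) m \<oplus>\<^bsub>M\<^esub> star y m"
    using star_add[of "x \<ominus>\<^bsub>A\<^esub> y" y m] assms by (simp add: A.minus_eq A.a_assoc A.l_neg)
  then show ?thesis
    using assms star_closed by (simp add: M.minus_eq M.a_assoc M.r_neg)
qed

lemma star_emb:
  assumes "r \<in> carrier R" "x \<in> carrier A" "m \<in> carrier M"
  shows "star (emb r \<otimes>\<^bsub>A\<^esub> x) m = ract r (star x m)"
proof -
  have "ract r (star x m) = (\<Oplus>\<^bsub>M\<^esub>b\<in>B. ract r (ract (x b) (hact (e b) m)))"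
    unfolding star_def using assms star_term ract_closed ract_add finite_basis
    by (intro finsum_hom[OF M.abelian_group_axioms M.abelian_group_axioms]) auto
  also have "\<dots> = star (emb r \<otimes>\<^bsub>A\<^esub> x) m"
    unfolding star_def
    using assms star_term coord_closed hact_closed e_closed ract_closed
    by (intro M.finsum_cong') (auto simp: coord_emb_mult M.ract_mult)
  finally show ?thesis ..
qed

lemma star_tens:
  assumes "h \<in> carrier H" "m \<in> carrier M"
  shows "star (tens h) m = hact h m"
proof -
  have "star (tens h) m = (\<Oplus>\<^bsub>M\<^esub>b\<in>B. h b \<odot>\<^bsub>M\<^esub> hact (e b) m)"
    unfolding star_def using assms hact_closed e_closed H_coord_closed ract_closed
    by (intro M.finsum_cong') (auto simp: tens_coord ract_smult unital)
  also have "\<dots> = hact h m"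
    using finsum_basis_expansion[OF field_K hopf M.module_axioms M.hact_bilinear assms]
    by (simp add: basis_eq)
  finally show ?thesis .
qed

lemma star_one: "m \<in> carrier M \<Longrightarrow> star \<one>\<^bsub>A\<^esub> m = m"
  using star_tens[OF H_one_closed] M.hact_one by (simp add: tens_one)

lemma star_emb': "r \<in> carrier R \<Longrightarrow> m \<in> carrier M \<Longrightarrow> star (emb r) m = ract r m"
  using star_emb[of r "\<one>\<^bsub>A\<^esub>" m] star_one by simp

lemma star_sweedler2:
  assumes "h \<in> carrier H" "m \<in> carrier M"
    and "\<And>c d. c \<in> basis H \<Longrightarrow> d \<in> basis H \<Longrightarrow> F (e c) (e d) \<in> carrier A"
  shows "star (sweedler2 K H A h F) m = sweedler2 K H M h (\<lambda>x y. star (F x y) m)"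
  using assms star_closed star_add star_smult
  by (intro sweedler2_hom[OF KA.module_axioms M.module_axioms hopf assms(1)]) auto

text \<open>The module axiom \<open>hact_hact\<close> is the product rule \<open>tens_tens\<close>
  read through \<open>star\<close>.\<close>

lemma star_tens_tens:
  assumes h: "h \<in> carrier H" and g: "g \<in> carrier H" and m: "m \<in> carrier M"
  shows "star (tens h \<otimes>\<^bsub>A\<^esub> tens g) m = hact h (hact g m)"
proof -
  note cl = tens_closed emb_closed \<sigma>_closed e_closed H_mult_closed A.m_closed
  have "star (tens h \<otimes>\<^bsub>A\<^esub> tens g) m = sweedler2 K H M h (\<lambda>h1 h2. star (sweedler2 K H A g (\<lambda>g1 g2.
      emb (\<sigma> h1 g1) \<otimes>\<^bsub>A\<^esub> tens (h2 \<otimes>\<^bsub>H\<^esub> g2))) m)"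
    unfolding tens_tens[OF h g]
    by (rule star_sweedler2[OF h m], rule sweedler2_closed[OF KA.module_axioms hopf g]) (intro cl)
  also have "\<dots> = sweedler2 K H M h (\<lambda>h1 h2. sweedler2 K H M g (\<lambda>g1 g2.
      ract (\<sigma> h1 g1) (hact (h2 \<otimes>\<^bsub>H\<^esub> g2) m)))"
  proof (rule sweedler2_cong[OF M.module_axioms hopf h])
    fix c d
    let ?F = "\<lambda>g1 g2. ract (\<sigma> (e c) g1) (hact (e d \<otimes>\<^bsub>H\<^esub> g2) m)"
    show "sweedler2 K H M g ?F \<in> carrier M"
      by (rule sweedler2_closed[OF M.module_axioms hopf g]) (intro cl ract_closed hact_closed m)
    have "star (sweedler2 K H A g (\<lambda>g1 g2. emb (\<sigma> (e c) g1) \<otimes>\<^bsub>A\<^esub> tens (e d \<otimes>\<^bsub>H\<^esub> g2))) m =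
        sweedler2 K H M g (\<lambda>g1 g2. star (emb (\<sigma> (e c) g1) \<otimes>\<^bsub>A\<^esub> tens (e d \<otimes>\<^bsub>H\<^esub> g2)) m)"
      by (rule star_sweedler2[OF g m]) (intro cl)
    also have "\<dots> = sweedler2 K H M g ?F"
      by (rule sweedler2_cong[OF M.module_axioms hopf g])
         (intro cl ract_closed hact_closed m, simp add: star_emb star_tens cl m)
    finally show "star (sweedler2 K H A g (\<lambda>g1 g2. emb (\<sigma> (e c) g1) \<otimes>\<^bsub>A\<^esub> tens (e d \<otimes>\<^bsub>H\<^esub> g2))) m =
        sweedler2 K H M g ?F" .
  qed
  also have "\<dots> = hact h (hact g m)" by (rule M.hact_hact[OF h g m, symmetric])
  finally show ?thesis .
qed

text \<open>Associativity of \<open>A\<close> splits off the product in \<open>tens_emb\<close>,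
  which \<open>star\<close> turns into the axiom \<open>hact_ract\<close>; what remains is a product
  of two tensors.\<close>

lemma star_tens_emb_tens:
  assumes h: "h \<in> carrier H" and r: "r \<in> carrier R" and g: "g \<in> carrier H" and m: "m \<in> carrier M"
  shows "star (tens h \<otimes>\<^bsub>A\<^esub> (emb r \<otimes>\<^bsub>A\<^esub> tens g)) m = hact h (star (emb r \<otimes>\<^bsub>A\<^esub> tens g) m)"
proof -
  note cl = tens_closed emb_closed act_closed e_closed H_mult_closed A.m_closed
  have "tens h \<otimes>\<^bsub>A\<^esub> (emb r \<otimes>\<^bsub>A\<^esub> tens g) = (tens h \<otimes>\<^bsub>A\<^esub> emb r) \<otimes>\<^bsub>A\<^esub> tens g"
    using h r g cl by (simp add: A.m_assoc)
  also have "\<dots> = sweedler2 K H A h (\<lambda>h1 h2. (emb (act h1 r) \<otimes>\<^bsub>A\<^esub> tens h2) \<otimes>\<^bsub>A\<^esub> tens g)"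
    unfolding tens_emb[OF h r]
    by (rule sweedler2_hom[OF KA.module_axioms KA.module_axioms hopf h])
       (use g r cl in \<open>auto simp: A.l_distr KA.smult_mult_left\<close>)
  finally have "star (tens h \<otimes>\<^bsub>A\<^esub> (emb r \<otimes>\<^bsub>A\<^esub> tens g)) m =
      star (sweedler2 K H A h (\<lambda>h1 h2. (emb (act h1 r) \<otimes>\<^bsub>A\<^esub> tens h2) \<otimes>\<^bsub>A\<^esub> tens g)) m" by simp
  also have "\<dots> = sweedler2 K H M h (\<lambda>h1 h2. star ((emb (act h1 r) \<otimes>\<^bsub>A\<^esub> tens h2) \<otimes>\<^bsub>A\<^esub> tens g) m)"
    by (rule star_sweedler2[OF h m]) (intro cl r g)
  also have "\<dots> = sweedler2 K H M h (\<lambda>h1 h2. ract (act h1 r) (hact h2 (hact g m)))"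
    by (rule sweedler2_cong[OF M.module_axioms hopf h])
       (intro cl ract_closed hact_closed m g r,
        use m g r in \<open>simp add: A.m_assoc star_emb star_tens_tens cl\<close>)
  also have "\<dots> = hact h (ract r (hact g m))"
    by (rule M.hact_ract[OF h r hact_closed[OF g m], symmetric])
  also have "\<dots> = hact h (star (emb r \<otimes>\<^bsub>A\<^esub> tens g) m)"
    using r g m by (simp add: star_emb star_tens cl)
  finally show ?thesis .
qed

lemma star_finsum:
  assumes "\<And>b. b \<in> B \<Longrightarrow> f b \<in> carrier A" "m \<in> carrier M"
  shows "star (\<Oplus>\<^bsub>A\<^esub>b\<in>B. f b) m = (\<Oplus>\<^bsub>M\<^esub>b\<in>B. star (f b) m)"
  using assms star_closed star_add finite_basis
  by (intro finsum_hom[OF A.abelian_group_axioms M.abelian_group_axioms]) auto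

lemma star_tens_mult:
  assumes h: "h \<in> carrier H" and y: "y \<in> carrier A" and m: "m \<in> carrier M"
  shows "star (tens h \<otimes>\<^bsub>A\<^esub> y) m = hact h (star y m)"
proof -
  note cl = tens_closed e_closed A.m_closed coord_closed[OF y]
  let ?y = "\<lambda>b. emb (y b) \<otimes>\<^bsub>A\<^esub> tens (e b)"
  have yc: "?y b \<in> carrier A" if "b \<in> B" for b using that cl by simp
  have y_eq: "y = (\<Oplus>\<^bsub>A\<^esub>b\<in>B. ?y b)"
    using basis_expansion[OF y] yc tens_basis
    by (subst A.finsum_cong'[where g = ?y, OF refl, symmetric]) auto
  have "tens h \<otimes>\<^bsub>A\<^esub> y = (\<Oplus>\<^bsub>A\<^esub>b\<in>B. tens h \<otimes>\<^bsub>A\<^esub> ?y b)"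
    using yc tens_closed[OF h] finite_basis by (subst y_eq, intro A.finsum_rdistr) auto
  then have "star (tens h \<otimes>\<^bsub>A\<^esub> y) m = (\<Oplus>\<^bsub>M\<^esub>b\<in>B. star (tens h \<otimes>\<^bsub>A\<^esub> ?y b) m)"
    using yc tens_closed[OF h] m by (simp add: star_finsum)
  also have "\<dots> = (\<Oplus>\<^bsub>M\<^esub>b\<in>B. hact h (star (?y b) m))"
    using h m yc hact_closed star_closed cl
    by (intro M.finsum_cong') (auto simp: star_tens_emb_tens)
  also have "\<dots> = hact h (\<Oplus>\<^bsub>M\<^esub>b\<in>B. star (?y b) m)"
    using h m yc hact_closed hact_add star_closed finite_basis
    by (intro finsum_hom[OF M.abelian_group_axioms M.abelian_group_axioms, symmetric]) auto
  also have "(\<Oplus>\<^bsub>M\<^esub>b\<in>B. star (?y b) m) = star y m"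
    using star_finsum[of ?y, OF yc m] arg_cong[OF y_eq, of "\<lambda>z. star z m"] by simp
  finally show ?thesis .
qed

text \<open>Associativity by linearity: \<open>star_tens_mult\<close> has dealt with an arbitrary
  right factor, and expanding the left factor leaves coefficients that \<open>star_emb\<close> takes
  out.\<close>

lemma star_mult:
  assumes x: "x \<in> carrier A" and y: "y \<in> carrier A" and m: "m \<in> carrier M"
  shows "star (x \<otimes>\<^bsub>A\<^esub> y) m = star x (star y m)"
proof -
  have xc: "emb (x b) \<in> carrier A" if "b \<in> B" for b using coord_closed[OF x that] by simp
  have "x \<otimes>\<^bsub>A\<^esub> y = (\<Oplus>\<^bsub>A\<^esub>b\<in>B. emb (x b) \<otimes>\<^bsub>A\<^esub> unit_vector b) \<otimes>\<^bsub>A\<^esub> y"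
    using basis_expansion[OF x] by simp
  also have "\<dots> = (\<Oplus>\<^bsub>A\<^esub>b\<in>B. emb (x b) \<otimes>\<^bsub>A\<^esub> unit_vector b \<otimes>\<^bsub>A\<^esub> y)"
    using xc y finite_basis by (intro A.finsum_ldistr) auto
  finally have "star (x \<otimes>\<^bsub>A\<^esub> y) m = (\<Oplus>\<^bsub>M\<^esub>b\<in>B. star (emb (x b) \<otimes>\<^bsub>A\<^esub> unit_vector b \<otimes>\<^bsub>A\<^esub> y) m)"
    using xc y m by (simp add: star_finsum)
  also have "\<dots> = star x (star y m)"
    unfolding star_def[of x]
  proof (rule M.finsum_cong'[OF refl])
    fix b assume b: "b \<in> B"
    have "star (emb (x b) \<otimes>\<^bsub>A\<^esub> unit_vector b \<otimes>\<^bsub>A\<^esub> y) m =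
        star (emb (x b) \<otimes>\<^bsub>A\<^esub> (tens (e b) \<otimes>\<^bsub>A\<^esub> y)) m"
      using b xc y by (simp add: A.m_assoc tens_basis)
    also have "\<dots> = ract (x b) (hact (e b) (star y m))"
      using b coord_closed[OF x b] y m e_closed tens_closed by (simp add: star_emb star_tens_mult)
    finally show "star (emb (x b) \<otimes>\<^bsub>A\<^esub> unit_vector b \<otimes>\<^bsub>A\<^esub> y) m = ract (x b) (hact (e b) (star y m))" .
  qed (use x y m star_term star_closed in auto)
  finally show ?thesis .
qed

lemma star_add_right:
  assumes x: "x \<in> carrier A" and m: "m \<in> carrier M" and n: "n \<in> carrier M"
  shows "star x (m \<oplus>\<^bsub>M\<^esub> n) = star x m \<oplus>\<^bsub>M\<^esub> star x n"
proof -
  have "star x (m \<oplus>\<^bsub>M\<^esub> n) = (\<Oplus>\<^bsub>M\<^esub>b\<in>B. ract (x b) (hact (e b) m) \<oplus>\<^bsub>M\<^esub> ract (x b) (hact (e b) n))"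
    unfolding star_def
    using assms star_term coord_closed hact_closed e_closed
    by (intro M.finsum_cong') (auto simp: hact_add ract_add)
  also have "\<dots> = star x m \<oplus>\<^bsub>M\<^esub> star x n"
    unfolding star_def using assms star_term by (intro M.finsum_addf) auto
  finally show ?thesis .
qed

text \<open>The cyclic submodule generated by \<open>n\<close>, to which irreducibility is
  applied.\<close>

lemma star_submodule:
  assumes n: "n \<in> carrier M"
  shows "RH_submodule K H R M ract hact ((\<lambda>x. star x n) ` carrier A)" (is "RH_submodule _ _ _ _ _ _ ?N")
  unfolding RH_submodule_def
proof (intro conjI ballI)
  have z: "star \<zero>\<^bsub>A\<^esub> n = \<zero>\<^bsub>M\<^esub>"
    using star_add[of "\<zero>\<^bsub>A\<^esub>" "\<zero>\<^bsub>A\<^esub>" n] star_closed[of "\<zero>\<^bsub>A\<^esub>" n] n by simp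
  show "submodule ?N K M"
  proof (rule M.submoduleI')
    show "\<zero>\<^bsub>M\<^esub> \<in> ?N" using z by (auto intro!: image_eqI[of _ _ "\<zero>\<^bsub>A\<^esub>"])
    show "x \<oplus>\<^bsub>M\<^esub> y \<in> ?N" if "x \<in> ?N" "y \<in> ?N" for x y
      using that n by (auto simp: star_add[symmetric])
    show "k \<odot>\<^bsub>M\<^esub> x \<in> ?N" if "k \<in> carrier K" "x \<in> ?N" for k x
      using that n by (auto simp: star_smult[symmetric])
  qed (use n star_closed in auto)
  show "ract a m \<in> ?N" if "a \<in> carrier R" "m \<in> ?N" for a m
    using that n by (auto simp: star_emb[symmetric])
  show "hact h m \<in> ?N" if "h \<in> carrier H" "m \<in> ?N" for h m
    using that n tens_closed by (auto simp: star_tens_mult[symmetric])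
qed

text \<open>If \<open>x m\<close> is nonzero it generates \<open>M\<close>, so
  \<open>m = a x m\<close> for some \<open>a\<close>, and \<open>1 - a x\<close> annihilates
  \<open>m\<close>. This is the criterion \<open>maximal_left_ideal_iff\<close>.\<close>

lemma annihilator_maximal_left_ideal:
  assumes sub: "\<And>N. RH_submodule K H R M ract hact N \<Longrightarrow> N = {\<zero>\<^bsub>M\<^esub>} \<or> N = carrier M"
    and m: "m \<in> carrier M" "m \<noteq> \<zero>\<^bsub>M\<^esub>"
  shows "maximal_left_ideal {x \<in> carrier A. star x m = \<zero>\<^bsub>M\<^esub>} A"
  unfolding A.maximal_left_ideal_iff
proof (intro conjI ballI)
  have z: "star x \<zero>\<^bsub>M\<^esub> = \<zero>\<^bsub>M\<^esub>" if "x \<in> carrier A" for x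
    using star_add_right[OF that, of "\<zero>\<^bsub>M\<^esub>" "\<zero>\<^bsub>M\<^esub>"] star_closed[OF that, of "\<zero>\<^bsub>M\<^esub>"] by simp
  have z': "star \<zero>\<^bsub>A\<^esub> m = \<zero>\<^bsub>M\<^esub>"
    using star_add[of "\<zero>\<^bsub>A\<^esub>" "\<zero>\<^bsub>A\<^esub>" m] star_closed[of "\<zero>\<^bsub>A\<^esub>" m] m by simp
  show "left_ideal {x \<in> carrier A. star x m = \<zero>\<^bsub>M\<^esub>} A"
    by (rule A.left_idealI) (use m z z' in \<open>auto simp: star_add star_mult\<close>)
  show "\<one>\<^bsub>A\<^esub> \<notin> {x \<in> carrier A. star x m = \<zero>\<^bsub>M\<^esub>}" using m by (simp add: star_one)
  fix x assume "x \<in> carrier A - {x \<in> carrier A. star x m = \<zero>\<^bsub>M\<^esub>}"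
  then have x: "x \<in> carrier A" "star x m \<noteq> \<zero>\<^bsub>M\<^esub>" by auto
  let ?n = "star x m"
  have n: "?n \<in> carrier M" using star_closed[OF x(1) m(1)] .
  have "star \<one>\<^bsub>A\<^esub> ?n \<in> (\<lambda>x. star x ?n) ` carrier A" by blast
  then have "(\<lambda>x. star x ?n) ` carrier A \<noteq> {\<zero>\<^bsub>M\<^esub>}" using x(2) n by (auto simp: star_one)
  then have "(\<lambda>x. star x ?n) ` carrier A = carrier M" using sub[OF star_submodule[OF n]] by blast
  then obtain a where a: "a \<in> carrier A" "m = star a ?n" using m(1) by blast
  then have "star (\<one>\<^bsub>A\<^esub> \<ominus>\<^bsub>A\<^esub> a \<otimes>\<^bsub>A\<^esub> x) m = m \<ominus>\<^bsub>M\<^esub> m"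
    using x(1) m(1) by (simp add: star_minus star_one star_mult)
  then have "star (\<one>\<^bsub>A\<^esub> \<ominus>\<^bsub>A\<^esub> a \<otimes>\<^bsub>A\<^esub> x) m = \<zero>\<^bsub>M\<^esub>"
    using m(1) by (simp add: M.minus_eq M.r_neg)
  then show "\<exists>a\<in>carrier A. \<one>\<^bsub>A\<^esub> \<ominus>\<^bsub>A\<^esub> a \<otimes>\<^bsub>A\<^esub> x \<in> {x \<in> carrier A. star x m = \<zero>\<^bsub>M\<^esub>}"
    using a(1) x(1) by auto
qed

end

text \<open>The unit of \<open>R\<close> fixes all elements of the form \<open>ract a n\<close>, and
  by \<open>RH_irreducible_cyclic\<close> an irreducible module consists of sums of such
  elements.\<close>

lemma RH_irreducible_unital:
  fixes M :: "('k, 'm) module"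
  assumes irr: "RH_irreducible K H R act \<sigma> M ract hact" and m: "m \<in> carrier M"
  shows "ract \<one> m = m"
proof -
  interpret M: RH_module K H R act \<sigma> M ract hact using irr by (simp add: RH_irreducible_def)
  obtain m0 where m0: "m0 \<in> carrier M" "carrier M =
      (\<lambda>x. \<Oplus>\<^bsub>M\<^esub>b\<in>basis H. ract (x b) (hact (e b) m0)) ` (basis H \<rightarrow>\<^sub>E carrier R)"
    by (rule RH_irreducible_cyclic[OF field_K hopf k_algebra_R twisted irr])
  then obtain x where x: "x \<in> basis H \<rightarrow>\<^sub>E carrier R"
    "m = (\<Oplus>\<^bsub>M\<^esub>b\<in>basis H. ract (x b) (hact (e b) m0))" using m by auto
  have rc: "ract a m \<in> carrier M" if "a \<in> carrier R" "m \<in> carrier M" for a m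
    using M.ract_bilinear that by (auto simp: bilinear_map_def)
  have hc: "hact (e b) m0 \<in> carrier M" for b
    using M.hact_bilinear m0(1) e_closed by (auto simp: bilinear_map_def)
  have ra: "ract a (m \<oplus>\<^bsub>M\<^esub> n) = ract a m \<oplus>\<^bsub>M\<^esub> ract a n"
    if "a \<in> carrier R" "m \<in> carrier M" "n \<in> carrier M" for a m n
    using M.ract_bilinear that by (auto simp: bilinear_map_def)
  have "ract \<one> m = (\<Oplus>\<^bsub>M\<^esub>b\<in>basis H. ract \<one> (ract (x b) (hact (e b) m0)))"
    unfolding x(2) using x(1) rc hc ra finite_basis
    by (intro finsum_hom[OF M.abelian_group_axioms M.abelian_group_axioms]) (auto simp: basis_eq)
  also have "\<dots> = m" unfolding x(2)
  proof (rule M.finsum_cong'[OF refl])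
    fix b assume "b \<in> basis H"
    then have "x b \<in> carrier R" using x(1) by auto
    then show "ract \<one> (ract (x b) (hact (e b) m0)) = ract (x b) (hact (e b) m0)"
      using M.ract_mult[of "\<one>" "x b" "hact (e b) m0"] hc by simp
  qed (use x(1) rc hc in auto)
  finally show ?thesis .
qed

subsection \<open>Simple modules over the crossed product\<close>

context
  fixes L
  assumes L: "maximal_left_ideal L A"
begin

lemma L_left_ideal: "left_ideal L A"
  by (rule A.maximal_left_idealD(1)[OF L])

lemmas LD = A.left_idealD[OF L_left_ideal]

text \<open>The coset of \<open>x\<close>, kept as a set of elements of \<open>A\<close>: the
  quotient then lives in the very type over which \<open>H_jacobson_radical\<close>
  quantifies.\<close>

definition proj :: "('b \<Rightarrow> 'r) \<Rightarrow> ('b \<Rightarrow> 'r) set" where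
  "proj x = {y \<in> carrier A. y \<ominus>\<^bsub>A\<^esub> x \<in> L}"

lemma proj_eq_iff:
  assumes x: "x \<in> carrier A" and y: "y \<in> carrier A"
  shows "proj x = proj y \<longleftrightarrow> x \<ominus>\<^bsub>A\<^esub> y \<in> L"
proof
  assume "proj x = proj y"
  moreover have "x \<in> proj x" using x LD(3) by (simp add: proj_def A.minus_eq A.r_neg)
  ultimately show "x \<ominus>\<^bsub>A\<^esub> y \<in> L" by (simp add: proj_def)
next
  assume d: "x \<ominus>\<^bsub>A\<^esub> y \<in> L"
  have "z \<ominus>\<^bsub>A\<^esub> y = (z \<ominus>\<^bsub>A\<^esub> x) \<oplus>\<^bsub>A\<^esub> (x \<ominus>\<^bsub>A\<^esub> y)"
    "z \<ominus>\<^bsub>A\<^esub> x = (z \<ominus>\<^bsub>A\<^esub> y) \<ominus>\<^bsub>A\<^esub> (x \<ominus>\<^bsub>A\<^esub> y)" if z: "z \<in> carrier A" for z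
  proof -
    show 1: "z \<ominus>\<^bsub>A\<^esub> y = (z \<ominus>\<^bsub>A\<^esub> x) \<oplus>\<^bsub>A\<^esub> (x \<ominus>\<^bsub>A\<^esub> y)"
      using x y z A.r_neg1[of x "\<ominus>\<^bsub>A\<^esub> y"] by (simp add: A.minus_eq A.a_assoc)
    show "z \<ominus>\<^bsub>A\<^esub> x = (z \<ominus>\<^bsub>A\<^esub> y) \<ominus>\<^bsub>A\<^esub> (x \<ominus>\<^bsub>A\<^esub> y)"
      unfolding 1 using x y z by (simp add: A.minus_eq A.a_assoc A.r_neg)
  qed
  then show "proj x = proj y"
    unfolding proj_def using LD(4,7) d by (metis (no_types, lifting))
qed

text \<open>An additive map that preserves \<open>L\<close> descends to cosets. This makes the
  operations below, which are defined through chosen representatives, independent of the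
  choice.\<close>

lemma proj_cong:
  assumes "proj x = proj y" "x \<in> carrier A" "y \<in> carrier A"
    and f: "\<And>x. x \<in> carrier A \<Longrightarrow> f x \<in> carrier A"
      "\<And>x y. x \<in> carrier A \<Longrightarrow> y \<in> carrier A \<Longrightarrow> f (x \<oplus>\<^bsub>A\<^esub> y) = f x \<oplus>\<^bsub>A\<^esub> f y"
      "\<And>x. x \<in> L \<Longrightarrow> f x \<in> L"
  shows "proj (f x) = proj (f y)"
proof -
  have "f x = f (x \<ominus>\<^bsub>A\<^esub> y) \<oplus>\<^bsub>A\<^esub> f y"
    using f(2)[of "x \<ominus>\<^bsub>A\<^esub> y" y] assms(2,3) by (simp add: A.minus_eq A.a_assoc A.l_neg)
  then have "f x \<ominus>\<^bsub>A\<^esub> f y = f (x \<ominus>\<^bsub>A\<^esub> y)"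
    using f(1) assms(2,3) by (simp add: A.minus_eq A.a_assoc A.r_neg)
  then show ?thesis using assms(1-3) f by (simp add: proj_eq_iff)
qed

definition rep :: "('b \<Rightarrow> 'r) set \<Rightarrow> 'b \<Rightarrow> 'r" where
  "rep = inv_into (carrier A) proj"

definition quot :: "('k, ('b \<Rightarrow> 'r) set) module" where
  "quot = \<lparr>carrier = proj ` carrier A, mult = undefined, one = undefined, zero = proj \<zero>\<^bsub>A\<^esub>,
     add = (\<lambda>X Y. proj (rep X \<oplus>\<^bsub>A\<^esub> rep Y)), smult = (\<lambda>k X. proj (k \<odot>\<^bsub>A\<^esub> rep X))\<rparr>"

lemma rep: "x \<in> carrier A \<Longrightarrow> rep (proj x) \<in> carrier A" "x \<in> carrier A \<Longrightarrow> proj (rep (proj x)) = proj x"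
  using inv_into_into[of "proj x" proj "carrier A"] f_inv_into_f[of "proj x" proj "carrier A"]
  by (simp_all add: rep_def)

lemma quot_simps: "carrier quot = proj ` carrier A" "\<zero>\<^bsub>quot\<^esub> = proj \<zero>\<^bsub>A\<^esub>"
  by (simp_all add: quot_def)

lemma quot_add:
  assumes "x \<in> carrier A" "y \<in> carrier A"
  shows "proj x \<oplus>\<^bsub>quot\<^esub> proj y = proj (x \<oplus>\<^bsub>A\<^esub> y)"
proof -
  let ?x = "rep (proj x)" and ?y = "rep (proj y)"
  have c: "?x \<in> carrier A" "?y \<in> carrier A" using rep assms by auto
  have "?x \<ominus>\<^bsub>A\<^esub> x \<in> L" "?y \<ominus>\<^bsub>A\<^esub> y \<in> L"
    using rep(2) assms c by (simp_all add: proj_eq_iff[symmetric])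
  then have "(?x \<ominus>\<^bsub>A\<^esub> x) \<oplus>\<^bsub>A\<^esub> (?y \<ominus>\<^bsub>A\<^esub> y) \<in> L" by (rule LD(4))
  also have "(?x \<ominus>\<^bsub>A\<^esub> x) \<oplus>\<^bsub>A\<^esub> (?y \<ominus>\<^bsub>A\<^esub> y) = (?x \<oplus>\<^bsub>A\<^esub> ?y) \<ominus>\<^bsub>A\<^esub> (x \<oplus>\<^bsub>A\<^esub> y)"
    using assms c by (simp add: A.minus_eq A.minus_add A.a_ac)
  finally show ?thesis using assms c by (simp add: quot_def proj_eq_iff)
qed

lemma quot_smult:
  assumes "k \<in> carrier K" "x \<in> carrier A"
  shows "k \<odot>\<^bsub>quot\<^esub> proj x = proj (k \<odot>\<^bsub>A\<^esub> x)"
  using proj_cong[of "rep (proj x)" x "\<lambda>z. k \<odot>\<^bsub>A\<^esub> z"] rep assms left_ideal_smult[OF L_left_ideal]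
  by (simp add: quot_def KA.smult_r_distr)

lemma quot_module: "module K quot"
proof (rule moduleI)
  show "cring K" by (rule module.axioms(1)[OF KA.module_axioms])
  show "abelian_group quot"
  proof (rule abelian_groupI)
    fix X assume "X \<in> carrier quot"
    then obtain x where x: "x \<in> carrier A" "X = proj x" by (auto simp: quot_simps)
    then have "proj (\<ominus>\<^bsub>A\<^esub> x) \<oplus>\<^bsub>quot\<^esub> X = \<zero>\<^bsub>quot\<^esub>" by (simp add: quot_add quot_simps A.l_neg)
    then show "\<exists>Y\<in>carrier quot. Y \<oplus>\<^bsub>quot\<^esub> X = \<zero>\<^bsub>quot\<^esub>" using x by (auto simp: quot_simps)
  qed (auto simp: quot_simps quot_add A.a_ac)
qed (auto simp: quot_simps quot_add quot_smult KA.smult_l_distr KA.smult_r_distr KA.smult_assoc1)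

definition quot_ract :: "'r \<Rightarrow> ('b \<Rightarrow> 'r) set \<Rightarrow> ('b \<Rightarrow> 'r) set" where
  "quot_ract a X = proj (emb a \<otimes>\<^bsub>A\<^esub> rep X)"

definition quot_hact :: "('b \<Rightarrow> 'k) \<Rightarrow> ('b \<Rightarrow> 'r) set \<Rightarrow> ('b \<Rightarrow> 'r) set" where
  "quot_hact h X = proj (tens h \<otimes>\<^bsub>A\<^esub> rep X)"

lemma proj_mult_rep:
  assumes "y \<in> carrier A" "x \<in> carrier A"
  shows "proj (y \<otimes>\<^bsub>A\<^esub> rep (proj x)) = proj (y \<otimes>\<^bsub>A\<^esub> x)"
  by (rule proj_cong) (use rep assms LD(5) in \<open>auto simp: A.r_distr\<close>)

lemma quot_ract: "a \<in> carrier R \<Longrightarrow> x \<in> carrier A \<Longrightarrow> quot_ract a (proj x) = proj (emb a \<otimes>\<^bsub>A\<^esub> x)"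
  by (simp add: quot_ract_def proj_mult_rep)

lemma quot_hact: "h \<in> carrier H \<Longrightarrow> x \<in> carrier A \<Longrightarrow> quot_hact h (proj x) = proj (tens h \<otimes>\<^bsub>A\<^esub> x)"
  by (simp add: quot_hact_def proj_mult_rep tens_closed)

lemma proj_sweedler2:
  assumes h: "h \<in> carrier H" and x: "x \<in> carrier A"
    and F: "\<And>c d. c \<in> basis H \<Longrightarrow> d \<in> basis H \<Longrightarrow> F (e c) (e d) \<in> carrier A"
  shows "proj (sweedler2 K H A h F \<otimes>\<^bsub>A\<^esub> x) = sweedler2 K H quot h (\<lambda>h1 h2. proj (F h1 h2 \<otimes>\<^bsub>A\<^esub> x))"
  by (rule sweedler2_hom[OF KA.module_axioms quot_module hopf h])
     (use x F in \<open>auto simp: quot_simps quot_add quot_smult A.l_distr KA.smult_mult_left\<close>)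

text \<open>The two axioms with Sweedler sums are associativity in \<open>A\<close>: the two factors
  acting on a coset are multiplied first, and their product is rewritten by \<open>tens_emb\<close>
  or \<open>tens_tens\<close>.\<close>

lemma quot_RH_module: "RH_module K H R act \<sigma> quot quot_ract quot_hact"
proof (rule RH_module.intro[OF quot_module], unfold_locales)
  show "bilinear_map K R quot quot quot_ract"
    by (auto simp: bilinear_map_def quot_simps quot_add quot_smult quot_ract A.l_distr A.r_distr
        emb_smult KA.smult_mult_left KA.smult_mult_right)
  have Hc: "carrier H = B \<rightarrow>\<^sub>E carrier K" "add H = (\<lambda>h g. \<lambda>b\<in>B. h b \<oplus>\<^bsub>K\<^esub> g b)"
    "smult H = (\<lambda>k h. \<lambda>b\<in>B. k \<otimes>\<^bsub>K\<^esub> h b)"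
    using hopf unfolding coordinate_hopf_def basis_eq by metis+
  have "h \<oplus>\<^bsub>H\<^esub> g \<in> carrier H" if "h \<in> carrier H" "g \<in> carrier H" for h g
    using that by (auto simp: Hc)
  moreover have "k \<odot>\<^bsub>H\<^esub> h \<in> carrier H" if "h \<in> carrier H" "k \<in> carrier K" for h k
    using that by (auto simp: Hc)
  ultimately show "bilinear_map K H quot quot quot_hact"
    by (auto simp: bilinear_map_def quot_simps quot_add quot_smult quot_hact A.l_distr A.r_distr
        tens_closed tens_add tens_smult KA.smult_mult_left KA.smult_mult_right)
  show "quot_ract (a \<otimes> b) m = quot_ract a (quot_ract b m)"
    if "a \<in> carrier R" "b \<in> carrier R" "m \<in> carrier quot" for a b m
    using that by (auto simp: quot_simps quot_ract A.m_assoc)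
  show "quot_hact \<one>\<^bsub>H\<^esub> m = m" if "m \<in> carrier quot" for m
    using that H_one_closed by (auto simp: quot_simps quot_hact tens_one)
next
  note cl = tens_closed emb_closed act_closed \<sigma>_closed e_closed H_mult_closed A.m_closed
  fix h a m assume h: "h \<in> carrier H" and a: "a \<in> carrier R" and "m \<in> carrier quot"
  then obtain x where x: "x \<in> carrier A" "m = proj x" by (auto simp: quot_simps)
  have "quot_hact h (quot_ract a m) = proj ((tens h \<otimes>\<^bsub>A\<^esub> emb a) \<otimes>\<^bsub>A\<^esub> x)"
    using h a x by (simp add: quot_hact quot_ract A.m_assoc cl)
  also have "\<dots> = sweedler2 K H quot h (\<lambda>h1 h2. proj (emb (act h1 a) \<otimes>\<^bsub>A\<^esub> tens h2 \<otimes>\<^bsub>A\<^esub> x))"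
    unfolding tens_emb[OF h a] by (rule proj_sweedler2[OF h x(1)]) (intro cl a)
  also have "\<dots> = sweedler2 K H quot h (\<lambda>h1 h2. quot_ract (act h1 a) (quot_hact h2 m))"
    by (rule sweedler2_cong[OF quot_module hopf h])
       (use a x in \<open>simp_all add: quot_simps quot_ract quot_hact cl A.m_assoc\<close>)
  finally show "quot_hact h (quot_ract a m) = \<dots>" .
next
  note cl = tens_closed emb_closed act_closed \<sigma>_closed e_closed H_mult_closed A.m_closed
  fix h g m assume h: "h \<in> carrier H" and g: "g \<in> carrier H" and "m \<in> carrier quot"
  then obtain x where x: "x \<in> carrier A" "m = proj x" by (auto simp: quot_simps)
  have "quot_hact h (quot_hact g m) = proj ((tens h \<otimes>\<^bsub>A\<^esub> tens g) \<otimes>\<^bsub>A\<^esub> x)"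
    using h g x by (simp add: quot_hact A.m_assoc cl)
  also have "\<dots> = sweedler2 K H quot h (\<lambda>h1 h2. proj (sweedler2 K H A g (\<lambda>g1 g2.
      emb (\<sigma> h1 g1) \<otimes>\<^bsub>A\<^esub> tens (h2 \<otimes>\<^bsub>H\<^esub> g2)) \<otimes>\<^bsub>A\<^esub> x))"
    unfolding tens_tens[OF h g]
    by (rule proj_sweedler2[OF h x(1)], rule sweedler2_closed[OF KA.module_axioms hopf g]) (intro cl)
  also have "\<dots> = sweedler2 K H quot h (\<lambda>h1 h2. sweedler2 K H quot g (\<lambda>g1 g2.
      quot_ract (\<sigma> h1 g1) (quot_hact (h2 \<otimes>\<^bsub>H\<^esub> g2) m)))"
  proof (rule sweedler2_cong[OF quot_module hopf h])
    fix c d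
    let ?F = "\<lambda>g1 g2. quot_ract (\<sigma> (e c) g1) (quot_hact (e d \<otimes>\<^bsub>H\<^esub> g2) m)"
    have Fc: "?F (e u) (e v) \<in> carrier quot" for u v
      using x by (simp add: quot_simps quot_ract quot_hact cl)
    then show "sweedler2 K H quot g ?F \<in> carrier quot"
      by (intro sweedler2_closed[OF quot_module hopf g])
    have "proj (sweedler2 K H A g (\<lambda>g1 g2. emb (\<sigma> (e c) g1) \<otimes>\<^bsub>A\<^esub> tens (e d \<otimes>\<^bsub>H\<^esub> g2)) \<otimes>\<^bsub>A\<^esub> x) =
        sweedler2 K H quot g (\<lambda>g1 g2. proj (emb (\<sigma> (e c) g1) \<otimes>\<^bsub>A\<^esub> tens (e d \<otimes>\<^bsub>H\<^esub> g2) \<otimes>\<^bsub>A\<^esub> x))"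
      by (rule proj_sweedler2[OF g x(1)]) (intro cl)
    also have "\<dots> = sweedler2 K H quot g ?F"
      by (rule sweedler2_cong[OF quot_module hopf g])
         (rule Fc, use x in \<open>simp add: quot_ract quot_hact cl A.m_assoc\<close>)
    finally show "proj (sweedler2 K H A g (\<lambda>g1 g2. emb (\<sigma> (e c) g1) \<otimes>\<^bsub>A\<^esub> tens (e d \<otimes>\<^bsub>H\<^esub> g2)) \<otimes>\<^bsub>A\<^esub> x) =
        sweedler2 K H quot g ?F" .
  qed
  finally show "quot_hact h (quot_hact g m) = \<dots>" .
qed

text \<open>The union of the cosets in a submodule is a left ideal between \<open>L\<close> and
  \<open>A\<close>, so maximality of \<open>L\<close> decides.\<close>

lemma quot_irreducible: "RH_irreducible K H R act \<sigma> quot quot_ract quot_hact"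
  unfolding RH_irreducible_def
proof (intro conjI quot_RH_module allI impI)
  have "proj \<one>\<^bsub>A\<^esub> \<noteq> proj \<zero>\<^bsub>A\<^esub>"
    using A.maximal_left_idealD(2)[OF L] by (simp add: proj_eq_iff A.minus_eq)
  then show "\<exists>a\<in>carrier R. \<exists>m\<in>carrier quot. quot_ract a m \<noteq> \<zero>\<^bsub>quot\<^esub>"
    by (intro bexI[of _ "\<one>"] bexI[of _ "proj \<one>\<^bsub>A\<^esub>"]) (simp_all add: quot_ract quot_simps)
  fix N assume N: "RH_submodule K H R quot quot_ract quot_hact N"
  then have s: "submodule N K quot" by (simp add: RH_submodule_def)
  interpret Q: module K quot by (rule quot_module)
  have N': "N \<subseteq> carrier quot" "\<zero>\<^bsub>quot\<^esub> \<in> N"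
    using Q.submoduleE(1)[OF s] subgroup.one_closed[OF submodule.axioms(1)[OF s]] by auto
  have Na: "X \<oplus>\<^bsub>quot\<^esub> Y \<in> N" if "X \<in> N" "Y \<in> N" for X Y using Q.submoduleE(5)[OF s that] .
  let ?J = "{x \<in> carrier A. proj x \<in> N}"
  have scale: "emb r \<otimes>\<^bsub>A\<^esub> x \<in> ?J" if "r \<in> carrier R" "x \<in> ?J" for r x
  proof -
    have "quot_ract r (proj x) \<in> N" using N that unfolding RH_submodule_def by blast
    then show ?thesis using that by (simp add: quot_ract)
  qed
  have tens: "tens h \<otimes>\<^bsub>A\<^esub> x \<in> ?J" if "h \<in> carrier H" "x \<in> ?J" for h x
  proof -
    have "quot_hact h (proj x) \<in> N" using N that unfolding RH_submodule_def by blast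
    then show ?thesis using that tens_closed by (simp add: quot_hact)
  qed
  have add: "x \<oplus>\<^bsub>A\<^esub> y \<in> ?J" if "x \<in> ?J" "y \<in> ?J" for x y
    using that Na[of "proj x" "proj y"] by (simp add: quot_add)
  have zero: "\<zero>\<^bsub>A\<^esub> \<in> ?J" using N'(2) by (simp add: quot_simps)
  have J: "left_ideal ?J A"
  proof (rule A.left_idealI)
    fix a x assume a: "a \<in> carrier A" and x: "x \<in> ?J"
    \<comment> \<open>Along the basis, left multiplication by \<open>a\<close> splits into
      multiplications by tensors and by elements of \<open>R\<close>, the only ones that a submodule
      is known to respect.\<close>
    have t: "emb (a b) \<otimes>\<^bsub>A\<^esub> unit_vector b \<otimes>\<^bsub>A\<^esub> x \<in> ?J" if b: "b \<in> B" for b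
    proof -
      have "emb (a b) \<otimes>\<^bsub>A\<^esub> (tens (e b) \<otimes>\<^bsub>A\<^esub> x) \<in> ?J"
        by (rule scale[OF coord_closed[OF a b] tens[OF e_closed x]])
      then show ?thesis using x coord_closed[OF a b] b by (simp add: A.m_assoc tens_basis)
    qed
    have "(\<Oplus>\<^bsub>A\<^esub>b\<in>S. emb (a b) \<otimes>\<^bsub>A\<^esub> unit_vector b \<otimes>\<^bsub>A\<^esub> x) \<in> ?J" if "finite S" "S \<subseteq> B" for S
      using that
    proof (induction S)
      case (insert b S)
      then have f: "(\<lambda>b. emb (a b) \<otimes>\<^bsub>A\<^esub> unit_vector b \<otimes>\<^bsub>A\<^esub> x) \<in> S \<rightarrow> carrier A"
        "emb (a b) \<otimes>\<^bsub>A\<^esub> unit_vector b \<otimes>\<^bsub>A\<^esub> x \<in> carrier A" using t by auto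
      have "emb (a b) \<otimes>\<^bsub>A\<^esub> unit_vector b \<otimes>\<^bsub>A\<^esub> x \<oplus>\<^bsub>A\<^esub>
          (\<Oplus>\<^bsub>A\<^esub>b\<in>S. emb (a b) \<otimes>\<^bsub>A\<^esub> unit_vector b \<otimes>\<^bsub>A\<^esub> x) \<in> ?J"
        by (rule add) (use insert t in auto)
      then show ?case unfolding A.finsum_insert[OF insert.hyps f] .
    qed (use zero in simp)
    then have "(\<Oplus>\<^bsub>A\<^esub>b\<in>B. emb (a b) \<otimes>\<^bsub>A\<^esub> unit_vector b \<otimes>\<^bsub>A\<^esub> x) \<in> ?J"
      using finite_basis by blast
    also have "(\<Oplus>\<^bsub>A\<^esub>b\<in>B. emb (a b) \<otimes>\<^bsub>A\<^esub> unit_vector b \<otimes>\<^bsub>A\<^esub> x) =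
        (\<Oplus>\<^bsub>A\<^esub>b\<in>B. emb (a b) \<otimes>\<^bsub>A\<^esub> unit_vector b) \<otimes>\<^bsub>A\<^esub> x"
      using x coord_closed[OF a] finite_basis by (intro A.finsum_ldistr[symmetric]) auto
    also have "\<dots> = a \<otimes>\<^bsub>A\<^esub> x" using basis_expansion[OF a] by simp
    finally show "a \<otimes>\<^bsub>A\<^esub> x \<in> ?J" .
  qed (use zero add in auto)
  have LJ: "L \<subseteq> ?J"
  proof
    fix x assume x: "x \<in> L"
    then have "x \<in> carrier A" "proj x = proj \<zero>\<^bsub>A\<^esub>" using LD(2) by (auto simp: proj_eq_iff A.minus_eq)
    then show "x \<in> ?J" using N'(2) by (simp add: quot_simps)
  qed
  have NJ: "N = proj ` ?J" using N'(1) by (auto simp: quot_simps)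
  have "?J = L \<or> ?J = carrier A"
    using L J LJ by (simp add: maximal_left_ideal_def)
  then show "N = {\<zero>\<^bsub>quot\<^esub>} \<or> N = carrier quot"
  proof
    assume "?J = L"
    moreover have "proj x = \<zero>\<^bsub>quot\<^esub>" if "x \<in> L" for x
      using that LD(2) by (simp add: quot_simps proj_eq_iff A.minus_eq)
    ultimately have "N \<subseteq> {\<zero>\<^bsub>quot\<^esub>}" using NJ by auto
    then show ?thesis using N'(2) by blast
  next
    assume "?J = carrier A"
    then show ?thesis using NJ by (simp add: quot_simps)
  qed
qed

end

text \<open>If \<open>r\<close> annihilates the irreducible modules, it kills the coset of the unit
  modulo each maximal \<open>L\<close>, that is, \<open>emb r \<in> L\<close>. Conversely, the
  annihilator in \<open>A\<close> of a nonzero element of an irreducible module is a maximal left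
  ideal, so it contains \<open>emb r\<close>.\<close>

theorem H_jacobson_radical_iff:
  "r \<in> H_jacobson_radical K H R act \<sigma> \<longleftrightarrow> r \<in> carrier R \<and> emb r \<in> jacobson_radical A"
proof
  assume r: "r \<in> H_jacobson_radical K H R act \<sigma>"
  then have rc: "r \<in> carrier R" by (simp add: H_jacobson_radical_def)
  have "emb r \<in> L" if L: "maximal_left_ideal L A" for L
  proof -
    have "proj L \<one>\<^bsub>A\<^esub> \<in> carrier (quot L)" by (simp add: quot_simps[OF L])
    then have "quot_ract L r (proj L \<one>\<^bsub>A\<^esub>) = \<zero>\<^bsub>quot L\<^esub>"
      using r quot_irreducible[OF L] unfolding H_jacobson_radical_def by blast
    then have "proj L (emb r) = proj L \<zero>\<^bsub>A\<^esub>"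
      using rc by (simp add: quot_ract[OF L] quot_simps[OF L])
    then show ?thesis using rc by (simp add: proj_eq_iff[OF L] A.minus_eq)
  qed
  then show "r \<in> carrier R \<and> emb r \<in> jacobson_radical A"
    using rc by (simp add: jacobson_radical_def)
next
  assume r: "r \<in> carrier R \<and> emb r \<in> jacobson_radical A"
  have "ract r m = \<zero>\<^bsub>M\<^esub>"
    if irr: "RH_irreducible K H R act \<sigma> M ract hact" and m: "m \<in> carrier M"
    for M :: "('k, ('b \<Rightarrow> 'r) set) module" and ract hact m
  proof -
    have RH: "RH_module K H R act \<sigma> M ract hact" using irr by (simp add: RH_irreducible_def)
    note u = RH_irreducible_unital[OF irr]
    show ?thesis
    proof (cases "m = \<zero>\<^bsub>M\<^esub>")
      case True
      interpret M: RH_module K H R act \<sigma> M ract hact by (rule RH)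
      show ?thesis
        using ract_add(1)[OF RH u, of r "\<zero>\<^bsub>M\<^esub>" "\<zero>\<^bsub>M\<^esub>"] ract_closed[OF RH u, of r "\<zero>\<^bsub>M\<^esub>"] r True by simp
    next
      case False
      have "maximal_left_ideal {x \<in> carrier A. star M ract hact x m = \<zero>\<^bsub>M\<^esub>} A"
        by (rule annihilator_maximal_left_ideal[OF RH u _ m False])
           (use irr in \<open>auto simp: RH_irreducible_def\<close>)
      then have "emb r \<in> {x \<in> carrier A. star M ract hact x m = \<zero>\<^bsub>M\<^esub>}"
        using r unfolding jacobson_radical_def by blast
      then show ?thesis using star_emb'[OF RH u, of r m] r m by simp
    qed
  qed
  then show "r \<in> H_jacobson_radical K H R act \<sigma>"
    using r by (simp add: H_jacobson_radical_def)
qed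

end

section \<open>From the radical of the crossed product to the three equalities\<close>

lemma (in k_algebra) inverse_order:
  assumes "finite (carrier G)" and u: "[order G] \<cdot>\<^bsub>K\<^esub> \<one>\<^bsub>K\<^esub> \<in> Units K"
  obtains c where "c \<in> carrier A" "c \<otimes>\<^bsub>A\<^esub> (\<Oplus>\<^bsub>A\<^esub>g\<in>carrier G. \<one>\<^bsub>A\<^esub>) = \<one>\<^bsub>A\<^esub>"
proof -
  define n where "n = (\<Oplus>\<^bsub>K\<^esub>g\<in>carrier G. \<one>\<^bsub>K\<^esub>)"
  have "n = [order G] \<cdot>\<^bsub>K\<^esub> \<one>\<^bsub>K\<^esub>"
    unfolding n_def by (simp add: K.add.finprod_const order_def)
  with u have n: "n \<in> Units K" by simp
  then have nc: "n \<in> carrier K" "inv\<^bsub>K\<^esub> n \<in> carrier K" "inv\<^bsub>K\<^esub> n \<otimes>\<^bsub>K\<^esub> n = \<one>\<^bsub>K\<^esub>" by auto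
  have "(\<Oplus>\<^bsub>A\<^esub>g\<in>carrier G. \<one>\<^bsub>A\<^esub>) = n \<odot>\<^bsub>A\<^esub> \<one>\<^bsub>A\<^esub>"
    unfolding n_def using assms(1) smult_l_distr
    by (subst finsum_hom[OF K.abelian_group_axioms A.abelian_group_axioms,
          where f = "\<lambda>k. k \<odot>\<^bsub>A\<^esub> \<one>\<^bsub>A\<^esub>"]) auto
  then have "(inv\<^bsub>K\<^esub> n \<odot>\<^bsub>A\<^esub> \<one>\<^bsub>A\<^esub>) \<otimes>\<^bsub>A\<^esub> (\<Oplus>\<^bsub>A\<^esub>g\<in>carrier G. \<one>\<^bsub>A\<^esub>) = \<one>\<^bsub>A\<^esub>"
    using nc by (simp add: smult_mult_left smult_assoc1[symmetric])
  then show thesis using that nc by blast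
qed

text \<open>Only \<open>mult\<close> and \<open>one\<close> are overridden in
  \<open>crossed_product\<close>, so the sums in \<open>tensor_space\<close> that define the product
  may be read as sums in the ring \<open>A\<close>.\<close>

lemma finsum_crossed_product: "finsum (tensor_space H R) f S = finsum (crossed_product K H R act \<sigma>) f S"
  by (simp add: finsum_def crossed_product_def)

lemma sweedler2_crossed_product:
  "sweedler2 K H (tensor_space H R) = sweedler2 K H (crossed_product K H R act \<sigma>)"
proof (rule ext, rule ext)
  fix h F
  have "smult (tensor_space H R) = smult (crossed_product K H R act \<sigma>)"
    by (simp add: crossed_product_def)
  then show "sweedler2 K H (tensor_space H R) h F = sweedler2 K H (crossed_product K H R act \<sigma>) h F"
    unfolding sweedler2_def finsum_crossed_product[of H R _ _ K act \<sigma>] by simp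
qed

context hopf_crossed_product
begin

lemma jacobson_radical_smult:
  assumes "k \<in> carrier K" "x \<in> jacobson_radical R"
  shows "k \<odot> x \<in> jacobson_radical R"
proof -
  have xc: "x \<in> carrier R" using assms R.jacobson_radicalD(2) by blast
  then have "k \<odot> x = (k \<odot> \<one>) \<otimes> x"
    using assms by (simp add: KR.smult_mult_left)
  then show ?thesis using R.jacobson_radicalD(5)[OF _ assms(2), of "k \<odot> \<one>"] assms(1) by simp
qed

text \<open>At \<open>b0\<close> the unit of \<open>A\<close> has coordinate \<one>, so
  \<open>emb r\<close> has the value \<open>r\<close> there, and its membership in the radical can
  be read off in \<open>R\<close>. Stability under the basis of \<open>H\<close> extends linearly to
  all of \<open>H\<close>; for the converse inclusion of the core the unit of \<open>H\<close> is
  enough.\<close>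

lemma radicals_eq:
  assumes J: "jacobson_radical A = coord_set (jacobson_radical R)"
    and act: "\<And>b r. b \<in> B \<Longrightarrow> r \<in> jacobson_radical R \<Longrightarrow> act (e b) r \<in> jacobson_radical R"
    and one: "b0 \<in> B" "\<one>\<^bsub>A\<^esub> b0 = \<one>"
  shows "jacobson_radical R = H_jacobson_radical K H R act \<sigma>" (is ?Hj)
    and "H_jacobson_radical K H R act \<sigma> = H_jacobson_core H R act" (is ?jH)
    and "jacobson_radical A = tensor_image H R (H_jacobson_radical K H R act \<sigma>)" (is ?A)
proof -
  let ?J = "jacobson_radical R"
  note JD = R.jacobson_radicalD
  have "r \<in> H_jacobson_radical K H R act \<sigma> \<longleftrightarrow> r \<in> ?J" for r
  proof
    assume "r \<in> H_jacobson_radical K H R act \<sigma>"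
    then have r: "r \<in> carrier R" "emb r \<in> coord_set ?J"
      unfolding H_jacobson_radical_iff J by auto
    then have "emb r b0 \<in> ?J" using one(1) by (simp add: coord_set_def)
    then show "r \<in> ?J" using r one by (simp add: emb_def)
  next
    assume r: "r \<in> ?J"
    then have rc: "r \<in> carrier R" using JD(2) by blast
    have "emb r \<in> coord_set ?J"
      by (rule coord_setI[OF emb_closed[OF rc]])
         (use r R.jacobson_radical_right coord_closed[OF A.one_closed] in \<open>simp add: emb_def\<close>)
    then show "r \<in> H_jacobson_radical K H R act \<sigma>"
      using rc unfolding H_jacobson_radical_iff J by simp
  qed
  then show Hj: ?Hj by blast
  have "act h r \<in> ?J" if h: "h \<in> carrier H" and r: "r \<in> ?J" for h r
  proof -
    have "act h r = (\<Oplus>b\<in>B. h b \<odot> act (e b) r)"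
      using finsum_basis_expansion[OF field_K hopf KR.module_axioms act_bilinear h JD(2)[OF r]]
      by (simp add: basis_eq)
    also have "\<dots> \<in> ?J"
      by (rule R.left_ideal_finsum[OF R.jacobson_radical_left_ideal])
         (use h r act jacobson_radical_smult H_coord_closed in auto)
    finally show ?thesis .
  qed
  moreover have "r \<in> ?J" if "r \<in> carrier R" "\<forall>h\<in>carrier H. act h r \<in> ?J" for r
  proof -
    have "act \<one>\<^bsub>H\<^esub> r = r"
      using twisted that(1) by (simp add: twisted_module_algebra_def weak_action_def)
    then show ?thesis using that H_one_closed by metis
  qed
  ultimately have "H_jacobson_core H R act = ?J"
    using JD(2) by (auto simp: H_jacobson_core_def H_core_def)
  then show ?jH using Hj by simp
  have am: "add_monoid (tensor_space H R) = add_monoid A"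
    by (simp add: crossed_product_def)
  let ?S = "{pure_tensor H R a h | a h. a \<in> ?J \<and> h \<in> carrier H}"
  \<comment> \<open>Pure tensors whose first factor lies in the radical have coordinates in it;
    conversely, every element is the sum of the pure tensors of its coordinates with the
    basis.\<close>
  have "generate (add_monoid A) ?S \<subseteq> coord_set ?J"
  proof (rule A.add.generate_subgroup_incl)
    show "?S \<subseteq> coord_set ?J"
    proof
      fix x assume "x \<in> ?S"
      then obtain a h where x: "x = pure_tensor H R a h" "a \<in> ?J" "h \<in> carrier H" by auto
      have "x b \<in> ?J" if "b \<in> B" for b
        using that x H_coord_closed jacobson_radical_smult by (simp add: pure_tensor_def basis_eq)
      moreover have "x \<in> carrier A"
        using x H_coord_closed JD(2) by (auto simp: carrier_eq pure_tensor_def basis_eq)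
      ultimately show "x \<in> coord_set ?J" by (rule coord_setI[rotated])
    qed
    show "subgroup (coord_set ?J) (add_monoid A)"
      using A.jacobson_radical_left_ideal unfolding J left_ideal_def
      by (simp add: additive_subgroup_def)
  qed
  moreover have "x \<in> generate (add_monoid A) ?S" if x: "x \<in> coord_set ?J" for x
  proof -
    have xc: "x \<in> carrier A" and xJ: "\<And>b. b \<in> B \<Longrightarrow> x b \<in> ?J" using x by (auto simp: coord_set_def)
    have p: "emb (x b) \<otimes>\<^bsub>A\<^esub> unit_vector b \<in> ?S" if b: "b \<in> B" for b
    proof -
      have "pure_tensor H R (x b) (e b) \<in> carrier A"
        using coord_closed[OF xc b] H_coord_closed[OF e_closed]
        by (auto simp: carrier_eq pure_tensor_def basis_eq)
      then have "emb (x b) \<otimes>\<^bsub>A\<^esub> unit_vector b = pure_tensor H R (x b) (e b)"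
        using coord_closed[OF xc b]
        by (intro coord_eqI)
           (auto simp: coord_emb_unit_vector pure_tensor_def basis_eq basis_vector_def)
      then show ?thesis using xJ[OF b] e_closed by blast
    qed
    have "(\<Oplus>\<^bsub>A\<^esub>b\<in>T. emb (x b) \<otimes>\<^bsub>A\<^esub> unit_vector b) \<in> generate (add_monoid A) ?S"
      if "finite T" "T \<subseteq> B" for T
      using that
    proof (induction T)
      case empty
      show ?case using generate.one[of "add_monoid A" ?S] by simp
    next
      case (insert b T)
      have f: "(\<lambda>b. emb (x b) \<otimes>\<^bsub>A\<^esub> unit_vector b) \<in> T \<rightarrow> carrier A"
        "emb (x b) \<otimes>\<^bsub>A\<^esub> unit_vector b \<in> carrier A"
        using coord_closed[OF xc] insert.prems by auto
      have "emb (x b) \<otimes>\<^bsub>A\<^esub> unit_vector b \<in> generate (add_monoid A) ?S"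
        by (rule generate.incl, rule p) (use insert.prems in simp)
      then show ?case
        unfolding A.finsum_insert[OF insert.hyps f]
        using generate.eng[of _ "add_monoid A" ?S] insert by simp
    qed
    from this[OF finite_basis subset_refl] show ?thesis using basis_expansion[OF xc] by simp
  qed
  ultimately have "coord_set ?J = generate (add_monoid A) ?S" by blast
  then show ?A unfolding J tensor_image_def am Hj[symmetric] .
qed

end

section \<open>The two Hopf algebras of a finite group\<close>

locale finite_group_crossed_product = KR: k_algebra K R + KA: k_algebra K "crossed_product K H R act \<sigma>" +
    G: group G
  for K :: "('k, 'z) ring_scheme" and G :: "('g, 'y) monoid_scheme" and H :: "('k, 'g) hopf"
    and R :: "('k, 'r, 'x) module_scheme" (structure)
    and act :: "('g \<Rightarrow> 'k) \<Rightarrow> 'r \<Rightarrow> 'r" and \<sigma> :: "('g \<Rightarrow> 'k) \<Rightarrow> ('g \<Rightarrow> 'k) \<Rightarrow> 'r" +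
  assumes finite_G: "finite (carrier G)" and hopf: "coordinate_hopf K H"
    and basis_eq: "basis H = carrier G"
    and twisted: "twisted_module_algebra K H R act \<sigma>"
begin

abbreviation A :: "('k, 'g \<Rightarrow> 'r) module" where
  "A \<equiv> crossed_product K H R act \<sigma>"

abbreviation e :: "'g \<Rightarrow> 'g \<Rightarrow> 'k" where
  "e \<equiv> basis_vector K H"

lemma field_K: "field K" by (rule KR.field_axioms)

lemma e_closed: "e g \<in> carrier H" by (rule basis_vector_closed[OF field_K hopf])

lemma H_carrier: "carrier H = carrier G \<rightarrow>\<^sub>E carrier K"
  using hopf by (simp add: coordinate_hopf_def basis_eq)

lemma H_coord_closed: "h \<in> carrier H \<Longrightarrow> g \<in> carrier G \<Longrightarrow> h g \<in> carrier K"
  by (auto simp: H_carrier)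

lemma e_coord: "h \<in> carrier G \<Longrightarrow> e g h = (if h = g then \<one>\<^bsub>K\<^esub> else \<zero>\<^bsub>K\<^esub>)"
  by (simp add: basis_vector_def basis_eq)

lemma H_mult_closed: "x \<in> carrier H \<Longrightarrow> y \<in> carrier H \<Longrightarrow> x \<otimes>\<^bsub>H\<^esub> y \<in> carrier H"
  using hopf unfolding coordinate_hopf_def by blast

lemma act_bilinear: "bilinear_map K H R R act" and \<sigma>_bilinear: "bilinear_map K H H R \<sigma>"
  using twisted[unfolded twisted_module_algebra_def weak_action_def, THEN conjunct1, THEN conjunct1]
    twisted[unfolded twisted_module_algebra_def, THEN conjunct2, THEN conjunct1] .

lemma act_closed: "h \<in> carrier H \<Longrightarrow> r \<in> carrier R \<Longrightarrow> act h r \<in> carrier R"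
  using act_bilinear by (simp add: bilinear_map_def)

lemma \<sigma>_closed: "h \<in> carrier H \<Longrightarrow> g \<in> carrier H \<Longrightarrow> \<sigma> h g \<in> carrier R"
  using \<sigma>_bilinear by (simp add: bilinear_map_def)

lemma act_add: "\<lbrakk>h \<in> carrier H; r \<in> carrier R; r' \<in> carrier R\<rbrakk> \<Longrightarrow>
    act h (r \<oplus> r') = act h r \<oplus> act h r'"
  using act_bilinear by (simp add: bilinear_map_def)

lemma act_smult: "\<lbrakk>h \<in> carrier H; k \<in> carrier K; r \<in> carrier R\<rbrakk> \<Longrightarrow>
    act h (k \<odot> r) = k \<odot> act h r"
  using act_bilinear by (simp add: bilinear_map_def)

lemma act_zero: "h \<in> carrier H \<Longrightarrow> act h \<zero> = \<zero>"
  using act_smult[of h "\<zero>\<^bsub>K\<^esub>" "\<zero>"] act_closed[of h "\<zero>"] by simp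

lemma act_mult: "\<lbrakk>h \<in> carrier H; r \<in> carrier R; r' \<in> carrier R\<rbrakk> \<Longrightarrow>
    act h (r \<otimes> r') = sweedler2 K H R h (\<lambda>h1 h2. act h1 r \<otimes> act h2 r')"
  using twisted by (simp add: twisted_module_algebra_def weak_action_def)

lemma act_one: "r \<in> carrier R \<Longrightarrow> act \<one>\<^bsub>H\<^esub> r = r"
  using twisted by (simp add: twisted_module_algebra_def weak_action_def)

text \<open>One convolution inverse is fixed, so that the inversion formulas and the twisted
  composition rule speak of the same map.\<close>

definition \<tau> :: "('g \<Rightarrow> 'k) \<Rightarrow> ('g \<Rightarrow> 'k) \<Rightarrow> 'r" where
  "\<tau> = (SOME \<tau>. bilinear_map K H H R \<tau> \<and> convolution_inverse K H R \<sigma> \<tau> \<and>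
      (\<forall>h\<in>carrier H. \<forall>g\<in>carrier H. \<forall>r\<in>carrier R.
        act h (act g r) =
          sweedler3 K H R h (\<lambda>h1 h2 h3. sweedler3 K H R g (\<lambda>g1 g2 g3.
            \<sigma> h1 g1 \<otimes> act (h2 \<otimes>\<^bsub>H\<^esub> g2) r \<otimes> \<tau> h3 g3))))"

lemma \<tau>: "bilinear_map K H H R \<tau>" "convolution_inverse K H R \<sigma> \<tau>"
    "\<lbrakk>h \<in> carrier H; g \<in> carrier H; r \<in> carrier R\<rbrakk> \<Longrightarrow> act h (act g r) =
      sweedler3 K H R h (\<lambda>h1 h2 h3. sweedler3 K H R g (\<lambda>g1 g2 g3.
        \<sigma> h1 g1 \<otimes> act (h2 \<otimes>\<^bsub>H\<^esub> g2) r \<otimes> \<tau> h3 g3))"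
proof -
  have "\<exists>\<tau>. bilinear_map K H H R \<tau> \<and> convolution_inverse K H R \<sigma> \<tau> \<and>
      (\<forall>h\<in>carrier H. \<forall>g\<in>carrier H. \<forall>r\<in>carrier R.
        act h (act g r) =
          sweedler3 K H R h (\<lambda>h1 h2 h3. sweedler3 K H R g (\<lambda>g1 g2 g3.
            \<sigma> h1 g1 \<otimes> act (h2 \<otimes>\<^bsub>H\<^esub> g2) r \<otimes> \<tau> h3 g3)))"
    using twisted unfolding twisted_module_algebra_def by blast
  from someI_ex[OF this, folded \<tau>_def]
  show "bilinear_map K H H R \<tau>" "convolution_inverse K H R \<sigma> \<tau>"
    "\<lbrakk>h \<in> carrier H; g \<in> carrier H; r \<in> carrier R\<rbrakk> \<Longrightarrow> act h (act g r) =
      sweedler3 K H R h (\<lambda>h1 h2 h3. sweedler3 K H R g (\<lambda>g1 g2 g3.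
        \<sigma> h1 g1 \<otimes> act (h2 \<otimes>\<^bsub>H\<^esub> g2) r \<otimes> \<tau> h3 g3))"
    by blast+
qed

lemma \<tau>_closed: "h \<in> carrier H \<Longrightarrow> g \<in> carrier H \<Longrightarrow> \<tau> h g \<in> carrier R"
  using \<tau>(1) by (simp add: bilinear_map_def)

lemma \<sigma>_\<tau>: "\<lbrakk>h \<in> carrier H; g \<in> carrier H\<rbrakk> \<Longrightarrow>
    sweedler2 K H R h (\<lambda>h1 h2. sweedler2 K H R g (\<lambda>g1 g2. \<sigma> h1 g1 \<otimes> \<tau> h2 g2))
      = (counit H h \<otimes>\<^bsub>K\<^esub> counit H g) \<odot> \<one>"
  and \<tau>_\<sigma>: "\<lbrakk>h \<in> carrier H; g \<in> carrier H\<rbrakk> \<Longrightarrow>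
    sweedler2 K H R h (\<lambda>h1 h2. sweedler2 K H R g (\<lambda>g1 g2. \<tau> h1 g1 \<otimes> \<sigma> h2 g2))
      = (counit H h \<otimes>\<^bsub>K\<^esub> counit H g) \<odot> \<one>"
  using \<tau>(2) by (simp_all add: convolution_inverse_def)

lemma A_carrier: "carrier A = carrier G \<rightarrow>\<^sub>E carrier R"
  by (simp add: crossed_product_def tensor_space_def basis_eq)

lemma A_coord_closed: "x \<in> carrier A \<Longrightarrow> b \<in> carrier G \<Longrightarrow> x b \<in> carrier R"
  by (auto simp: A_carrier)

lemma A_add: "b \<in> carrier G \<Longrightarrow> (x \<oplus>\<^bsub>A\<^esub> y) b = x b \<oplus> y b"
  by (simp add: crossed_product_def tensor_space_def basis_eq)

lemma A_smult: "b \<in> carrier G \<Longrightarrow> (k \<odot>\<^bsub>A\<^esub> x) b = k \<odot> x b"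
  by (simp add: crossed_product_def tensor_space_def basis_eq)

lemma A_one: "b \<in> carrier G \<Longrightarrow> \<one>\<^bsub>A\<^esub> b = \<one>\<^bsub>H\<^esub> b \<odot> \<one>"
  by (simp add: crossed_product_def pure_tensor_def basis_eq)

lemma A_finsum:
  assumes "finite S" "\<And>i. i \<in> S \<Longrightarrow> f i \<in> carrier A" "b \<in> carrier G"
  shows "(\<Oplus>\<^bsub>A\<^esub>i\<in>S. f i) b = (\<Oplus>i\<in>S. f i b)"
  using assms A_add A_coord_closed
  by (intro finsum_hom[OF KA.abelian_group_axioms KR.abelian_group_axioms, where f = "\<lambda>x. x b"]) auto

lemma pure_tensor_closed: "a \<in> carrier R \<Longrightarrow> h \<in> carrier H \<Longrightarrow> pure_tensor H R a h \<in> carrier A"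
  using H_coord_closed by (auto simp: A_carrier pure_tensor_def basis_eq)

lemma pure_tensor_coord: "b \<in> carrier G \<Longrightarrow> pure_tensor H R a h b = h b \<odot> a"
  by (simp add: pure_tensor_def basis_eq)

lemma A_mult: "x \<otimes>\<^bsub>A\<^esub> y = (\<Oplus>\<^bsub>A\<^esub>b\<in>carrier G. \<Oplus>\<^bsub>A\<^esub>c\<in>carrier G.
    pure_mult K H R act \<sigma> (x b) (e b) (y c) (e c))"
  unfolding finsum_crossed_product[of H R _ _ K act \<sigma>, symmetric]
  by (simp add: crossed_product_def basis_eq)

lemma pure_mult_eq: "pure_mult K H R act \<sigma> a h b g = sweedler2 K H A h (\<lambda>h' h3.
    sweedler2 K H A h' (\<lambda>h1 h2. sweedler2 K H A g (\<lambda>g1 g2.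
      pure_tensor H R (a \<otimes> act h1 b \<otimes> \<sigma> h2 g1) (h3 \<otimes>\<^bsub>H\<^esub> g2))))"
  unfolding pure_mult_def sweedler3_def sweedler2_crossed_product[of K H R act \<sigma>] ..

lemma pure_mult_summand_closed:
  assumes "a \<in> carrier R" "b \<in> carrier R" "h1 \<in> carrier H" "h2 \<in> carrier H" "h3 \<in> carrier H"
    "g1 \<in> carrier H" "g2 \<in> carrier H"
  shows "pure_tensor H R (a \<otimes> act h1 b \<otimes> \<sigma> h2 g1) (h3 \<otimes>\<^bsub>H\<^esub> g2) \<in> carrier A"
  using assms act_closed \<sigma>_closed H_mult_closed by (intro pure_tensor_closed) auto

lemma pure_mult_closed:
  assumes "a \<in> carrier R" "b \<in> carrier R" "h \<in> carrier H" "g \<in> carrier H"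
  shows "pure_mult K H R act \<sigma> a h b g \<in> carrier A"
  unfolding pure_mult_eq
  by (intro sweedler2_closed[OF KA.module_axioms hopf] pure_mult_summand_closed assms e_closed)

lemma A_mult_coord:
  assumes x: "x \<in> carrier A" and y: "y \<in> carrier A" and w: "w \<in> carrier G"
  shows "(x \<otimes>\<^bsub>A\<^esub> y) w = (\<Oplus>b\<in>carrier G. \<Oplus>c\<in>carrier G.
    pure_mult K H R act \<sigma> (x b) (e b) (y c) (e c) w)"
proof -
  have p: "pure_mult K H R act \<sigma> (x b) (e b) (y c) (e c) \<in> carrier A"
    if "b \<in> carrier G" "c \<in> carrier G" for b c
    using that by (intro pure_mult_closed A_coord_closed[OF x] A_coord_closed[OF y] e_closed)
  have "(x \<otimes>\<^bsub>A\<^esub> y) w = (\<Oplus>b\<in>carrier G. (\<Oplus>\<^bsub>A\<^esub>c\<in>carrier G.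
      pure_mult K H R act \<sigma> (x b) (e b) (y c) (e c)) w)"
    unfolding A_mult using p by (intro A_finsum finite_G w KA.finsum_closed) auto
  also have "\<dots> = (\<Oplus>b\<in>carrier G. \<Oplus>c\<in>carrier G.
      pure_mult K H R act \<sigma> (x b) (e b) (y c) (e c) w)"
    using p w A_coord_closed A_finsum[OF finite_G _ w]
    by (intro KR.finsum_cong'[OF refl]) (auto intro!: KR.finsum_closed)
  finally show ?thesis .
qed

text \<open>\<open>F\<close> collects what does not depend on the left factor. The coordinates of
  \<open>x\<close> occur only as leftmost factors, which is why left scaling passes through the
  product.\<close>

lemma free_extensionI:
  assumes F: "\<And>b c r w. \<lbrakk>b \<in> carrier G; c \<in> carrier G; r \<in> carrier R; w \<in> carrier G\<rbrakk> \<Longrightarrow>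
      F b c r w \<in> carrier R"
    and mult: "\<And>x y w. \<lbrakk>x \<in> carrier A; y \<in> carrier A; w \<in> carrier G\<rbrakk> \<Longrightarrow>
      (x \<otimes>\<^bsub>A\<^esub> y) w = (\<Oplus>b\<in>carrier G. \<Oplus>c\<in>carrier G. x b \<otimes> F b c (y c) w)"
  shows "free_extension R A (carrier G)"
proof (unfold_locales)
  fix r x y assume r: "r \<in> carrier R" and x: "x \<in> carrier A" and y: "y \<in> carrier A"
  note xc = A_coord_closed[OF x] and yc = A_coord_closed[OF y]
  let ?x = "\<lambda>b\<in>carrier G. r \<otimes> x b"
  have rx: "?x \<in> carrier A" using r xc by (auto simp: A_carrier)
  have "(?x \<otimes>\<^bsub>A\<^esub> y) w = r \<otimes> (x \<otimes>\<^bsub>A\<^esub> y) w" if w: "w \<in> carrier G" for w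
  proof -
    have "(?x \<otimes>\<^bsub>A\<^esub> y) w = (\<Oplus>b\<in>carrier G. \<Oplus>c\<in>carrier G. r \<otimes> (x b \<otimes> F b c (y c) w))"
      unfolding mult[OF rx y w] using r w xc yc F
      by (intro KR.finsum_cong2) (auto simp: KR.m_assoc)
    also have "\<dots> = (\<Oplus>b\<in>carrier G. r \<otimes> (\<Oplus>c\<in>carrier G. x b \<otimes> F b c (y c) w))"
      using r w xc yc F finite_G
      by (intro KR.finsum_cong'[OF refl] KR.finsum_rdistr[symmetric]) (auto intro!: KR.finsum_closed)
    also have "\<dots> = r \<otimes> (x \<otimes>\<^bsub>A\<^esub> y) w"
      unfolding mult[OF x y w] using r w xc yc F finite_G
      by (intro KR.finsum_rdistr[symmetric]) (auto intro!: KR.finsum_closed)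
    finally show ?thesis .
  qed
  moreover have "?x \<otimes>\<^bsub>A\<^esub> y \<in> carrier G \<rightarrow>\<^sub>E carrier R"
    using KA.m_closed[OF rx y] by (simp add: A_carrier)
  moreover have "(\<lambda>b\<in>carrier G. r \<otimes> (x \<otimes>\<^bsub>A\<^esub> y) b) \<in> carrier G \<rightarrow>\<^sub>E carrier R"
    using r x y by (simp add: A_coord_closed)
  ultimately show "?x \<otimes>\<^bsub>A\<^esub> y = (\<lambda>b\<in>carrier G. r \<otimes> (x \<otimes>\<^bsub>A\<^esub> y) b)"
    by (intro PiE_ext) auto
qed (use finite_G A_carrier A_add in auto)

end

subsection \<open>The group algebra\<close>

locale group_algebra_crossed_product = finite_group_crossed_product K G "group_algebra K G" R act \<sigma>
  for K :: "('k, 'z) ring_scheme" and G :: "('g, 'y) monoid_scheme"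
    and R :: "('k, 'r, 'x) module_scheme" (structure)
    and act :: "('g \<Rightarrow> 'k) \<Rightarrow> 'r \<Rightarrow> 'r" and \<sigma> :: "('g \<Rightarrow> 'k) \<Rightarrow> ('g \<Rightarrow> 'k) \<Rightarrow> 'r"
begin

abbreviation H :: "('k, 'g) hopf" where "H \<equiv> group_algebra K G"

lemma sweedler2_eq:
  assumes V: "module K V" and h: "h \<in> carrier H"
    and F: "\<And>c d. c \<in> carrier G \<Longrightarrow> d \<in> carrier G \<Longrightarrow> F (e c) (e d) \<in> carrier V"
  shows "sweedler2 K H V h F = (\<Oplus>\<^bsub>V\<^esub>c\<in>carrier G. h c \<odot>\<^bsub>V\<^esub> F (e c) (e c))"
proof -
  interpret V: module K V by (rule V)
  have c: "comult H h c d = (if c = d then h c else \<zero>\<^bsub>K\<^esub>)" for c d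
    by (simp add: group_algebra_def)
  show ?thesis
    unfolding sweedler2_def basis_eq
  proof (rule V.finsum_cong'[OF refl])
    fix b assume b: "b \<in> carrier G"
    show "(\<Oplus>\<^bsub>V\<^esub>d\<in>carrier G. comult H h b d \<odot>\<^bsub>V\<^esub> F (e b) (e d)) = h b \<odot>\<^bsub>V\<^esub> F (e b) (e b)"
      using b F H_coord_closed[OF h] finite_G by (subst V.finsum_single[where i = b]) (auto simp: c)
  qed (use F H_coord_closed[OF h] in auto)
qed

lemma sweedler2_e:
  assumes V: "module K V" and g: "g \<in> carrier G"
    and F: "\<And>c d. c \<in> carrier G \<Longrightarrow> d \<in> carrier G \<Longrightarrow> F (e c) (e d) \<in> carrier V"
  shows "sweedler2 K H V (e g) F = F (e g) (e g)"
proof -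
  interpret V: module K V by (rule V)
  have "sweedler2 K H V (e g) F = (\<Oplus>\<^bsub>V\<^esub>c\<in>carrier G. e g c \<odot>\<^bsub>V\<^esub> F (e c) (e c))"
    by (rule sweedler2_eq[OF V e_closed]) (rule F)
  also have "\<dots> = F (e g) (e g)"
    using g F finite_G by (subst V.finsum_single[where i = g]) (auto simp: e_coord)
  finally show ?thesis .
qed

lemma e_mult:
  assumes g: "g \<in> carrier G" and h: "h \<in> carrier G"
  shows "e g \<otimes>\<^bsub>H\<^esub> e h = e (g \<otimes>\<^bsub>G\<^esub> h)"
proof
  fix b
  have "(\<Oplus>\<^bsub>K\<^esub>a\<in>carrier G. e g a \<otimes>\<^bsub>K\<^esub> e h (inv\<^bsub>G\<^esub> a \<otimes>\<^bsub>G\<^esub> b)) = e (g \<otimes>\<^bsub>G\<^esub> h) b" if b: "b \<in> carrier G"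
  proof -
    have "inv\<^bsub>G\<^esub> g \<otimes>\<^bsub>G\<^esub> b = h \<longleftrightarrow> b = g \<otimes>\<^bsub>G\<^esub> h"
      using b g h by (metis G.inv_closed G.m_closed G.inv_solve_left)
    then show ?thesis
      using b g h finite_G by (subst KR.K.finsum_single[where i = g]) (auto simp: e_coord)
  qed
  then show "(e g \<otimes>\<^bsub>H\<^esub> e h) b = e (g \<otimes>\<^bsub>G\<^esub> h) b"
    by (cases "b \<in> carrier G") (simp_all add: group_algebra_def basis_vector_def)
qed

lemma H_one: "\<one>\<^bsub>H\<^esub> = e \<one>\<^bsub>G\<^esub>"
  by (simp add: group_algebra_def basis_vector_def)

lemma counit_e: "g \<in> carrier G \<Longrightarrow> counit H (e g) = \<one>\<^bsub>K\<^esub>"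
  using finite_G
  by (simp add: group_algebra_def, subst KR.K.finsum_single[where i = g])
     (auto simp: basis_vector_def)

definition a :: "'g \<Rightarrow> 'r \<Rightarrow> 'r" where "a g = act (e g)"
definition s :: "'g \<Rightarrow> 'g \<Rightarrow> 'r" where "s g h = \<sigma> (e g) (e h)"
definition t :: "'g \<Rightarrow> 'g \<Rightarrow> 'r" where "t g h = \<tau> (e g) (e h)"

lemma a_carrier: "r \<in> carrier R \<Longrightarrow> a g r \<in> carrier R"
  by (simp add: a_def act_closed e_closed)

lemma s_carrier: "s g h \<in> carrier R" and t_carrier: "t g h \<in> carrier R"
  by (simp_all add: s_def t_def \<sigma>_closed \<tau>_closed e_closed)

lemma a_add: "r \<in> carrier R \<Longrightarrow> r' \<in> carrier R \<Longrightarrow> a g (r \<oplus> r') = a g r \<oplus> a g r'"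
  by (simp add: a_def act_add e_closed)

lemma a_smult: "k \<in> carrier K \<Longrightarrow> r \<in> carrier R \<Longrightarrow> a g (k \<odot> r) = k \<odot> a g r"
  by (simp add: a_def act_smult e_closed)

lemma a_mult: "g \<in> carrier G \<Longrightarrow> r \<in> carrier R \<Longrightarrow> r' \<in> carrier R \<Longrightarrow> a g (r \<otimes> r') = a g r \<otimes> a g r'"
  unfolding a_def act_mult[OF e_closed]
  by (rule sweedler2_e[OF KR.module_axioms]) (auto intro: act_closed e_closed)

lemma a_one: "r \<in> carrier R \<Longrightarrow> a \<one>\<^bsub>G\<^esub> r = r"
  using act_one by (simp add: a_def H_one)

lemma s_t: "g \<in> carrier G \<Longrightarrow> h \<in> carrier G \<Longrightarrow> s g h \<otimes> t g h = \<one>"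
  and t_s: "g \<in> carrier G \<Longrightarrow> h \<in> carrier G \<Longrightarrow> t g h \<otimes> s g h = \<one>"
proof -
  assume g: "g \<in> carrier G" and h: "h \<in> carrier G"
  have c: "(counit H (e g) \<otimes>\<^bsub>K\<^esub> counit H (e h)) \<odot> \<one> = \<one>"
    using g h by (simp add: counit_e)
  have "\<one> = sweedler2 K H R (e g) (\<lambda>h1 h2. sweedler2 K H R (e h) (\<lambda>g1 g2. \<sigma> h1 g1 \<otimes> \<tau> h2 g2))"
    using \<sigma>_\<tau>[OF e_closed e_closed, of g h] c by simp
  also have "\<dots> = sweedler2 K H R (e h) (\<lambda>g1 g2. \<sigma> (e g) g1 \<otimes> \<tau> (e g) g2)"
    by (rule sweedler2_e[OF KR.module_axioms g])
       (intro sweedler2_closed[OF KR.module_axioms hopf] KR.m_closed \<sigma>_closed \<tau>_closed e_closed)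
  also have "\<dots> = s g h \<otimes> t g h" unfolding s_def t_def
    by (rule sweedler2_e[OF KR.module_axioms h]) (intro KR.m_closed \<sigma>_closed \<tau>_closed e_closed)
  finally show "s g h \<otimes> t g h = \<one>" ..
  have "\<one> = sweedler2 K H R (e g) (\<lambda>h1 h2. sweedler2 K H R (e h) (\<lambda>g1 g2. \<tau> h1 g1 \<otimes> \<sigma> h2 g2))"
    using \<tau>_\<sigma>[OF e_closed e_closed, of g h] c by simp
  also have "\<dots> = sweedler2 K H R (e h) (\<lambda>g1 g2. \<tau> (e g) g1 \<otimes> \<sigma> (e g) g2)"
    by (rule sweedler2_e[OF KR.module_axioms g])
       (intro sweedler2_closed[OF KR.module_axioms hopf] KR.m_closed \<sigma>_closed \<tau>_closed e_closed)
  also have "\<dots> = t g h \<otimes> s g h" unfolding s_def t_def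
    by (rule sweedler2_e[OF KR.module_axioms h]) (intro KR.m_closed \<sigma>_closed \<tau>_closed e_closed)
  finally show "t g h \<otimes> s g h = \<one>" ..
qed

lemma sweedler3_e:
  assumes g: "g \<in> carrier G"
    and F: "\<And>b c d. F (e b) (e c) (e d) \<in> carrier R"
  shows "sweedler3 K H R (e g) F = F (e g) (e g) (e g)"
proof -
  have "sweedler3 K H R (e g) F = sweedler2 K H R (e g) (\<lambda>h1 h2. F h1 h2 (e g))"
    unfolding sweedler3_def
    by (rule sweedler2_e[OF KR.module_axioms g])
       (intro sweedler2_closed[OF KR.module_axioms hopf] F e_closed)
  also have "\<dots> = F (e g) (e g) (e g)"
    by (rule sweedler2_e[OF KR.module_axioms g]) (rule F)
  finally show ?thesis .
qed

lemma a_a: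
  assumes g: "g \<in> carrier G" and h: "h \<in> carrier G" and r: "r \<in> carrier R"
  shows "a g (a h r) = s g h \<otimes> a (g \<otimes>\<^bsub>G\<^esub> h) r \<otimes> t g h"
proof -
  note cl = KR.m_closed \<sigma>_closed \<tau>_closed e_closed act_closed H_mult_closed r
  have F: "sweedler3 K H R (e h) (\<lambda>g1 g2 g3. \<sigma> (e b) g1 \<otimes> act (e c \<otimes>\<^bsub>H\<^esub> g2) r \<otimes> \<tau> (e d) g3) =
      \<sigma> (e b) (e h) \<otimes> act (e c \<otimes>\<^bsub>H\<^esub> e h) r \<otimes> \<tau> (e d) (e h)" for b c d
    by (rule sweedler3_e[OF h]) (intro cl)
  have "a g (a h r) = sweedler3 K H R (e g) (\<lambda>h1 h2 h3. sweedler3 K H R (e h) (\<lambda>g1 g2 g3.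
        \<sigma> h1 g1 \<otimes> act (h2 \<otimes>\<^bsub>H\<^esub> g2) r \<otimes> \<tau> h3 g3))"
    unfolding a_def by (rule \<tau>(3)[OF e_closed e_closed r])
  also have "\<dots> = sweedler3 K H R (e h) (\<lambda>g1 g2 g3.
        \<sigma> (e g) g1 \<otimes> act (e g \<otimes>\<^bsub>H\<^esub> g2) r \<otimes> \<tau> (e g) g3)"
    by (rule sweedler3_e[OF g], unfold F) (intro cl)
  also have "\<dots> = s g h \<otimes> a (g \<otimes>\<^bsub>G\<^esub> h) r \<otimes> t g h"
    unfolding F by (simp add: s_def t_def a_def e_mult g h)
  finally show ?thesis .
qed

text \<open>Group elements are group-like, so all Sweedler sums have a single term, and the product
  of the terms at \<open>b\<close> and \<open>c\<close> is concentrated at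
  \<open>b c\<close>.\<close>

lemma pure_mult_coord:
  assumes x: "x \<in> carrier R" and y: "y \<in> carrier R"
    and b: "b \<in> carrier G" and c: "c \<in> carrier G" and w: "w \<in> carrier G"
  shows "pure_mult K H R act \<sigma> x (e b) y (e c) w =
    (if c = inv\<^bsub>G\<^esub> b \<otimes>\<^bsub>G\<^esub> w then x \<otimes> a b y \<otimes> s b c else \<zero>)"
proof -
  note cl = pure_mult_summand_closed x y e_closed sweedler2_closed[OF KA.module_axioms hopf]
  have p: "pure_mult K H R act \<sigma> x (e b) y (e c) =
      pure_tensor H R (x \<otimes> act (e b) y \<otimes> \<sigma> (e b) (e c)) (e b \<otimes>\<^bsub>H\<^esub> e c)"
    unfolding pure_mult_eq
    by (subst sweedler2_e[OF KA.module_axioms b], intro cl,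
        subst sweedler2_e[OF KA.module_axioms b], intro cl,
        rule sweedler2_e[OF KA.module_axioms c], intro cl)
  have "pure_mult K H R act \<sigma> x (e b) y (e c) w =
      e (b \<otimes>\<^bsub>G\<^esub> c) w \<odot> (x \<otimes> a b y \<otimes> s b c)"
    unfolding p using w b c by (simp add: pure_tensor_coord e_mult a_def s_def)
  also have "\<dots> = (if c = inv\<^bsub>G\<^esub> b \<otimes>\<^bsub>G\<^esub> w then x \<otimes> a b y \<otimes> s b c else \<zero>)"
  proof -
    have "w = b \<otimes>\<^bsub>G\<^esub> c \<longleftrightarrow> c = inv\<^bsub>G\<^esub> b \<otimes>\<^bsub>G\<^esub> w"
      using b c w by (metis G.inv_closed G.m_closed G.inv_solve_left)
    then show ?thesis using w x a_carrier[OF y] s_carrier by (simp add: e_coord)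
  qed
  finally show ?thesis .
qed

sublocale free_extension R A "carrier G"
proof (rule free_extensionI[where F = "\<lambda>b c r w.
      if c = inv\<^bsub>G\<^esub> b \<otimes>\<^bsub>G\<^esub> w then a b r \<otimes> s b c else \<zero>"])
  fix x y w assume x: "x \<in> carrier A" and y: "y \<in> carrier A" and w: "w \<in> carrier G"
  show "(x \<otimes>\<^bsub>A\<^esub> y) w = (\<Oplus>b\<in>carrier G. \<Oplus>c\<in>carrier G.
      x b \<otimes> (if c = inv\<^bsub>G\<^esub> b \<otimes>\<^bsub>G\<^esub> w then a b (y c) \<otimes> s b c else \<zero>))"
    unfolding A_mult_coord[OF x y w]
    using x y w A_coord_closed a_carrier s_carrier
    by (intro KR.finsum_cong2) (auto simp: pure_mult_coord KR.m_assoc)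
qed (use a_carrier s_carrier in auto)

lemma mult_coord:
  assumes x: "x \<in> carrier A" and y: "y \<in> carrier A" and w: "w \<in> carrier G"
  shows "(x \<otimes>\<^bsub>A\<^esub> y) w =
    (\<Oplus>b\<in>carrier G. x b \<otimes> a b (y (inv\<^bsub>G\<^esub> b \<otimes>\<^bsub>G\<^esub> w)) \<otimes> s b (inv\<^bsub>G\<^esub> b \<otimes>\<^bsub>G\<^esub> w))"
  unfolding A_mult_coord[OF x y w]
proof (rule KR.finsum_cong'[OF refl])
  note cl = A_coord_closed[OF x] A_coord_closed[OF y] a_carrier s_carrier
  fix b assume b: "b \<in> carrier G"
  show "(\<Oplus>c\<in>carrier G. pure_mult K H R act \<sigma> (x b) (e b) (y c) (e c) w) =
      x b \<otimes> a b (y (inv\<^bsub>G\<^esub> b \<otimes>\<^bsub>G\<^esub> w)) \<otimes> s b (inv\<^bsub>G\<^esub> b \<otimes>\<^bsub>G\<^esub> w)"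
    using b w cl finite_G
    by (subst KR.finsum_single[where i = "inv\<^bsub>G\<^esub> b \<otimes>\<^bsub>G\<^esub> w"]) (auto simp: pure_mult_coord)
qed (use A_coord_closed[OF x] A_coord_closed[OF y] a_carrier s_carrier w in auto)

lemma one_coord: "b \<in> carrier G \<Longrightarrow> \<one>\<^bsub>A\<^esub> b = (if b = \<one>\<^bsub>G\<^esub> then \<one> else \<zero>)"
  by (simp add: A_one H_one e_coord)

lemma emb_coord: "r \<in> carrier R \<Longrightarrow> b \<in> carrier G \<Longrightarrow> emb r b = (if b = \<one>\<^bsub>G\<^esub> then r else \<zero>)"
  by (simp add: emb_def one_coord)

text \<open>
  The right unit law gives \<open>(g \<cdot> 1) \<sigma>(g, 1) = 1\<close>, and \<open>g \<cdot> 1\<close> is idempotent; so both factors are 1.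
\<close>

lemma a_unit: "g \<in> carrier G \<Longrightarrow> a g \<one> = \<one>"
  and s_one: "g \<in> carrier G \<Longrightarrow> s g \<one>\<^bsub>G\<^esub> = \<one>"
proof -
  assume g: "g \<in> carrier G"
  have ac: "a g \<one> \<in> carrier R" by (simp add: a_carrier)
  have "\<one> = unit_vector g g" using g by (simp add: unit_vector_def)
  also have "\<dots> = (unit_vector g \<otimes>\<^bsub>A\<^esub> \<one>\<^bsub>A\<^esub>) g" by simp
  also have "\<dots> = a g \<one> \<otimes> s g \<one>\<^bsub>G\<^esub>"
    unfolding mult_coord[OF unit_vector_closed KA.one_closed g]
    using g ac a_carrier s_carrier finite_G
    by (subst KR.finsum_single[where i = g]) (auto simp: unit_vector_def one_coord)
  finally have us: "a g \<one> \<otimes> s g \<one>\<^bsub>G\<^esub> = \<one>" ..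
  have uu: "a g \<one> \<otimes> a g \<one> = a g \<one>" using a_mult[OF g, of "\<one>" "\<one>"] by simp
  have "a g \<one> = a g \<one> \<otimes> (a g \<one> \<otimes> s g \<one>\<^bsub>G\<^esub>)" using us ac by simp
  also have "\<dots> = a g \<one> \<otimes> a g \<one> \<otimes> s g \<one>\<^bsub>G\<^esub>" by (simp only: KR.m_assoc ac s_carrier)
  also have "\<dots> = \<one>" unfolding uu us ..
  finally show "a g \<one> = \<one>" .
  with us s_carrier show "s g \<one>\<^bsub>G\<^esub> = \<one>" by simp
qed

lemma a_null: "a g \<zero> = \<zero>"
  by (simp add: a_def act_zero e_closed)

lemma mult_emb_coord:
  assumes x: "x \<in> carrier A" and r: "r \<in> carrier R" and w: "w \<in> carrier G"
  shows "(x \<otimes>\<^bsub>A\<^esub> emb r) w = x w \<otimes> a w r"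
proof -
  have "inv\<^bsub>G\<^esub> b \<otimes>\<^bsub>G\<^esub> w = \<one>\<^bsub>G\<^esub> \<longleftrightarrow> b = w" if "b \<in> carrier G" for b
    using that w by (metis G.inv_closed G.l_inv G.inv_solve_left G.r_one G.one_closed)
  then show ?thesis
    unfolding mult_coord[OF x emb_closed[OF r] w]
    using w r A_coord_closed[OF x] a_carrier s_carrier finite_G
    by (subst KR.finsum_single[where i = w]) (auto simp: emb_coord a_null s_one)
qed

text \<open>Composing \<open>a g\<close> with the map at the inverse of \<open>g\<close> gives, in
  either order, conjugation by an invertible value of the cocycle, so \<open>a g\<close> is
  bijective. It preserves \<one> by \<open>a_unit\<close>.\<close>

lemma a_iso:
  assumes g: "g \<in> carrier G"
  shows "a g \<in> ring_iso R R"
proof -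
  let ?h = "inv\<^bsub>G\<^esub> g"
  have gh: "a g (a ?h r) = s g ?h \<otimes> r \<otimes> t g ?h" and
    hg: "a ?h (a g r) = s ?h g \<otimes> r \<otimes> t ?h g" if "r \<in> carrier R" for r
    using a_a[of g ?h r] a_a[of ?h g r] g that by (simp_all add: a_one)
  have inj: "inj_on (a g) (carrier R)"
  proof (rule inj_on_inverseI)
    fix r assume r: "r \<in> carrier R"
    have "t ?h g \<otimes> a ?h (a g r) \<otimes> s ?h g =
        (t ?h g \<otimes> s ?h g) \<otimes> r \<otimes> (t ?h g \<otimes> s ?h g)"
      unfolding hg[OF r] using r s_carrier t_carrier by (simp add: KR.m_assoc)
    then show "t ?h g \<otimes> a ?h (a g r) \<otimes> s ?h g = r"
      using r g by (simp add: t_s)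
  qed
  have "r \<in> a g ` carrier R" if r: "r \<in> carrier R" for r
  proof
    let ?r = "t g ?h \<otimes> r \<otimes> s g ?h"
    have rc: "?r \<in> carrier R" using r s_carrier t_carrier by simp
    then show "a ?h ?r \<in> carrier R" by (rule a_carrier)
    have "a g (a ?h ?r) = (s g ?h \<otimes> t g ?h) \<otimes> r \<otimes> (s g ?h \<otimes> t g ?h)"
      unfolding gh[OF rc] using r s_carrier t_carrier by (simp add: KR.m_assoc)
    then show "r = a g (a ?h ?r)" using r g by (simp add: s_t)
  qed
  then have "bij_betw (a g) (carrier R) (carrier R)"
    using inj a_carrier by (auto simp: bij_betw_def)
  then show ?thesis
    using g by (intro ring_iso_memI) (auto simp: a_carrier a_mult a_add a_unit)
qed

lemma unit_mult_emb:
  assumes g: "g \<in> carrier G" and r: "r \<in> carrier R"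
  shows "unit_vector g \<otimes>\<^bsub>A\<^esub> emb r = emb (a g r) \<otimes>\<^bsub>A\<^esub> unit_vector g"
proof (rule coord_eqI)
  show "(unit_vector g \<otimes>\<^bsub>A\<^esub> emb r) w = (emb (a g r) \<otimes>\<^bsub>A\<^esub> unit_vector g) w" if "w \<in> carrier G" for w
    using that g r a_carrier
    by (simp add: mult_emb_coord coord_emb_unit_vector) (simp add: unit_vector_def)
qed (use r a_carrier in auto)

lemma unit_mult_unit:
  assumes g: "g \<in> carrier G" and h: "h \<in> carrier G"
  shows "unit_vector g \<otimes>\<^bsub>A\<^esub> unit_vector h = emb (s g h) \<otimes>\<^bsub>A\<^esub> unit_vector (g \<otimes>\<^bsub>G\<^esub> h)"
proof (rule coord_eqI)
  fix w assume w: "w \<in> carrier G"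
  have i: "inv\<^bsub>G\<^esub> g \<otimes>\<^bsub>G\<^esub> w = h \<longleftrightarrow> w = g \<otimes>\<^bsub>G\<^esub> h"
    using g h w by (metis G.inv_closed G.m_closed G.inv_solve_left)
  have "(unit_vector g \<otimes>\<^bsub>A\<^esub> unit_vector h) w =
      a g (unit_vector h (inv\<^bsub>G\<^esub> g \<otimes>\<^bsub>G\<^esub> w)) \<otimes> s g (inv\<^bsub>G\<^esub> g \<otimes>\<^bsub>G\<^esub> w)"
    unfolding mult_coord[OF unit_vector_closed unit_vector_closed w]
    using g h w a_carrier[OF coord_closed[OF unit_vector_closed]] s_carrier finite_G
    by (subst KR.finsum_single[where i = g]) (auto simp: unit_vector_def[of g])
  also have "\<dots> = (if w = g \<otimes>\<^bsub>G\<^esub> h then s g h else \<zero>)"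
    using g h w s_carrier i by (auto simp: unit_vector_def a_unit a_null)
  also have "\<dots> = (emb (s g h) \<otimes>\<^bsub>A\<^esub> unit_vector (g \<otimes>\<^bsub>G\<^esub> h)) w"
    using g h w s_carrier by (simp add: coord_emb_unit_vector)
  finally show "(unit_vector g \<otimes>\<^bsub>A\<^esub> unit_vector h) w =
      (emb (s g h) \<otimes>\<^bsub>A\<^esub> unit_vector (g \<otimes>\<^bsub>G\<^esub> h)) w" .
qed (use s_carrier in auto)

sublocale group_crossed_product R A G a s t
proof
  show "unit_vector \<one>\<^bsub>G\<^esub> = \<one>\<^bsub>A\<^esub>"
    by (rule coord_eqI) (simp_all add: one_coord, simp add: unit_vector_def)
qed (use a_iso s_carrier t_carrier s_t t_s a_a unit_mult_emb unit_mult_unit in auto)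

text \<open>The product rules are compared coordinate by coordinate. The normalisations enter here:
  \<open>s_one\<close>, through \<open>mult_emb_coord\<close>, for the first rule and
  \<open>a_unit\<close> for the second.\<close>

sublocale modules: hopf_crossed_product K H R act \<sigma> "carrier G"
proof
  fix h r assume h: "h \<in> carrier H" and r: "r \<in> carrier R"
  note hc = H_coord_closed[OF h]
  let ?T = "pure_tensor H R \<one>"
  let ?F = "\<lambda>h1 h2. emb (act h1 r) \<otimes>\<^bsub>A\<^esub> ?T h2"
  have Tc: "?T g \<in> carrier A" if "g \<in> carrier H" for g using that by (intro pure_tensor_closed) auto
  have Fc: "?F (e c) (e d) \<in> carrier A" for c d
    using r Tc e_closed act_closed by simp
  show "?T h \<otimes>\<^bsub>A\<^esub> emb r = sweedler2 K H A h ?F"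
    unfolding sweedler2_eq[where F = ?F, OF KA.module_axioms h Fc]
  proof (rule coord_eqI)
    fix w assume w: "w \<in> carrier G"
    have "(\<Oplus>\<^bsub>A\<^esub>c\<in>carrier G. h c \<odot>\<^bsub>A\<^esub> ?F (e c) (e c)) w =
        (\<Oplus>c\<in>carrier G. (h c \<odot>\<^bsub>A\<^esub> ?F (e c) (e c)) w)"
      using Fc hc by (intro coord_finsum w) auto
    also have "\<dots> = (\<Oplus>c\<in>carrier G. if c = w then h w \<odot> a w r else \<zero>)"
      using w hc r a_carrier[OF r] Tc e_closed act_closed
      by (intro KR.finsum_cong')
         (auto simp: A_smult coord_emb_mult pure_tensor_coord e_coord a_def)
    also have "\<dots> = h w \<odot> a w r"
      using w hc a_carrier[OF r] finite_G by (subst KR.finsum_single[where i = w]) auto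
    also have "\<dots> = (?T h \<otimes>\<^bsub>A\<^esub> emb r) w"
      using w hc[OF w] a_carrier[OF r] Tc[OF h] r
      by (simp add: mult_emb_coord pure_tensor_coord KR.smult_mult_left)
    finally show "(?T h \<otimes>\<^bsub>A\<^esub> emb r) w = (\<Oplus>\<^bsub>A\<^esub>c\<in>carrier G. h c \<odot>\<^bsub>A\<^esub> ?F (e c) (e c)) w" ..
  qed (use Tc[OF h] r Fc hc in \<open>auto intro!: KA.finsum_closed\<close>)
next
  fix h g assume h: "h \<in> carrier H" and g: "g \<in> carrier H"
  note hc = H_coord_closed[OF h] and gc = H_coord_closed[OF g]
  let ?T = "pure_tensor H R \<one>"
  let ?F = "\<lambda>h1 h2 g1 g2. emb (\<sigma> h1 g1) \<otimes>\<^bsub>A\<^esub> ?T (h2 \<otimes>\<^bsub>H\<^esub> g2)"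
  have Tc: "?T g \<in> carrier A" if "g \<in> carrier H" for g using that by (intro pure_tensor_closed) auto
  have Fc: "?F (e b) (e c) (e d) (e f) \<in> carrier A" for b c d f
    using Tc e_closed \<sigma>_closed H_mult_closed by simp
  have in': "sweedler2 K H A g (?F (e b) (e c)) = (\<Oplus>\<^bsub>A\<^esub>d\<in>carrier G. g d \<odot>\<^bsub>A\<^esub> ?F (e b) (e c) (e d) (e d))"
    for b c
    by (rule sweedler2_eq[OF KA.module_axioms g]) (rule Fc)
  have inc: "(\<Oplus>\<^bsub>A\<^esub>d\<in>carrier G. g d \<odot>\<^bsub>A\<^esub> ?F (e b) (e c) (e d) (e d)) \<in> carrier A" for b c
    using Fc gc by (intro KA.finsum_closed) auto
  have "sweedler2 K H A h (\<lambda>h1 h2. sweedler2 K H A g (?F h1 h2)) =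
      (\<Oplus>\<^bsub>A\<^esub>b\<in>carrier G. h b \<odot>\<^bsub>A\<^esub> sweedler2 K H A g (?F (e b) (e b)))"
    by (rule sweedler2_eq[OF KA.module_axioms h]) (unfold in', rule inc)
  also have "\<dots> = ?T h \<otimes>\<^bsub>A\<^esub> ?T g"
    unfolding in'
  proof (rule coord_eqI)
    fix w assume w: "w \<in> carrier G"
    have "(\<Oplus>\<^bsub>A\<^esub>b\<in>carrier G. h b \<odot>\<^bsub>A\<^esub> (\<Oplus>\<^bsub>A\<^esub>d\<in>carrier G. g d \<odot>\<^bsub>A\<^esub> ?F (e b) (e b) (e d) (e d))) w =
        (\<Oplus>b\<in>carrier G. (h b \<odot>\<^bsub>A\<^esub> (\<Oplus>\<^bsub>A\<^esub>d\<in>carrier G. g d \<odot>\<^bsub>A\<^esub> ?F (e b) (e b) (e d) (e d))) w)"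
      using inc hc by (intro coord_finsum w) auto
    also have "\<dots> = (\<Oplus>b\<in>carrier G. (h b \<odot> \<one>) \<otimes>
        a b (g (inv\<^bsub>G\<^esub> b \<otimes>\<^bsub>G\<^esub> w) \<odot> \<one>) \<otimes> s b (inv\<^bsub>G\<^esub> b \<otimes>\<^bsub>G\<^esub> w))"
    proof (rule KR.finsum_cong'[OF refl])
      fix b assume b: "b \<in> carrier G"
      let ?d = "inv\<^bsub>G\<^esub> b \<otimes>\<^bsub>G\<^esub> w"
      have i: "w = b \<otimes>\<^bsub>G\<^esub> d \<longleftrightarrow> d = ?d" if "d \<in> carrier G" for d
        using b w that by (metis G.inv_closed G.m_closed G.inv_solve_left)
      have "(\<Oplus>\<^bsub>A\<^esub>d\<in>carrier G. g d \<odot>\<^bsub>A\<^esub> ?F (e b) (e b) (e d) (e d)) w =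
          (\<Oplus>d\<in>carrier G. (g d \<odot>\<^bsub>A\<^esub> ?F (e b) (e b) (e d) (e d)) w)"
        using Fc gc by (intro coord_finsum w) auto
      also have "\<dots> = (\<Oplus>d\<in>carrier G. if d = ?d then g d \<odot> s b d else \<zero>)"
        using w b gc s_carrier Tc e_closed \<sigma>_closed i
        by (intro KR.finsum_cong')
           (auto simp: A_smult coord_emb_mult pure_tensor_coord e_mult e_coord s_def)
      also have "\<dots> = g ?d \<odot> s b ?d"
        using w b gc s_carrier finite_G by (subst KR.finsum_single[where i = ?d]) auto
      finally show "(h b \<odot>\<^bsub>A\<^esub> (\<Oplus>\<^bsub>A\<^esub>d\<in>carrier G. g d \<odot>\<^bsub>A\<^esub> ?F (e b) (e b) (e d) (e d))) w =
          (h b \<odot> \<one>) \<otimes> a b (g ?d \<odot> \<one>) \<otimes> s b ?d"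
        using b w hc gc s_carrier
        by (simp add: A_smult a_smult a_unit KR.smult_mult_left)
    qed (use hc gc w a_carrier s_carrier in auto)
    also have "\<dots> = (?T h \<otimes>\<^bsub>A\<^esub> ?T g) w"
      unfolding mult_coord[OF Tc[OF h] Tc[OF g] w]
      using hc gc w a_carrier s_carrier by (intro KR.finsum_cong') (auto simp: pure_tensor_coord)
    finally show "(\<Oplus>\<^bsub>A\<^esub>b\<in>carrier G. h b \<odot>\<^bsub>A\<^esub> (\<Oplus>\<^bsub>A\<^esub>d\<in>carrier G. g d \<odot>\<^bsub>A\<^esub> ?F (e b) (e b) (e d) (e d))) w =
        (?T h \<otimes>\<^bsub>A\<^esub> ?T g) w" .
  qed (use Tc h g inc hc in \<open>auto intro!: KA.finsum_closed\<close>)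
  finally show "?T h \<otimes>\<^bsub>A\<^esub> ?T g = sweedler2 K H A h (\<lambda>h1 h2. sweedler2 K H A g (?F h1 h2))" ..
qed (use field_K hopf basis_eq twisted KR.k_algebra_axioms KA.k_algebra_axioms in auto)

theorem radicals:
  assumes "[order G] \<cdot>\<^bsub>K\<^esub> \<one>\<^bsub>K\<^esub> \<in> Units K"
  shows "jacobson_radical R = H_jacobson_radical K H R act \<sigma> \<and>
    H_jacobson_radical K H R act \<sigma> = H_jacobson_core H R act \<and>
    jacobson_radical A = tensor_image H R (H_jacobson_radical K H R act \<sigma>)"
proof -
  obtain c where c: "c \<in> carrier R" "c \<otimes> (\<Oplus>g\<in>carrier G. \<one>) = \<one>"
    by (rule KR.inverse_order[OF finite_G assms])
  \<comment> \<open>The identity of \<open>G\<close> serves as \<open>b0\<close>: the unit of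
    \<open>A\<close> is concentrated there.\<close>
  show ?thesis
    using modules.radicals_eq[OF jacobson_radical_eq[OF c] _ G.one_closed] a_jacobson_radical
    by (simp add: one_coord a_def)
qed

end

subsection \<open>The dual of the group algebra\<close>

locale dual_group_algebra_crossed_product =
    finite_group_crossed_product K G "dual_hopf K (group_algebra K G)" R act \<sigma>
  for K :: "('k, 'z) ring_scheme" and G :: "('g, 'y) monoid_scheme"
    and R :: "('k, 'r, 'x) module_scheme" (structure)
    and act :: "('g \<Rightarrow> 'k) \<Rightarrow> 'r \<Rightarrow> 'r" and \<sigma> :: "('g \<Rightarrow> 'k) \<Rightarrow> ('g \<Rightarrow> 'k) \<Rightarrow> 'r"
begin

abbreviation H :: "('k, 'g) hopf" where "H \<equiv> dual_hopf K (group_algebra K G)"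

lemma H_structure:
  assumes "h \<in> carrier H" "h' \<in> carrier H"
  shows "h \<otimes>\<^bsub>H\<^esub> h' = (\<lambda>g\<in>carrier G. h g \<otimes>\<^bsub>K\<^esub> h' g)"
    and "\<one>\<^bsub>H\<^esub> = (\<lambda>g\<in>carrier G. \<one>\<^bsub>K\<^esub>)"
    and "\<lbrakk>c \<in> carrier G; d \<in> carrier G\<rbrakk> \<Longrightarrow> comult H h c d = h (c \<otimes>\<^bsub>G\<^esub> d)"
    and "counit H h = h \<one>\<^bsub>G\<^esub>"
  using dual_group_algebra[OF field_K G.group_axioms finite_G assms[unfolded H_carrier]] by simp_all

lemma e_mult_coord:
  "w \<in> carrier G \<Longrightarrow> (e c \<otimes>\<^bsub>H\<^esub> e d) w = (if w = c \<and> w = d then \<one>\<^bsub>K\<^esub> else \<zero>\<^bsub>K\<^esub>)"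
  unfolding H_structure(1)[OF e_closed e_closed] by (simp add: e_coord)

lemma sweedler2_eq:
  assumes V: "module K V" and h: "h \<in> carrier H"
    and F: "\<And>c d. c \<in> carrier G \<Longrightarrow> d \<in> carrier G \<Longrightarrow> F (e c) (e d) \<in> carrier V"
  shows "sweedler2 K H V h F =
    (\<Oplus>\<^bsub>V\<^esub>c\<in>carrier G. \<Oplus>\<^bsub>V\<^esub>d\<in>carrier G. h (c \<otimes>\<^bsub>G\<^esub> d) \<odot>\<^bsub>V\<^esub> F (e c) (e d))"
proof -
  interpret V: module K V by (rule V)
  show ?thesis
    unfolding sweedler2_def basis_eq using F H_coord_closed[OF h]
    by (intro V.finsum_cong2) (auto simp: H_structure(3)[OF h h])
qed

text \<open>The coproduct of the dual basis vector at \<open>g\<close> runs over the factorisations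
  of \<open>g\<close> in the group.\<close>

lemma sweedler2_e:
  assumes V: "module K V" and g: "g \<in> carrier G"
    and F: "\<And>c d. c \<in> carrier G \<Longrightarrow> d \<in> carrier G \<Longrightarrow> F (e c) (e d) \<in> carrier V"
  shows "sweedler2 K H V (e g) F = (\<Oplus>\<^bsub>V\<^esub>c\<in>carrier G. F (e c) (e (inv\<^bsub>G\<^esub> c \<otimes>\<^bsub>G\<^esub> g)))"
proof -
  interpret V: module K V by (rule V)
  have "sweedler2 K H V (e g) F =
      (\<Oplus>\<^bsub>V\<^esub>c\<in>carrier G. \<Oplus>\<^bsub>V\<^esub>d\<in>carrier G. e g (c \<otimes>\<^bsub>G\<^esub> d) \<odot>\<^bsub>V\<^esub> F (e c) (e d))"
    by (rule sweedler2_eq[OF V e_closed]) (rule F)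
  also have "\<dots> = (\<Oplus>\<^bsub>V\<^esub>c\<in>carrier G. F (e c) (e (inv\<^bsub>G\<^esub> c \<otimes>\<^bsub>G\<^esub> g)))"
  proof (rule V.finsum_cong'[OF refl])
    fix c assume c: "c \<in> carrier G"
    have "c \<otimes>\<^bsub>G\<^esub> d = g \<longleftrightarrow> d = inv\<^bsub>G\<^esub> c \<otimes>\<^bsub>G\<^esub> g" if "d \<in> carrier G" for d
      using c g that by (metis G.inv_solve_left)
    then show "(\<Oplus>\<^bsub>V\<^esub>d\<in>carrier G. e g (c \<otimes>\<^bsub>G\<^esub> d) \<odot>\<^bsub>V\<^esub> F (e c) (e d)) = F (e c) (e (inv\<^bsub>G\<^esub> c \<otimes>\<^bsub>G\<^esub> g))"
      using c g F finite_G
      by (subst V.finsum_single[where i = "inv\<^bsub>G\<^esub> c \<otimes>\<^bsub>G\<^esub> g"]) (auto simp: e_coord)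
  qed (use F g in auto)
  finally show ?thesis .
qed

definition a :: "'g \<Rightarrow> 'r \<Rightarrow> 'r" where "a g = act (e g)"
definition s :: "'g \<Rightarrow> 'g \<Rightarrow> 'r" where "s g h = \<sigma> (e g) (e h)"
definition t :: "'g \<Rightarrow> 'g \<Rightarrow> 'r" where "t g h = \<tau> (e g) (e h)"

lemma a_carrier: "r \<in> carrier R \<Longrightarrow> a g r \<in> carrier R"
  by (simp add: a_def act_closed e_closed)

lemma s_carrier: "s g h \<in> carrier R" and t_carrier: "t g h \<in> carrier R"
  by (simp_all add: s_def t_def \<sigma>_closed \<tau>_closed e_closed)

lemma a_smult: "k \<in> carrier K \<Longrightarrow> r \<in> carrier R \<Longrightarrow> a g (k \<odot> r) = k \<odot> a g r"
  by (simp add: a_def act_smult e_closed)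

lemma a_unit_expansion:
  assumes g: "g \<in> carrier G"
  shows "a g \<one> = (\<Oplus>u\<in>carrier G. a u \<one> \<otimes> a (inv\<^bsub>G\<^esub> u \<otimes>\<^bsub>G\<^esub> g) \<one>)"
proof -
  have "a g \<one> = act (e g) (\<one> \<otimes> \<one>)" by (simp add: a_def)
  also have "\<dots> = sweedler2 K H R (e g) (\<lambda>h1 h2. act h1 \<one> \<otimes> act h2 \<one>)"
    by (rule act_mult[OF e_closed]) simp_all
  also have "\<dots> = (\<Oplus>u\<in>carrier G. a u \<one> \<otimes> a (inv\<^bsub>G\<^esub> u \<otimes>\<^bsub>G\<^esub> g) \<one>)"
    unfolding a_def
    by (rule sweedler2_e[OF KR.module_axioms g]) (simp add: act_closed e_closed)
  finally show ?thesis .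
qed

lemma t_s_convolution:
  assumes g: "g \<in> carrier G" and h: "h \<in> carrier G"
  shows "(\<Oplus>p\<in>carrier G. \<Oplus>q\<in>carrier G. t p q \<otimes> s (inv\<^bsub>G\<^esub> p \<otimes>\<^bsub>G\<^esub> g) (inv\<^bsub>G\<^esub> q \<otimes>\<^bsub>G\<^esub> h)) =
    (if g = \<one>\<^bsub>G\<^esub> \<and> h = \<one>\<^bsub>G\<^esub> then \<one> else \<zero>)"
proof -
  have in': "sweedler2 K H R (e h) (\<lambda>g1 g2. \<tau> (e p) g1 \<otimes> \<sigma> (e p') g2) =
      (\<Oplus>q\<in>carrier G. t p q \<otimes> s p' (inv\<^bsub>G\<^esub> q \<otimes>\<^bsub>G\<^esub> h))" for p p'
    unfolding s_def t_def
    by (rule sweedler2_e[OF KR.module_axioms h]) (simp add: \<sigma>_closed \<tau>_closed e_closed)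
  have inc: "(\<Oplus>q\<in>carrier G. t p q \<otimes> s p' (inv\<^bsub>G\<^esub> q \<otimes>\<^bsub>G\<^esub> h)) \<in> carrier R" for p p'
    using s_carrier t_carrier by (intro KR.finsum_closed) auto
  have "(\<Oplus>p\<in>carrier G. \<Oplus>q\<in>carrier G. t p q \<otimes> s (inv\<^bsub>G\<^esub> p \<otimes>\<^bsub>G\<^esub> g) (inv\<^bsub>G\<^esub> q \<otimes>\<^bsub>G\<^esub> h)) =
      sweedler2 K H R (e g) (\<lambda>h1 h2. sweedler2 K H R (e h) (\<lambda>g1 g2. \<tau> h1 g1 \<otimes> \<sigma> h2 g2))"
    unfolding in'[symmetric]
    by (rule sweedler2_e[OF KR.module_axioms g, symmetric]) (unfold in', rule inc)
  also have "\<dots> = (counit H (e g) \<otimes>\<^bsub>K\<^esub> counit H (e h)) \<odot> \<one>"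
    by (rule \<tau>_\<sigma>[OF e_closed e_closed])
  also have "\<dots> = (if g = \<one>\<^bsub>G\<^esub> \<and> h = \<one>\<^bsub>G\<^esub> then \<one> else \<zero>)"
    by (auto simp: H_structure(4)[OF e_closed e_closed] e_coord)
  finally show ?thesis .
qed

text \<open>Two dual basis vectors have a nonzero product only if they coincide. At \<open>w\<close>
  this forces the last factors split off from \<open>e b\<close> and \<open>e c\<close> to be
  \<open>e w\<close>. The parts split off before them then sit at \<open>b w^-1\<close> and
  \<open>c w^-1\<close>, and only the further splitting of the former, by \<open>u\<close>, is
  summed.\<close>

lemma pure_mult_coord:
  assumes x: "x \<in> carrier R" and y: "y \<in> carrier R"
    and b: "b \<in> carrier G" and c: "c \<in> carrier G" and w: "w \<in> carrier G"
  shows "pure_mult K H R act \<sigma> x (e b) y (e c) w = x \<otimes>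
    (\<Oplus>u\<in>carrier G. a u y \<otimes> s (inv\<^bsub>G\<^esub> u \<otimes>\<^bsub>G\<^esub> (b \<otimes>\<^bsub>G\<^esub> inv\<^bsub>G\<^esub> w)) (c \<otimes>\<^bsub>G\<^esub> inv\<^bsub>G\<^esub> w))"
proof -
  note cl = pure_mult_summand_closed x y e_closed sweedler2_closed[OF KA.module_axioms hopf]
  let ?m = "\<lambda>u d p. x \<otimes> act (e u) y \<otimes> \<sigma> (e (inv\<^bsub>G\<^esub> u \<otimes>\<^bsub>G\<^esub> d)) (e p)"
  let ?p = "\<lambda>d u p. pure_tensor H R (?m u d p) (e (inv\<^bsub>G\<^esub> d \<otimes>\<^bsub>G\<^esub> b) \<otimes>\<^bsub>H\<^esub> e (inv\<^bsub>G\<^esub> p \<otimes>\<^bsub>G\<^esub> c))"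
  let ?d = "b \<otimes>\<^bsub>G\<^esub> inv\<^bsub>G\<^esub> w" and ?q = "c \<otimes>\<^bsub>G\<^esub> inv\<^bsub>G\<^esub> w"
  have pc: "?p d u p \<in> carrier A" for d u p by (intro cl)
  have mc: "?m u d p \<in> carrier R" for u d p
    using x y by (simp add: act_closed \<sigma>_closed e_closed)
  have 1: "sweedler2 K H A (e c) (\<lambda>g1 g2. pure_tensor H R
        (x \<otimes> act (e u) y \<otimes> \<sigma> (e (inv\<^bsub>G\<^esub> u \<otimes>\<^bsub>G\<^esub> d)) g1) (e (inv\<^bsub>G\<^esub> d \<otimes>\<^bsub>G\<^esub> b) \<otimes>\<^bsub>H\<^esub> g2)) =
      (\<Oplus>\<^bsub>A\<^esub>p\<in>carrier G. ?p d u p)" for u d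
    by (rule sweedler2_e[OF KA.module_axioms c]) (intro cl)
  have 2: "sweedler2 K H A (e d) (\<lambda>h1 h2. sweedler2 K H A (e c) (\<lambda>g1 g2. pure_tensor H R
        (x \<otimes> act h1 y \<otimes> \<sigma> h2 g1) (e (inv\<^bsub>G\<^esub> d \<otimes>\<^bsub>G\<^esub> b) \<otimes>\<^bsub>H\<^esub> g2))) =
      (\<Oplus>\<^bsub>A\<^esub>u\<in>carrier G. \<Oplus>\<^bsub>A\<^esub>p\<in>carrier G. ?p d u p)" if "d \<in> carrier G" for d
    unfolding 1[symmetric] by (rule sweedler2_e[OF KA.module_axioms that]) (intro cl)
  have "pure_mult K H R act \<sigma> x (e b) y (e c) = (\<Oplus>\<^bsub>A\<^esub>d\<in>carrier G.
      sweedler2 K H A (e d) (\<lambda>h1 h2. sweedler2 K H A (e c) (\<lambda>g1 g2. pure_tensor H R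
        (x \<otimes> act h1 y \<otimes> \<sigma> h2 g1) (e (inv\<^bsub>G\<^esub> d \<otimes>\<^bsub>G\<^esub> b) \<otimes>\<^bsub>H\<^esub> g2))))"
    unfolding pure_mult_eq by (rule sweedler2_e[OF KA.module_axioms b]) (intro cl)
  also have "\<dots> = (\<Oplus>\<^bsub>A\<^esub>d\<in>carrier G. \<Oplus>\<^bsub>A\<^esub>u\<in>carrier G. \<Oplus>\<^bsub>A\<^esub>p\<in>carrier G. ?p d u p)"
    using pc by (intro KA.finsum_cong'[OF refl] 2) (auto intro!: KA.finsum_closed)
  finally have "pure_mult K H R act \<sigma> x (e b) y (e c) w =
      (\<Oplus>\<^bsub>A\<^esub>d\<in>carrier G. \<Oplus>\<^bsub>A\<^esub>u\<in>carrier G. \<Oplus>\<^bsub>A\<^esub>p\<in>carrier G. ?p d u p) w" by simp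
  also have "\<dots> = (\<Oplus>d\<in>carrier G. (\<Oplus>\<^bsub>A\<^esub>u\<in>carrier G. \<Oplus>\<^bsub>A\<^esub>p\<in>carrier G. ?p d u p) w)"
    using pc by (intro A_finsum finite_G w) (auto intro!: KA.finsum_closed)
  also have "\<dots> = (\<Oplus>d\<in>carrier G. if d = ?d then \<Oplus>u\<in>carrier G. ?m u ?d ?q else \<zero>)"
  proof (rule KR.finsum_cong'[OF refl])
    fix d assume d: "d \<in> carrier G"
    have i: "w = inv\<^bsub>G\<^esub> d \<otimes>\<^bsub>G\<^esub> b \<longleftrightarrow> d = ?d"
      using b w d by (metis G.inv_closed G.inv_solve_left G.inv_solve_right)
    have j: "w = inv\<^bsub>G\<^esub> p \<otimes>\<^bsub>G\<^esub> c \<longleftrightarrow> p = ?q" if "p \<in> carrier G" for p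
      using c w that by (metis G.inv_closed G.inv_solve_left G.inv_solve_right)
    have "(\<Oplus>\<^bsub>A\<^esub>u\<in>carrier G. \<Oplus>\<^bsub>A\<^esub>p\<in>carrier G. ?p d u p) w =
        (\<Oplus>u\<in>carrier G. (\<Oplus>\<^bsub>A\<^esub>p\<in>carrier G. ?p d u p) w)"
      using pc by (intro A_finsum finite_G w) (auto intro!: KA.finsum_closed)
    also have "\<dots> = (\<Oplus>u\<in>carrier G. if d = ?d then ?m u ?d ?q else \<zero>)"
    proof (rule KR.finsum_cong'[OF refl])
      fix u assume u: "u \<in> carrier G"
      have "(\<Oplus>\<^bsub>A\<^esub>p\<in>carrier G. ?p d u p) w = (\<Oplus>p\<in>carrier G. ?p d u p w)"
        using pc by (intro A_finsum finite_G w)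
      also have "\<dots> = ?p d u ?q w"
        using w c pc mc j A_coord_closed[OF pc w]
        by (intro KR.finsum_single finite_G) (auto simp: pure_tensor_coord e_mult_coord)
      also have "\<dots> = (if d = ?d then ?m u ?d ?q else \<zero>)"
        using w c mc i j[of ?q] by (auto simp: pure_tensor_coord e_mult_coord)
      finally show "(\<Oplus>\<^bsub>A\<^esub>p\<in>carrier G. ?p d u p) w = (if d = ?d then ?m u ?d ?q else \<zero>)" .
    qed (use mc in auto)
    also have "\<dots> = (if d = ?d then \<Oplus>u\<in>carrier G. ?m u ?d ?q else \<zero>)" by simp
    finally show "(\<Oplus>\<^bsub>A\<^esub>u\<in>carrier G. \<Oplus>\<^bsub>A\<^esub>p\<in>carrier G. ?p d u p) w =
        (if d = ?d then \<Oplus>u\<in>carrier G. ?m u ?d ?q else \<zero>)" .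
  qed (use mc in \<open>auto intro!: KR.finsum_closed\<close>)
  also have "\<dots> = (\<Oplus>u\<in>carrier G. ?m u ?d ?q)"
  proof -
    have "(\<Oplus>u\<in>carrier G. ?m u ?d ?q) \<in> carrier R" using mc by (intro KR.finsum_closed) auto
    then show ?thesis using b w finite_G by (subst KR.finsum_single[where i = ?d]) auto
  qed
  also have "\<dots> = (\<Oplus>u\<in>carrier G. x \<otimes> (a u y \<otimes> s (inv\<^bsub>G\<^esub> u \<otimes>\<^bsub>G\<^esub> ?d) ?q))"
    unfolding a_def s_def using x y
    by (intro KR.finsum_cong') (auto simp: KR.m_assoc act_closed \<sigma>_closed e_closed)
  also have "\<dots> = x \<otimes> (\<Oplus>u\<in>carrier G. a u y \<otimes> s (inv\<^bsub>G\<^esub> u \<otimes>\<^bsub>G\<^esub> ?d) ?q)"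
    using x y a_carrier s_carrier by (intro KR.finsum_rdistr[symmetric] finite_G) auto
  finally show ?thesis .
qed

lemma inner_closed: "r \<in> carrier R \<Longrightarrow>
    (\<Oplus>u\<in>carrier G. a u r \<otimes> s (inv\<^bsub>G\<^esub> u \<otimes>\<^bsub>G\<^esub> b) c) \<in> carrier R"
  using a_carrier s_carrier by (intro KR.finsum_closed) auto

sublocale free_extension R A "carrier G"
proof (rule free_extensionI[where F = "\<lambda>b c r w.
      \<Oplus>u\<in>carrier G. a u r \<otimes> s (inv\<^bsub>G\<^esub> u \<otimes>\<^bsub>G\<^esub> (b \<otimes>\<^bsub>G\<^esub> inv\<^bsub>G\<^esub> w)) (c \<otimes>\<^bsub>G\<^esub> inv\<^bsub>G\<^esub> w)"])
  fix x y w assume x: "x \<in> carrier A" and y: "y \<in> carrier A" and w: "w \<in> carrier G"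
  show "(x \<otimes>\<^bsub>A\<^esub> y) w = (\<Oplus>b\<in>carrier G. \<Oplus>c\<in>carrier G. x b \<otimes>
      (\<Oplus>u\<in>carrier G. a u (y c) \<otimes> s (inv\<^bsub>G\<^esub> u \<otimes>\<^bsub>G\<^esub> (b \<otimes>\<^bsub>G\<^esub> inv\<^bsub>G\<^esub> w)) (c \<otimes>\<^bsub>G\<^esub> inv\<^bsub>G\<^esub> w)))"
    unfolding A_mult_coord[OF x y w]
    using x y w A_coord_closed inner_closed
    by (intro KR.finsum_cong2) (auto simp: pure_mult_coord)
qed (rule inner_closed)

text \<open>Replacing \<open>b\<close> and \<open>c\<close> by \<open>b w\<close> and
  \<open>c w\<close> frees the arguments of the cocycle from \<open>w\<close>; this is the form that
  shows translations to be multiplicative.\<close>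

lemma mult_coord_shifted:
  assumes x: "x \<in> carrier A" and y: "y \<in> carrier A" and w: "w \<in> carrier G"
  shows "(x \<otimes>\<^bsub>A\<^esub> y) w = (\<Oplus>b\<in>carrier G. \<Oplus>c\<in>carrier G. x (b \<otimes>\<^bsub>G\<^esub> w) \<otimes>
    (\<Oplus>u\<in>carrier G. a u (y (c \<otimes>\<^bsub>G\<^esub> w)) \<otimes> s (inv\<^bsub>G\<^esub> u \<otimes>\<^bsub>G\<^esub> b) c))"
proof -
  note xc = A_coord_closed[OF x] and yc = A_coord_closed[OF y]
  let ?P = "\<lambda>b c. pure_mult K H R act \<sigma> (x b) (e b) (y c) (e c) w"
  have P: "?P b c \<in> carrier R" if "b \<in> carrier G" "c \<in> carrier G" for b c
    using that xc yc w inner_closed by (simp add: pure_mult_coord)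
  have "(x \<otimes>\<^bsub>A\<^esub> y) w = (\<Oplus>b\<in>carrier G. \<Oplus>c\<in>carrier G. ?P b c)"
    by (rule A_mult_coord[OF x y w])
  also have "\<dots> = (\<Oplus>b\<in>carrier G. \<Oplus>c\<in>carrier G. ?P (b \<otimes>\<^bsub>G\<^esub> w) c)"
    using P w by (intro KR.finsum_bij[OF G.bij_right_mult[OF w], symmetric]) (auto intro!: KR.finsum_closed)
  also have "\<dots> = (\<Oplus>b\<in>carrier G. \<Oplus>c\<in>carrier G. ?P (b \<otimes>\<^bsub>G\<^esub> w) (c \<otimes>\<^bsub>G\<^esub> w))"
  proof (rule KR.finsum_cong'[OF refl])
    fix b assume b: "b \<in> carrier G"
    show "(\<Oplus>c\<in>carrier G. ?P (b \<otimes>\<^bsub>G\<^esub> w) c) = (\<Oplus>c\<in>carrier G. ?P (b \<otimes>\<^bsub>G\<^esub> w) (c \<otimes>\<^bsub>G\<^esub> w))"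
      using P w b by (intro KR.finsum_bij[OF G.bij_right_mult[OF w], symmetric]) auto
  qed (use P w in \<open>auto intro!: KR.finsum_closed\<close>)
  also have "\<dots> = (\<Oplus>b\<in>carrier G. \<Oplus>c\<in>carrier G. x (b \<otimes>\<^bsub>G\<^esub> w) \<otimes>
    (\<Oplus>u\<in>carrier G. a u (y (c \<otimes>\<^bsub>G\<^esub> w)) \<otimes> s (inv\<^bsub>G\<^esub> u \<otimes>\<^bsub>G\<^esub> b) c))"
    using xc yc w inner_closed
    by (intro KR.finsum_cong2) (auto simp: pure_mult_coord G.m_assoc)
  finally show ?thesis .
qed

sublocale function_crossed_product R A G a s t
proof
  show "\<one>\<^bsub>A\<^esub> g = \<one>" if "g \<in> carrier G" for g
    using that by (simp add: A_one H_structure(2)[OF e_closed e_closed])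
qed (use a_carrier s_carrier t_carrier a_unit_expansion t_s_convolution mult_coord_shifted
      act_zero e_closed in \<open>auto simp: a_def\<close>)

sublocale modules: hopf_crossed_product K H R act \<sigma> "carrier G"
proof
  fix h r assume h: "h \<in> carrier H" and r: "r \<in> carrier R"
  note hc = H_coord_closed[OF h]
  let ?T = "pure_tensor H R \<one>"
  let ?F = "\<lambda>h1 h2. emb (act h1 r) \<otimes>\<^bsub>A\<^esub> ?T h2"
  have Tc: "?T g \<in> carrier A" if "g \<in> carrier H" for g using that by (intro pure_tensor_closed) auto
  have Fc: "?F (e c) (e d) \<in> carrier A" for c d
    using r Tc e_closed act_closed by simp
  have "sweedler2 K H A h ?F = (\<Oplus>\<^bsub>A\<^esub>c\<in>carrier G. \<Oplus>\<^bsub>A\<^esub>d\<in>carrier G. h (c \<otimes>\<^bsub>G\<^esub> d) \<odot>\<^bsub>A\<^esub> ?F (e c) (e d))"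
    by (rule sweedler2_eq[OF KA.module_axioms h]) (rule Fc)
  also have "\<dots> = ?T h \<otimes>\<^bsub>A\<^esub> emb r"
  proof (rule coord_eqI)
    fix w assume w: "w \<in> carrier G"
    have "(\<Oplus>\<^bsub>A\<^esub>c\<in>carrier G. \<Oplus>\<^bsub>A\<^esub>d\<in>carrier G. h (c \<otimes>\<^bsub>G\<^esub> d) \<odot>\<^bsub>A\<^esub> ?F (e c) (e d)) w =
        (\<Oplus>c\<in>carrier G. (\<Oplus>\<^bsub>A\<^esub>d\<in>carrier G. h (c \<otimes>\<^bsub>G\<^esub> d) \<odot>\<^bsub>A\<^esub> ?F (e c) (e d)) w)"
      using Fc hc by (intro coord_finsum w) (auto intro!: KA.finsum_closed)
    also have "\<dots> = (\<Oplus>c\<in>carrier G. ?T h (c \<otimes>\<^bsub>G\<^esub> w) \<otimes> a c r)"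
    proof (rule KR.finsum_cong'[OF refl])
      fix c assume c: "c \<in> carrier G"
      have "(\<Oplus>\<^bsub>A\<^esub>d\<in>carrier G. h (c \<otimes>\<^bsub>G\<^esub> d) \<odot>\<^bsub>A\<^esub> ?F (e c) (e d)) w =
          (\<Oplus>d\<in>carrier G. (h (c \<otimes>\<^bsub>G\<^esub> d) \<odot>\<^bsub>A\<^esub> ?F (e c) (e d)) w)"
        using Fc hc c by (intro coord_finsum w) auto
      also have "\<dots> = (\<Oplus>d\<in>carrier G. if d = w then h (c \<otimes>\<^bsub>G\<^esub> d) \<odot> a c r else \<zero>)"
        using w c hc r a_carrier[OF r] Tc e_closed act_closed
        by (intro KR.finsum_cong')
           (auto simp: A_smult coord_emb_mult pure_tensor_coord e_coord a_def)
      also have "\<dots> = ?T h (c \<otimes>\<^bsub>G\<^esub> w) \<otimes> a c r"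
        using w c hc a_carrier[OF r] finite_G
        by (subst KR.finsum_single[where i = w]) (auto simp: pure_tensor_coord KR.smult_mult_left)
      finally show "(\<Oplus>\<^bsub>A\<^esub>d\<in>carrier G. h (c \<otimes>\<^bsub>G\<^esub> d) \<odot>\<^bsub>A\<^esub> ?F (e c) (e d)) w =
          ?T h (c \<otimes>\<^bsub>G\<^esub> w) \<otimes> a c r" .
    qed (use w A_coord_closed[OF Tc[OF h]] a_carrier[OF r] in auto)
    also have "\<dots> = (?T h \<otimes>\<^bsub>A\<^esub> emb r) w" by (rule mult_emb_coord[OF Tc[OF h] r w, symmetric])
    finally show "(\<Oplus>\<^bsub>A\<^esub>c\<in>carrier G. \<Oplus>\<^bsub>A\<^esub>d\<in>carrier G. h (c \<otimes>\<^bsub>G\<^esub> d) \<odot>\<^bsub>A\<^esub> ?F (e c) (e d)) w =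
        (?T h \<otimes>\<^bsub>A\<^esub> emb r) w" .
  qed (use Tc[OF h] r Fc hc in \<open>auto intro!: KA.finsum_closed\<close>)
  finally show "?T h \<otimes>\<^bsub>A\<^esub> emb r = sweedler2 K H A h ?F" ..
next
  fix h g assume h: "h \<in> carrier H" and g: "g \<in> carrier H"
  note hc = H_coord_closed[OF h] and gc = H_coord_closed[OF g]
  let ?T = "pure_tensor H R \<one>"
  let ?F = "\<lambda>h1 h2 g1 g2. emb (\<sigma> h1 g1) \<otimes>\<^bsub>A\<^esub> ?T (h2 \<otimes>\<^bsub>H\<^esub> g2)"
  have Tc: "?T g \<in> carrier A" if "g \<in> carrier H" for g using that by (intro pure_tensor_closed) auto
  have Fc: "?F (e b) (e c) (e d) (e f) \<in> carrier A" for b c d f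
    using Tc e_closed \<sigma>_closed H_mult_closed by simp
  let ?D = "\<lambda>b c. \<Oplus>\<^bsub>A\<^esub>q\<in>carrier G. \<Oplus>\<^bsub>A\<^esub>f\<in>carrier G. g (q \<otimes>\<^bsub>G\<^esub> f) \<odot>\<^bsub>A\<^esub> ?F (e b) (e c) (e q) (e f)"
  have in': "sweedler2 K H A g (?F (e b) (e c)) = ?D b c" for b c
    by (rule sweedler2_eq[OF KA.module_axioms g]) (rule Fc)
  have inc: "?D b c \<in> carrier A" for b c
    using Fc gc by (auto intro!: KA.finsum_closed)
  \<comment> \<open>The product of the dual basis vectors at \<open>c\<close> and \<open>f\<close>
    has a coordinate at \<open>w\<close> only for \<open>c = f = w\<close>, which leaves the sum
    over \<open>q\<close>.\<close>
  have D: "?D b c w = (if c = w then \<Oplus>q\<in>carrier G. g (q \<otimes>\<^bsub>G\<^esub> w) \<odot> s b q else \<zero>)"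
    if w: "w \<in> carrier G" for b c w
  proof -
    have "?D b c w = (\<Oplus>q\<in>carrier G. (\<Oplus>\<^bsub>A\<^esub>f\<in>carrier G. g (q \<otimes>\<^bsub>G\<^esub> f) \<odot>\<^bsub>A\<^esub> ?F (e b) (e c) (e q) (e f)) w)"
      using Fc gc by (intro coord_finsum w) (auto intro!: KA.finsum_closed)
    also have "\<dots> = (\<Oplus>q\<in>carrier G. if c = w then g (q \<otimes>\<^bsub>G\<^esub> w) \<odot> s b q else \<zero>)"
    proof (rule KR.finsum_cong'[OF refl])
      fix q assume q: "q \<in> carrier G"
      have "(\<Oplus>\<^bsub>A\<^esub>f\<in>carrier G. g (q \<otimes>\<^bsub>G\<^esub> f) \<odot>\<^bsub>A\<^esub> ?F (e b) (e c) (e q) (e f)) w =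
          (\<Oplus>f\<in>carrier G. (g (q \<otimes>\<^bsub>G\<^esub> f) \<odot>\<^bsub>A\<^esub> ?F (e b) (e c) (e q) (e f)) w)"
        using Fc gc q by (intro coord_finsum w) auto
      also have "\<dots> = (\<Oplus>f\<in>carrier G. if w = c \<and> w = f then g (q \<otimes>\<^bsub>G\<^esub> f) \<odot> s b q else \<zero>)"
        using w q gc s_carrier Tc e_closed \<sigma>_closed H_mult_closed
        by (intro KR.finsum_cong')
           (auto simp: A_smult coord_emb_mult pure_tensor_coord e_mult_coord s_def)
      also have "\<dots> = (if c = w then g (q \<otimes>\<^bsub>G\<^esub> w) \<odot> s b q else \<zero>)"
        using w q gc s_carrier finite_G by (subst KR.finsum_single[where i = w]) auto
      finally show "(\<Oplus>\<^bsub>A\<^esub>f\<in>carrier G. g (q \<otimes>\<^bsub>G\<^esub> f) \<odot>\<^bsub>A\<^esub> ?F (e b) (e c) (e q) (e f)) w =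
          (if c = w then g (q \<otimes>\<^bsub>G\<^esub> w) \<odot> s b q else \<zero>)" .
    qed (use w gc s_carrier in auto)
    also have "\<dots> = (if c = w then \<Oplus>q\<in>carrier G. g (q \<otimes>\<^bsub>G\<^esub> w) \<odot> s b q else \<zero>)"
      by simp
    finally show ?thesis .
  qed
  have "sweedler2 K H A h (\<lambda>h1 h2. sweedler2 K H A g (?F h1 h2)) =
      (\<Oplus>\<^bsub>A\<^esub>b\<in>carrier G. \<Oplus>\<^bsub>A\<^esub>d\<in>carrier G. h (b \<otimes>\<^bsub>G\<^esub> d) \<odot>\<^bsub>A\<^esub> sweedler2 K H A g (?F (e b) (e d)))"
    by (rule sweedler2_eq[OF KA.module_axioms h]) (unfold in', rule inc)
  also have "\<dots> = ?T h \<otimes>\<^bsub>A\<^esub> ?T g"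
    unfolding in'
  proof (rule coord_eqI)
    fix w assume w: "w \<in> carrier G"
    have sc: "g (q \<otimes>\<^bsub>G\<^esub> w) \<odot> s b q \<in> carrier R" if "q \<in> carrier G" for b q
      using that w gc s_carrier by simp
    have "(\<Oplus>\<^bsub>A\<^esub>b\<in>carrier G. \<Oplus>\<^bsub>A\<^esub>d\<in>carrier G. h (b \<otimes>\<^bsub>G\<^esub> d) \<odot>\<^bsub>A\<^esub> ?D b d) w =
        (\<Oplus>b\<in>carrier G. (\<Oplus>\<^bsub>A\<^esub>d\<in>carrier G. h (b \<otimes>\<^bsub>G\<^esub> d) \<odot>\<^bsub>A\<^esub> ?D b d) w)"
      using inc hc by (intro coord_finsum w) (auto intro!: KA.finsum_closed)
    also have "\<dots> = (\<Oplus>b\<in>carrier G. \<Oplus>q\<in>carrier G. ?T h (b \<otimes>\<^bsub>G\<^esub> w) \<otimes>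
        (\<Oplus>u\<in>carrier G. a u (?T g (q \<otimes>\<^bsub>G\<^esub> w)) \<otimes> s (inv\<^bsub>G\<^esub> u \<otimes>\<^bsub>G\<^esub> b) q))"
    proof (rule KR.finsum_cong'[OF refl])
      fix b assume b: "b \<in> carrier G"
      have "(\<Oplus>\<^bsub>A\<^esub>d\<in>carrier G. h (b \<otimes>\<^bsub>G\<^esub> d) \<odot>\<^bsub>A\<^esub> ?D b d) w =
          (\<Oplus>d\<in>carrier G. (h (b \<otimes>\<^bsub>G\<^esub> d) \<odot>\<^bsub>A\<^esub> ?D b d) w)"
        using inc hc b by (intro coord_finsum w) auto
      also have "\<dots> = h (b \<otimes>\<^bsub>G\<^esub> w) \<odot> (\<Oplus>q\<in>carrier G. g (q \<otimes>\<^bsub>G\<^esub> w) \<odot> s b q)"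
      proof -
        have "(\<Oplus>q\<in>carrier G. g (q \<otimes>\<^bsub>G\<^esub> w) \<odot> s b q) \<in> carrier R"
          using sc by (intro KR.finsum_closed) auto
        then show ?thesis
          using w b hc finite_G
          by (subst KR.finsum_single[where i = w]) (auto simp: A_smult D[OF w])
      qed
      also have "\<dots> = (\<Oplus>q\<in>carrier G. h (b \<otimes>\<^bsub>G\<^esub> w) \<odot> (g (q \<otimes>\<^bsub>G\<^esub> w) \<odot> s b q))"
        using sc hc b w by (intro KR.finsum_smult_ldistr finite_G) auto
      also have "\<dots> = (\<Oplus>q\<in>carrier G. ?T h (b \<otimes>\<^bsub>G\<^esub> w) \<otimes>
        (\<Oplus>u\<in>carrier G. a u (?T g (q \<otimes>\<^bsub>G\<^esub> w)) \<otimes> s (inv\<^bsub>G\<^esub> u \<otimes>\<^bsub>G\<^esub> b) q))"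
      proof (rule KR.finsum_cong'[OF refl])
        fix q assume q: "q \<in> carrier G"
        \<comment> \<open>By \<open>a_one_eq\<close>, multiples of \<one> are annihilated by
          \<open>a u\<close> unless \<open>u\<close> is the identity of \<open>G\<close>.\<close>
        have "(\<Oplus>u\<in>carrier G. a u (?T g (q \<otimes>\<^bsub>G\<^esub> w)) \<otimes> s (inv\<^bsub>G\<^esub> u \<otimes>\<^bsub>G\<^esub> b) q) =
            g (q \<otimes>\<^bsub>G\<^esub> w) \<odot> s b q"
          using q b w gc s_carrier finite_G
          by (subst KR.finsum_single[where i = "\<one>\<^bsub>G\<^esub>"])
             (auto simp: pure_tensor_coord a_smult a_one_eq KR.smult_mult_left)
        then show "h (b \<otimes>\<^bsub>G\<^esub> w) \<odot> (g (q \<otimes>\<^bsub>G\<^esub> w) \<odot> s b q) = ?T h (b \<otimes>\<^bsub>G\<^esub> w) \<otimes>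
          (\<Oplus>u\<in>carrier G. a u (?T g (q \<otimes>\<^bsub>G\<^esub> w)) \<otimes> s (inv\<^bsub>G\<^esub> u \<otimes>\<^bsub>G\<^esub> b) q)"
          using hc b w sc[OF q] by (simp add: pure_tensor_coord KR.smult_mult_left)
      qed (use hc gc b w inner_closed A_coord_closed[OF Tc[OF h]] A_coord_closed[OF Tc[OF g]] in auto)
      finally show "(\<Oplus>\<^bsub>A\<^esub>d\<in>carrier G. h (b \<otimes>\<^bsub>G\<^esub> d) \<odot>\<^bsub>A\<^esub> ?D b d) w = (\<Oplus>q\<in>carrier G.
        ?T h (b \<otimes>\<^bsub>G\<^esub> w) \<otimes>
        (\<Oplus>u\<in>carrier G. a u (?T g (q \<otimes>\<^bsub>G\<^esub> w)) \<otimes> s (inv\<^bsub>G\<^esub> u \<otimes>\<^bsub>G\<^esub> b) q))" .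
    qed (use w inner_closed A_coord_closed[OF Tc[OF h]] A_coord_closed[OF Tc[OF g]]
          in \<open>auto intro!: KR.finsum_closed\<close>)
    also have "\<dots> = (?T h \<otimes>\<^bsub>A\<^esub> ?T g) w"
      by (rule mult_coord[OF Tc[OF h] Tc[OF g] w, symmetric])
    finally show "(\<Oplus>\<^bsub>A\<^esub>b\<in>carrier G. \<Oplus>\<^bsub>A\<^esub>d\<in>carrier G. h (b \<otimes>\<^bsub>G\<^esub> d) \<odot>\<^bsub>A\<^esub> ?D b d) w =
        (?T h \<otimes>\<^bsub>A\<^esub> ?T g) w" .
  qed (use Tc h g inc hc in \<open>auto intro!: KA.finsum_closed\<close>)
  finally show "?T h \<otimes>\<^bsub>A\<^esub> ?T g = sweedler2 K H A h (\<lambda>h1 h2. sweedler2 K H A g (?F h1 h2))" ..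
qed (use field_K hopf basis_eq twisted KR.k_algebra_axioms KA.k_algebra_axioms in auto)

theorem radicals:
  assumes "[order G] \<cdot>\<^bsub>K\<^esub> \<one>\<^bsub>K\<^esub> \<in> Units K"
  shows "jacobson_radical R = H_jacobson_radical K H R act \<sigma> \<and>
    H_jacobson_radical K H R act \<sigma> = H_jacobson_core H R act \<and>
    jacobson_radical A = tensor_image H R (H_jacobson_radical K H R act \<sigma>)"
proof -
  obtain c where c: "c \<in> carrier R" "c \<otimes> (\<Oplus>g\<in>carrier G. \<one>) = \<one>"
    by (rule KR.inverse_order[OF finite_G assms])
  show ?thesis
    using modules.radicals_eq[OF jacobson_radical_eq[OF c] _ G.one_closed] a_jacobson_radical[OF c]
    by (simp add: one_coord a_def)
qed

end

theorem theorem2p7: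
  fixes K :: "('k, 'z) ring_scheme" and G :: "('g, 'y) monoid_scheme" and H :: "('k, 'g) hopf"
    and R :: "('k, 'r, 'x) module_scheme"
    and act :: "('g \<Rightarrow> 'k) \<Rightarrow> 'r \<Rightarrow> 'r" and \<sigma> :: "('g \<Rightarrow> 'k) \<Rightarrow> ('g \<Rightarrow> 'k) \<Rightarrow> 'r"
  assumes "field K"
    and "group G" and "finite (carrier G)"
    and "[order G] \<cdot>\<^bsub>K\<^esub> \<one>\<^bsub>K\<^esub> \<in> Units K"
    and "H = group_algebra K G \<or> H = dual_hopf K (group_algebra K G)"
    and "k_algebra K R"
    and "twisted_module_algebra K H R act \<sigma>"
    and "k_algebra K (crossed_product K H R act \<sigma>)"
  shows "jacobson_radical R = H_jacobson_radical K H R act \<sigma> \<and>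
         H_jacobson_radical K H R act \<sigma> = H_jacobson_core H R act \<and>
         jacobson_radical (crossed_product K H R act \<sigma>)
           = tensor_image H R (H_jacobson_radical K H R act \<sigma>)"
proof -
  have H: "coordinate_hopf K (group_algebra K G)"
    by (rule coordinate_hopf_group_algebra[OF assms(1-3)])
  from assms(5) show ?thesis
  proof
    assume e: "H = group_algebra K G"
    have "group_algebra_crossed_product K G R act \<sigma>"
      unfolding group_algebra_crossed_product_def finite_group_crossed_product_def
        finite_group_crossed_product_axioms_def
      using assms H by (simp add: e) (simp add: group_algebra_def)
    from group_algebra_crossed_product.radicals[OF this assms(4)] show ?thesis by (simp add: e)
  next
    assume e: "H = dual_hopf K (group_algebra K G)"
    have "dual_group_algebra_crossed_product K G R act \<sigma>"
      unfolding dual_group_algebra_crossed_product_def finite_group_crossed_product_def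
        finite_group_crossed_product_axioms_def
      using assms coordinate_hopf_dual[OF assms(1) H]
      by (simp add: e) (simp add: dual_hopf_def group_algebra_def)
    from dual_group_algebra_crossed_product.radicals[OF this assms(4)] show ?thesis by (simp add: e)
  qed
qed

end
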